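(* Let $S$ be a finite subset of $\mathbf E_q$. The abelian regular objects with singularities in $S$ are classified by the representations of the following algebraic group: $$\pi^1_{ab,S,reg}=\frac{L_{S,s}}{L'_{S,s}}\times L_{S,u}.$$
   Context: Fix $q\in\mathbb C$, $|q|>1$; $\mathbf E_q=\mathbb C^*/q^{\mathbb Z}$ is the associated elliptic curve (with origin $0_{\mathbf E_q}$, group law written additively), and $\mathcal M(\mathbf E_q)$ is its field of meromorphic functions. For an open subset $U$ of the Riemann sphere, $\mathcal M(U)$ is the field of meromorphic functions on $U$. Regular objects. A system $\sigma_qX=AX$ with $A\in GL_n(\mathbb C(z))$ (where $(\sigma_qX)(z)=X(qz)$) is regular if it is equivalent to $I_n$ both at $0$ and at $\infty$: there are $M^{(0)}\in GL_n(\mathcal M(\mathbb C))$ and $M^{(\infty)}\in GL_n(\mathcal M(\mathbb P^1(\mathbb C)\setminus\{0\}))$ with $\sigma_qM^{(0)}=AM^{(0)}$ and $\sigma_qM^{(\infty)}=AM^{(\infty)}$. Its connection matrix is $P=(M^{(\infty)})^{-1}M^{(0)}\in GL_n(\mathcal M(\mathbf E_q))$. The object has singularities in $S$ if all poles of $P$ and of $P^{-1}$ lie in $S$. It is abelian if its connection component, the group generated by the values $P(a)^{-1}P(b)$ ($a,b\in\mathbf E_q$ outside the poles of $P$ and $P^{-1}$), is commutative. The group. $\mathbf G_m$ and $\mathbf G_a$ are the multiplicative and additive groups over $\mathbb C$. Put $$L_{S,s}=\mathbf G_m^S/\Delta,\qquad \Delta=\{(x,\dots,x)\}\subset\mathbf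 G_m^S\ \text{(the diagonal)},$$ $$L_{S,u}=\prod_{p\in S}\bigl(1+t_p\mathbb C[[t_p]]\bigr),$$ where $t_p$ is a local parameter at $p$ and $1+t_p\mathbb C[[t_p]]$ is the multiplicative group, projective limit over $n$ of the groups $\{1+b_1t_p+\dots+b_{n-1}t_p^{n-1}\bmod t_p^n\}\simeq\mathbf G_a^{n-1}$. Put $$Rel_{\mathbf E_q}(S)=\Bigl\{(n_p)_{p\in S}\in\mathbb Z^S\;:\;\sum_{p\in S}n_p\,p=0_{\mathbf E_q}\Bigr\},$$ and let $L'_{S,s}$ be the image in $L_{S,s}$ of $\bigl\{(x_p)_{p\in S}\in\mathbf G_m^S\;:\;\prod_{p\in S}x_p^{n_p}=1\text{ for all }(n_p)_{p\in S}\in Rel_{\mathbf E_q}(S)\bigr\}$. *)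

theory Defs
  imports
    "HOL-Complex_Analysis.Complex_Analysis"
    "HOL-Computational_Algebra.Formal_Power_Series"
    "HOL-Computational_Algebra.Normalized_Fraction"
    "HOL-Computational_Algebra.Polynomial_Factorial"
    "HOL-Computational_Algebra.Field_as_Ring"
    "HOL-Algebra.Coset"
    "HOL-Algebra.Generated_Groups"
    "HOL-Algebra.Product_Groups"
    "Jordan_Normal_Form.Matrix"
begin

section \<open>The elliptic curve\<close>

definition Cstar :: "complex monoid" where
  "Cstar = \<lparr>carrier = - {0}, monoid.mult = (*), one = 1\<rparr>"

definition qZ :: "complex \<Rightarrow> complex set" where
  "qZ q = range (\<lambda>k::int. q powi k)"

text \<open>Points are cosets of \<open>qZ q\<close>; the group law is written multiplicatively.\<close>

definition ell_curve :: "complex \<Rightarrow> complex set monoid" where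
  "ell_curve q = Cstar Mod qZ q"

definition ell_pt :: "complex \<Rightarrow> complex \<Rightarrow> complex set" where
  "ell_pt q a = qZ q #>\<^bsub>Cstar\<^esub> a"


section \<open>Regular systems and their connection matrices\<close>

definition GL :: "'k::field itself \<Rightarrow> nat \<Rightarrow> 'k mat monoid" where
  "GL T n = units_of (ring_mat T n ())"

abbreviation GLC :: "nat \<Rightarrow> complex mat monoid" where
  "GLC n \<equiv> GL TYPE(complex) n"

type_synonym ratfun = "complex poly fract"

definition rat_eval :: "ratfun \<Rightarrow> complex \<Rightarrow> complex" where
  "rat_eval r z = poly (fst (quot_of_fract r)) z / poly (snd (quot_of_fract r)) z"

definition rat_const :: "complex \<Rightarrow> ratfun" where
  "rat_const c = to_fract [:c:]"

definition sigma_rat :: "complex \<Rightarrow> ratfun \<Rightarrow> ratfun" where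
  "sigma_rat q r = Fract (fst (quot_of_fract r) \<circ>\<^sub>p [:0, q:]) (snd (quot_of_fract r) \<circ>\<^sub>p [:0, q:])"

definition mat_eval :: "ratfun mat \<Rightarrow> complex \<Rightarrow> complex mat" where
  "mat_eval A z = map_mat (\<lambda>r. rat_eval r z) A"

text \<open>
  A meromorphic matrix is represented by a function with meromorphic entries. Values on a sparse
  set are irrelevant, so identities between such matrices are required only outside a sparse set.
\<close>

definition mero_mat :: "complex set \<Rightarrow> nat \<Rightarrow> (complex \<Rightarrow> complex mat) \<Rightarrow> bool" where
  "mero_mat U n M \<longleftrightarrow> (\<forall>z. M z \<in> carrier_mat n n) \<and>
     (\<forall>i<n. \<forall>j<n. (\<lambda>z. M z $$ (i,j)) meromorphic_on U)"

definition mero_GL :: "complex set \<Rightarrow> nat \<Rightarrow> (complex \<Rightarrow> complex mat) \<Rightarrow> bool" where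
  "mero_GL U n M \<longleftrightarrow> mero_mat U n M \<and>
     (\<exists>N. mero_mat U n N \<and> (\<forall>\<^sub>\<approx>z\<in>U. M z * N z = 1\<^sub>m n \<and> N z * M z = 1\<^sub>m n))"

text \<open>
  The punctured sphere \<open>P\<^sup>1(C) - {0}\<close> is identified with \<open>C\<close> through the coordinate \<open>1/z\<close>.
\<close>

definition mero_GL_inf :: "nat \<Rightarrow> (complex \<Rightarrow> complex mat) \<Rightarrow> bool" where
  "mero_GL_inf n M \<longleftrightarrow> mero_GL UNIV n (\<lambda>w. M (inverse w))"

definition sol_zero :: "complex \<Rightarrow> nat \<Rightarrow> ratfun mat \<Rightarrow> (complex \<Rightarrow> complex mat) \<Rightarrow> bool" where
  "sol_zero q n A M \<longleftrightarrow> mero_GL UNIV n M \<and> (\<forall>\<^sub>\<approx>z\<in>UNIV. M (q * z) = mat_eval A z * M z)"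

definition sol_inf :: "complex \<Rightarrow> nat \<Rightarrow> ratfun mat \<Rightarrow> (complex \<Rightarrow> complex mat) \<Rightarrow> bool" where
  "sol_inf q n A M \<longleftrightarrow> mero_GL_inf n M \<and> (\<forall>\<^sub>\<approx>z\<in>- {0}. M (q * z) = mat_eval A z * M z)"

definition regular_system :: "complex \<Rightarrow> nat \<Rightarrow> ratfun mat \<Rightarrow> bool" where
  "regular_system q n A \<longleftrightarrow> A \<in> carrier (GL TYPE(ratfun) n) \<and>
     (\<exists>M0. sol_zero q n A M0) \<and> (\<exists>Minf. sol_inf q n A Minf)"

text \<open>
  \<open>P\<close> is a function on the punctured plane (invariant under multiplication by \<open>q\<close>). Its entries
  are \<open>nicely\<close> meromorphic so that \<open>P a\<close> is the actual value at every \<open>a\<close> which is not a pole.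
\<close>

definition connection_matrix ::
    "complex \<Rightarrow> nat \<Rightarrow> ratfun mat \<Rightarrow> (complex \<Rightarrow> complex mat) \<Rightarrow> bool" where
  "connection_matrix q n A P \<longleftrightarrow>
     (\<forall>z. P z \<in> carrier_mat n n) \<and>
     (\<forall>i<n. \<forall>j<n. (\<lambda>z. P z $$ (i,j)) nicely_meromorphic_on - {0}) \<and>
     (\<exists>M0 Minf. sol_zero q n A M0 \<and> sol_inf q n A Minf \<and>
        (\<forall>\<^sub>\<approx>z\<in>- {0}. P z = inv\<^bsub>GLC n\<^esub> (Minf z) * M0 z))"

definition mat_poles :: "nat \<Rightarrow> (complex \<Rightarrow> complex mat) \<Rightarrow> complex set" where
  "mat_poles n P = {a. a \<noteq> 0 \<and> (\<exists>i<n. \<exists>j<n. is_pole (\<lambda>z. P z $$ (i,j)) a)}"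

definition sing_set :: "nat \<Rightarrow> (complex \<Rightarrow> complex mat) \<Rightarrow> complex set" where
  "sing_set n P = mat_poles n P \<union> mat_poles n (\<lambda>z. inv\<^bsub>GLC n\<^esub> (P z))"

definition connection_component :: "nat \<Rightarrow> (complex \<Rightarrow> complex mat) \<Rightarrow> complex mat monoid" where
  "connection_component n P = subgroup_generated (GLC n)
     {inv\<^bsub>GLC n\<^esub> (P a) * P b | a b. a \<in> - {0} - sing_set n P \<and> b \<in> - {0} - sing_set n P}"

text \<open>
  Another choice of \<open>M0\<close>, \<open>Minf\<close> multiplies \<open>P\<close> on both sides by constant invertible
  matrices, which affects neither the singularities nor the commutativity.
\<close>

definition abelian_regular :: "complex \<Rightarrow> complex set set \<Rightarrow> nat \<Rightarrow> ratfun mat \<Rightarrow> bool" where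
  "abelian_regular q S n A \<longleftrightarrow> regular_system q n A \<and>
     (\<exists>P. connection_matrix q n A P \<and> ell_pt q ` sing_set n P \<subseteq> S \<and>
          comm_group (connection_component n P))"


section \<open>Tensor categories of matrices\<close>

text \<open>
  Objects have a rank, morphisms \<open>X \<rightarrow> Y\<close> are matrices of size \<open>rk Y \<times> rk X\<close> over a field \<open>'k\<close>
  into which the complex numbers are embedded by \<open>scal\<close>. Composition is the matrix product,
  identities are identity matrices, and the tensor product of morphisms is the Kronecker product.
  The Kronecker product being strictly associative and unital, the associator and the unitors are
  identity matrices; the symmetry is the commutation matrix.
\<close>

record ('o, 'k) mat_cat =
  Ob :: "'o set"
  rk :: "'o \<Rightarrow> nat"
  Mor :: "'o \<Rightarrow> 'o \<Rightarrow> 'k mat set"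
  tens :: "'o \<Rightarrow> 'o \<Rightarrow> 'o"
  unit_ob :: "'o"
  scal :: "complex \<Rightarrow> 'k"

definition kron :: "'k::times mat \<Rightarrow> 'k mat \<Rightarrow> 'k mat" where
  "kron A B = mat (dim_row A * dim_row B) (dim_col A * dim_col B)
     (\<lambda>(i,j). A $$ (i div dim_row B, j div dim_col B) * B $$ (i mod dim_row B, j mod dim_col B))"

text \<open>\<open>swap_mat m n\<close> sends \<open>e\<^sub>i \<otimes> f\<^sub>j\<close> (index \<open>i * n + j\<close>) to \<open>f\<^sub>j \<otimes> e\<^sub>i\<close> (index \<open>j * m + i\<close>).\<close>

definition swap_mat :: "nat \<Rightarrow> nat \<Rightarrow> 'k::zero_neq_one mat" where
  "swap_mat m n = mat (n * m) (m * n)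
     (\<lambda>(r,c). if r div m = c mod n \<and> r mod m = c div n then 1 else 0)"

definition isos :: "('o, 'k::field) mat_cat \<Rightarrow> 'o \<Rightarrow> 'o \<Rightarrow> 'k mat set" where
  "isos C X Y = {f \<in> Mor C X Y. \<exists>g \<in> Mor C Y X. f * g = 1\<^sub>m (rk C Y) \<and> g * f = 1\<^sub>m (rk C X)}"

definition linear_functor ::
    "('o, 'k::field) mat_cat \<Rightarrow> ('p, 'l::field) mat_cat \<Rightarrow>
     ('o \<Rightarrow> 'p) \<Rightarrow> ('o \<Rightarrow> 'o \<Rightarrow> 'k mat \<Rightarrow> 'l mat) \<Rightarrow> bool" where
  "linear_functor C D Fo Fm \<longleftrightarrow>
     (\<forall>X\<in>Ob C. Fo X \<in> Ob D) \<and>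
     (\<forall>X\<in>Ob C. \<forall>Y\<in>Ob C. \<forall>f\<in>Mor C X Y. Fm X Y f \<in> Mor D (Fo X) (Fo Y)) \<and>
     (\<forall>X\<in>Ob C. Fm X X (1\<^sub>m (rk C X)) = 1\<^sub>m (rk D (Fo X))) \<and>
     (\<forall>X\<in>Ob C. \<forall>Y\<in>Ob C. \<forall>Z\<in>Ob C. \<forall>f\<in>Mor C X Y. \<forall>g\<in>Mor C Y Z.
        Fm X Z (g * f) = Fm Y Z g * Fm X Y f) \<and>
     (\<forall>X\<in>Ob C. \<forall>Y\<in>Ob C. \<forall>f\<in>Mor C X Y. \<forall>g\<in>Mor C X Y.
        Fm X Y (f + g) = Fm X Y f + Fm X Y g) \<and>
     (\<forall>X\<in>Ob C. \<forall>Y\<in>Ob C. \<forall>f\<in>Mor C X Y. \<forall>c.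
        Fm X Y (scal C c \<cdot>\<^sub>m f) = scal D c \<cdot>\<^sub>m Fm X Y f)"

definition category_equivalence ::
    "('o, 'k::field) mat_cat \<Rightarrow> ('p, 'l::field) mat_cat \<Rightarrow>
     ('o \<Rightarrow> 'p) \<Rightarrow> ('o \<Rightarrow> 'o \<Rightarrow> 'k mat \<Rightarrow> 'l mat) \<Rightarrow> bool" where
  "category_equivalence C D Fo Fm \<longleftrightarrow>
     (\<forall>X\<in>Ob C. \<forall>Y\<in>Ob C. bij_betw (Fm X Y) (Mor C X Y) (Mor D (Fo X) (Fo Y))) \<and>
     (\<forall>Y\<in>Ob D. \<exists>X\<in>Ob C. isos D (Fo X) Y \<noteq> {})"

text \<open>
  \<open>J X Y\<close> and \<open>J1\<close> are the structure isomorphisms of a symmetric monoidal functor; the conditions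
  are, in order: naturality, associativity, left and right unit, symmetry.
\<close>

definition symmetric_monoidal ::
    "('o, 'k::field) mat_cat \<Rightarrow> ('p, 'l::field) mat_cat \<Rightarrow>
     ('o \<Rightarrow> 'p) \<Rightarrow> ('o \<Rightarrow> 'o \<Rightarrow> 'k mat \<Rightarrow> 'l mat) \<Rightarrow> ('o \<Rightarrow> 'o \<Rightarrow> 'l mat) \<Rightarrow> 'l mat \<Rightarrow> bool" where
  "symmetric_monoidal C D Fo Fm J J1 \<longleftrightarrow>
     J1 \<in> isos D (unit_ob D) (Fo (unit_ob C)) \<and>
     (\<forall>X\<in>Ob C. \<forall>Y\<in>Ob C. J X Y \<in> isos D (tens D (Fo X) (Fo Y)) (Fo (tens C X Y))) \<and>
     (\<forall>X\<in>Ob C. \<forall>X'\<in>Ob C. \<forall>Y\<in>Ob C. \<forall>Y'\<in>Ob C. \<forall>f\<in>Mor C X X'. \<forall>g\<in>Mor C Y Y'.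
        Fm (tens C X Y) (tens C X' Y') (kron f g) * J X Y = J X' Y' * kron (Fm X X' f) (Fm Y Y' g)) \<and>
     (\<forall>X\<in>Ob C. \<forall>Y\<in>Ob C. \<forall>Z\<in>Ob C.
        J (tens C X Y) Z * kron (J X Y) (1\<^sub>m (rk D (Fo Z))) =
        J X (tens C Y Z) * kron (1\<^sub>m (rk D (Fo X))) (J Y Z)) \<and>
     (\<forall>X\<in>Ob C. J (unit_ob C) X * kron J1 (1\<^sub>m (rk D (Fo X))) = 1\<^sub>m (rk D (Fo X))) \<and>
     (\<forall>X\<in>Ob C. J X (unit_ob C) * kron (1\<^sub>m (rk D (Fo X))) J1 = 1\<^sub>m (rk D (Fo X))) \<and>
     (\<forall>X\<in>Ob C. \<forall>Y\<in>Ob C.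
        Fm (tens C X Y) (tens C Y X) (swap_mat (rk C X) (rk C Y)) * J X Y =
        J Y X * swap_mat (rk D (Fo X)) (rk D (Fo Y)))"

definition tensor_equivalent ::
    "('o, 'k::field) mat_cat \<Rightarrow> ('p, 'l::field) mat_cat \<Rightarrow> bool" where
  "tensor_equivalent C D \<longleftrightarrow>
     (\<exists>Fo Fm J J1. linear_functor C D Fo Fm \<and> category_equivalence C D Fo Fm \<and>
        symmetric_monoidal C D Fo Fm J J1)"

text \<open>
  A morphism from \<open>A\<close> to \<open>B\<close> is a rational matrix \<open>F\<close> such that \<open>X \<mapsto> F X\<close> maps solutions of
  \<open>\<sigma>\<^sub>q X = A X\<close> to solutions of \<open>\<sigma>\<^sub>q Y = B Y\<close>.
\<close>

definition abelian_regular_cat :: "complex \<Rightarrow> complex set set \<Rightarrow> (ratfun mat, ratfun) mat_cat" where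
  "abelian_regular_cat q S =
     \<lparr>Ob = {A. abelian_regular q S (dim_row A) A},
      rk = dim_row,
      Mor = (\<lambda>A B. {F \<in> carrier_mat (dim_row B) (dim_row A).
                      map_mat (sigma_rat q) F * A = B * F}),
      tens = kron,
      unit_ob = 1\<^sub>m 1,
      scal = rat_const\<rparr>"


section \<open>(Pro-)algebraic groups and their representations\<close>

text \<open>
  An affine (pro-)algebraic group over the complex numbers is given by its group of complex points
  together with its coordinate algebra, the algebra of regular functions on these points. Only the
  restriction of a regular function to the carrier matters.
\<close>

record 'a alg_group = "'a monoid" +
  reg_funs :: "('a \<Rightarrow> complex) set"

inductive_set fun_algebra :: "'a set \<Rightarrow> ('a \<Rightarrow> complex) set \<Rightarrow> ('a \<Rightarrow> complex) set"
  for X :: "'a set" and B :: "('a \<Rightarrow> complex) set" where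
  gen: "f \<in> B \<Longrightarrow> f \<in> fun_algebra X B"
| const: "(\<lambda>_. c) \<in> fun_algebra X B"
| add: "f \<in> fun_algebra X B \<Longrightarrow> g \<in> fun_algebra X B \<Longrightarrow> (\<lambda>x. f x + g x) \<in> fun_algebra X B"
| mult: "f \<in> fun_algebra X B \<Longrightarrow> g \<in> fun_algebra X B \<Longrightarrow> (\<lambda>x. f x * g x) \<in> fun_algebra X B"
| cong: "f \<in> fun_algebra X B \<Longrightarrow> (\<forall>x\<in>X. g x = f x) \<Longrightarrow> g \<in> fun_algebra X B"

definition with_regular :: "'a monoid \<Rightarrow> ('a \<Rightarrow> complex) set \<Rightarrow> 'a alg_group" where
  "with_regular G R = monoid.extend G (alg_group.fields R)"

definition Gm :: "complex alg_group" where
  "Gm = with_regular Cstar (fun_algebra (carrier Cstar) {\<lambda>x. x, \<lambda>x. inverse x})"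

text \<open>
  The group \<open>1 + t C[[t]]\<close>. As it is the projective limit of its truncations, a regular function is
  a polynomial in finitely many of the coefficients.
\<close>

definition one_units :: "complex fps alg_group" where
  "one_units = with_regular \<lparr>carrier = {f. fps_nth f 0 = 1}, monoid.mult = (*), one = 1\<rparr>
     (fun_algebra {f. fps_nth f 0 = 1} (range (\<lambda>n f. fps_nth f n)))"

definition alg_product :: "'i set \<Rightarrow> ('i \<Rightarrow> 'a alg_group) \<Rightarrow> ('i \<Rightarrow> 'a) alg_group" where
  "alg_product I G = with_regular (product_group I G)
     (fun_algebra (carrier (product_group I G)) {\<lambda>x. f (x i) | i f. i \<in> I \<and> f \<in> reg_funs (G i)})"

definition alg_dirprod :: "'a alg_group \<Rightarrow> 'b alg_group \<Rightarrow> ('a \<times> 'b) alg_group" where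
  "alg_dirprod G H = with_regular (G \<times>\<times> H)
     (fun_algebra (carrier (G \<times>\<times> H))
        ({\<lambda>x. f (fst x) | f. f \<in> reg_funs G} \<union> {\<lambda>x. f (snd x) | f. f \<in> reg_funs H}))"

text \<open>
  Quotient by a closed normal subgroup: the regular functions are the invariant ones upstairs.
\<close>

definition alg_quotient :: "'a alg_group \<Rightarrow> 'a set \<Rightarrow> 'a set alg_group" where
  "alg_quotient G N = with_regular (G Mod N) {f. (\<lambda>x. f (N #>\<^bsub>G\<^esub> x)) \<in> reg_funs G}"

definition rep_cat :: "'a alg_group \<Rightarrow> ('a \<Rightarrow> complex mat, complex) mat_cat" where
  "rep_cat G =
     \<lparr>Ob = {\<rho>. \<exists>n. \<rho> \<in> Group.hom G (GLC n) \<and>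
                 (\<forall>i<n. \<forall>j<n. (\<lambda>g. \<rho> g $$ (i,j)) \<in> reg_funs G)},
      rk = (\<lambda>\<rho>. dim_row (\<rho> \<one>\<^bsub>G\<^esub>)),
      Mor = (\<lambda>\<rho> \<tau>. {T \<in> carrier_mat (dim_row (\<tau> \<one>\<^bsub>G\<^esub>)) (dim_row (\<rho> \<one>\<^bsub>G\<^esub>)).
                      \<forall>g\<in>carrier G. T * \<rho> g = \<tau> g * T}),
      tens = (\<lambda>\<rho> \<tau> g. kron (\<rho> g) (\<tau> g)),
      unit_ob = (\<lambda>_. 1\<^sub>m 1),
      scal = id\<rparr>"


section \<open>The group\<close>

text \<open>
  Points of \<open>S\<close> index the factors; the local parameter at each point is a formal variable.
\<close>

definition Gm_pow :: "complex set set \<Rightarrow> (complex set \<Rightarrow> complex) alg_group" where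
  "Gm_pow S = alg_product S (\<lambda>_. Gm)"

definition diagonal :: "complex set set \<Rightarrow> (complex set \<Rightarrow> complex) set" where
  "diagonal S = {\<lambda>p\<in>S. x | x. x \<in> carrier Gm}"

definition L_s :: "complex set set \<Rightarrow> (complex set \<Rightarrow> complex) set alg_group" where
  "L_s S = alg_quotient (Gm_pow S) (diagonal S)"

definition L_u :: "complex set set \<Rightarrow> (complex set \<Rightarrow> complex fps) alg_group" where
  "L_u S = alg_product S (\<lambda>_. one_units)"

definition Rel :: "complex \<Rightarrow> complex set set \<Rightarrow> (complex set \<Rightarrow> int) set" where
  "Rel q S = {n \<in> S \<rightarrow>\<^sub>E UNIV.
     finprod (ell_curve q) (\<lambda>p. p [^]\<^bsub>ell_curve q\<^esub> n p) S = \<one>\<^bsub>ell_curve q\<^esub>}"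

definition L_s' :: "complex \<Rightarrow> complex set set \<Rightarrow> (complex set \<Rightarrow> complex) set set" where
  "L_s' q S = (\<lambda>x. diagonal S #>\<^bsub>Gm_pow S\<^esub> x) `
     {x \<in> carrier (Gm_pow S). \<forall>n\<in>Rel q S. (\<Prod>p\<in>S. x p powi n p) = 1}"

definition pi1_ab ::
    "complex \<Rightarrow> complex set set \<Rightarrow>
     ((complex set \<Rightarrow> complex) set set \<times> (complex set \<Rightarrow> complex fps)) alg_group" where
  "pi1_ab q S = alg_dirprod (alg_quotient (L_s S) (L_s' q S)) (L_u S)"

end

theory Submission
  imports Defs
    "Jordan_Normal_Form.Jordan_Normal_Form_Existence"
    "Jordan_Normal_Form.Char_Poly"
begin

text \<open>
  A regular system with normalized solutions \<open>M\<close> at \<open>0\<close> and \<open>N\<close> at \<open>\<infinity>\<close> is determined by its connection matrix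
  \<open>P\<close>, \<open>M = N P\<close>. Choose a base point \<open>b\<close> outside \<open>S\<close> and normalize \<open>P b = 1\<close>; then abelian means that the values
  of \<open>P\<close> on the complement \<open>W\<close> of \<open>S\<close> commute with one another. A rational morphism becomes, in the frames \<open>M\<close> and
  \<open>N\<close>, a meromorphic \<open>q\<close>-invariant matrix on the plane, hence a constant matrix that intertwines the connection
  matrices; conversely an intertwiner \<open>T\<close> gives \<open>M' T M\<inverse>\<close>, which is meromorphic on the whole sphere and so
  rational (\<open>cdata_mor\<close>, \<open>cdata_mor_conv\<close>). Objects are thus the same as commuting normalized elliptic matrices
  \<open>P\<close>, and it remains to compare these with representations of \<open>G = \<pi>\<^sup>1\<close>.

  The comparison is made by a universal map \<open>gam\<close> from \<open>W\<close> to \<open>G\<close>, an analogue of the Albanese map. The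
  characters of \<open>L\<^sub>s / L'\<^sub>s\<close> form the lattice \<open>RR\<close> of integer vectors of degree \<open>0\<close> with \<open>\<Sum> n\<^sub>p p = 0\<close>. By
  Abel's theorem these are the divisors of the elliptic functions without zeros and poles in \<open>W\<close>. The logarithmic
  coordinates of \<open>L\<^sub>u\<close> are matched with a basis \<open>ee p k\<close> of the elliptic functions that are regular on \<open>W\<close> and
  vanish at \<open>b\<close>. Hence every character, respectively additive coordinate, of \<open>G\<close> composed with \<open>gam\<close> is one
  of these functions, and all of them occur (\<open>EE_multiplicative\<close>, \<open>EE_additive\<close>).

  Given \<open>P\<close>, joint generalized eigenspaces of the commuting values split \<open>P\<close> into a sum of characters times a
  unipotent factor. The eigenvalues are elliptic units, hence characters of \<open>G\<close>; the logarithm of the unipotent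
  factor is a combination of the \<open>ee p k\<close> with commuting nilpotent coefficients. Replacing elliptic functions by
  the coordinates of \<open>G\<close> gives a representation \<open>\<rho>\<close> with \<open>\<rho> (gam z) = P z\<close> (\<open>rep_exists\<close>). It is compatible with
  morphisms because the values of \<open>gam\<close> generate a Zariski dense monoid (\<open>PG_density\<close>): a regular function
  on \<open>G\<close> is an exponential polynomial, and a difference operator argument separates its terms.

  Conversely, theta functions factor \<open>gam\<close> itself: it is the quotient of a meromorphic map on the plane and one on
  the sphere without \<open>0\<close>, both with values in \<open>G\<close>. Applying \<open>\<rho>\<close> to both gives the frames \<open>M\<close> and \<open>N\<close>, and
  \<open>M (q z) (M z)\<inverse>\<close> is meromorphic on the sphere, which is the rational system sought (\<open>cdata_of_rep\<close>).
  The frames of a tensor product are the Kronecker products of frames, up to a constant matrix; these constants are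
  the monoidal structure, and all coherence conditions follow by cancelling the frames.
\<close>

section \<open>Rational functions and meromorphic functions on the sphere\<close>

lemma cosparse_mono: "A \<subseteq> B ==> eventually P (cosparse B) ==> eventually P (cosparse A)"
  by (auto simp: eventually_cosparse intro: sparse_in_subset)

lemma cosparse_not_false: "A ~= {} ==> \<not> eventually (%_. False) (cosparse (A :: complex set))"
  by (metis cosparse_eq_bot_iff' trivial_limit_def)

lemma eventually_cosparse_poly: "d ~= 0 ==> eventually (%z. poly d z ~= 0) (cosparse (A :: complex set))"
  using poly_roots_finite[of d] by (simp add: eventually_cosparse finite_imp_sparse)

text \<open>The numerator and denominator of the normalized fraction divide those of any other representation, so no cancellation changes the value where the denominator does not vanish.\<close>
lemma rat_eval_Fract:
  assumes "poly d z ~= 0"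
  shows "rat_eval (Fract n d) z = poly n z / poly d z"
proof -
 define a where "a = fst (quot_of_fract (Fract n d))"
 define b where "b = snd (quot_of_fract (Fract n d))"
 have d: "d ~= 0" using assms by auto
 have b: "b ~= 0" by (simp add: b_def)
 have "Fract a b = Fract n d" by (simp add: a_def b_def Fract_quot_of_fract)
 hence e: "a * d = n * b" using d b by (simp add: eq_fract)
 have "coprime a b" unfolding a_def b_def by (rule coprime_quot_of_fract)
 moreover have "b dvd a * d" unfolding e by simp
 ultimately have "b dvd d" by (metis coprime_commute coprime_dvd_mult_right_iff)
 hence bz: "poly b z ~= 0" using assms by (auto elim!: dvdE)
 have "poly a z * poly d z = poly n z * poly b z" using e by (metis poly_mult)
 thus ?thesis using bz assms by (simp add: rat_eval_def a_def[symmetric] b_def[symmetric] frac_eq_eq)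
qed

lemma ratfun_cases: "\<exists>n d. d ~= 0 \<and> (r :: ratfun) = Fract n d"
 by (metis Fract_quot_of_fract snd_quot_of_fract_nonzero)

lemma rat_eval_add: "eventually (%z. rat_eval (r + s) z = rat_eval r z + rat_eval s z) (cosparse A)"
proof -
 obtain a b c d where r: "r = Fract a b" "b ~= 0" and s: "s = Fract c d" "d ~= 0" using ratfun_cases by metis
 show ?thesis using eventually_cosparse_poly[OF r(2), of A] eventually_cosparse_poly[OF s(2), of A]
  by eventually_elim (simp add: r s rat_eval_Fract add_frac_eq)
qed

lemma rat_eval_mult: "eventually (%z. rat_eval (r * s) z = rat_eval r z * rat_eval s z) (cosparse A)"
proof -
 obtain a b c d where r: "r = Fract a b" "b ~= 0" and s: "s = Fract c d" "d ~= 0" using ratfun_cases by metis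
 show ?thesis using eventually_cosparse_poly[OF r(2), of A] eventually_cosparse_poly[OF s(2), of A]
  by eventually_elim (simp add: r s rat_eval_Fract)
qed

lemma rat_eval_const [simp]: "rat_eval (rat_const c) z = c"
 using rat_eval_Fract[of 1 z "[:c:]"] by (simp add: rat_const_def to_fract_def)

lemma rat_eval_0 [simp]: "rat_eval 0 z = 0"
 using rat_eval_const[of 0 z] by (simp add: rat_const_def)

lemma rat_eval_1 [simp]: "rat_eval 1 z = 1"
 using rat_eval_const[of 1 z] by (simp add: rat_const_def one_pCons[symmetric])

lemma rat_eval_sum: "finite I ==> eventually (%z. rat_eval (sum f I) z = (\<Sum>i\<in>I. rat_eval (f i) z)) (cosparse A)"
proof (induction I rule: finite_induct)
 case (insert i I)
 show ?case using insert(3) rat_eval_add[of "f i" "sum f I" A]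
  by eventually_elim (use insert(1,2) in simp)
qed simp

lemma rat_eval_eqI:
 assumes "eventually (%z. rat_eval r z = rat_eval s z) (cosparse A)" "A ~= {}"
 shows "r = s"
proof -
 obtain a b c d where r: "r = Fract a b" "b ~= 0" and s: "s = Fract c d" "d ~= 0" using ratfun_cases by metis
 have "a * d - c * b = 0"
 proof (rule ccontr)
  assume "a * d - c * b ~= 0"
  hence "eventually (%z. poly (a * d - c * b) z ~= 0) (cosparse A)" by (rule eventually_cosparse_poly)
  hence "eventually (%_. False) (cosparse A)"
   using eventually_cosparse_poly[OF r(2), of A] eventually_cosparse_poly[OF s(2), of A] assms(1)
   by eventually_elim (auto simp: r s rat_eval_Fract frac_eq_eq)
  thus False using cosparse_not_false[OF assms(2)] by blast
 qed
 thus ?thesis using r s by (simp add: eq_fract)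
qed

lemma rat_eval_sigma: "q ~= 0 ==> eventually (%z. rat_eval (sigma_rat q r) z = rat_eval r (q * z)) (cosparse A)"
proof -
 assume q: "q ~= 0"
 define b where "b = snd (quot_of_fract r)"
 have "b ~= 0" by (simp add: b_def)
 hence "b \<circ>\<^sub>p [:0, q:] ~= 0" using q by (auto simp: pcompose_eq_0)
 from eventually_cosparse_poly[OF this, of A] show ?thesis
  by eventually_elim (simp add: sigma_rat_def rat_eval_Fract b_def[symmetric] rat_eval_def[of r] poly_pcompose mult.commute[of q])
qed

lemma poly_meromorphic: "f meromorphic_on A ==> (%z. poly p (f z)) meromorphic_on A"
 unfolding poly_altdef by (intro meromorphic_intros)

lemma rat_eval_meromorphic: "f meromorphic_on A ==> (%z. rat_eval r (f z)) meromorphic_on A"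
 unfolding rat_eval_def by (intro meromorphic_intros poly_meromorphic)

lemma meromorphic_pole_bound:
 assumes f: "f meromorphic_on {a}"
 shows "\<exists>m L. ((%z. (z - a) ^ m * f z) \<longlongrightarrow> L) (at a)"
proof (cases "\<exists>\<^sub>F w in at a. f w ~= 0")
 case False
 hence "eventually (%z. (z - a) ^ 0 * f z = 0) (at a)" by (simp add: not_frequently)
 hence "((%z. (z - a) ^ 0 * f z) \<longlongrightarrow> 0) (at a)" by (rule tendsto_eventually)
 thus ?thesis by blast
next
 case True
 have "isolated_singularity_at f a" "not_essential f a" using f by (auto simp: meromorphic_at_iff)
 from zorder_exist[OF this True] obtain r where r: "r > 0" "zor_poly f a holomorphic_on cball a r"
  "\<And>w. w \<in> cball a r - {a} ==> f w = zor_poly f a w * (w - a) powi zorder f a" by auto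
 define n where "n = zorder f a"
 have "continuous_on (cball a r) (zor_poly f a)" using r(2) by (rule holomorphic_on_imp_continuous_on)
 hence "isCont (zor_poly f a) a" using r(1) by (intro continuous_on_interior[of "cball a r"]) auto
 hence "isCont (%w. (w - a) ^ nat (n + \<bar>n\<bar>) * zor_poly f a w) a" by (intro continuous_intros)
 hence "((%w. (w - a) ^ nat (n + \<bar>n\<bar>) * zor_poly f a w) \<longlongrightarrow> (a - a) ^ nat (n + \<bar>n\<bar>) * zor_poly f a a) (at a)"
  by (rule isContD)
 moreover have "eventually (%w. (w - a) ^ nat (n + \<bar>n\<bar>) * zor_poly f a w = (w - a) ^ nat \<bar>n\<bar> * f w) (at a)"
 proof -
  have "eventually (%w. w \<in> cball a r - {a}) (at a)"
   using r(1) unfolding eventually_at by (auto simp: dist_commute intro!: exI[of _ r])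
  thus ?thesis
  proof eventually_elim
   case (elim w)
   hence wa: "w - a ~= 0" by auto
   have "(w - a) ^ nat (n + \<bar>n\<bar>) = (w - a) powi (\<bar>n\<bar> + n)"
    by (simp add: power_int_def add.commute)
   also have "... = (w - a) ^ nat \<bar>n\<bar> * (w - a) powi n"
    using wa by (simp add: power_int_add) (simp add: power_int_def)
   finally show ?case using r(3)[OF elim] by (simp add: n_def)
  qed
 qed
 ultimately have "((%w. (w - a) ^ nat \<bar>n\<bar> * f w) \<longlongrightarrow> (a - a) ^ nat (n + \<bar>n\<bar>) * zor_poly f a a) (at a)"
  by (rule Lim_transform_eventually)
 thus ?thesis by blast
qed

lemma inverse_tendsto_at: "z ~= 0 ==> filterlim inverse (at (inverse z)) (at (z :: complex))"
 unfolding filterlim_at by (auto intro!: tendsto_intros always_eventually simp: eventually_at_filter)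

text \<open>
 The chart at infinity bounds the poles, so a polynomial removes all of them; the product extends to an entire
 function of polynomial growth, again by the chart at infinity, and Liouville applies.
\<close>
theorem meromorphic_on_sphere_imp_rational:
 assumes f: "f meromorphic_on UNIV" and g: "g meromorphic_on UNIV"
  and fg: "eventually (%z. f z = g (inverse z)) (cosparse (- {0}))"
 shows "\<exists>r. eventually (%z. rat_eval r z = f z) (cosparse UNIV)"
proof -
 have fg_at: "eventually (%w. f w = g (inverse w)) (at z)" if "z ~= 0" for z
  using fg that by (intro eventually_cosparse_imp_eventually_at) auto
 have fm: "f meromorphic_on {z}" for z using meromorphic_on_subset[OF f] by auto
 have gm: "g meromorphic_on {0}" using meromorphic_on_subset[OF g] by auto
 hence "isolated_singularity_at g 0" by (simp add: meromorphic_at_iff)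
 then obtain r0 where r0: "r0 > 0" "g analytic_on ball 0 r0 - {0}"
  unfolding isolated_singularity_at_def by (elim exE conjE)
 have nz: "z ~= 0" if "norm z > 1 / r0" for z :: complex
  using that r0(1) by auto
 have gcont: "((%w. g (inverse w)) \<longlongrightarrow> g (inverse z)) (at z)" if z: "norm z > 1 / r0" for z
 proof -
  have "1 < norm z * r0" using z r0(1) by (simp add: pos_divide_less_eq)
  hence "norm (inverse z) < r0"
   using nz[OF z] by (simp add: norm_divide inverse_eq_divide pos_divide_less_eq mult.commute)
  hence "inverse z \<in> ball 0 r0 - {0}" using nz[OF z] by simp
  hence "g analytic_on {inverse z}" using r0(2) analytic_on_subset[of g "ball 0 r0 - {0}" "{inverse z}"] by simp
  hence "isCont g (inverse z)" by (rule analytic_at_imp_isCont)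
  hence "(g \<longlongrightarrow> g (inverse z)) (at (inverse z))" by (rule isContD)
  from filterlim_compose[OF this inverse_tendsto_at[OF nz[OF z]]] show ?thesis .
 qed
 define PS where "PS = {z. \<nexists>L. (f \<longlongrightarrow> L) (at z)}"
 have far: "z \<notin> PS" if "norm z > 1 / r0" for z
 proof -
  note z = nz[OF that]
  note gcont[OF that]
  moreover have "eventually (%w. g (inverse w) = f w) (at z)"
   using fg_at[OF z] by eventually_elim simp
  ultimately have "(f \<longlongrightarrow> g (inverse z)) (at z)" by (rule Lim_transform_eventually)
  thus ?thesis by (auto simp: PS_def)
 qed
 have "{z. \<not> f analytic_on {z}} sparse_in UNIV"
  using meromorphic_on_imp_analytic_cosparse[OF f] by (simp add: eventually_cosparse)
 moreover have "PS \<subseteq> {z. \<not> f analytic_on {z}}"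
  unfolding PS_def by (intro Collect_mono impI notI, elim notE) (rule exI, rule isContD, rule analytic_at_imp_isCont)
 ultimately have "PS sparse_in UNIV" by (rule sparse_in_subset2)
 hence "PS sparse_in cball 0 (1 / r0)" by (rule sparse_in_subset) simp
 hence "finite (cball 0 (1 / r0) \<inter> PS)" by (rule sparse_in_compact_finite) simp
 moreover have "cball 0 (1 / r0) \<inter> PS = PS" using far by (force simp: not_le)
 ultimately have PS: "finite PS" by simp
 have "\<forall>a\<in>PS. \<exists>m L. ((%z. (z - a) ^ m * f z) \<longlongrightarrow> L) (at a)"
  by (intro ballI meromorphic_pole_bound fm)
 from bchoice[OF this] obtain m where m: "\<forall>a\<in>PS. \<exists>L. ((%z. (z - a) ^ m a * f z) \<longlongrightarrow> L) (at a)" by (elim exE)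
 define P where "P = (\<Prod>a\<in>PS. [:- a, 1:] ^ m a)"
 have P: "P ~= 0" using PS by (simp add: P_def)
 define K where "K z = poly P z * f z" for z
 have Km: "K meromorphic_on UNIV"
  unfolding K_def by (intro meromorphic_intros poly_meromorphic f)
 have Klim: "\<exists>L. (K \<longlongrightarrow> L) (at z)" for z
 proof (cases "z \<in> PS")
  case False
  then obtain L where "(f \<longlongrightarrow> L) (at z)" by (auto simp: PS_def)
  hence "(K \<longlongrightarrow> poly P z * L) (at z)" unfolding K_def by (intro tendsto_intros)
  thus ?thesis by (rule exI)
 next
  case True
  then obtain L where L: "((%w. (w - z) ^ m z * f w) \<longlongrightarrow> L) (at z)" using bspec[OF m True] by (elim exE)
  have "P = (\<Prod>a\<in>PS - {z}. [:- a, 1:] ^ m a) * [:- z, 1:] ^ m z"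
   unfolding P_def using prod.remove[OF PS True] by (simp add: mult.commute)
  hence Kw: "K = (%w. poly (\<Prod>a\<in>PS - {z}. [:- a, 1:] ^ m a) w * ((w - z) ^ m z * f w))"
   by (simp add: K_def fun_eq_iff)
  have "((%w. poly (\<Prod>a\<in>PS - {z}. [:- a, 1:] ^ m a) w * ((w - z) ^ m z * f w)) \<longlongrightarrow>
    poly (\<Prod>a\<in>PS - {z}. [:- a, 1:] ^ m a) z * L) (at z)"
   by (intro tendsto_mult L) (intro tendsto_intros)
  thus ?thesis unfolding Kw by (rule exI)
 qed
 define H where "H = remove_sings K"
 have Hhol: "H holomorphic_on UNIV"
 proof (rule analytic_imp_holomorphic, subst analytic_on_analytic_at, rule ballI)
  fix z
  obtain L where L: "(K \<longlongrightarrow> L) (at z)" using Klim[of z] by (elim exE)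
  have "isolated_singularity_at K z" using Km by (simp add: meromorphic_on_altdef)
  from remove_sings_analytic_at[OF this L] show "H analytic_on {z}" by (simp add: H_def)
 qed
 define k where "k w = poly P (inverse w) * g w" for w
 have "k meromorphic_on {0}"
  unfolding k_def by (intro meromorphic_intros poly_meromorphic gm)
 from meromorphic_pole_bound[OF this] obtain n L where nL: "((%w. (w - 0) ^ n * k w) \<longlongrightarrow> L) (at 0)"
  by (elim exE)
 have "((%w. norm (w ^ n * k w)) \<longlongrightarrow> norm L) (at 0)" using tendsto_norm[OF nL] by simp
 hence "eventually (%w. norm (w ^ n * k w) < norm L + 1) (at 0)" by (rule order_tendstoD) simp
 then obtain e where e: "e > 0" "\<forall>w\<in>UNIV. w ~= 0 \<and> dist w 0 < e --> norm (w ^ n * k w) < norm L + 1"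
  unfolding eventually_at by (elim exE conjE)
 define R where "R = max (1 / r0) (1 / e) + 1"
 have bound: "norm (H z) \<le> (norm L + 1) * norm z ^ n" if z: "R \<le> norm z" for z
 proof -
  have zr: "norm z > 1 / r0" "norm z > 1 / e" using z by (auto simp: R_def)
  note z0 = nz[OF zr(1)]
  have "((%w. g (inverse w)) \<longlongrightarrow> g (inverse z)) (at z)" by (rule gcont[OF zr(1)])
  hence "((%w. poly P w * g (inverse w)) \<longlongrightarrow> poly P z * g (inverse z)) (at z)" by (intro tendsto_intros)
  moreover have "eventually (%w. poly P w * g (inverse w) = K w) (at z)"
   using fg_at[OF z0] by eventually_elim (simp add: K_def)
  ultimately have "(K \<longlongrightarrow> poly P z * g (inverse z)) (at z)" by (rule Lim_transform_eventually)
  hence H: "H z = k (inverse z)" unfolding H_def k_def inverse_inverse_eq by (rule remove_sings_eqI)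
  have "1 < norm z * e" using zr(2) e(1) by (simp add: pos_divide_less_eq)
  hence "norm (inverse z) < e" using z0 by (simp add: norm_divide inverse_eq_divide pos_divide_less_eq mult.commute)
  hence "norm (inverse z ^ n * k (inverse z)) < norm L + 1" using bspec[OF e(2) UNIV_I, of "inverse z"] z0 by simp
  hence "norm (k (inverse z)) / norm z ^ n \<le> norm L + 1"
   by (simp add: norm_mult norm_power norm_inverse power_inverse divide_inverse mult.commute)
  thus ?thesis using z0 by (simp add: H pos_divide_le_eq)
 qed
 have Hpoly: "H z = (\<Sum>k\<le>n. (deriv ^^ k) H 0 / fact k * z ^ k)" for z
  by (rule Liouville_polynomial[OF Hhol bound])
 define Q where "Q = (\<Sum>k\<le>n. monom ((deriv ^^ k) H 0 / fact k) k)"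
 have HQ: "H z = poly Q z" for z
  unfolding Q_def poly_sum using Hpoly[of z] by (simp add: poly_monom)
 have "eventually (%z. remove_sings K z = K z) (cosparse UNIV)" using Km by (rule eventually_remove_sings_eq)
 hence "eventually (%z. rat_eval (Fract Q P) z = f z) (cosparse UNIV)"
  using eventually_cosparse_poly[OF P, of UNIV]
 proof eventually_elim
  case (elim z)
  have "poly Q z = poly P z * f z" using elim(1) HQ[of z] by (simp add: H_def K_def)
  thus ?case using elim(2) by (simp add: rat_eval_Fract)
 qed
 thus ?thesis by (rule exI)
qed

section \<open>Matrices of all sizes in one ring\<close>

text \<open>
 Matrices of all sizes act on sequences. This places them in one ring with unit, the matrices of size \<open>n\<close> being a
 corner of it, so that ring reasoning needs no conditions on dimensions and \<open>1 + Y\<close> makes sense for \<open>Y\<close> of any size.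
\<close>
typedef linop = "{f :: (nat => complex) => nat => complex.
 (\<forall>x y. f (%i. x i + y i) = (%i. f x i + f y i)) \<and> (\<forall>c x. f (%i. c * x i) = (%i. c * f x i))}"
 morphisms ap Abs_linop
 by (rule exI[of _ "%x. x"]) auto

setup_lifting type_definition_linop

instantiation linop :: ring_1
begin
lift_definition zero_linop :: linop is "%x i. 0" by auto
lift_definition one_linop :: linop is "%x. x" by auto
lift_definition plus_linop :: "linop => linop => linop" is "%f g x i. f x i + g x i"
 by (auto simp: algebra_simps)
lift_definition minus_linop :: "linop => linop => linop" is "%f g x i. f x i - g x i"
 by (auto simp: algebra_simps)
lift_definition uminus_linop :: "linop => linop" is "%f x i. - f x i"
 by (auto simp: algebra_simps)
lift_definition times_linop :: "linop => linop => linop" is "%f g x. f (g x)"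
 by auto
instance
proof
 show "(0::linop) ~= 1"
  by transfer (auto simp: fun_eq_iff intro!: exI[of _ "%_. 1"])
qed (transfer; auto simp: algebra_simps)+
end

lift_definition cc :: "complex => linop" is "%c x i. c * x i"
 by (auto simp: algebra_simps)

lift_definition emb :: "complex mat => linop" is
 "%A x i. if i < dim_row A then (\<Sum>j<dim_col A. A $$ (i,j) * x j) else 0"
 by (auto simp: algebra_simps sum.distrib sum_distrib_left)

definition ent :: "linop => nat => nat => complex" where
 "ent a i j = ap a (%k. if k = j then 1 else 0) i"

definition corner :: "nat => linop set" where
 "corner n = emb ` carrier_mat n n"

definition cut :: "nat => linop => complex mat" where
 "cut n a = mat n n (%(i,j). ent a i j)"

lemma linop_eqI: "(\<And>x i. ap a x i = ap b x i) ==> a = b"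
 by (metis ap_inject ext)

lemma ap_simps [simp]:
 "ap 0 x i = 0" "ap 1 x = x" "ap (a + b) x i = ap a x i + ap b x i"
 "ap (a - b) x i = ap a x i - ap b x i" "ap (- a) x i = - ap a x i"
 "ap (a * b) x = ap a (ap b x)" "ap (cc c) x i = c * x i"
 by (simp_all add: zero_linop.rep_eq one_linop.rep_eq plus_linop.rep_eq minus_linop.rep_eq
   uminus_linop.rep_eq times_linop.rep_eq cc.rep_eq)

lemma ap_sum [simp]: "ap (sum f I) x i = (\<Sum>k\<in>I. ap (f k) x i)"
 by (induction I rule: infinite_finite_induct) auto

lemma ap_scale: "ap a (%i. c * x i) i = c * ap a x i"
 using ap[of a] by (auto simp: fun_eq_iff)

lemma ap_emb: "ap (emb A) x i = (if i < dim_row A then (\<Sum>j<dim_col A. A $$ (i,j) * x j) else 0)"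
 by (simp add: emb.rep_eq)

lemma cc_simps [simp]: "cc 0 = 0" "cc 1 = 1"
 by (auto intro!: linop_eqI)

lemma cc_add: "cc (a + b) = cc a + cc b"
 and cc_diff: "cc (a - b) = cc a - cc b"
 and cc_minus: "cc (- a) = - cc a"
 and cc_mult: "cc (a * b) = cc a * cc b"
 by (auto intro!: linop_eqI simp: algebra_simps)

lemma cc_sum: "cc (sum f I) = (\<Sum>k\<in>I. cc (f k))"
 by (induction I rule: infinite_finite_induct) (auto simp: cc_add)

lemma cc_commute: "cc c * a = a * cc c"
proof (rule linop_eqI)
 fix x i
 have "ap (cc c) x = (%i. c * x i)" by (rule ext) simp
 thus "ap (cc c * a) x i = ap (a * cc c) x i" by (simp add: ap_scale)
qed

lemma diff_cc_commute: "a * b = b * a ==> (a - cc c) * b = b * (a - cc c)"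
 by (simp add: left_diff_distrib right_diff_distrib cc_commute[of c b])

lemma cc_left_commute: "a * (cc c * b) = cc c * (a * b)"
 by (metis cc_commute mult.assoc)

lemma cc_cc: "cc a * (cc b * x) = cc (a * b) * x"
 by (simp add: cc_mult mult.assoc)

lemma cc_prod: "cc a * x * (cc b * y) = cc (a * b) * (x * y)"
 by (simp add: mult.assoc cc_left_commute[of x] cc_cc)

lemma ent_simps [simp]:
 "ent 0 i j = 0" "ent (a + b) i j = ent a i j + ent b i j"
 "ent (a - b) i j = ent a i j - ent b i j" "ent (cc c * a) i j = c * ent a i j"
 "ent (sum f I) i j = (\<Sum>k\<in>I. ent (f k) i j)"
 by (auto simp: ent_def)

lemma ent_emb: "i < dim_row A ==> j < dim_col A ==> ent (emb A) i j = A $$ (i,j)"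
 by (simp add: ent_def ap_emb if_distrib[of "%x. _ * x"] sum.delta cong: if_cong)

lemma emb_mult: "dim_col A = dim_row B ==> emb (A * B) = emb A * emb B"
proof (rule linop_eqI)
 fix x i assume d: "dim_col A = dim_row B"
 have "i < dim_row A ==> (\<Sum>j<dim_col B. (\<Sum>k<dim_row B. A $$ (i,k) * B $$ (k,j)) * x j)
   = (\<Sum>k<dim_row B. A $$ (i,k) * (\<Sum>j<dim_col B. B $$ (k,j) * x j))"
  by (simp add: sum_distrib_left sum_distrib_right mult.assoc) (rule sum.swap)
 thus "ap (emb (A * B)) x i = ap (emb A * emb B) x i"
  using d by (auto simp: ap_emb scalar_prod_def lessThan_atLeast0)
qed

lemma emb_add: "A \<in> carrier_mat n m ==> B \<in> carrier_mat n m ==> emb (A + B) = emb A + emb B"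
 by (rule linop_eqI) (auto simp: ap_emb algebra_simps sum.distrib)

lemma emb_smult: "emb (c \<cdot>\<^sub>m A) = cc c * emb A"
 by (rule linop_eqI) (auto simp: ap_emb sum_distrib_left mult.assoc)

lemma emb_zero: "emb (0\<^sub>m n m) = 0"
 by (rule linop_eqI) (auto simp: ap_emb)

lemma emb_inj:
 assumes "A \<in> carrier_mat n m" "B \<in> carrier_mat n m" "emb A = emb B"
 shows "A = B"
proof (rule eq_matI)
 fix i j assume "i < dim_row B" "j < dim_col B"
 thus "A $$ (i,j) = B $$ (i,j)"
  using assms ent_emb[of i A j] ent_emb[of i B j] by auto
qed (use assms in auto)

abbreviation idn :: "nat => linop" where "idn n \<equiv> emb (1\<^sub>m n)"

lemma corner_emb [intro, simp]: "A \<in> carrier_mat n n ==> emb A \<in> corner n"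
 by (simp add: corner_def)

lemma corner_zero [simp]: "0 \<in> corner n"
 by (metis corner_emb emb_zero zero_carrier_mat)

lemma corner_add: "a \<in> corner n ==> b \<in> corner n ==> a + b \<in> corner n"
 unfolding corner_def by (auto simp: emb_add[symmetric])

lemma corner_scale: "a \<in> corner n ==> cc c * a \<in> corner n"
 unfolding corner_def by (auto simp: emb_smult[symmetric])

lemma corner_minus: "a \<in> corner n ==> b \<in> corner n ==> a - b \<in> corner n"
 using corner_add[of a n "cc (-1) * b"] corner_scale[of b n "-1"] by (simp add: cc_minus)

lemma corner_mult: "a \<in> corner n ==> b \<in> corner n ==> a * b \<in> corner n"
 unfolding corner_def by (auto simp: emb_mult[symmetric])

lemma corner_sum: "(\<And>k. k \<in> I ==> f k \<in> corner n) ==> sum f I \<in> corner n"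
 by (induction I rule: infinite_finite_induct) (auto intro: corner_add)

lemma corner_id: "a \<in> corner n ==> idn n * a = a" "a \<in> corner n ==> a * idn n = a"
 unfolding corner_def by (auto simp: emb_mult[symmetric])

lemma cut_carrier [simp]: "cut n a \<in> carrier_mat n n"
 by (simp add: cut_def)

lemma cut_emb: "A \<in> carrier_mat n n ==> cut n (emb A) = A"
 by (rule eq_matI) (auto simp: cut_def ent_emb)

lemma emb_cut: "a \<in> corner n ==> emb (cut n a) = a"
 unfolding corner_def by (auto simp: cut_emb)

lemma ent_mult:
 assumes "a \<in> corner n" "b \<in> corner n" "i < n" "j < n"
 shows "ent (a * b) i j = (\<Sum>k<n. ent a i k * ent b k j)"
proof -
 obtain A B where AB: "a = emb A" "b = emb B" "A \<in> carrier_mat n n" "B \<in> carrier_mat n n"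
  using assms by (auto simp: corner_def)
 have "ent (a * b) i j = (A * B) $$ (i,j)"
  using AB assms(3,4) by (simp add: emb_mult[symmetric] ent_emb)
 also have "... = (\<Sum>k<n. ent a i k * ent b k j)"
  using AB assms(3,4) by (auto simp: scalar_prod_def lessThan_atLeast0 ent_emb intro!: sum.cong)
 finally show ?thesis .
qed

lemma corner_eqI:
 assumes "a \<in> corner n" "b \<in> corner n" "\<And>i j. i < n ==> j < n ==> ent a i j = ent b i j"
 shows "a = b"
proof -
 have "cut n a = cut n b" using assms(3) by (auto simp: cut_def intro!: eq_matI)
 thus ?thesis using emb_cut assms by metis
qed

section \<open>Nilpotency and commuting families\<close>

lemma power_commute: "(a::'a::monoid_mult) * b = b * a ==> a ^ k * b = b * a ^ k"
 by (metis power_commuting_commutes)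

lemma power_Suc_mult: "(a::'a::monoid_mult) ^ Suc k * b = a ^ k * (a * b)"
 by (metis mult.assoc power_Suc2)

lemma power_left_commute: "(a::'a::monoid_mult) * b = b * a ==> a ^ k * (b * c) = b * (a ^ k * c)"
 by (simp add: mult.assoc[symmetric] power_commute)

text \<open>Every monomial of the expanded power contains \<open>X ^ a\<close> or \<open>Y ^ b\<close>; the factor \<open>W\<close> allows nilpotency on a subspace only.\<close>
lemma nilpotent_add:
 fixes X Y W :: "'a::ring_1"
 assumes "X * Y = Y * X" "X ^ a * W = 0" "Y ^ b * W = 0"
 shows "(X + Y) ^ (a + b) * W = 0"
 using assms(2,3)
proof (induction "a + b" arbitrary: a b W)
 case 0
 thus ?case by simp
next
 case (Suc k)
 show ?case
 proof (cases "a = 0 \<or> b = 0")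
  case True
  hence "W = 0" using Suc by auto
  thus ?thesis by simp
 next
  case False
  then obtain a' b' where ab: "a = Suc a'" "b = Suc b'" by (meson not0_implies_Suc)
  have k: "k = a' + b" "k = a + b'" using Suc(2) ab by auto
  have "Y ^ b * (X * W) = X * (Y ^ b * W)"
   by (rule power_left_commute) (simp add: assms(1))
  moreover have "X ^ a * (Y * W) = Y * (X ^ a * W)"
   by (rule power_left_commute) (simp add: assms(1))
  moreover have "X ^ a' * (X * W) = 0" "Y ^ b' * (Y * W) = 0"
   using Suc(3,4) unfolding ab power_Suc_mult .
  ultimately have 1: "(X + Y) ^ (a' + b) * (X * W) = 0" "(X + Y) ^ (a + b') * (Y * W) = 0"
   using Suc(1)[OF k(1), of "X * W"] Suc(1)[OF k(2), of "Y * W"] Suc(3,4) by simp_all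
  have "(X + Y) ^ (a + b) * W = (X + Y) ^ k * ((X + Y) * W)"
   unfolding Suc(2)[symmetric] by (rule power_Suc_mult)
  also have "... = 0" using 1 k by (simp add: distrib_left distrib_right)
  finally show ?thesis .
 qed
qed

lemma nilpotent_sum:
 fixes X :: "'i => 'a::ring_1"
 assumes "finite I" "\<And>i j. i \<in> I ==> j \<in> I ==> X i * X j = X j * X i"
  "\<And>i. i \<in> I ==> X i ^ d i * W = 0" 
 shows "I = {} \<or> (\<Sum>i\<in>I. X i) ^ (\<Sum>i\<in>I. d i) * W = 0"
 using assms
proof (induction I rule: finite_induct)
 case (insert x I)
 have "X x * sum X I = sum X I * X x"
  unfolding sum_distrib_left sum_distrib_right using insert by (intro sum.cong) auto
 thus ?case using insert nilpotent_add[of "X x" "sum X I" "d x" W "sum d I"]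
  by (cases "I = {}") auto
qed auto

text \<open>Generalized eigenspaces for different eigenvalues meet in zero, because \<open>a - cc l\<close> and \<open>a - cc m\<close> differ by an invertible scalar.\<close>
lemma coprime_annihilators:
 assumes "(a - cc l) ^ d * Y = 0" "(a - cc m) ^ e * Y = 0" "l ~= m"
 shows "Y = 0"
 using assms(1,2)
proof (induction "d + e" arbitrary: d e Y rule: less_induct)
 case less
 show ?case
 proof (cases "d = 0 \<or> e = 0")
  case False
  then obtain d' e' where de: "d = Suc d'" "e = Suc e'" by (meson not0_implies_Suc)
  have com: "(a - cc l) * (a - cc m) = (a - cc m) * (a - cc l)"
   by (intro diff_cc_commute diff_cc_commute[symmetric] refl)
  have 1: "(a - cc l) * Y = 0"
  proof (rule less(1)[of d' e])
   show "(a - cc l) ^ d' * ((a - cc l) * Y) = 0"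
    using less(2) unfolding de power_Suc_mult .
   show "(a - cc m) ^ e * ((a - cc l) * Y) = 0"
    using power_left_commute[OF com[symmetric], of e Y] less(3) by simp
  qed (use de in auto)
  have 2: "(a - cc m) * Y = 0"
  proof (rule less(1)[of d e'])
   show "(a - cc m) ^ e' * ((a - cc m) * Y) = 0"
    using less(3) unfolding de power_Suc_mult .
   show "(a - cc l) ^ d * ((a - cc m) * Y) = 0"
    using power_left_commute[OF com, of d Y] less(2) by simp
  qed (use de in auto)
  have "cc (1 / (m - l)) * (cc (m - l) * Y) = 0"
   using 1 2 by (simp add: cc_diff left_diff_distrib right_diff_distrib)
  thus ?thesis using assms(3) by (simp add: mult.assoc[symmetric] cc_mult[symmetric])
 qed (use less in auto)
qed

lemma jordan_matrix_blocks:
 assumes "i < sum_list (map fst n_as)" "j < sum_list (map fst n_as)"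
  "jordan_matrix n_as $$ (i,j) ~= (0::complex)"
 shows "i \<le> j \<and> jordan_matrix n_as $$ (i,i) = jordan_matrix n_as $$ (j,j)"
 using assms
proof (induction n_as arbitrary: i j)
 case (Cons na n_as)
 obtain k a where na: "na = (k,a)" by (cases na)
 define m where "m = sum_list (map fst n_as)"
 define J where "J = jordan_matrix n_as"
 have d: "J \<in> carrier_mat m m" unfolding J_def m_def by (rule jordan_matrix_carrier)
 have J: "jordan_matrix (na # n_as) = four_block_mat (jordan_block k a) (0\<^sub>m k m) (0\<^sub>m m k) J"
  using na by (simp add: jordan_matrix_Cons J_def m_def)
 have ij: "i < k + m" "j < k + m" using Cons.prems na by (auto simp: m_def)
 have e: "four_block_mat (jordan_block k a) (0\<^sub>m k m) (0\<^sub>m m k) J $$ (i,j) =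
   (if i < k then if j < k then jordan_block k a $$ (i,j) else 0
   else if j < k then 0 else J $$ (i - k, j - k))" if "i < k + m" "j < k + m" for i j
  using that d by auto
 have nz: "(if i < k then if j < k then jordan_block k a $$ (i,j) else 0
   else if j < k then 0 else J $$ (i - k, j - k)) ~= 0"
  using Cons.prems(3) unfolding J e[OF ij] .
 have IH: "i - k \<le> j - k \<and> J $$ (i - k, i - k) = J $$ (j - k, j - k)" if "\<not> i < k" "\<not> j < k"
  using Cons.IH[of "i - k" "j - k"] nz that ij by (simp add: J_def m_def)
 show ?case
  unfolding J e[OF ij(1) ij(1)] e[OF ij(2) ij(2)]
  using nz IH ij by (cases "i < k"; cases "j < k") (auto simp: jordan_block_def split: if_splits)
qed auto

text \<open>The projections to the generalized eigenspaces, read off from a Jordan form: in the Jordan basis they are diagonal matrices that select the blocks of one eigenvalue.\<close>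
lemma spectral_idempotents:
 assumes A: "A \<in> carrier_mat n n"
 obtains \<Lambda> :: "complex set" and E :: "complex => linop" where
  "finite \<Lambda>" "(\<Sum>l\<in>\<Lambda>. E l) = idn n" "\<And>l. E l \<in> corner n"
  "\<And>l. (emb A - cc l) ^ n * E l = 0"
  "\<And>l m. E l * E m = (if l = m then E l else 0)"
  "\<And>b l. b \<in> corner n ==> emb A * b = b * emb A ==> l \<in> \<Lambda> ==> b * E l = E l * b"
proof -
 obtain as n_as where "jordan_nf A n_as"
  using char_poly_factorized[OF A] jordan_nf_exists[OF A] by blast
 then obtain Q R where w: "similar_mat_wit A (jordan_matrix n_as) Q R"
  by (auto simp: jordan_nf_def similar_mat_def)
 define J where "J = jordan_matrix n_as"
 have c: "J \<in> carrier_mat n n" "Q \<in> carrier_mat n n" "R \<in> carrier_mat n n"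
  and AJ: "A = Q * J * R" and QR: "Q * R = 1\<^sub>m n" "R * Q = 1\<^sub>m n"
  using similar_mat_witD2[OF A w] by (auto simp: J_def)
 have n: "sum_list (map fst n_as) = n"
  using carrier_matD(1)[OF c(1)] unfolding J_def by simp
 have J: "i \<le> j \<and> J $$ (i,i) = J $$ (j,j)" if "i < n" "j < n" "J $$ (i,j) ~= 0" for i j
  using jordan_matrix_blocks[of i n_as j] that n by (simp add: J_def)
 define j where "j = emb J"
 define D where "D l = emb (mat n n (%(i,k). if i = k \<and> J $$ (i,i) = l then 1 else 0))" for l
 have apD: "ap (D l) x i = (if i < n \<and> J $$ (i,i) = l then x i else 0)" for l x i
  by (auto simp: D_def ap_emb if_distrib[of "%x. x * _"] if_distribR sum.delta cong: if_cong)
 have apj: "ap j x i = (if i < n then (\<Sum>k<n. J $$ (i,k) * x k) else 0)" for x i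
  using c by (simp add: j_def ap_emb)
 define q r where "q = emb Q" and "r = emb R"
 define E where "E l = q * D l * r" for l
 define \<Lambda> where "\<Lambda> = (%i. J $$ (i,i)) ` {..<n}"
 have cor: "j \<in> corner n" "q \<in> corner n" "r \<in> corner n" "D l \<in> corner n" for l
  using c by (auto simp: j_def q_def r_def D_def)
 have qr: "q * r = idn n" "r * q = idn n"
  using QR c by (auto simp: q_def r_def emb_mult[symmetric])
 have a: "emb A = q * j * r"
  using c by (simp add: AJ q_def j_def r_def emb_mult mult.assoc)
 have Dj: "D l * j = j * D l" for l
 proof (rule linop_eqI)
  fix x i
  have "(\<Sum>k<n. J $$ (i,k) * (if J $$ (k,k) = l then x k else 0))
    = (if J $$ (i,i) = l then \<Sum>k<n. J $$ (i,k) * x k else 0)" if "i < n"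
   using J[OF that] by (auto intro!: sum.cong sum.neutral) (metis, metis)
  thus "ap (D l * j) x i = ap (j * D l) x i"
   by (auto simp: apD apj)
 qed
 have DD: "D l * D m = (if l = m then D l else 0)" for l m
  by (auto intro!: linop_eqI simp: apD)
 have nil: "i < n \<and> J $$ (i,i) = l \<and> i + k < n" if "ap ((j - cc l) ^ k * D l) x i ~= 0" for l k x i
  using that
 proof (induction k arbitrary: i)
  case 0
  thus ?case by (auto simp: apD split: if_splits)
 next
  case (Suc k)
  define v where "v = ap ((j - cc l) ^ k * D l) x"
  have v: "v i ~= 0 ==> i < n \<and> J $$ (i,i) = l \<and> i + k < n" for i
   using Suc.IH by (simp add: v_def)
  have w: "ap j v i - l * v i ~= 0"
   using Suc.prems by (simp add: v_def mult.assoc)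
  have i: "i < n" using w v[of i] by (auto simp: apj split: if_splits)
  have "\<exists>k<n. (if k = i then J $$ (i,i) - l else J $$ (i,k)) * v k ~= 0"
  proof (rule ccontr)
   assume "\<not> ?thesis"
   hence "(\<Sum>k<n. (if k = i then J $$ (i,i) - l else J $$ (i,k)) * v k) = 0"
    by (intro sum.neutral) blast
   also have "(\<Sum>k<n. (if k = i then J $$ (i,i) - l else J $$ (i,k)) * v k)
     = (\<Sum>k<n. J $$ (i,k) * v k - (if k = i then l * v i else 0))"
    by (intro sum.cong) (auto simp: algebra_simps)
   also have "... = ap j v i - l * v i" using i by (simp add: apj sum_subtractf)
   finally show False using w by simp
  qed
  then obtain k' where k': "k' < n" "(if k' = i then J $$ (i,i) - l else J $$ (i,k')) * v k' ~= 0"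
   by blast
  hence vk: "J $$ (k',k') = l" "k' + k < n" using v[of k'] by auto
  with k' have "k' ~= i" "J $$ (i,k') ~= 0" by (auto split: if_splits)
  with J[OF i k'(1)] vk show ?case by auto
 qed
 have nilD: "(j - cc l) ^ n * D l = 0" for l
  by (rule linop_eqI) (use nil[of l n] in fastforce)
 have conj: "(emb A - cc l) ^ k * q = q * (j - cc l) ^ k" for l k
 proof (induction k)
  case (Suc k)
  have "(emb A - cc l) * q = q * j * (r * q) - q * cc l"
   by (simp add: a left_diff_distrib mult.assoc cc_commute[of l q])
  also have "... = q * (j - cc l)"
   using cor by (simp add: qr corner_id corner_mult right_diff_distrib mult.assoc)
  finally have s: "(emb A - cc l) * q = q * (j - cc l)" .
  have "(emb A - cc l) ^ Suc k * q = (emb A - cc l) * ((emb A - cc l) ^ k * q)"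
   by (simp add: mult.assoc)
  also have "... = ((emb A - cc l) * q) * (j - cc l) ^ k" by (simp add: Suc mult.assoc)
  finally show ?case by (simp add: s mult.assoc)
 qed auto
 have E4: "(emb A - cc l) ^ n * E l = 0" for l
 proof -
  have "(emb A - cc l) ^ n * E l = ((emb A - cc l) ^ n * q) * D l * r" by (simp add: E_def mult.assoc)
  also have "... = q * ((j - cc l) ^ n * D l) * r" by (simp add: conj mult.assoc)
  finally show ?thesis by (simp add: nilD)
 qed
 have E5: "E l * E m = (if l = m then E l else 0)" for l m
 proof -
  have "E l * E m = q * D l * (r * q) * D m * r" by (simp add: E_def mult.assoc)
  also have "... = q * (D l * D m) * r" using cor by (simp add: qr corner_id corner_mult mult.assoc)
  finally show ?thesis by (simp add: DD E_def)
 qed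
 have "(\<Sum>l\<in>\<Lambda>. D l) = idn n"
 proof (rule linop_eqI)
  fix x :: "nat => complex" and i
  have "finite \<Lambda>" by (simp add: \<Lambda>_def)
  moreover have "i < n ==> J $$ (i,i) \<in> \<Lambda>" by (auto simp: \<Lambda>_def)
  moreover have "(\<Sum>l\<in>\<Lambda>. if i < n \<and> J $$ (i,i) = l then x i else 0)
    = (\<Sum>l\<in>\<Lambda>. if l = J $$ (i,i) then (if i < n then x i else 0) else 0)"
   by (intro sum.cong) auto
  moreover have "(\<Sum>j<n. 1\<^sub>m n $$ (i,j) * x j) = x i" if "i < n"
   using that by (subst sum.cong[OF refl, of _ _ "%k. if k = i then x k else 0"]) auto
  ultimately show "ap (\<Sum>l\<in>\<Lambda>. D l) x i = ap (idn n) x i"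
   by (auto simp: apD ap_emb)
 qed
 hence E2: "(\<Sum>l\<in>\<Lambda>. E l) = idn n"
  using cor qr unfolding E_def by (simp add: sum_distrib_left[symmetric] sum_distrib_right[symmetric] corner_id(2))
 have E3: "E l \<in> corner n" for l using cor by (auto simp: E_def intro: corner_mult)
 have aE: "emb A * E l = E l * emb A" for l
 proof -
  have "emb A * E l = q * j * (r * q) * D l * r" by (simp add: a E_def mult.assoc)
  also have "... = q * (j * D l) * r" using cor by (simp add: qr corner_id corner_mult mult.assoc)
  also have "... = q * D l * (r * q) * j * r"
   using cor by (simp add: Dj[symmetric] qr corner_id corner_mult mult.assoc)
  finally show ?thesis by (simp add: a E_def mult.assoc)
 qed
 have E6: "b * E l = E l * b" if b: "b \<in> corner n" "emb A * b = b * emb A" "l \<in> \<Lambda>" for b l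
 proof -
  have z: "E m * b * E k = 0" if "m ~= k" for m k
  proof (rule coprime_annihilators[OF _ _ that])
   have 1: "(emb A - cc m) * b = b * (emb A - cc m)" for m
    using b by (intro diff_cc_commute) auto
   have 2: "(emb A - cc k) * E m = E m * (emb A - cc k)" for k m
    by (intro diff_cc_commute) (simp add: aE)
   show "(emb A - cc m) ^ n * (E m * b * E k) = 0"
    by (simp add: mult.assoc[symmetric] E4)
   show "(emb A - cc k) ^ n * (E m * b * E k) = 0"
    using power_left_commute[OF 1, of k n "E k"] power_left_commute[OF 2, of k n m "b * E k"] E4[of k]
    by (simp add: mult.assoc)
  qed
  have fin: "finite \<Lambda>" by (simp add: \<Lambda>_def)
  have "b * E l = (\<Sum>m\<in>\<Lambda>. E m) * b * E l" using b E2 by (simp add: corner_id)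
  also have "... = (\<Sum>m\<in>\<Lambda>. if m = l then E l * b * E l else 0)"
   unfolding sum_distrib_right using z by (intro sum.cong) auto
  also have "... = E l * b * E l" using fin b by simp
  also have "... = (\<Sum>m\<in>\<Lambda>. if m = l then E l * b * E l else 0)" using fin b by simp
  also have "... = E l * b * (\<Sum>m\<in>\<Lambda>. E m)"
   unfolding sum_distrib_left using z by (intro sum.cong) auto
  also have "... = E l * b" using b E2 E3 by (simp add: corner_id mult.assoc)
  finally show ?thesis .
 qed
 show ?thesis by (rule that[OF _ E2 E3 E4 E5 E6]) (auto simp: \<Lambda>_def)
qed

text \<open>The idempotents of one matrix commute with all the others, so the products of idempotents of the individual matrices do the job. Induction over the list.\<close>
lemma joint_spectral_idempotents:
 assumes "set as \<subseteq> corner n" "\<And>a b. a \<in> set as ==> b \<in> set as ==> a * b = b * a"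
 shows "\<exists>K E. finite K \<and> (\<Sum>k\<in>K. E k) = idn n \<and> (\<forall>k. E k \<in> corner n) \<and>
  (\<forall>k\<in>K. \<forall>i<length as. (as ! i - cc (k ! i)) ^ n * E k = 0) \<and>
  (\<forall>k\<in>K. \<forall>l\<in>K. E k * E l = (if k = l then E k else 0)) \<and>
  (\<forall>k\<in>K. \<forall>b\<in>corner n. (\<forall>a\<in>set as. a * b = b * a) --> b * E k = E k * b)"
 using assms
proof (induction as)
 case Nil
 show ?case
  by (rule exI[of _ "{[]}"], rule exI[of _ "%_. idn n"]) (auto simp: corner_id)
next
 case (Cons a as)
 from Cons.IH Cons.prems obtain K E where IH: "finite K" "(\<Sum>k\<in>K. E k) = idn n" "\<And>k. E k \<in> corner n"
  "\<And>k i. k \<in> K ==> i < length as ==> (as ! i - cc (k ! i)) ^ n * E k = 0"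
  "\<And>k l. k \<in> K ==> l \<in> K ==> E k * E l = (if k = l then E k else 0)"
  "\<And>k b. k \<in> K ==> b \<in> corner n ==> (\<And>a. a \<in> set as ==> a * b = b * a) ==> b * E k = E k * b"
  by auto
 obtain A where A: "a = emb A" "A \<in> carrier_mat n n"
  using Cons.prems by (auto simp: corner_def)
 obtain \<Lambda> F where F: "finite \<Lambda>" "(\<Sum>l\<in>\<Lambda>. F l) = idn n" "\<And>l. F l \<in> corner n"
  "\<And>l. (a - cc l) ^ n * F l = 0" "\<And>l m. F l * F m = (if l = m then F l else 0)"
  "\<And>b l. b \<in> corner n ==> a * b = b * a ==> l \<in> \<Lambda> ==> b * F l = F l * b"
  using spectral_idempotents[OF A(2)] A(1) by metis
 define G where "G k = F (hd k) * E (tl k)" for k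
 define M where "M = (%(l,k). l # k) ` (\<Lambda> \<times> K)"
 have aE: "E k * a = a * E k" if "k \<in> K" for k
  using IH(6)[OF that, of a] Cons.prems by (auto simp: A)
 have EF: "E k * F l = F l * E k" if "k \<in> K" "l \<in> \<Lambda>" for k l
  using F(6)[OF IH(3) aE[symmetric] that(2)] that by auto
 have MD: "\<exists>l k. x = l # k \<and> l \<in> \<Lambda> \<and> k \<in> K" if "x \<in> M" for x
  using that by (auto simp: M_def)
 have "finite M" using F(1) IH(1) by (simp add: M_def)
 moreover have "(\<Sum>k\<in>M. G k) = idn n"
 proof -
  have "(\<Sum>k\<in>M. G k) = (\<Sum>(l,k)\<in>\<Lambda> \<times> K. F l * E k)"
   unfolding M_def by (subst sum.reindex) (auto simp: G_def inj_on_def intro!: sum.cong)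
  also have "... = (\<Sum>l\<in>\<Lambda>. F l) * (\<Sum>k\<in>K. E k)"
   by (simp add: sum_product sum.cartesian_product)
  finally show ?thesis using F(2) IH(2) corner_id(1)[of "idn n" n] by simp
 qed
 moreover have "\<forall>k. G k \<in> corner n" using F(3) IH(3) by (auto simp: G_def intro: corner_mult)
 moreover have "\<forall>x\<in>M. \<forall>i<length (a # as). ((a # as) ! i - cc (x ! i)) ^ n * G x = 0"
 proof (intro ballI allI impI)
  fix x i assume x: "x \<in> M" and i: "i < length (a # as)"
  from MD[OF x] obtain l k where lk: "x = l # k" "l \<in> \<Lambda>" "k \<in> K" by auto
  show "((a # as) ! i - cc (x ! i)) ^ n * G x = 0"
  proof (cases i)
   case 0
   thus ?thesis using lk F(4)[of l] by (simp add: G_def mult.assoc[symmetric])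
  next
   case (Suc j)
   hence "(as ! j - cc (k ! j)) ^ n * E k = 0" using IH(4)[OF lk(3), of j] i by simp
   thus ?thesis using lk Suc
    by (simp add: G_def EF[OF lk(3,2), symmetric]) (simp add: mult.assoc[symmetric])
  qed
 qed
 moreover have "\<forall>x\<in>M. \<forall>y\<in>M. G x * G y = (if x = y then G x else 0)"
 proof (intro ballI)
  fix x y assume x: "x \<in> M" and y: "y \<in> M"
  from MD[OF x] obtain l k where lk: "x = l # k" "l \<in> \<Lambda>" "k \<in> K" by auto
  from MD[OF y] obtain l' k' where lk': "y = l' # k'" "l' \<in> \<Lambda>" "k' \<in> K" by auto
  have "G x * G y = F l * (E k * F l') * E k'" using lk lk' by (simp add: G_def mult.assoc)
  also have "... = (F l * F l') * (E k * E k')" using EF[OF lk(3) lk'(2)] by (simp add: mult.assoc)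
  finally show "G x * G y = (if x = y then G x else 0)"
   using F(5) IH(5)[OF lk(3) lk'(3)] lk lk' by (auto simp: G_def)
 qed
 moreover have "\<forall>x\<in>M. \<forall>b\<in>corner n. (\<forall>a\<in>set (a # as). a * b = b * a) --> b * G x = G x * b"
 proof (intro ballI impI)
  fix x b assume x: "x \<in> M" and b: "b \<in> corner n" "\<forall>c\<in>set (a # as). c * b = b * c"
  from MD[OF x] obtain l k where lk: "x = l # k" "l \<in> \<Lambda>" "k \<in> K" by auto
  have "b * G x = (b * F l) * E k" using lk by (simp add: G_def mult.assoc)
  also have "b * F l = F l * b" using F(6)[OF b(1)] b(2) lk by auto
  also have "F l * b * E k = F l * (b * E k)" by (simp add: mult.assoc)
  also have "b * E k = E k * b" using IH(6)[OF lk(3) b(1)] b(2) by auto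
  finally show "b * G x = G x * b" using lk by (simp add: G_def mult.assoc)
 qed
 ultimately show ?case by blast
qed

text \<open>A finite-dimensional space of functions embeds in its values at finitely many points. The formula expresses a function by its values there with coefficients from the same space.\<close>
lemma finite_interpolation:
 fixes g :: "'i => 'z => complex"
 assumes "finite I"
 shows "\<exists>m (w :: nat => 'z) c. (\<forall>k<m. w k \<in> Z) \<and>
  (\<forall>z\<in>Z. \<forall>i\<in>I. g i z = (\<Sum>k<m. (\<Sum>j\<in>I. c k j * g j z) * g i (w k)))"
 using assms
proof (induction I rule: finite_induct)
 case (insert x I)
 then obtain m :: nat and w c where IH0: "(\<forall>k<m. w k \<in> Z) \<and>
  (\<forall>z\<in>Z. \<forall>i\<in>I. g i z = (\<Sum>k<m. (\<Sum>j\<in>I. c k j * g j z) * g i (w k)))"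
  by (elim exE)
 hence IH: "\<And>k. k < m ==> w k \<in> Z"
  "\<And>z i. z \<in> Z ==> i \<in> I ==> g i z = (\<Sum>k<m. (\<Sum>j\<in>I. c k j * g j z) * g i (w k))"
  by blast+
 define C where "C k z = (\<Sum>j\<in>I. c k j * g j z)" for k z
 have IH': "(\<Sum>k<m. C k z * g i (w k)) = g i z" if "z \<in> Z" "i \<in> I" for z i
  using IH(2)[OF that] by (simp add: C_def)
 define h where "h z = g x z - (\<Sum>k<m. C k z * g x (w k))" for z
 show ?case
 proof (cases "\<forall>z\<in>Z. h z = 0")
  case True
  define c' where "c' k j = (if j = x then 0 else c k j)" for k j
  have c': "(\<Sum>j\<in>insert x I. c' k j * g j z) = C k z" for k z
   using insert(1,2) by (auto simp: c'_def C_def intro!: sum.cong)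
  have "g i z = (\<Sum>k<m. C k z * g i (w k))" if "z \<in> Z" "i \<in> insert x I" for z i
  proof (cases "i = x")
   case True
   have "h z = 0" using \<open>\<forall>z\<in>Z. h z = 0\<close> that(1) by blast
   thus ?thesis unfolding h_def True by simp
  next
   case False
   thus ?thesis using IH'[of z i] that by simp
  qed
  hence "\<forall>z\<in>Z. \<forall>i\<in>insert x I. g i z = (\<Sum>k<m. (\<Sum>j\<in>insert x I. c' k j * g j z) * g i (w k))"
   unfolding c' by blast
  with IH(1) show ?thesis by blast
 next
  case False
  then obtain s where s: "s \<in> Z" "h s ~= 0" by auto
  define eta where "eta j = (if j = x then 1 else - (\<Sum>k<m. g x (w k) * c k j))" for j
  have h: "(\<Sum>j\<in>insert x I. eta j * g j z) = h z" for z
  proof -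
   have "(\<Sum>j\<in>insert x I. eta j * g j z) = g x z + (\<Sum>j\<in>I. eta j * g j z)"
    using insert(1,2) by (simp add: eta_def)
   also have "(\<Sum>j\<in>I. eta j * g j z) = (\<Sum>j\<in>I. - (\<Sum>k<m. g x (w k) * c k j) * g j z)"
    using insert(2) by (intro sum.cong) (auto simp: eta_def)
   also have "... = - (\<Sum>k<m. C k z * g x (w k))"
    by (simp add: C_def sum_distrib_right sum_distrib_left sum_negf mult_ac) (rule sum.swap)
   finally show ?thesis by (simp add: h_def)
  qed
  define w' where "w' k = (if k = m then s else w k)" for k
  define c' where "c' k j = (if k = m then eta j / h s else
    (if j = x then 0 else c k j) - C k s * (eta j / h s))" for k j
  define C' where "C' k z = (\<Sum>j\<in>insert x I. c' k j * g j z)" for k z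
  have Cm: "C' m z = h z / h s" for z
   using h[of z] by (simp add: C'_def c'_def sum_divide_distrib[symmetric])
  have Ck: "C' k z = C k z - C k s * (h z / h s)" if "k < m" for k z
  proof -
   have "C' k z = (\<Sum>j\<in>insert x I. (if j = x then 0 else c k j) * g j z)
     - (\<Sum>j\<in>insert x I. C k s / h s * (eta j * g j z))"
    using that by (simp add: C'_def c'_def algebra_simps sum_subtractf del: sum.insert)
   also have "(\<Sum>j\<in>insert x I. (if j = x then 0 else c k j) * g j z) = C k z"
    using insert(1,2) by (auto simp: C_def intro!: sum.cong)
   also have "(\<Sum>j\<in>insert x I. C k s / h s * (eta j * g j z)) = C k s / h s * h z"
    by (simp only: sum_distrib_left[symmetric] h)
   finally show ?thesis by simp
  qed
  have S: "(\<Sum>k<Suc m. C' k z * g i (w' k))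
    = (\<Sum>k<m. C k z * g i (w k)) - (h z / h s) * (\<Sum>k<m. C k s * g i (w k)) + h z / h s * g i s" for z i
  proof -
   have "(\<Sum>k<Suc m. C' k z * g i (w' k)) = (\<Sum>k<m. C' k z * g i (w' k)) + C' m z * g i (w' m)"
    by simp
   also have "(\<Sum>k<m. C' k z * g i (w' k)) = (\<Sum>k<m. C k z * g i (w k) - (h z / h s) * (C k s * g i (w k)))"
    by (intro sum.cong) (auto simp: Ck w'_def algebra_simps)
   finally show ?thesis
    by (simp add: Cm w'_def sum_subtractf sum_distrib_left)
  qed
  have "g i z = (\<Sum>k<Suc m. C' k z * g i (w' k))" if "z \<in> Z" "i \<in> insert x I" for z i
  proof (cases "i = x")
   case True
   have e: "(\<Sum>k<m. C k z * g x (w k)) = g x z - h z" for z by (simp add: h_def)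
   show ?thesis unfolding S True e using s(2) by (simp add: field_simps)
  next
   case False
   hence "i \<in> I" using that by simp
   thus ?thesis unfolding S using IH'[OF that(1)] IH'[OF s(1)] by simp
  qed
  hence "\<forall>z\<in>Z. \<forall>i\<in>insert x I. g i z = (\<Sum>k<Suc m. (\<Sum>j\<in>insert x I. c' k j * g j z) * g i (w' k))"
   unfolding C'_def by blast
  moreover have "\<forall>k<Suc m. w' k \<in> Z" using s(1) IH(1) by (simp add: w'_def less_Suc_eq)
  ultimately show ?thesis by blast
 qed
qed auto

lemma dual_points:
 fixes g :: "'i => 'z => complex"
 assumes "finite I" and ind: "\<And>c. (\<And>z. z \<in> Z ==> (\<Sum>i\<in>I. c i * g i z) = 0) ==> \<forall>i\<in>I. c i = 0"
 shows "\<exists>m (w :: nat => 'z) b. (\<forall>k<m. w k \<in> Z) \<and>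
  (\<forall>i\<in>I. \<forall>j\<in>I. (\<Sum>k<m. b k j * g i (w k)) = (if i = j then 1 else 0))"
proof -
 obtain m :: nat and w c where "(\<forall>k<m. w k \<in> Z) \<and>
  (\<forall>z\<in>Z. \<forall>i\<in>I. g i z = (\<Sum>k<m. (\<Sum>j\<in>I. c k j * g j z) * g i (w k)))"
  using finite_interpolation[OF assms(1), where ?Z = Z and g = g] by (elim exE)
 hence 1: "\<And>k. k < m ==> w k \<in> Z"
  "\<And>z i. z \<in> Z ==> i \<in> I ==> g i z = (\<Sum>k<m. (\<Sum>j\<in>I. c k j * g j z) * g i (w k))"
  by blast+
 have "(\<Sum>k<m. c k j * g i (w k)) = (if i = j then 1 else 0)" if "i \<in> I" "j \<in> I" for i j
 proof -
  have "(\<Sum>j\<in>I. ((\<Sum>k<m. c k j * g i (w k)) - (if i = j then 1 else 0)) * g j z) = 0" if "z \<in> Z" for z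
  proof -
   have "(\<Sum>j\<in>I. ((\<Sum>k<m. c k j * g i (w k)) - (if i = j then 1 else 0)) * g j z)
    = (\<Sum>j\<in>I. \<Sum>k<m. c k j * g j z * g i (w k)) - (\<Sum>j\<in>I. if i = j then g j z else 0)"
    unfolding sum_subtractf[symmetric]
    by (intro sum.cong) (auto simp: algebra_simps sum_distrib_left sum_distrib_right)
   also have "(\<Sum>j\<in>I. \<Sum>k<m. c k j * g j z * g i (w k)) = g i z"
    using 1(2)[OF that \<open>i \<in> I\<close>] by (subst sum.swap) (simp add: sum_distrib_right)
   finally show ?thesis using \<open>i \<in> I\<close> assms(1) by simp
  qed
  from ind[OF this] that(2) show ?thesis by simp
 qed
 with 1(1) show ?thesis by (intro exI[of _ m] exI[of _ w] exI[of _ c]) simp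
qed

section \<open>Exponential and logarithm of nilpotent elements\<close>

definition ev :: "nat => linop => complex fps => linop" where
 "ev D Y f = (\<Sum>k<D. cc (fps_nth f k) * Y ^ k)"

definition nexp :: "nat => linop => linop" where
 "nexp D X = (\<Sum>k<D. cc (1 / fact k) * X ^ k)"

lemma ev_mult:
 assumes "Y ^ D = 0"
 shows "ev D Y (f * g) = ev D Y f * ev D Y g"
proof -
 have Y0: "Y ^ k = 0" if "k \<ge> D" for k
  using assms that by (metis le_add_diff_inverse mult_zero_left power_add)
 let ?t = "%(i,j). cc (fps_nth f i * fps_nth g j) * Y ^ (i + j)"
 have "ev D Y f * ev D Y g = (\<Sum>i<D. \<Sum>j<D. ?t (i,j))"
  unfolding ev_def sum_product
  by (intro sum.cong refl) (simp add: power_add cc_prod)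
 also have "... = sum ?t ({..<D} \<times> {..<D})" by (simp add: sum.cartesian_product)
 also have "... = sum ?t {(i,j). i + j < D}"
 proof (rule sum.mono_neutral_right)
  have "?t (a, b) = 0" if "\<not> a + b < D" for a b using Y0[of "a + b"] that by simp
  thus "\<forall>x\<in>{..<D} \<times> {..<D} - {(i, j). i + j < D}. ?t x = 0" by blast
 qed auto
 also have "... = (\<Sum>k<D. \<Sum>i\<le>k. ?t (i, k - i))"
  using sum.triangle_reindex[of "%i j. ?t (i,j)" D] by simp
 also have "... = ev D Y (f * g)"
  unfolding ev_def by (intro sum.cong refl)
   (auto simp: fps_mult_nth cc_sum sum_distrib_right atLeast0AtMost intro!: sum.cong)
 finally show ?thesis ..
qed

lemma ev_one: "D > 0 ==> ev D Y 1 = 1"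
 unfolding ev_def
 by (subst sum.cong[OF refl, of _ _ "%k. if k = 0 then 1 else 0"]) auto

lemma ev_power: "D > 0 ==> Y ^ D = 0 ==> ev D Y (f ^ k) = ev D Y f ^ k"
 by (induction k) (simp_all add: ev_one ev_mult)

text \<open>The power series \<open>log (1 + X)\<close>.\<close>
definition logser :: "complex fps" where
 "logser = fps_inv (fps_exp 1 - 1)"

lemma logser: "fps_nth logser 0 = 0" "fps_exp 1 oo logser = 1 + fps_X"
proof -
 show 0: "fps_nth logser 0 = 0" by (simp add: logser_def fps_inv_def)
 have "(fps_exp 1 - 1) oo logser = fps_X"
  unfolding logser_def by (rule fps_inv_right) auto
 thus "fps_exp 1 oo logser = 1 + fps_X"
  by (simp add: fps_compose_sub_distrib algebra_simps)
qed

text \<open>The identity of formal series \<open>exp (log (1 + X)) = 1 + X\<close>, evaluated at a nilpotent element.\<close>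
lemma nexp_log:
 assumes "Y ^ D = 0" "D \<ge> 2"
 shows "nexp D (ev D Y logser) = 1 + Y" "ev D Y logser ^ D = 0"
proof -
 have z: "fps_nth (logser ^ k) i = 0" if "i < k" for i k
  using startsby_zero_power_prefix[of logser k] logser(1) that by auto
 have D: "D > 0" using assms by simp
 have "nexp D (ev D Y logser) = (\<Sum>k<D. cc (1 / fact k) * ev D Y (logser ^ k))"
  by (simp add: nexp_def ev_power[OF D assms(1)])
 also have "... = (\<Sum>i<D. cc (\<Sum>k<D. 1 / fact k * fps_nth (logser ^ k) i) * Y ^ i)"
  unfolding ev_def sum_distrib_left cc_sum sum_distrib_right
  by (subst sum.swap) (simp add: cc_cc)
 also have "... = (\<Sum>i<D. cc (fps_nth (1 + fps_X) i) * Y ^ i)"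
 proof (intro sum.cong refl)
  fix i assume i: "i \<in> {..<D}"
  have "(\<Sum>k<D. 1 / fact k * fps_nth (logser ^ k) i) = (\<Sum>k\<in>{0..i}. 1 / fact k * fps_nth (logser ^ k) i)"
   using i by (intro sum.mono_neutral_right) (auto simp: z)
  also have "... = fps_nth (fps_exp 1 oo logser) i"
   by (simp add: fps_compose_nth)
  finally show "cc (\<Sum>k<D. 1 / fact k * fps_nth (logser ^ k) i) * Y ^ i = cc (fps_nth (1 + fps_X) i) * Y ^ i"
   by (simp add: logser)
 qed
 also have "... = (\<Sum>i\<in>{0,1}. cc (fps_nth (1 + fps_X) i) * Y ^ i)"
  using assms(2) by (intro sum.mono_neutral_right) (auto simp: fps_X_def)
 finally show "nexp D (ev D Y logser) = 1 + Y" by simp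
 have "ev D Y logser ^ D = ev D Y (logser ^ D)" by (simp add: ev_power[OF D assms(1)])
 also have "... = 0" by (simp add: ev_def z)
 finally show "ev D Y logser ^ D = 0" .
qed

lemma exp_terms_add:
 fixes X Y :: linop
 assumes "X * Y = Y * X"
 shows "cc (1 / fact k) * (X + Y) ^ k = (\<Sum>i\<le>k. cc (1 / fact i) * X ^ i * (cc (1 / fact (k - i)) * Y ^ (k - i)))"
proof (induction k)
 case (Suc k)
 define S where "S Z i = cc (1 / fact i) * Z ^ i" for Z :: linop and i
 have S1: "Z * S Z i = cc (of_nat (Suc i)) * S Z (Suc i)" for Z i
  by (simp add: S_def cc_left_commute[of Z] cc_cc del: of_nat_Suc)
 have YS: "Y * (S X i * Z) = S X i * (Y * Z)" for i Z
  unfolding S_def using power_left_commute[of X Y i Z] assms by (simp add: mult.assoc cc_left_commute[of Y])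
 have "cc (of_nat (Suc k)) * S (X + Y) (Suc k) = (X + Y) * S (X + Y) k" by (simp only: S1)
 also have "... = X * (\<Sum>i\<le>k. S X i * S Y (k - i)) + Y * (\<Sum>i\<le>k. S X i * S Y (k - i))"
  using Suc by (simp add: S_def distrib_right)
 also have "Y * (\<Sum>i\<le>k. S X i * S Y (k - i)) = (\<Sum>i\<le>k. cc (of_nat (Suc k - i)) * (S X i * S Y (Suc k - i)))"
  unfolding sum_distrib_left
  by (intro sum.cong refl) (auto simp: YS S1 cc_left_commute[where a = "S X i" for i] Suc_diff_le)
 also have "... = (\<Sum>i\<le>Suc k. cc (of_nat (Suc k - i)) * (S X i * S Y (Suc k - i)))" by simp
 also have "X * (\<Sum>i\<le>k. S X i * S Y (k - i)) = (\<Sum>i\<le>k. cc (of_nat (Suc i)) * (S X (Suc i) * S Y (k - i)))"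
  unfolding sum_distrib_left
  by (intro sum.cong refl) (simp add: mult.assoc[symmetric] S1 del: of_nat_Suc)
 also have "... = (\<Sum>i\<le>Suc k. cc (of_nat i) * (S X i * S Y (Suc k - i)))"
  by (subst sum.atMost_Suc_shift) (simp del: of_nat_Suc)
 finally have "cc (of_nat (Suc k)) * S (X + Y) (Suc k) = (\<Sum>i\<le>Suc k. cc (of_nat (Suc k)) * (S X i * S Y (Suc k - i)))"
  unfolding sum.distrib[symmetric] distrib_right[symmetric] cc_add[symmetric] of_nat_add[symmetric]
  by (simp del: of_nat_Suc)
 hence "cc (1 / of_nat (Suc k)) * (cc (of_nat (Suc k)) * S (X + Y) (Suc k)) =
  cc (1 / of_nat (Suc k)) * (cc (of_nat (Suc k)) * (\<Sum>i\<le>Suc k. S X i * S Y (Suc k - i)))"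
  by (simp only: sum_distrib_left)
 thus ?case by (simp add: cc_cc S_def del: of_nat_Suc)
qed auto

lemma nexp_extend: "X ^ D = 0 ==> D \<le> D' ==> nexp D' X = nexp D X"
 unfolding nexp_def
proof (rule sum.mono_neutral_right)
 assume "X ^ D = 0"
 hence "X ^ k = 0" if "k \<ge> D" for k
  using that by (metis le_add_diff_inverse mult_zero_left power_add)
 thus "\<forall>i\<in>{..<D'} - {..<D}. cc (1 / fact i) * X ^ i = 0" by auto
qed auto

text \<open>The truncation is harmless because all terms of order \<open>D\<close> or more vanish.\<close>
lemma nexp_add:
 assumes c: "X * Y = Y * X" and "X ^ D = 0" "Y ^ D = 0" "(X + Y) ^ D = 0"
 shows "nexp D (X + Y) = nexp D X * nexp D Y"
proof -
 let ?S = "%Z i. cc (1 / fact i) * Z ^ i"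
 have z: "Z ^ k = 0" if "Z ^ D = 0" "k \<ge> D" for Z :: linop and k
  using that by (metis le_add_diff_inverse mult_zero_left power_add)
 have "nexp D (X + Y) = nexp (2 * D) (X + Y)" using assms by (simp add: nexp_extend[of "X + Y" D "2 * D"])
 also have "... = (\<Sum>k<2*D. \<Sum>i\<le>k. ?S X i * ?S Y (k - i))"
  unfolding nexp_def using exp_terms_add[OF c] by simp
 also have "... = (\<Sum>(i,j)\<in>{(i,j). i + j < 2 * D}. ?S X i * ?S Y j)"
  using sum.triangle_reindex[of "%i j. ?S X i * ?S Y j" "2 * D"] by simp
 also have "... = (\<Sum>(i,j)\<in>{..<D} \<times> {..<D}. ?S X i * ?S Y j)"
 proof (rule sum.mono_neutral_right)
  show "finite {(i::nat, j). i + j < 2 * D}"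
   by (rule finite_subset[of _ "{..<2*D} \<times> {..<2*D}"]) auto
  show "\<forall>x\<in>{(i, j). i + j < 2 * D} - {..<D} \<times> {..<D}. (case x of (i,j) => ?S X i * ?S Y j) = 0"
  proof (intro ballI)
   fix p assume p: "p \<in> {(i, j). i + j < 2 * D} - {..<D} \<times> {..<D}"
   obtain i j where ij: "p = (i,j)" by (cases p)
   hence "\<not> (i < D \<and> j < D)" using p by auto
   hence "X ^ i = 0 \<or> Y ^ j = 0"
    using z[OF assms(2), of i] z[OF assms(3), of j] by (cases "D \<le> i") auto
   thus "(case p of (i,j) => ?S X i * ?S Y j) = 0" using ij by auto
  qed
 qed auto
 also have "... = nexp D X * nexp D Y"
  unfolding nexp_def sum_product by (simp add: sum.cartesian_product)
 finally show ?thesis .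
qed

section \<open>A theta function and its logarithmic derivatives\<close>

text \<open>Taylor coefficients of the entire function with \<open>th q 0 = 1\<close> and \<open>th q z = (1 - z) th q (z / q)\<close>, which is the product of all \<open>1 - z / q\<^sup>r\<close>. Its simple zeros are the \<open>q\<^sup>r\<close> with \<open>r \<ge> 0\<close>; the product \<open>th q z \<cdot> th q (1 / (q z))\<close> is a theta function with zeros on all of \<open>q\<^sup>\<int>\<close>.\<close>
fun tc :: "complex => nat => complex" where
 "tc q 0 = 1"
| "tc q (Suc n) = - q * tc q n / (q ^ Suc n - 1)"

definition th :: "complex => complex => complex" where
 "th q = eval_fps (Abs_fps (tc q))"

locale qplane =
 fixes q :: complex
 assumes q: "norm q > 1"
begin

lemma q_nz [simp]: "q ~= 0" using q by auto

lemma q_pow: "q ^ Suc n ~= 1"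
 by (metis norm_one norm_power one_less_power q less_irrefl zero_less_Suc)

lemma th_conv: "fps_conv_radius (Abs_fps (tc q)) = \<infinity>"
 unfolding fps_conv_radius_def
proof (rule conv_radius_inftyI'')
 fix z
 show "summable (%n. fps_nth (Abs_fps (tc q)) n * z ^ n)"
 proof (cases "z = 0")
  case False
  have lim: "(%n. norm q * norm z * (1 / (norm q ^ Suc n - 1))) \<longlonglongrightarrow> norm q * norm z * 0"
  proof (rule tendsto_mult_left)
   have "(%n. (1 / norm q) ^ Suc n) \<longlonglongrightarrow> 0"
    using q by (intro LIMSEQ_Suc LIMSEQ_power_zero) simp
   hence "(%n. (1 / norm q) ^ Suc n / (1 - (1 / norm q) ^ Suc n)) \<longlonglongrightarrow> 0 / (1 - 0)"
    by (intro tendsto_intros) auto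
   moreover have "(1 / norm q) ^ Suc n / (1 - (1 / norm q) ^ Suc n) = 1 / (norm q ^ Suc n - 1)" for n
    using one_less_power[OF q, of "Suc n"] by (simp add: power_one_over divide_simps)
   ultimately show "(%n. 1 / (norm q ^ Suc n - 1)) \<longlonglongrightarrow> 0" by simp
  qed
  hence "eventually (%n. norm q * norm z * (1 / (norm q ^ Suc n - 1)) < 1/2) sequentially"
   by (intro order_tendstoD) auto
  then obtain N where N: "\<And>n. n \<ge> N ==> norm q * norm z * (1 / (norm q ^ Suc n - 1)) < 1/2"
   by (auto simp: eventually_sequentially)
  show ?thesis
  proof (rule summable_ratio_test[of "1/2" N])
   fix n assume n: "n \<ge> N"
   have g: "norm q ^ Suc n - 1 > 0" using one_less_power[OF q, of "Suc n"] by simp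
   have "norm q ^ Suc n - 1 \<le> norm (q ^ Suc n - 1)"
    using norm_triangle_ineq2[of "q ^ Suc n" 1] by (simp add: norm_power norm_mult)
   hence "norm q * norm z / norm (q ^ Suc n - 1) \<le> norm q * norm z / (norm q ^ Suc n - 1)"
    using g by (intro divide_left_mono mult_pos_pos) (auto intro: less_le_trans)
   also have "... \<le> 1/2" using N[OF n] by simp
   finally have r: "norm q * norm z / norm (q ^ Suc n - 1) \<le> 1/2" .
   have "norm (fps_nth (Abs_fps (tc q)) (Suc n) * z ^ Suc n)
     = norm q * norm z / norm (q ^ Suc n - 1) * norm (fps_nth (Abs_fps (tc q)) n * z ^ n)"
    by (simp add: norm_mult norm_divide norm_power)
   also have "... \<le> 1/2 * norm (fps_nth (Abs_fps (tc q)) n * z ^ n)"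
    by (intro mult_right_mono r) auto
   finally show "norm (fps_nth (Abs_fps (tc q)) (Suc n) * z ^ Suc n)
     \<le> 1/2 * norm (fps_nth (Abs_fps (tc q)) n * z ^ n)" .
  qed auto
 qed (auto intro: summable_comparison_test)
qed

lemma th_sums: "(%n. tc q n * z ^ n) sums th q z"
 using sums_eval_fps[of z "Abs_fps (tc q)"] by (simp add: th_def th_conv)

lemma th_hol [holomorphic_intros]: "th q holomorphic_on A"
 unfolding th_def by (intro holomorphic_intros) (simp add: th_conv)

lemma th_hol' [holomorphic_intros]: "f holomorphic_on A ==> (%z. th q (f z)) holomorphic_on A"
 using holomorphic_on_compose[OF _ th_hol, of f A] by (simp add: o_def)

lemma th_0: "th q 0 = 1"
 by (simp add: th_def eval_fps_at_0)

lemma th_eq: "th q z = (1 - z) * th q (z / q)"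
proof -
 have 1: "(%n. tc q n * (z / q) ^ n) sums th q (z / q)" by (rule th_sums)
 have 2: "(%n. (case n of 0 => 0 | Suc n => z * (tc q n * (z / q) ^ n))) sums (z * th q (z / q))"
  using sums_mult[OF 1, of z]
   sums_Suc_iff[of "%n. case n of 0 => 0 | Suc n => z * (tc q n * (z / q) ^ n)"] by simp
 have "(%n. tc q n * z ^ n) sums (th q (z / q) - z * th q (z / q))"
 proof (rule sums_cong[THEN iffD1, OF _ sums_diff[OF 1 2]])
  fix n
  show "tc q n * (z / q) ^ n - (case n of 0 => 0 | Suc n => z * (tc q n * (z / q) ^ n)) = tc q n * z ^ n"
  proof (cases n)
   case (Suc m)
   have e: "c * (w / Q) + c * (Q - 1) * (w / Q) = c * w" if "Q ~= 0" for c w Q :: complex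
    using that by (simp add: field_simps)
   have "tc q m = - tc q (Suc m) * (q ^ Suc m - 1) / q" using q_pow[of m] by simp
   hence "tc q (Suc m) * (z / q) ^ Suc m - z * (tc q m * (z / q) ^ m)
     = tc q (Suc m) * (z ^ Suc m / q ^ Suc m) + tc q (Suc m) * (q ^ Suc m - 1) * (z ^ Suc m / q ^ Suc m)"
    by (simp add: power_divide del: tc.simps)
   also have "... = tc q (Suc m) * z ^ Suc m" by (rule e) simp
   finally show ?thesis using Suc by simp
  qed auto
 qed
 from sums_unique2[OF th_sums this] show ?thesis by (simp add: algebra_simps)
qed

lemma th_deriv: "(th q has_field_derivative deriv (th q) z) (at z)"
 using holomorphic_derivI[OF th_hol[of UNIV]] by simp

lemma th_deriv_eq: "deriv (th q) z = - th q (z / q) + (1 - z) * (deriv (th q) (z / q) / q)"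
proof (rule DERIV_unique[OF th_deriv])
 have "((%z. (1 - z) * th q (z / q)) has_field_derivative - th q (z / q) + (1 - z) * (deriv (th q) (z / q) / q)) (at z)"
  by (rule derivative_eq_intros DERIV_chain2[OF th_deriv] refl | simp)+
 thus "(th q has_field_derivative - th q (z / q) + (1 - z) * (deriv (th q) (z / q) / q)) (at z)"
  by (subst (asm) th_eq[symmetric])
qed

lemma th_zero_iff: "th q z = 0 \<longleftrightarrow> (\<exists>r::nat. z = q ^ r)"
proof
 assume z: "th q z = 0"
 show "\<exists>r::nat. z = q ^ r"
 proof (rule ccontr)
  assume no: "\<not> ?thesis"
  have "th q (z / q ^ n) = 0" for n
  proof (induction n)
   case (Suc n)
   have "z / q ^ n ~= 1" using no by auto
   with Suc th_eq[of "z / q ^ n"] show ?case by (simp add: field_simps)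
  qed (use z in auto)
  moreover have "(%n. th q (z / q ^ n)) \<longlonglongrightarrow> th q 0"
  proof (rule isCont_tendsto_compose[of _ "th q"])
   show "isCont (th q) 0" using th_deriv DERIV_isCont by blast
   have "(%n. z * (1 / q) ^ n) \<longlonglongrightarrow> z * 0"
    using q by (intro tendsto_mult_left LIMSEQ_power_zero) (simp add: norm_divide)
   thus "(%n. z / q ^ n) \<longlonglongrightarrow> 0" by (simp add: power_one_over field_simps)
  qed
  ultimately show False by (simp add: LIMSEQ_const_iff th_0)
 qed
next
 assume "\<exists>r::nat. z = q ^ r"
 then obtain r :: nat where "z = q ^ r" by blast
 moreover have "th q (q ^ r) = 0"
  by (induction r) (simp_all add: th_eq[of 1] th_eq[of "q * _"])
 ultimately show "th q z = 0" by simp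
qed

lemma th_simple: "th q z = 0 ==> deriv (th q) z ~= 0"
proof -
 have "deriv (th q) (q ^ r) ~= 0" for r
 proof (induction r)
  case 0
  have "\<nexists>r::nat. 1 / q = q ^ r"
  proof
   assume "\<exists>r::nat. 1 / q = q ^ r"
   then obtain r :: nat where "q ^ Suc r = 1" by (auto simp: field_simps)
   thus False using q_pow by blast
  qed
  thus ?case using th_zero_iff[of "1 / q"] th_deriv_eq[of 1] by simp
 next
  case (Suc r)
  have "th q (q ^ r) = 0" using th_zero_iff by blast
  thus ?case using Suc q_pow[of r] th_deriv_eq[of "q ^ Suc r"] by simp
 qed
 thus "th q z = 0 ==> deriv (th q) z ~= 0" by (auto simp: th_zero_iff)
qed

primrec hk :: "nat => complex => complex" where
 "hk 0 = (%z. z * deriv (th q) z)"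
| "hk (Suc k) = (%z. z * (deriv (hk k) z * th q z - of_nat (Suc k) * hk k z * deriv (th q) z))"

text \<open>\<open>zk k\<close> is the function \<open>(z d/dz)\<^sup>k (z th' / th)\<close>.\<close>
definition zk :: "nat => complex => complex" where
 "zk k z = hk k z / th q z ^ Suc k"

lemma hk_hol: "hk k holomorphic_on UNIV"
 by (induction k) (auto intro!: holomorphic_intros)

lemma hk_hol' [holomorphic_intros]: "f holomorphic_on A ==> (%z. hk k (f z)) holomorphic_on A"
 using holomorphic_on_compose[OF _ holomorphic_on_subset[OF hk_hol subset_UNIV], of f A] by (simp add: o_def)

lemma hk_nz: "th q z = 0 ==> hk k z ~= 0"
proof (induction k)
 case 0
 hence "z ~= 0" using th_0 by auto
 thus ?case using th_simple[OF 0] by simp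
next
 case (Suc k)
 hence "z ~= 0" using th_0 by auto
 moreover have "hk (Suc k) z = - (z * of_nat (Suc k) * hk k z * deriv (th q) z)"
  using Suc(2) by (simp del: of_nat_Suc)
 ultimately show ?case using th_simple[OF Suc(2)] Suc by (simp del: of_nat_Suc hk.simps)
qed

lemma zk_deriv:
 assumes "th q z ~= 0" "z ~= 0"
 shows "(zk k has_field_derivative zk (Suc k) z / z) (at z)"
proof -
 have h: "(hk k has_field_derivative deriv (hk k) z) (at z)"
  using holomorphic_derivI[OF hk_hol[of k]] by simp
 have "((%z. hk k z / th q z ^ Suc k) has_field_derivative
  (deriv (hk k) z * th q z ^ Suc k - hk k z * (of_nat (Suc k) * th q z ^ k * deriv (th q) z)) / (th q z ^ Suc k * th q z ^ Suc k)) (at z)"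
  by (rule DERIV_cong[OF DERIV_divide[OF h DERIV_power_Suc[OF th_deriv]]])
   (use assms in \<open>simp_all only: of_nat_Suc mult_ac power_not_zero not_False_eq_True\<close>)
 also have "(deriv (hk k) z * th q z ^ Suc k - hk k z * (of_nat (Suc k) * th q z ^ k * deriv (th q) z)) / (th q z ^ Suc k * th q z ^ Suc k)
  = th q z ^ k * (deriv (hk k) z * th q z - of_nat (Suc k) * hk k z * deriv (th q) z) / (th q z ^ k * th q z ^ Suc (Suc k))"
  by (simp add: algebra_simps)
 also have "... = zk (Suc k) z / z"
  using assms by (simp add: zk_def)
 finally show ?thesis by (simp add: zk_def[abs_def])
qed

text \<open>The quasi-periodic functions on the punctured plane assembled from two copies of \<open>zk\<close>.\<close>
definition zeta :: "nat => complex => complex" where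
 "zeta k z = zk k z - (- 1) ^ k * zk k (1 / (q * z))"

definition spiral :: "complex set" where
 "spiral = range (%k::int. q powi k)"

lemma spiral_q: "q * z \<in> spiral \<longleftrightarrow> z \<in> spiral"
proof
 assume "q * z \<in> spiral"
 then obtain k where "q * z = q powi k" by (auto simp: spiral_def)
 hence "z = q powi (k - 1)" by (simp add: power_int_diff field_simps)
 thus "z \<in> spiral" by (auto simp: spiral_def)
next
 assume "z \<in> spiral"
 then obtain k where "z = q powi k" by (auto simp: spiral_def)
 hence "q * z = q powi (k + 1)" by (simp add: power_int_add)
 thus "q * z \<in> spiral" by (auto simp: spiral_def simp del: power_int_add_1)
qed

lemma spiral_iff: "z ~= 0 ==> z \<in> spiral \<longleftrightarrow> th q z = 0 \<or> th q (1 / (q * z)) = 0"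
proof -
 assume z: "z ~= 0"
 have "z \<in> spiral \<longleftrightarrow> (\<exists>r::nat. z = q ^ r) \<or> (\<exists>r::nat. z = inverse (q ^ Suc r))"
 proof
  assume "z \<in> spiral"
  then obtain k where k: "z = q powi k" by (auto simp: spiral_def)
  show "(\<exists>r::nat. z = q ^ r) \<or> (\<exists>r::nat. z = inverse (q ^ Suc r))"
  proof (cases "k \<ge> 0")
   case True
   thus ?thesis using k by (auto simp: power_int_def)
  next
   case False
   hence "z = inverse (q ^ Suc (nat (- k) - 1))" using k by (simp add: power_int_def power_inverse del: power_Suc)
   thus ?thesis by blast
  qed
 next
  assume "(\<exists>r::nat. z = q ^ r) \<or> (\<exists>r::nat. z = inverse (q ^ Suc r))"
  thus "z \<in> spiral"
  proof (elim disjE exE)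
   fix r :: nat assume "z = q ^ r"
   hence "z = q powi int r" by simp
   thus ?thesis unfolding spiral_def by blast
  next
   fix r :: nat assume "z = inverse (q ^ Suc r)"
   hence "z = q powi (- int (Suc r))" by (simp only: power_int_minus power_int_of_nat)
   thus ?thesis unfolding spiral_def by blast
  qed
 qed
 moreover have "th q (1 / (q * z)) = 0 \<longleftrightarrow> (\<exists>r::nat. z = inverse (q ^ Suc r))"
  unfolding th_zero_iff using z by (auto simp: field_simps)
 ultimately show ?thesis by (simp add: th_zero_iff)
qed

lemma spiral_nz: "z \<in> spiral ==> z ~= 0"
 by (auto simp: spiral_def)

lemma zeta_deriv:
 assumes "z ~= 0" "z \<notin> spiral"
 shows "(zeta k has_field_derivative zeta (Suc k) z / z) (at z)"
proof -
 have t: "th q z ~= 0" "th q (1 / (q * z)) ~= 0" using spiral_iff assms by auto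
 have 2: "((%z. zk k (1 / (q * z))) has_field_derivative - (zk (Suc k) (1 / (q * z)) / z)) (at z)"
  by (rule DERIV_chain2[where f = "zk k", THEN DERIV_cong])
   (use assms t in \<open>auto intro!: zk_deriv derivative_eq_intros simp: field_simps power2_eq_square\<close>)
 show ?thesis unfolding zeta_def[abs_def]
  using zk_deriv[OF t(1) assms(1), of k] 2
  by (auto intro!: derivative_eq_intros simp: diff_divide_distrib add_divide_distrib)
qed

lemma DERIV_scale:
 "(f has_field_derivative D) (at (q * z)) ==> ((%z. f (q * z)) has_field_derivative D * q) (at z)"
 by (rule DERIV_chain2[where f = f and g = "%z. q * z"]) (auto intro!: derivative_eq_intros)

lemma DERIV_exp_comp:
 "(f has_field_derivative D) (at (exp w)) ==> ((%w. f (exp w)) has_field_derivative D * exp w) (at w)"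
 for f :: "complex => complex"
 by (rule DERIV_chain2[where f = f and g = exp]) (auto intro!: derivative_eq_intros)

lemma zeta_0_q: 
 assumes "z ~= 0" "z \<notin> spiral"
 shows "zeta 0 (q * z) = zeta 0 z + 1"
proof -
 have t: "th q z ~= 0" "th q (1 / (q * z)) ~= 0" using spiral_iff assms by auto
 have t': "th q (q * z) ~= 0" "th q (1 / (q * (q * z))) ~= 0"
  using spiral_iff[of "q * z"] spiral_q assms by auto
 have Z: "zk 0 w = - w / (1 - w) + zk 0 (w / q)" if "th q w ~= 0" "th q (w / q) ~= 0" for w
 proof -
  have "w ~= 1" using that th_eq[of 1] by auto
  thus ?thesis using that th_deriv_eq[of w] th_eq[of w]
   by (simp add: zk_def divide_simps) (simp add: algebra_simps)
 qed
 have n: "q * z ~= 1" using th_zero_iff[of "1 / (q * z)"] t(2) by (metis divide_self one_neq_zero power_0)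
 have 1: "zk 0 (q * z) = - (q * z) / (1 - q * z) + zk 0 z" using Z[OF t'(1)] t by simp
 have 2: "zk 0 (1 / (q * z)) = - (1 / (q * z)) / (1 - 1 / (q * z)) + zk 0 (1 / (q * (q * z)))"
  using Z[OF t(2)] t'(2) by (simp add: mult.commute)
 have 3: "- (q * z) / (1 - q * z) + - (1 / (q * z)) / (1 - 1 / (q * z)) = 1"
  using n assms(1) by (simp add: divide_simps) (simp add: algebra_simps)
 have lin: "x - v = y - u + 1" if "x = a + y" "u = b + v" "a + b = 1" for x y u v a b :: complex
  using that(3) unfolding that(1,2) by (simp add: algebra_simps)
 show ?thesis using lin[OF 1 2 3] by (simp add: zeta_def)
qed

lemma open_spiral: "open (- {0} - spiral)"
proof -
 have "- {0} - spiral = (- {0} \<inter> th q -` (- {0})) \<inter> (- {0} \<inter> (%z. th q (1 / (q * z))) -` (- {0}))"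
  using spiral_iff by auto
 moreover have "open (- {0} \<inter> th q -` (- {0}))" "open (- {0} \<inter> (%z. th q (1 / (q * z))) -` (- {0::complex}))"
  by (intro continuous_open_preimage holomorphic_on_imp_continuous_on holomorphic_intros; auto)+
 ultimately show ?thesis by auto
qed

lemma zeta_q:
 assumes "z ~= 0" "z \<notin> spiral"
 shows "zeta (Suc k) (q * z) = zeta (Suc k) z"
proof -
 have step: "zeta (Suc k) (q * z) = zeta (Suc k) z"
  if c: "\<And>z. z \<in> - {0} - spiral ==> zeta k (q * z) = zeta k z + c" and z: "z \<in> - {0} - spiral" for k c z
 proof -
  have "((%z. zeta k (q * z)) has_field_derivative zeta (Suc k) (q * z) / (q * z) * q) (at z)"
   by (intro DERIV_scale zeta_deriv) (use z spiral_q in auto)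
  moreover have "((%z. zeta k (q * z)) has_field_derivative zeta (Suc k) z / z) (at z)"
  proof (rule has_field_derivative_transform_within_open[OF _ open_spiral z])
   show "((%z. zeta k z + c) has_field_derivative zeta (Suc k) z / z) (at z)"
    using DERIV_add[OF zeta_deriv[of z k] DERIV_const[of c]] z by simp
  qed (simp add: c)
  ultimately have "zeta (Suc k) (q * z) / (q * z) * q = zeta (Suc k) z / z" by (rule DERIV_unique)
  thus ?thesis using z by simp
 qed
 have "zeta (Suc k) (q * z) = zeta (Suc k) z" if "z \<in> - {0} - spiral" for k z
  using that
 proof (induction k arbitrary: z)
  case 0
  show ?case by (rule step[of 0 1]) (use zeta_0_q 0 in auto)
 next
  case (Suc k)
  show ?case by (rule step[of "Suc k" 0]) (use Suc in auto)
 qed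
 thus ?thesis using assms by simp
qed

section \<open>Holomorphic quasi-periodic functions on the punctured plane\<close>

lemma fundamental_annulus: "z ~= 0 ==> \<exists>k::int. norm (q powi k * z) \<in> {1..norm q}"
proof -
 assume z: "z ~= 0"
 define x where "x = ln (norm z) / ln (norm q)"
 have lq: "ln (norm q) > 0" using q by simp
 have nz: "norm z = norm q powr x" using z q by (simp add: x_def powr_def)
 have e: "norm q powi (- \<lfloor>x\<rfloor>) = norm q powr of_int (- \<lfloor>x\<rfloor>)"
  using powr_real_of_int'[of "norm q" "- \<lfloor>x\<rfloor>"] q by simp
 have "norm (q powi (- \<lfloor>x\<rfloor>) * z) = norm q powr (x - of_int \<lfloor>x\<rfloor>)"
  unfolding norm_mult norm_power_int e nz powr_add[symmetric] by simp
 moreover have "norm q powr 0 \<le> norm q powr (x - of_int \<lfloor>x\<rfloor>)"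
  using q by (intro powr_mono) auto
 moreover have "norm q powr (x - of_int \<lfloor>x\<rfloor>) \<le> norm q powr 1"
  using q by (intro powr_mono) linarith+
 ultimately show ?thesis using q by (intro exI[of _ "- \<lfloor>x\<rfloor>"]) auto
qed

lemma invariant_powi:
 assumes "\<And>z. z ~= 0 ==> f (q * z) = f z" "z ~= 0"
 shows "f (q powi k * z) = f z"
proof (induction k rule: int_induct[where k = 0])
 case (step1 i)
 have "q powi (i + 1) * z = q * (q powi i * z)" by (simp add: power_int_add)
 thus ?case using step1 assms(1)[of "q powi i * z"] assms(2) by (simp add: mult.assoc)
next
 case (step2 i)
 have "q powi i * z = q * (q powi (i - 1) * z)" by (simp add: power_int_diff)
 thus ?case using step2 assms(1)[of "q powi (i - 1) * z"] assms(2) by (simp add: mult.assoc)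
qed auto

text \<open>Invariance reduces to a compact annulus, so the function is bounded and extends over \<open>0\<close>.\<close>
lemma invariant_imp_constant:
 assumes f: "f holomorphic_on - {0}" and inv: "\<And>z. z ~= 0 ==> f (q * z) = f z"
 obtains c where "\<And>z. z ~= 0 ==> f z = c"
proof -
 have "compact (cball 0 (norm q) - ball (0::complex) 1)" by (intro compact_diff) auto
 moreover have "continuous_on (cball 0 (norm q) - ball 0 1) f"
  using f by (intro holomorphic_on_imp_continuous_on) (auto elim!: holomorphic_on_subset)
 ultimately have "bounded (f ` (cball 0 (norm q) - ball 0 1))"
  using compact_continuous_image compact_imp_bounded by blast
 then obtain B where "\<forall>y\<in>f ` (cball 0 (norm q) - ball 0 1). norm y \<le> B"
  unfolding bounded_iff by blast
 hence B: "\<And>z. z \<in> cball 0 (norm q) - ball 0 1 ==> norm (f z) \<le> B" by blast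
 have B': "norm (f z) \<le> B" if "z ~= 0" for z
 proof -
  obtain k :: int where "norm (q powi k * z) \<in> {1..norm q}" using fundamental_annulus[OF \<open>z ~= 0\<close>] by blast
  hence "norm (f (q powi k * z)) \<le> B" by (intro B) auto
  thus ?thesis using invariant_powi[of f, OF inv that] by simp
 qed
 have "\<exists>g. g holomorphic_on UNIV \<and> (\<forall>z\<in>UNIV - {0}. g z = f z)"
  using holomorphic_on_extend_bounded[of f UNIV 0] f B'
  by (auto simp: Compl_eq_Diff_UNIV eventually_at_filter intro!: exI[of _ B] always_eventually)
 then obtain g where g: "g holomorphic_on UNIV" "\<And>z. z ~= 0 ==> g z = f z" by auto
 have "bounded (range g)"
  unfolding bounded_iff
 proof (intro exI ballI)
  fix y assume "y \<in> range g"
  then obtain z where "y = g z" by auto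
  thus "norm y \<le> max B (norm (g 0))"
   using B'[of z] g(2)[of z] by (cases "z = 0") auto
 qed
 with g(1) have "g constant_on UNIV" by (rule Liouville_theorem)
 then obtain c where "\<And>z. g z = c" by (auto simp: constant_on_def)
 with g(2) show ?thesis by (intro that[of c]) metis
qed

text \<open>The logarithmic derivative \<open>z f'\<close> is invariant, hence a constant \<open>k\<close>, and \<open>f (exp w) - k w\<close> is constant; periodicity of \<open>exp\<close> forces \<open>k = 0\<close>.\<close>
lemma additive_automorphy_trivial:
 assumes f: "f holomorphic_on - {0}" and qp: "\<And>z. z ~= 0 ==> f (q * z) = f z + c"
 shows "c = 0" "\<exists>d. \<forall>z. z ~= 0 --> f z = d"
proof -
 have D: "(f has_field_derivative deriv f z) (at z)" if "z ~= 0" for z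
  using that by (intro holomorphic_derivI[OF f]) auto
 define K where "K z = z * deriv f z" for z
 have Kq: "K (q * z) = K z" if z: "z ~= 0" for z
 proof -
  have "((%z. f (q * z)) has_field_derivative deriv f (q * z) * q) (at z)"
   by (intro DERIV_scale D) (use z in auto)
  moreover have "((%z. f (q * z)) has_field_derivative deriv f z) (at z)"
   by (rule has_field_derivative_transform_within_open[where S = "- {0}" and f = "%z. f z + c"])
    (use z qp in \<open>auto intro!: D derivative_eq_intros\<close>)
  ultimately have "deriv f (q * z) * q = deriv f z" by (rule DERIV_unique)
  thus ?thesis by (simp add: K_def mult_ac)
 qed
 have "K holomorphic_on - {0}"
  unfolding K_def by (intro holomorphic_intros f) auto
 then obtain k where k: "\<And>z. z ~= 0 ==> K z = k" using invariant_imp_constant Kq by blast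
 define g where "g w = f (exp w) - k * w" for w
 have "(g has_field_derivative 0) (at w)" for w
 proof -
  have "((%w. f (exp w)) has_field_derivative deriv f (exp w) * exp w) (at w)"
   by (intro DERIV_exp_comp D) auto
  thus ?thesis unfolding g_def using k[of "exp w"]
   by (auto intro!: derivative_eq_intros simp: K_def mult_ac)
 qed
 hence g: "\<exists>d. \<forall>w. g w = d"
  using has_field_derivative_zero_constant[of UNIV g] by auto
 then obtain d where d: "\<And>w. g w = d" by blast
 have "k = 0" using d[of 0] d[of "2 * of_real pi * \<i>"] by (simp add: g_def)
 hence fd: "f z = d" if "z ~= 0" for z using d[of "Ln z"] that by (simp add: g_def)
 thus "\<exists>d. \<forall>z. z ~= 0 --> f z = d" by blast
 show "c = 0" using qp[of 1] fd by simp
qed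

lemma multiplicative_automorphy_monomial:
 fixes m :: int
 assumes h: "h holomorphic_on - {0}" and nz: "\<And>z. z ~= 0 ==> h z ~= 0"
  and qp: "\<And>z. z ~= 0 ==> h (q * z) = c * z powi m * h z"
 shows "m = 0" "\<exists>C L. C ~= 0 \<and> c = q powi L \<and> (\<forall>z. z ~= 0 --> h z = C * z powi L)"
proof -
 have D: "(h has_field_derivative deriv h z) (at z)" if "z ~= 0" for z
  using that by (intro holomorphic_derivI[OF h]) auto
 have alg: "z * (c * p * d + c * (M * (p / z)) * x) = c * p * x * (z * d / x + M)"
  if "z ~= 0" "x ~= 0" for z p d M x :: complex
  using that by (simp add: distrib_left distrib_right)
 define F where "F z = z * deriv h z / h z" for z
 have Fq: "F (q * z) = F z + of_int m" if z: "z ~= 0" for z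
 proof -
  have c: "c ~= 0" using qp[of 1] nz[of q] by auto
  have "((%z. h (q * z)) has_field_derivative deriv h (q * z) * q) (at z)"
   by (intro DERIV_scale D) (use z in auto)
  moreover have "((%z. h (q * z)) has_field_derivative
    c * z powi m * deriv h z + c * (of_int m * z powi (m - 1)) * h z) (at z)"
  proof (rule has_field_derivative_transform_within_open[where S = "- {0}" and f = "%z. c * z powi m * h z"])
   have "((%z. z powi m) has_field_derivative of_int m * z powi (m - 1) * 1) (at z)"
    by (rule DERIV_power_int[OF DERIV_ident]) (use z in simp)
   from DERIV_mult'[OF DERIV_cmult[OF this, of c] D[OF z]]
   show "((%z. c * z powi m * h z) has_field_derivative
    c * z powi m * deriv h z + c * (of_int m * z powi (m - 1)) * h z) (at z)" by simp
  qed (use z qp in auto)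
  ultimately have "deriv h (q * z) * q = c * z powi m * deriv h z + c * (of_int m * z powi (m - 1)) * h z"
   by (rule DERIV_unique)
  note e = this
  have zm: "z powi (m - 1) = z powi m / z" using z by (simp add: power_int_diff)
  have "z * (deriv h (q * z) * q) = c * z powi m * h z * (F z + of_int m)"
   unfolding e F_def zm by (rule alg[OF z nz[OF z]])
  moreover have "F (q * z) = z * (deriv h (q * z) * q) / h (q * z)"
   by (simp add: F_def)
  ultimately have "F (q * z) = c * z powi m * h z * (F z + of_int m) / (c * z powi m * h z)"
   by (simp only: qp[OF z])
  thus ?thesis using c z nz[OF z] by simp
 qed
 have "F holomorphic_on - {0}"
  unfolding F_def by (intro holomorphic_intros h) (use nz in auto)
 note F = additive_automorphy_trivial[where f = F and c = "of_int m", OF this Fq]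
 thus m: "m = 0" by simp
 from F(2) obtain k where k: "\<And>z. z ~= 0 ==> F z = k" by blast
 define g where "g w = h (exp w) * exp (- k * w)" for w
 have "(g has_field_derivative 0) (at w)" for w
 proof -
  have "((%w. h (exp w)) has_field_derivative deriv h (exp w) * exp w) (at w)"
   by (intro DERIV_exp_comp D) auto
  moreover have "exp w * deriv h (exp w) = k * h (exp w)"
   using k[of "exp w"] nz[of "exp w"] by (simp add: F_def field_simps)
  ultimately show ?thesis unfolding g_def
   by (auto intro!: derivative_eq_intros simp: mult_ac)
 qed
 hence "\<exists>d. \<forall>w. g w = d"
  using has_field_derivative_zero_constant[of UNIV g] by auto
 then obtain C where C: "\<And>w. g w = C" by blast
 have C0: "C ~= 0" using C[of 0] nz[of 1] by (simp add: g_def)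
 have "exp (- k * (2 * of_real pi * \<i>)) = 1"
  using C[of 0] C[of "2 * of_real pi * \<i>"] nz[of 1] by (simp add: g_def)
 then obtain L :: int where L: "Re (- k * (2 * of_real pi * \<i>)) = 0" "Im (- k * (2 * of_real pi * \<i>)) = of_int (2 * L) * pi"
  unfolding exp_eq_1 by blast
 have "Im k = 0" "pi * (Re k + of_int L) = 0" using L by (auto simp: algebra_simps)
 hence kL: "k = of_int (- L)" by (simp add: complex_eq_iff add_eq_0_iff)
 have hz: "h z = C * z powi (- L)" if "z ~= 0" for z
 proof -
  have "h z = C * exp (k * Ln z)" using C[of "Ln z"] that by (simp add: g_def exp_minus field_simps)
  also have "exp (k * Ln z) = z powi (- L)"
   using that by (metis kL exp_Ln exp_power_int)
  finally show ?thesis .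
 qed
 have "c = q powi (- L)" using qp[of 1] hz[of q] hz[of 1] C0 m by simp
 thus "\<exists>C L. C ~= 0 \<and> c = q powi L \<and> (\<forall>z. z ~= 0 --> h z = C * z powi L)"
  using hz C0 by blast
qed

end

section \<open>The elliptic curve and its points\<close>

lemma Cstar_comm: "comm_group Cstar"
proof (rule comm_groupI)
 fix x assume "x \<in> carrier Cstar"
 thus "\<exists>y\<in>carrier Cstar. y \<otimes>\<^bsub>Cstar\<^esub> x = \<one>\<^bsub>Cstar\<^esub>"
  by (intro bexI[of _ "inverse x"]) (auto simp: Cstar_def)
qed (auto simp: Cstar_def)

lemma Cstar_simps: "carrier Cstar = - {0}" "x \<otimes>\<^bsub>Cstar\<^esub> y = x * y" "\<one>\<^bsub>Cstar\<^esub> = 1"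
 by (auto simp: Cstar_def)

lemma Cstar_inv: "x ~= 0 ==> inv\<^bsub>Cstar\<^esub> x = inverse x"
 using comm_group.axioms(2)[OF Cstar_comm] by (intro group.inv_equality) (auto simp: Cstar_simps)

lemma Cstar_nat_pow: "x [^]\<^bsub>Cstar\<^esub> (k::nat) = x ^ k"
proof -
 interpret comm_group Cstar by (rule Cstar_comm)
 show ?thesis by (induction k) (auto simp: Cstar_simps)
qed

lemma Cstar_pow: "x ~= 0 ==> x [^]\<^bsub>Cstar\<^esub> (k::int) = x powi k"
 by (auto simp: int_pow_def2 Cstar_nat_pow Cstar_inv power_int_def power_inverse)

lemma powi_sum: "x ~= 0 ==> x powi (sum f A) = (\<Prod>a\<in>A. (x::complex) powi f a)"
 by (induction A rule: infinite_finite_induct) (auto simp: power_int_add)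

context qplane
begin

lemma spiral_mult: "x \<in> spiral ==> y \<in> spiral ==> x * y \<in> spiral"
 by (auto simp: spiral_def) (metis q_nz power_int_add rangeI)

lemma spiral_inverse: "x \<in> spiral ==> inverse x \<in> spiral"
 by (auto simp: spiral_def) (metis power_int_minus rangeI)

lemma one_spiral [simp]: "1 \<in> spiral"
 unfolding spiral_def by (metis power_int_0_right rangeI)

lemma qZ_normal: "qZ q \<lhd> Cstar"
proof -
 interpret comm_group Cstar by (rule Cstar_comm)
 have "subgroup (qZ q) Cstar"
 proof (rule subgroupI)
  fix a assume "a \<in> qZ q"
  thus "inv\<^bsub>Cstar\<^esub> a \<in> qZ q"
   using spiral_inverse[of a] spiral_nz[of a] by (simp add: qZ_def spiral_def Cstar_inv)
 qed (use spiral_mult spiral_nz in \<open>auto simp: qZ_def spiral_def Cstar_simps\<close>)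
 thus ?thesis by (rule subgroup_imp_normal)
qed

lemma ell_comm: "comm_group (ell_curve q)"
 unfolding ell_curve_def
 by (intro comm_group.abelian_FactGroup Cstar_comm normal_imp_subgroup qZ_normal)

lemma mem_ell_pt: "x \<in> ell_pt q a \<longleftrightarrow> (\<exists>h\<in>spiral. x = h * a)"
 by (auto simp: ell_pt_def r_coset_def qZ_def spiral_def Cstar_simps)

lemma ell_pt_eq: "a ~= 0 ==> c ~= 0 ==> ell_pt q a = ell_pt q c \<longleftrightarrow> a / c \<in> spiral"
proof
 assume a: "a ~= 0" "c ~= 0" and "ell_pt q a = ell_pt q c"
 hence "a \<in> ell_pt q c" using mem_ell_pt[of a a] one_spiral by force
 thus "a / c \<in> spiral" using a by (auto simp: mem_ell_pt)
next
 assume a: "a ~= 0" "c ~= 0" and s: "a / c \<in> spiral"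
 have 1: "h * a \<in> ell_pt q c" if "h \<in> spiral" for h
  unfolding mem_ell_pt by (rule bexI[of _ "h * (a / c)"]) (use spiral_mult[OF that s] a in auto)
 have 2: "h * c \<in> ell_pt q a" if "h \<in> spiral" for h
  unfolding mem_ell_pt
  by (rule bexI[of _ "h * inverse (a / c)"]) (use a spiral_mult[OF that spiral_inverse[OF s]] in auto)
 show "ell_pt q a = ell_pt q c" using 1 2 by (auto simp: mem_ell_pt[of _ a] mem_ell_pt[of _ c])
qed

lemma ell_carrier: "carrier (ell_curve q) = ell_pt q ` (- {0})"
 by (auto simp: ell_curve_def FactGroup_def RCOSETS_def ell_pt_def Cstar_simps)

lemma ell_pt_hom: "a ~= 0 ==> c ~= 0 ==> ell_pt q (a * c) = ell_pt q a \<otimes>\<^bsub>ell_curve q\<^esub> ell_pt q c"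
 using normal.rcos_sum[OF qZ_normal, of a c] by (simp add: ell_pt_def ell_curve_def FactGroup_def Cstar_simps)

lemma ell_pt_pow: "a ~= 0 ==> ell_pt q a [^]\<^bsub>ell_curve q\<^esub> (k::int) = ell_pt q (a powi k)"
 using normal.FactGroup_int_pow[OF qZ_normal, of a k]
 by (simp add: ell_pt_def ell_curve_def Cstar_simps Cstar_pow)

lemma ell_pt_one: "\<one>\<^bsub>ell_curve q\<^esub> = ell_pt q 1"
 by (auto simp: ell_curve_def FactGroup_def ell_pt_def r_coset_def Cstar_simps)

lemma th_eventually_nz: "eventually (%w. th q w ~= 0) (at w0)"
proof (cases "th q w0 = 0")
 case True
 have "((%w. (th q w - th q w0) / (w - w0)) \<longlongrightarrow> deriv (th q) w0) (at w0)"
  using th_deriv[of w0] by (simp add: has_field_derivative_iff)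
 hence "eventually (%w. (th q w - th q w0) / (w - w0) ~= 0) (at w0)"
  using th_simple[OF True] tendsto_imp_eventually_ne by blast
 thus ?thesis by (rule eventually_mono) (use True in auto)
next
 case False
 have "(th q \<longlongrightarrow> th q w0) (at w0)" using th_deriv DERIV_isCont isCont_def by blast
 thus ?thesis using False tendsto_imp_eventually_ne by blast
qed

lemma th_eventually_nz_scale: "a ~= 0 ==> eventually (%z. th q (z / a) ~= 0) (at z0)"
proof -
 assume a: "a ~= 0"
 have "filterlim (%z. z / a) (at (z0 / a)) (at z0)"
  unfolding filterlim_at using a by (auto intro!: tendsto_intros simp: eventually_at_filter)
 with th_eventually_nz show ?thesis by (rule eventually_compose_filterlim)
qed

lemma th_isCont: "isCont (th q) z"
 using th_deriv DERIV_isCont by blast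

lemma hk_isCont: "isCont (hk k) z"
 using holomorphic_on_imp_continuous_on[OF hk_hol[of k]] by (simp add: continuous_on_eq_continuous_at)

lemma th_q_nz: "th q (1 / q) ~= 0"
proof
 assume "th q (1 / q) = 0"
 then obtain r :: nat where "1 / q = q ^ r" using th_zero_iff by blast
 hence "q ^ Suc r = 1" by (auto simp: field_simps)
 thus False using q_pow by blast
qed

lemma th_1: "th q 1 = 0"
 using th_eq[of 1] by simp

lemma th_simple_limit: "a ~= 0 ==> ((%z. th q (z / a) / (z - a)) \<longlongrightarrow> deriv (th q) 1 / a) (at a)"
proof -
 assume a: "a ~= 0"
 have "((%z. th q (z / a)) has_field_derivative deriv (th q) (a / a) * (1 / a)) (at a)"
  by (rule DERIV_chain2[OF th_deriv]) (use a in \<open>auto intro!: derivative_eq_intros\<close>)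
 thus ?thesis using a th_1 by (simp add: has_field_derivative_iff)
qed

lemma zeta_pole:
 assumes a: "a ~= 0"
 shows "\<exists>C. C ~= 0 \<and> ((%z. (z - a) ^ Suc k * zeta k (z / a)) \<longlongrightarrow> C) (at a)"
proof -
 define D where "D = deriv (th q) 1 / a"
 have D: "D ~= 0" using th_simple[OF th_1] a by (simp add: D_def)
 have 1: "((%z. 1 / (th q (z / a) / (z - a))) \<longlongrightarrow> 1 / D) (at a)"
  unfolding D_def using D by (intro tendsto_divide tendsto_const th_simple_limit a) (simp add: D_def)
 have c: "isCont (%z. (z - a) ^ Suc k * ((- 1) ^ k * (hk k (1 / (q * (z / a))) / th q (1 / (q * (z / a))) ^ Suc k))) a"
  using a th_q_nz by (intro continuous_intros isCont_o2[OF _ hk_isCont] isCont_o2[OF _ th_isCont]) auto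
 have c': "((%z. hk k (z / a)) \<longlongrightarrow> hk k 1) (at a)"
 proof -
  have "((%z. z / a) \<longlongrightarrow> a / a) (at a)" using a by (intro tendsto_intros)
  from isCont_tendsto_compose[OF hk_isCont this] show ?thesis using a by simp
 qed
 have "((%z. (1 / (th q (z / a) / (z - a))) ^ Suc k * hk k (z / a)
  - (z - a) ^ Suc k * ((- 1) ^ k * (hk k (1 / (q * (z / a))) / th q (1 / (q * (z / a))) ^ Suc k)))
  \<longlongrightarrow> (1 / D) ^ Suc k * hk k 1 - (a - a) ^ Suc k * ((- 1) ^ k * (hk k (1 / (q * (a / a))) / th q (1 / (q * (a / a))) ^ Suc k))) (at a)"
  by (intro tendsto_diff tendsto_mult tendsto_power 1 c' isContD[OF c])
 also have "(%z. (1 / (th q (z / a) / (z - a))) ^ Suc k * hk k (z / a)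
  - (z - a) ^ Suc k * ((- 1) ^ k * (hk k (1 / (q * (z / a))) / th q (1 / (q * (z / a))) ^ Suc k)))
  = (%z. (z - a) ^ Suc k * zeta k (z / a))"
  by (rule ext) (simp add: zeta_def zk_def power_divide right_diff_distrib mult_ac)
 finally have "((%z. (z - a) ^ Suc k * zeta k (z / a)) \<longlongrightarrow> (1 / D) ^ Suc k * hk k 1) (at a)" by simp
 moreover have "(1 / D) ^ Suc k * hk k 1 ~= 0" using D hk_nz[OF th_1] by simp
 ultimately show ?thesis by blast
qed

lemma zeta_lim: "z ~= 0 ==> a ~= 0 ==> z / a \<notin> spiral ==> ((%z. zeta k (z / a)) \<longlongrightarrow> zeta k (z / a)) (at z)"
 by (rule isCont_tendsto_compose[OF DERIV_isCont[OF zeta_deriv]]) (auto intro!: tendsto_intros)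

lemma entire_comp_mero:
 "f holomorphic_on UNIV ==> g analytic_on A ==> (%z. f (g z)) meromorphic_on A"
 using analytic_on_compose_gen[of g A f UNIV]
 by (intro analytic_on_imp_meromorphic_on) (auto simp: analytic_on_open o_def)

lemma zk_mero: "g analytic_on A ==> (%z. zk k (g z)) meromorphic_on A"
 unfolding zk_def by (intro meromorphic_intros entire_comp_mero hk_hol th_hol)

lemma zeta_mero: "a ~= 0 ==> (%z. zeta k (z / a)) meromorphic_on - {0}"
 unfolding zeta_def by (intro meromorphic_intros zk_mero analytic_intros) auto

lemma zeta_hol: "a ~= 0 ==> (\<And>z. z \<in> A ==> z ~= 0 \<and> z / a \<notin> spiral) ==> (%z. zeta k (z / a)) holomorphic_on A"
proof -
 assume a: "a ~= 0" and A: "\<And>z. z \<in> A ==> z ~= 0 \<and> z / a \<notin> spiral"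
 have "zeta k holomorphic_on - {0} - spiral"
  using zeta_deriv by (subst holomorphic_on_open[OF open_spiral]) blast
 moreover have "(%z. z / a) holomorphic_on A" using a by (intro holomorphic_intros)
 moreover have "(%z. z / a) ` A \<subseteq> - {0} - spiral" using A a by auto
 ultimately show ?thesis using holomorphic_on_compose_gen[of "%z. z / a" A "zeta k"] by (simp add: o_def)
qed

end

locale punctures = qplane +
 fixes S :: "complex set set" and b :: complex
 assumes finS: "finite S" and S: "S \<subseteq> carrier (ell_curve q)" and b0: "b ~= 0" and bS: "ell_pt q b \<notin> S"
begin

text \<open>A representative in the plane of a point of the curve.\<close>
definition rp :: "complex set => complex" where
 "rp p = (SOME a. a ~= 0 \<and> p = ell_pt q a)"

definition W :: "complex set" where
 "W = {z. z ~= 0 \<and> ell_pt q z \<notin> S}"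

text \<open>The elliptic functions that are regular outside \<open>S\<close>, regarded as functions on the plane.\<close>
definition EE :: "(complex => complex) => bool" where
 "EE f \<longleftrightarrow> f holomorphic_on W \<and> (\<forall>z\<in>W. f (q * z) = f z) \<and> f meromorphic_on - {0}"

lemma rp: "p \<in> S ==> rp p ~= 0 \<and> ell_pt q (rp p) = p"
proof -
 assume "p \<in> S"
 hence "\<exists>a. a ~= 0 \<and> p = ell_pt q a" using S ell_carrier by auto
 from someI_ex[OF this] show ?thesis by (simp add: rp_def)
qed

lemma W_iff: "z \<in> W \<longleftrightarrow> z ~= 0 \<and> (\<forall>p\<in>S. z / rp p \<notin> spiral)"
 unfolding W_def using rp ell_pt_eq by (metis (mono_tags, lifting) mem_Collect_eq)

lemma b_W: "b \<in> W" using b0 bS by (simp add: W_def)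

lemma W_q: "q * z \<in> W \<longleftrightarrow> z \<in> W"
 unfolding W_iff using spiral_q[of "z / rp _"] by auto

lemma W_nz: "z \<in> W ==> z ~= 0" by (simp add: W_def)

lemma W_open: "open W"
proof -
 have "W = (\<Inter>p\<in>S. (%z. z / rp p) -` (- {0} - spiral)) \<inter> - {0}"
  using rp by (auto simp: W_iff)
 moreover have "open ((%z. z / rp p) -` (- {0} - spiral))" if "p \<in> S" for p
  using rp[OF that] by (intro open_vimage open_spiral continuous_intros) auto
 ultimately show ?thesis using finS by (auto intro!: open_Int open_INT)
qed

lemma eventually_W: "a ~= 0 ==> eventually (%z. z \<in> W) (at a)"
proof -
 assume a: "a ~= 0"
 have "eventually (%z. z / rp p \<notin> spiral) (at a)" if p: "p \<in> S" for p
 proof -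
  have r: "rp p ~= 0" using rp[OF p] by simp
  have "filterlim (%z. 1 / (q * (z / rp p))) (at (1 / (q * (a / rp p)))) (at a)"
   unfolding filterlim_at using a r by (auto intro!: tendsto_intros simp: eventually_at_filter)
  with th_eventually_nz have 1: "eventually (%z. th q (1 / (q * (z / rp p))) ~= 0) (at a)"
   by (rule eventually_compose_filterlim)
  have 2: "eventually (%z. z ~= 0) (at a)" using a by (intro eventually_neq_at_within)
  show ?thesis using 1 2 th_eventually_nz_scale[OF r, of a]
   by eventually_elim (use r spiral_iff in auto)
 qed
 hence 1: "eventually (%z. \<forall>p\<in>S. z / rp p \<notin> spiral) (at a)" using finS by (simp add: eventually_ball_finite)
 have 2: "eventually (%z. z ~= 0) (at a)" using a by (intro eventually_neq_at_within)
 show ?thesis using 1 2 by eventually_elim (auto simp: W_iff)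
qed

lemma rp_disjoint: "p \<in> S ==> p' \<in> S ==> p ~= p' ==> rp p / rp p' \<notin> spiral"
 using rp ell_pt_eq by metis

definition p0 :: "complex set" where "p0 = (SOME p. p \<in> S)"

lemma p0: "S ~= {} ==> p0 \<in> S" by (simp add: p0_def some_in_eq)

text \<open>An index \<open>(p, k)\<close> stands for a function with a pole of order \<open>pole_ord p (Suc k)\<close> at \<open>p\<close>.\<close>
definition cmb :: "(nat => complex set => complex) => complex set => nat => complex" where
 "cmb f p k = (if p = p0 then f (Suc k) p else if k = 0 then f 0 p - f 0 p0 else f k p)"

definition pole_ord :: "complex set => nat => nat" where
 "pole_ord p k = (if p = p0 then Suc k else k)"

definition ee :: "complex set => nat => complex => complex" where
 "ee p k z = cmb (%j p. zeta j (z / rp p)) p k - cmb (%j p. zeta j (b / rp p)) p k"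

lemma ee_b: "ee p k b = 0" by (simp add: ee_def)

lemma ee_EE: assumes p: "p \<in> S" shows "EE (ee p k)"
proof -
 have p0: "p0 \<in> S" using p p0 by auto
 have r: "rp p ~= 0" "rp p0 ~= 0" using rp p p0 by auto
 have hol: "(%z. zeta j (z / rp p')) holomorphic_on W" if "p' \<in> S" for j p'
  using rp[OF that] that by (intro zeta_hol) (auto simp: W_iff)
 have inv: "zeta (Suc j) (q * z / rp p') = zeta (Suc j) (z / rp p')"
  "zeta 0 (q * z / rp p') = zeta 0 (z / rp p') + 1" if "p' \<in> S" "z \<in> W" for j p' z
  using zeta_q[of "z / rp p'" j] zeta_0_q[of "z / rp p'"] that rp[of p'] by (auto simp: W_iff)
 show ?thesis unfolding EE_def
 proof (intro conjI ballI)
  show "ee p k holomorphic_on W"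
   unfolding ee_def[abs_def] cmb_def using p p0 by (auto intro!: holomorphic_intros hol)
  show "ee p k meromorphic_on - {0}"
   unfolding ee_def[abs_def] cmb_def using r by (auto intro!: meromorphic_intros zeta_mero)
  fix z assume z: "z \<in> W"
  show "ee p k (q * z) = ee p k z"
   using inv(1)[OF p z] inv(2)[OF p z] inv(2)[OF p0 z] by (cases k) (auto simp: ee_def cmb_def)
 qed
qed

lemma ee_leading:
 assumes p: "p \<in> S"
 shows "\<exists>C. C ~= 0 \<and> ((%z. (z - rp p) ^ pole_ord p (Suc k) * ee p k z) \<longlongrightarrow> C) (at (rp p))"
proof -
 define a where "a = rp p"
 have p0: "p0 \<in> S" using p p0 by auto
 have a: "a ~= 0" using rp[OF p] by (simp add: a_def)
 define j where "j = pole_ord p (Suc k) - 1"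
 have j: "Suc j = pole_ord p (Suc k)" by (simp add: j_def pole_ord_def)
 define R where "R z = ee p k z - zeta j (z / a)" for z
 have R: "\<exists>L. (R \<longlongrightarrow> L) (at a)"
 proof (cases "p = p0 \<or> k ~= 0")
  case True
  hence "R = (%z. - cmb (%j p. zeta j (b / rp p)) p k)"
   using j by (auto simp: R_def ee_def cmb_def pole_ord_def a_def fun_eq_iff split: if_splits)
  thus ?thesis by (auto intro!: exI tendsto_const)
 next
  case False
  hence "R = (%z. - zeta 0 (z / rp p0) - cmb (%j p. zeta j (b / rp p)) p k)"
   using j by (auto simp: R_def ee_def cmb_def pole_ord_def a_def fun_eq_iff split: if_splits)
  moreover have "((%z. zeta 0 (z / rp p0)) \<longlongrightarrow> zeta 0 (a / rp p0)) (at a)"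
   using False rp_disjoint[OF p p0] rp[OF p0] a by (intro zeta_lim) (auto simp: a_def)
  ultimately show ?thesis by (auto intro!: exI tendsto_intros)
 qed
 then obtain L where L: "(R \<longlongrightarrow> L) (at a)" by blast
 obtain C where C: "C ~= 0" "((%z. (z - a) ^ Suc j * zeta j (z / a)) \<longlongrightarrow> C) (at a)"
  using zeta_pole[OF a] by blast
 have "((%z. (z - a) ^ Suc j) \<longlongrightarrow> (a - a) ^ Suc j) (at a)" by (intro tendsto_intros)
 from tendsto_add[OF C(2) tendsto_mult[OF this L]]
 have "((%z. (z - a) ^ Suc j * ee p k z) \<longlongrightarrow> C) (at a)"
  by (simp add: R_def algebra_simps)
 thus ?thesis using C(1) j by (auto simp: a_def)
qed

lemma ee_other:
 assumes p: "p \<in> S" "p' \<in> S" "p ~= p'"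
 shows "\<exists>L. ((%z. (z - rp p') ^ pole_ord p' 0 * ee p k z) \<longlongrightarrow> L) (at (rp p'))"
proof -
 define a where "a = rp p'"
 have p0: "p0 \<in> S" using p p0 by auto
 have a: "a ~= 0" using rp[OF p(2)] by (simp add: a_def)
 have l: "((%z. zeta j (z / rp r)) \<longlongrightarrow> zeta j (a / rp r)) (at a)" if "r \<in> S" "r ~= p'" for j r
  using rp_disjoint[OF p(2) that(1)] that rp[OF that(1)] a by (intro zeta_lim) (auto simp: a_def)
 define c where "c = cmb (%j p. zeta j (b / rp p)) p k"
 have lz: "((%z. z - a) \<longlongrightarrow> a - a) (at a)" by (intro tendsto_intros)
 show ?thesis
 proof (cases "p' = p0")
  case False
  note l1 = l[OF p(1) p(3)] and l2 = l[OF p0 False[symmetric]]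
  have "\<exists>L. ((%z. zeta j (z / rp p) - c) \<longlongrightarrow> L) (at a)" for j
   by (rule exI) (rule tendsto_diff[OF l1 tendsto_const])
  moreover have "\<exists>L. ((%z. zeta j (z / rp p) - zeta j (z / rp p0) - c) \<longlongrightarrow> L) (at a)" for j
   by (rule exI) (rule tendsto_diff[OF tendsto_diff[OF l1 l2] tendsto_const])
  ultimately have "\<exists>L. (ee p k \<longlongrightarrow> L) (at a)"
   unfolding ee_def[abs_def] c_def[symmetric] unfolding cmb_def by (cases "p = p0"; cases "k = 0") simp_all
  thus ?thesis using False by (simp add: pole_ord_def a_def)
 next
  case True
  obtain C where C: "((%z. (z - a) ^ Suc 0 * zeta 0 (z / a)) \<longlongrightarrow> C) (at a)"
   using zeta_pole[OF a] by blast
  show ?thesis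
  proof (cases "k = 0")
   case True
   have "((%z. (z - a) * (zeta 0 (z / rp p) - c) - (z - a) ^ Suc 0 * zeta 0 (z / a)) \<longlongrightarrow>
    (a - a) * (zeta 0 (a / rp p) - c) - C) (at a)"
    using p by (intro tendsto_diff tendsto_mult lz C l tendsto_const) auto
   thus ?thesis using True \<open>p' = p0\<close> p
    by (auto simp: pole_ord_def ee_def cmb_def c_def a_def algebra_simps)
  next
   case False
   have "((%z. (z - a) * (zeta k (z / rp p) - c)) \<longlongrightarrow> (a - a) * (zeta k (a / rp p) - c)) (at a)"
    using p by (intro tendsto_diff tendsto_mult lz l tendsto_const) auto
   thus ?thesis using False \<open>p' = p0\<close> p
    by (auto simp: pole_ord_def ee_def cmb_def c_def a_def)
  qed
 qed
qed

text \<open>At each point the functions indexed by it have pairwise different pole orders. The others are regular there, except for simple poles at \<open>p0\<close>, and the functions indexed by \<open>p0\<close> have order at least \<open>2\<close>.\<close>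
lemma ee_independent:
 assumes "finite I" "I \<subseteq> S \<times> UNIV" "\<And>z. z \<in> W ==> (\<Sum>(p,k)\<in>I. c (p,k) * ee p k z) = 0"
 shows "\<forall>i\<in>I. c i = 0"
proof (rule ccontr)
 assume "\<not> ?thesis"
 then obtain p k where pk: "(p,k) \<in> I" "c (p,k) ~= 0" by auto
 define M where "M = {k. (p,k) \<in> I \<and> c (p,k) ~= 0}"
 have "finite M" using assms(1) by (rule finite_surj[of I _ snd]) (force simp: M_def)
 moreover have "M ~= {}" using pk by (auto simp: M_def)
 ultimately have K: "Max M \<in> M" "\<And>k. k \<in> M ==> k \<le> Max M" using Max_in Max_ge by auto
 define K where "K = Max M"
 have p: "p \<in> S" using pk assms(2) by auto
 define a where "a = rp p"
 have a: "a ~= 0" using rp[OF p] by (simp add: a_def)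
 obtain C where C: "C ~= 0" "((%z. (z - a) ^ pole_ord p (Suc K) * ee p K z) \<longlongrightarrow> C) (at a)"
  using ee_leading[OF p] by (auto simp: a_def)
 have lz: "((%z. (z - a) ^ Suc m) \<longlongrightarrow> 0) (at a)" for m
 proof -
  have "((%z. (z - a) ^ Suc m) \<longlongrightarrow> (a - a) ^ Suc m) (at a)" by (intro tendsto_intros)
  thus ?thesis by simp
 qed
 have summand: "((%z. (z - a) ^ pole_ord p (Suc K) * (c i * ee (fst i) (snd i) z)) \<longlongrightarrow> (if i = (p,K) then c (p,K) * C else 0)) (at a)"
  if iI: "i \<in> I" for i
 proof -
  obtain r k where i: "i = (r,k)" by (cases i)
  have r: "r \<in> S" using iI assms(2) i by auto
  consider "c i = 0" | "i = (p,K)" "c i ~= 0" | "r = p" "k < K" | "r ~= p"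
  proof (cases "r = p \<and> c i ~= 0 \<and> k ~= K")
   case True
   hence "k \<in> M" using iI i by (auto simp: M_def)
   hence "k \<le> K" using K(2) by (simp add: K_def)
   thus ?thesis using True that(3) by simp
  qed (use that i in auto)
  thus ?thesis
  proof cases
   case 1
   thus ?thesis using K(1) by (auto simp: M_def K_def)
  next
   case 2
   thus ?thesis using tendsto_mult_left[OF C(2), of "c i"] by (simp add: mult_ac)
  next
   case 3
   obtain C' where C': "((%z. (z - a) ^ pole_ord p (Suc k) * ee p k z) \<longlongrightarrow> C') (at a)"
    using ee_leading[OF p] by (auto simp: a_def)
   obtain m where "K = k + Suc m" using 3(2) less_iff_Suc_add by auto
   hence "pole_ord p (Suc K) = pole_ord p (Suc k) + Suc m" by (simp add: pole_ord_def)
   thus ?thesis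
    using tendsto_mult_left[OF tendsto_mult[OF lz[of m] C'], of "c i"] 3 i by (simp add: power_add mult_ac)
  next
   case 4
   obtain L where L: "((%z. (z - a) ^ pole_ord p 0 * ee r k z) \<longlongrightarrow> L) (at a)"
    using ee_other[OF r p 4] by (auto simp: a_def)
   have "pole_ord p (Suc K) = pole_ord p 0 + Suc K" by (simp add: pole_ord_def)
   thus ?thesis
    using tendsto_mult_left[OF tendsto_mult[OF lz[of K] L], of "c i"] 4 i by (simp add: power_add mult_ac)
  qed
 qed
 have "((%z. \<Sum>i\<in>I. (z - a) ^ pole_ord p (Suc K) * (c i * ee (fst i) (snd i) z)) \<longlongrightarrow>
   (\<Sum>i\<in>I. if i = (p,K) then c (p,K) * C else 0)) (at a)"
  by (intro tendsto_sum summand)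
 moreover have "(p,K) \<in> I" "c (p,K) ~= 0" using K(1) by (auto simp: M_def K_def)
 ultimately have l: "((%z. \<Sum>i\<in>I. (z - a) ^ pole_ord p (Suc K) * (c i * ee (fst i) (snd i) z)) \<longlongrightarrow> c (p,K) * C) (at a)"
  using assms(1) by simp
 have "eventually (%z. (\<Sum>i\<in>I. (z - a) ^ pole_ord p (Suc K) * (c i * ee (fst i) (snd i) z)) = 0) (at a)"
  using eventually_W[OF a]
 proof eventually_elim
  case (elim z)
  thus ?case using assms(3)[OF elim] by (simp add: sum_distrib_left[symmetric] case_prod_unfold)
 qed
 hence "((%z. \<Sum>i\<in>I. (z - a) ^ pole_ord p (Suc K) * (c i * ee (fst i) (snd i) z)) \<longlongrightarrow> 0) (at a)"
  by (rule tendsto_eventually)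
 from LIM_unique[OF l this] C(1) \<open>c (p,K) ~= 0\<close> show False by simp
qed

lemma isolated_singularity_W:
 assumes "f holomorphic_on W" "a ~= 0"
 shows "isolated_singularity_at f a"
proof -
 obtain r where r: "r > 0" "\<forall>z. z ~= a \<and> dist z a < r --> z \<in> W"
  using eventually_W[OF assms(2)] by (auto simp: eventually_at)
 have "ball a r - {a} \<subseteq> W" using r(2) by (auto simp: dist_commute)
 hence "f holomorphic_on ball a r - {a}" using assms(1) holomorphic_on_subset by blast
 hence "f analytic_on ball a r - {a}" by (subst analytic_on_open) auto
 thus ?thesis unfolding isolated_singularity_at_def using r(1) by blast
qed

lemma reduce_pole_order:
 assumes f: "f holomorphic_on W" and p: "p \<in> S"
  and l: "((%z. (z - rp p) ^ Suc m * f z) \<longlongrightarrow> 0) (at (rp p))"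
 shows "\<exists>L. ((%z. (z - rp p) ^ m * f z) \<longlongrightarrow> L) (at (rp p))"
proof -
 define a where "a = rp p"
 have a: "a ~= 0" using rp[OF p] by (simp add: a_def)
 define g where "g z = (z - a) ^ Suc m * f z" for z
 have l': "(g \<longlongrightarrow> 0) (at a)" using l by (simp add: g_def[abs_def] a_def)
 have iso: "isolated_singularity_at g a"
  unfolding g_def by (intro isolated_singularity_W holomorphic_intros f a)
 have "remove_sings g analytic_on {a}" by (rule remove_sings_analytic_at[OF iso l'])
 then obtain D where D: "(remove_sings g has_field_derivative D) (at a)"
  using analytic_on_imp_differentiable_at field_differentiable_def by blast
 have 0: "remove_sings g a = 0" using l' by blast
 have "((%z. (remove_sings g z - 0) / (z - a)) \<longlongrightarrow> D) (at a)"
  using D 0 by (simp add: has_field_derivative_iff)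
 moreover have "eventually (%z. (remove_sings g z - 0) / (z - a) = (z - a) ^ m * f z) (at a)"
  using eventually_remove_sings_eq_at[OF iso] eventually_neq_at_within[of a a UNIV]
  by eventually_elim (simp add: g_def)
 ultimately have "((%z. (z - a) ^ m * f z) \<longlongrightarrow> D) (at a)" by (rule Lim_transform_eventually)
 thus ?thesis unfolding a_def by blast
qed

text \<open>Removable singularities: the automorphy relation carries a limit at the chosen representatives to limits at all points over \<open>S\<close>.\<close>
lemma extend_over_punctures:
 assumes h: "h holomorphic_on W"
  and AB: "continuous_on (- {0}) A" "continuous_on (- {0}) B" "\<And>z. z ~= 0 ==> A z ~= 0"
  and eq: "\<And>z. z \<in> W ==> h (q * z) = A z * h z + B z"
  and lim: "\<And>p. p \<in> S ==> \<exists>L. (h \<longlongrightarrow> L) (at (rp p))"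
 shows "\<exists>H. H holomorphic_on - {0} \<and> (\<forall>z\<in>W. H z = h z) \<and>
  (\<forall>z. z ~= 0 --> H (q * z) = A z * H z + B z) \<and> (\<forall>p\<in>S. (h \<longlongrightarrow> H (rp p)) (at (rp p)))"
proof -
 have AC: "(A \<longlongrightarrow> A a) (at a)" "(B \<longlongrightarrow> B a) (at a)" if "a ~= 0" for a
  using AB(1,2) continuous_on_eq_continuous_at[of "- {0}" A] continuous_on_eq_continuous_at[of "- {0}" B] that
  by (simp_all add: isCont_def open_Compl)
 have up: "(h \<longlongrightarrow> A a * L + B a) (at (q * a))" if "(h \<longlongrightarrow> L) (at a)" "a ~= 0" for a L
 proof -
  have "((%z. A z * h z + B z) \<longlongrightarrow> A a * L + B a) (at a)"
   by (intro tendsto_add tendsto_mult AC that)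
  moreover have "eventually (%z. A z * h z + B z = h (q * z)) (at a)"
   by (rule eventually_mono[OF eventually_W[OF that(2)]]) (simp add: eq)
  ultimately have 1: "((%z. h (q * z)) \<longlongrightarrow> A a * L + B a) (at a)"
   by (rule Lim_transform_eventually)
  have "filterlim (%z. z / q) (at a) (at (q * a))"
   unfolding filterlim_at
   by (auto intro!: tendsto_eq_intros always_eventually simp: eventually_at_filter divide_eq_eq mult.commute)
  from filterlim_compose[OF 1 this] show ?thesis by simp
 qed
 have down: "(h \<longlongrightarrow> (L - B a) / A a) (at a)" if "(h \<longlongrightarrow> L) (at (q * a))" "a ~= 0" for a L
 proof -
  have "filterlim (%z. q * z) (at (q * a)) (at a)"
   unfolding filterlim_at by (auto intro!: tendsto_eq_intros simp: eventually_at_filter)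
  from filterlim_compose[OF that(1) this] have "((%z. (h (q * z) - B z) / A z) \<longlongrightarrow> (L - B a) / A a) (at a)"
   by (intro tendsto_divide tendsto_diff AC AB(3)[OF that(2)] that(2))
  moreover have "eventually (%z. (h (q * z) - B z) / A z = h z) (at a)"
   by (rule eventually_mono[OF eventually_W[OF that(2)]]) (simp add: eq AB(3) W_nz)
  ultimately show ?thesis by (rule Lim_transform_eventually)
 qed
 have lim: "\<exists>L. (h \<longlongrightarrow> L) (at a)" if a: "a ~= 0" for a
 proof (cases "a \<in> W")
  case True
  hence "isCont h a"
   using holomorphic_on_imp_continuous_on[OF h] continuous_on_eq_continuous_at[OF W_open] by blast
  thus ?thesis by (auto simp: isCont_def)
 next
  case False
  then obtain p where p: "p \<in> S" "a / rp p \<in> spiral" using a by (auto simp: W_iff)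
  then obtain k where "a / rp p = q powi k" by (auto simp: spiral_def)
  hence ak: "a = q powi k * rp p" using rp[OF p(1)] by (simp add: field_simps)
  have "\<exists>L. (h \<longlongrightarrow> L) (at (q powi k * rp p))"
  proof (induction k rule: int_induct[where k = 0])
   case base
   thus ?case using lim[OF p(1)] by simp
  next
   case (step1 i)
   have "q powi (i + 1) * rp p = q * (q powi i * rp p)" by (simp add: power_int_add)
   moreover have "q powi i * rp p ~= 0" using rp[OF p(1)] by simp
   ultimately show ?case using step1(2) up by metis
  next
   case (step2 i)
   have "q powi i * rp p = q * (q powi (i - 1) * rp p)" by (simp add: power_int_diff)
   moreover have "q powi (i - 1) * rp p ~= 0" using rp[OF p(1)] by simp
   ultimately show ?case using step2(2) down by metis
  qed
  thus ?thesis using ak by simp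
 qed
 define H where "H = remove_sings h"
 have H: "(h \<longlongrightarrow> H a) (at a)" if "a ~= 0" for a
  using lim[OF that] remove_sings_eqI by (auto simp: H_def)
 have an: "H analytic_on {a}" if a: "a ~= 0" for a
 proof -
  have "isolated_singularity_at h a" using h a by (rule isolated_singularity_W)
  thus ?thesis unfolding H_def using remove_sings_analytic_at H[OF a] by blast
 qed
 show ?thesis
 proof (intro exI[of _ H] conjI ballI allI impI)
  show "H holomorphic_on - {0}"
   by (rule analytic_imp_holomorphic, subst analytic_on_analytic_at) (use an in simp)
  show "H z = h z" if z: "z \<in> W" for z
   unfolding H_def
   using h W_open z by (intro remove_sings_at_analytic) (auto intro: holomorphic_on_imp_analytic_at)
  show "H (q * z) = A z * H z + B z" if "z ~= 0" for z
   using LIM_unique[OF H[of "q * z"] up[OF H[OF that] that]] that by simp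
  show "(h \<longlongrightarrow> H (rp p)) (at (rp p))" if "p \<in> S" for p using H rp[OF that] by blast
 qed
qed

text \<open>Induction on the total pole order: subtracting a multiple of the basis function with the same leading term lowers the order at one point. At the end a \<open>zeta 0\<close> at \<open>p0\<close> remains, and its additive automorphy excludes it.\<close>
lemma ee_span_aux:
 assumes "f holomorphic_on W" "\<And>z. z \<in> W ==> f (q * z) = f z"
  and "\<And>p. p \<in> S ==> \<exists>L. ((%z. (z - rp p) ^ pole_ord p (x p) * f z) \<longlongrightarrow> L) (at (rp p))"
 shows "\<exists>I c d. finite I \<and> I \<subseteq> S \<times> UNIV \<and> (\<forall>z\<in>W. f z = d + (\<Sum>(p,k)\<in>I. c (p,k) * ee p k z))"
 using assms
proof (induction "\<Sum>p\<in>S. x p" arbitrary: f x rule: less_induct)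
 case less
 show ?case
 proof (cases "\<exists>p\<in>S. x p ~= 0")
  case True
  then obtain p k where p: "p \<in> S" "x p = Suc k" by (auto simp: gr0_conv_Suc)
  obtain C where C: "C ~= 0" "((%z. (z - rp p) ^ pole_ord p (Suc k) * ee p k z) \<longlongrightarrow> C) (at (rp p))"
   using ee_leading[OF p(1)] by blast
  obtain L where L: "((%z. (z - rp p) ^ pole_ord p (Suc k) * f z) \<longlongrightarrow> L) (at (rp p))"
   using less(4)[OF p(1)] p(2) by auto
  define g where "g z = f z - L / C * ee p k z" for z
  define y where "y = x(p := k)"
  have eE: "ee p k holomorphic_on W" "\<And>z. z \<in> W ==> ee p k (q * z) = ee p k z"
   using ee_EE[OF p(1), of k] by (auto simp: EE_def)
  have gh: "g holomorphic_on W" unfolding g_def by (intro holomorphic_intros less eE)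
  have "(\<Sum>p\<in>S. y p) < (\<Sum>p\<in>S. x p)"
   using finS p by (intro sum_strict_mono_ex1) (auto simp: y_def)
  moreover have "g (q * z) = g z" if "z \<in> W" for z using less(3) eE(2) that by (simp add: g_def)
  moreover have "\<exists>L. ((%z. (z - rp r) ^ pole_ord r (y r) * g z) \<longlongrightarrow> L) (at (rp r))" if r: "r \<in> S" for r
  proof (cases "r = p")
   case True
   have "((%z. (z - rp p) ^ pole_ord p (Suc k) * f z - L / C * ((z - rp p) ^ pole_ord p (Suc k) * ee p k z)) \<longlongrightarrow> L - L / C * C) (at (rp p))"
    by (intro tendsto_intros L C)
   moreover have "pole_ord p (Suc k) = Suc (pole_ord p k)" by (simp add: pole_ord_def)
   ultimately have "((%z. (z - rp p) ^ Suc (pole_ord p k) * g z) \<longlongrightarrow> 0) (at (rp p))"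
    using C(1) by (simp add: g_def algebra_simps)
   from reduce_pole_order[OF gh p(1) this] show ?thesis using True by (simp add: y_def)
  next
   case False
   obtain L1 where L1: "((%z. (z - rp r) ^ pole_ord r (x r) * f z) \<longlongrightarrow> L1) (at (rp r))"
    using less(4)[OF r] by blast
   obtain L2 where L2: "((%z. (z - rp r) ^ pole_ord r 0 * ee p k z) \<longlongrightarrow> L2) (at (rp r))"
    using ee_other[OF p(1) r] False by blast
   have e: "pole_ord r (x r) = x r + pole_ord r 0" by (simp add: pole_ord_def)
   have "((%z. (z - rp r) ^ pole_ord r (x r) * f z - L / C * ((z - rp r) ^ x r * ((z - rp r) ^ pole_ord r 0 * ee p k z)))
    \<longlongrightarrow> L1 - L / C * ((rp r - rp r) ^ x r * L2)) (at (rp r))"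
    by (intro tendsto_intros L1 L2)
   moreover have "(z - rp r) ^ pole_ord r (x r) * f z - L / C * ((z - rp r) ^ x r * ((z - rp r) ^ pole_ord r 0 * ee p k z))
    = (z - rp r) ^ pole_ord r (y r) * g z" for z
    unfolding e using False by (simp add: y_def e g_def power_add algebra_simps)
   ultimately show ?thesis by auto
  qed
  ultimately have "\<exists>I c d. finite I \<and> I \<subseteq> S \<times> UNIV \<and> (\<forall>z\<in>W. g z = d + (\<Sum>(p,k)\<in>I. c (p,k) * ee p k z))"
   by (intro less(1)[of y g] gh)
  then obtain I c d where I0: "finite I \<and> I \<subseteq> S \<times> UNIV \<and> (\<forall>z\<in>W. g z = d + (\<Sum>(p,k)\<in>I. c (p,k) * ee p k z))"
   by (elim exE)
  hence I: "finite I" "I \<subseteq> S \<times> UNIV"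
   "\<And>z. z \<in> W ==> g z = d + (\<Sum>(p,k)\<in>I. c (p,k) * ee p k z)" by blast+
  define c' where "c' i = (if i \<in> I then c i else 0) + (if i = (p,k) then L / C else 0)" for i
  have "f z = d + (\<Sum>(p,k)\<in>insert (p,k) I. c' (p,k) * ee p k z)" if z: "z \<in> W" for z
  proof -
   have "(\<Sum>(r,j)\<in>insert (p,k) I. c' (r,j) * ee r j z) =
    (\<Sum>i\<in>insert (p,k) I. if i \<in> I then c i * ee (fst i) (snd i) z else 0) +
    (\<Sum>i\<in>insert (p,k) I. if i = (p,k) then L / C * ee p k z else 0)"
    unfolding sum.distrib[symmetric]
    by (intro sum.cong refl) (auto simp: c'_def algebra_simps split: if_splits)
   also have "(\<Sum>i\<in>insert (p,k) I. if i \<in> I then c i * ee (fst i) (snd i) z else 0) = (\<Sum>(p,k)\<in>I. c (p,k) * ee p k z)"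
    using I(1) by (intro sum.mono_neutral_cong_right) auto
   also have "(\<Sum>i\<in>insert (p,k) I. if i = (p,k) then L / C * ee p k z else 0) = L / C * ee p k z"
    using I(1) by simp
   moreover have "f z = g z + L / C * ee p k z" by (simp add: g_def)
   ultimately show ?thesis using I(3)[OF z] by (simp add: add.assoc)
  qed
  hence "\<forall>z\<in>W. f z = d + (\<Sum>(p,k)\<in>insert (p,k) I. c' (p,k) * ee p k z)" by blast
  moreover have "finite (insert (p,k) I)" "insert (p,k) I \<subseteq> S \<times> UNIV" using I(1,2) p by auto
  ultimately show ?thesis by blast
 next
  case False
  have const: "\<exists>d. \<forall>z\<in>W. f z = d"
  proof (cases "S = {}")
   case True
   have one_nz: "\<And>z::complex. z ~= 0 ==> (1::complex) ~= 0" by simp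
   have fq: "\<And>z. z \<in> W ==> f (q * z) = 1 * f z + 0" using less(3) by simp
   have fl: "\<And>p. p \<in> S ==> \<exists>L. (f \<longlongrightarrow> L) (at (rp p))" using True by simp
   have "\<exists>H. H holomorphic_on - {0} \<and> (\<forall>z\<in>W. H z = f z) \<and>
    (\<forall>z. z ~= 0 --> H (q * z) = 1 * H z + 0) \<and> (\<forall>p\<in>S. (f \<longlongrightarrow> H (rp p)) (at (rp p)))"
    by (rule extend_over_punctures[OF less(2) continuous_on_const continuous_on_const], erule one_nz, erule fq, erule fl)
   then obtain H where HH: "H holomorphic_on - {0} \<and> (\<forall>z\<in>W. H z = f z) \<and>
    (\<forall>z. z ~= 0 --> H (q * z) = 1 * H z + 0) \<and> (\<forall>p\<in>S. (f \<longlongrightarrow> H (rp p)) (at (rp p)))"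
    by (elim exE)
   hence H: "H holomorphic_on - {0}" "\<And>z. z \<in> W ==> H z = f z" by blast+
   have Hq: "\<And>z. z ~= 0 ==> H (q * z) = H z" using HH by simp
   obtain d where d: "\<And>z. z ~= 0 ==> H z = d" 
    by (rule invariant_imp_constant[OF H(1)], erule Hq) blast
   have "f z = d" if "z \<in> W" for z using H(2)[OF that] d[OF W_nz[OF that]] by simp
   thus ?thesis by blast
  next
   case False
   hence p0: "p0 \<in> S" by (rule p0)
   define a where "a = rp p0"
   have a: "a ~= 0" using rp[OF p0] by (simp add: a_def)
   have x0: "x p = 0" if "p \<in> S" for p using \<open>\<not> (\<exists>p\<in>S. x p ~= 0)\<close> that by auto
   obtain C where C: "C ~= 0" "((%z. (z - a) ^ Suc 0 * zeta 0 (z / a)) \<longlongrightarrow> C) (at a)"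
    using zeta_pole[OF a] by blast
   obtain L where L: "((%z. (z - a) ^ Suc 0 * f z) \<longlongrightarrow> L) (at a)"
    using less(4)[OF p0] x0[OF p0] by (auto simp: pole_ord_def a_def)
   define g where "g z = f z - L / C * zeta 0 (z / a)" for z
   have zh: "(%z. zeta 0 (z / a)) holomorphic_on W"
    using p0 a by (intro zeta_hol) (auto simp: W_iff a_def)
   have gh: "g holomorphic_on W" unfolding g_def by (intro holomorphic_intros less zh)
   have gq: "g (q * z) = 1 * g z + - (L / C)" if z: "z \<in> W" for z
   proof -
    have "zeta 0 (q * (z / a)) = zeta 0 (z / a) + 1"
     using z p0 a by (intro zeta_0_q) (auto simp: W_iff a_def)
    thus ?thesis using less(3)[OF z] by (simp add: g_def algebra_simps)
   qed
   have gl: "\<exists>L. (g \<longlongrightarrow> L) (at (rp r))" if r: "r \<in> S" for r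
   proof (cases "r = p0")
    case True
    have "((%z. (z - a) ^ Suc 0 * f z - L / C * ((z - a) ^ Suc 0 * zeta 0 (z / a))) \<longlongrightarrow> L - L / C * C) (at a)"
     by (intro tendsto_intros L C)
    moreover have "(z - a) ^ Suc 0 * f z - L / C * ((z - a) ^ Suc 0 * zeta 0 (z / a)) = (z - rp p0) ^ Suc 0 * g z" for z
     unfolding g_def a_def by (simp only: right_diff_distrib mult_ac)
    ultimately have "((%z. (z - rp p0) ^ Suc 0 * g z) \<longlongrightarrow> 0) (at (rp p0))"
     using C(1) by (simp add: a_def)
    from reduce_pole_order[OF gh p0 this] show ?thesis using True by simp
   next
    case False
    obtain L1 where L1: "(f \<longlongrightarrow> L1) (at (rp r))"
     using less(4)[OF r] x0[OF r] False by (auto simp: pole_ord_def)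
    have "((%z. zeta 0 (z / a)) \<longlongrightarrow> zeta 0 (rp r / a)) (at (rp r))"
     using rp_disjoint[OF r p0 False] rp[OF r] a by (intro zeta_lim) (auto simp: a_def)
    thus ?thesis unfolding g_def[abs_def] using tendsto_diff[OF L1 tendsto_mult_left] by blast
   qed
   have one_nz: "\<And>z::complex. z ~= 0 ==> (1::complex) ~= 0" by simp
   have "\<exists>H. H holomorphic_on - {0} \<and> (\<forall>z\<in>W. H z = g z) \<and>
    (\<forall>z. z ~= 0 --> H (q * z) = 1 * H z + - (L / C)) \<and> (\<forall>p\<in>S. (g \<longlongrightarrow> H (rp p)) (at (rp p)))"
    by (rule extend_over_punctures[OF gh continuous_on_const continuous_on_const], erule one_nz, erule gq, erule gl)
   then obtain H where HH: "H holomorphic_on - {0} \<and> (\<forall>z\<in>W. H z = g z) \<and>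
    (\<forall>z. z ~= 0 --> H (q * z) = 1 * H z + - (L / C)) \<and> (\<forall>p\<in>S. (g \<longlongrightarrow> H (rp p)) (at (rp p)))"
    by (elim exE)
   hence H: "H holomorphic_on - {0}" "\<And>z. z \<in> W ==> H z = g z" by blast+
   have Hq: "\<And>z. z ~= 0 ==> H (q * z) = H z + - (L / C)" using HH by simp
   have "\<exists>d. \<forall>z. z ~= 0 --> H z = d"
    by (rule additive_automorphy_trivial(2)[OF H(1)], erule Hq)
   then obtain d where d: "\<forall>z. z ~= 0 --> H z = d" by (elim exE)
   have "- (L / C) = 0" by (rule additive_automorphy_trivial(1)[OF H(1)], erule Hq)
   hence LC: "L / C = 0" by simp
   have "f z = d" if "z \<in> W" for z
    using H(2)[OF that] d W_nz[OF that] unfolding g_def LC by simp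
   thus ?thesis by blast
  qed
  thus ?thesis by (intro exI[of _ "{}"]) auto
 qed
qed

lemma EE_additive:
 assumes f: "EE f" and fb: "f b = 0"
 shows "\<exists>I c. finite I \<and> I \<subseteq> S \<times> UNIV \<and> (\<forall>z\<in>W. f z = (\<Sum>(p,k)\<in>I. c (p,k) * ee p k z))"
proof -
 have "\<exists>m L. ((%z. (z - rp p) ^ m * f z) \<longlongrightarrow> L) (at (rp p))" if "p \<in> S" for p
  using f rp[OF that] by (intro meromorphic_pole_bound) (auto simp: EE_def intro: meromorphic_on_subset)
 then obtain x L where x: "\<And>p. p \<in> S ==> ((%z. (z - rp p) ^ x p * f z) \<longlongrightarrow> L p) (at (rp p))"
  by metis
 have "\<exists>L. ((%z. (z - rp p) ^ pole_ord p (x p) * f z) \<longlongrightarrow> L) (at (rp p))" if "p \<in> S" for p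
 proof -
  have "((%z. (z - rp p) ^ x p * f z * (z - rp p)) \<longlongrightarrow> L p * (rp p - rp p)) (at (rp p))"
   by (intro tendsto_intros x that)
  thus ?thesis using x[OF that] by (auto simp: pole_ord_def mult_ac)
 qed
 hence "\<exists>I c d. finite I \<and> I \<subseteq> S \<times> UNIV \<and> (\<forall>z\<in>W. f z = d + (\<Sum>(p,k)\<in>I. c (p,k) * ee p k z))"
  using f by (intro ee_span_aux[of f x]) (auto simp: EE_def)
 then obtain I c d where "finite I \<and> I \<subseteq> S \<times> UNIV \<and> (\<forall>z\<in>W. f z = d + (\<Sum>(p,k)\<in>I. c (p,k) * ee p k z))"
  by (elim exE)
 hence I: "finite I" "I \<subseteq> S \<times> UNIV"
  "\<And>z. z \<in> W ==> f z = d + (\<Sum>(p,k)\<in>I. c (p,k) * ee p k z)" by blast+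
 have "d = 0" using I(3)[OF b_W] fb by (simp add: ee_b case_prod_unfold)
 hence "\<forall>z\<in>W. f z = (\<Sum>(p,k)\<in>I. c (p,k) * ee p k z)" using I(3) by simp
 with I(1,2) show ?thesis by blast
qed

end

lemma prod_powi_minus: "(\<Prod>p\<in>S. f p powi (- n p)) = 1 / (\<Prod>p\<in>S. (f p :: complex) powi n p)"
 by (simp add: power_int_minus prod_inversef[symmetric] divide_inverse)

lemma ln_powi: "x > 0 ==> ln (x powi n) = of_int n * ln (x::real)"
 by (simp add: power_int_def ln_realpow ln_inverse)

context punctures
begin

section \<open>Elliptic functions with given divisor\<close>

definition TT :: "complex set => complex => complex" where
 "TT p z = th q (z / rp p) * th q (rp p / (q * z))"

text \<open>The characters of \<open>L\<^sub>s / L'\<^sub>s\<close>: degree \<open>0\<close> makes a monomial trivial on the diagonal, the second condition says that it is a relation.\<close>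
definition RR :: "(complex set => int) set" where
 "RR = {n \<in> S \<rightarrow>\<^sub>E UNIV. (\<Sum>p\<in>S. n p) = 0 \<and> (\<Prod>p\<in>S. rp p powi n p) \<in> spiral}"

definition ch :: "(complex set => int) => (complex set => complex) => complex" where
 "ch n x = (\<Prod>p\<in>S. x p powi n p)"

text \<open>The factor \<open>exp (kap p Ln z)\<close> in \<open>xx0\<close> is multivalued, but in a character from \<open>RR\<close> these factors combine to an integral power of \<open>z\<close>; this is where the relation \<open>\<Sum> n\<^sub>p p = 0\<close> enters. Default values \<open>1\<close> keep the coordinates nonzero everywhere.\<close>
definition kap :: "complex set => real" where
 "kap p = ln (norm (rp p)) / ln (norm q)"

definition xx0 :: "complex set => complex => complex" where
 "xx0 p z = (if th q (z / rp p) = 0 then 1 else th q (z / rp p) * exp (of_real (kap p) * Ln z))"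

definition xxN :: "complex set => complex" where
 "xxN p = TT p b * exp (of_real (kap p) * Ln b)"

definition xxI :: "complex set => complex => complex" where
 "xxI p z = (if th q (rp p / (q * z)) = 0 then 1 else xxN p / th q (rp p / (q * z)))"

definition xx :: "complex set => complex => complex" where
 "xx p z = xx0 p z / xxI p z"

lemma ch_mult: "ch n (%p. x p * y p) = ch n x * ch n y"
 by (simp add: ch_def power_int_mult_distrib prod.distrib)

lemma ch_divide: "ch n (%p. x p / y p) = ch n x / ch n y"
 by (simp add: ch_def power_int_divide_distrib prod_dividef)

lemma TT_zero_iff: "p \<in> S ==> z ~= 0 ==> TT p z = 0 \<longleftrightarrow> z / rp p \<in> spiral"
 using spiral_iff[of "z / rp p"] rp[of p] by (simp add: TT_def)

lemma TT_W: "p \<in> S ==> z \<in> W ==> TT p z ~= 0"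
 using TT_zero_iff W_nz by (auto simp: W_iff)

lemma TT_hol: "p \<in> S ==> TT p holomorphic_on - {0}"
 unfolding TT_def[abs_def] using rp by (auto intro!: holomorphic_intros)

lemma TT_q:
 assumes p: "p \<in> S" and z: "z \<in> W"
 shows "TT p (q * z) = (- q / rp p) * z * TT p z"
proof -
 define u where "u = q * z / rp p"
 have r: "rp p ~= 0" using rp[OF p] by simp
 have z0: "z ~= 0" using z W_nz by auto
 have "q * z / rp p \<notin> spiral" using z p spiral_q[of "z / rp p"] by (auto simp: W_iff)
 hence u: "u ~= 0" "u ~= 1" using z0 r one_spiral by (auto simp: u_def)
 have 1: "th q u = (1 - u) * th q (z / rp p)" using th_eq[of u] by (simp add: u_def)
 have 2: "th q (1 / u) = (1 - 1 / u) * th q (rp p / (q * (q * z)))"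
  using th_eq[of "1 / u"] by (simp add: u_def mult_ac)
 have "TT p (q * z) * (1 - 1 / u) = th q u * th q (1 / u)"
  unfolding 2 by (simp add: TT_def u_def)
 also have "... = (1 - u) * TT p z" unfolding 1 by (simp add: TT_def u_def)
 finally have "TT p (q * z) * ((u - 1) / u) = (1 - u) * TT p z" using u by (simp add: diff_divide_distrib)
 hence "TT p (q * z) * (u - 1) = - u * TT p z * (u - 1)" using u by (simp add: field_simps)
 moreover have "u - 1 ~= 0" using u by simp
 ultimately have "TT p (q * z) = - u * TT p z" using mult_right_cancel by blast
 thus ?thesis by (simp add: u_def)
qed

lemma TT_simple:
 assumes p: "p \<in> S"
 shows "\<exists>D. D ~= 0 \<and> ((%z. TT p z / (z - rp p)) \<longlongrightarrow> D) (at (rp p))"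
proof -
 have a: "rp p ~= 0" using rp[OF p] by simp
 have c: "isCont (%z. th q (rp p / (q * z))) (rp p)"
  using a by (intro isCont_o2[OF _ th_isCont] continuous_intros) auto
 have "((%z. th q (z / rp p) / (z - rp p) * th q (rp p / (q * z))) \<longlongrightarrow>
   deriv (th q) 1 / rp p * th q (rp p / (q * rp p))) (at (rp p))"
  by (intro tendsto_mult th_simple_limit a isContD[OF c])
 moreover have "deriv (th q) 1 / rp p * th q (rp p / (q * rp p)) ~= 0"
  using a th_q_nz th_simple[OF th_1] by simp
 ultimately show ?thesis by (intro exI conjI) (auto simp: TT_def)
qed

lemma TT_other: "p \<in> S ==> p' \<in> S ==> p ~= p' ==> (TT p \<longlongrightarrow> TT p (rp p')) (at (rp p')) \<and> TT p (rp p') ~= 0"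
proof -
 assume p: "p \<in> S" "p' \<in> S" "p ~= p'"
 have "isCont (TT p) (rp p')"
  using holomorphic_on_imp_continuous_on[OF TT_hol[OF p(1)]] rp[OF p(2)]
   continuous_on_eq_continuous_at[of "- {0}" "TT p"] by (simp add: open_Compl)
 thus ?thesis using p rp_disjoint[of p' p] TT_zero_iff[of p "rp p'"] rp[OF p(2)] by (auto simp: isCont_def)
qed

text \<open>The product of the \<open>TT p powi n p\<close> has order \<open>n p\<close> at \<open>p\<close>.\<close>
lemma TT_prod_order:
 assumes p: "p \<in> S"
 shows "\<exists>C. C ~= 0 \<and> ((%z. (\<Prod>r\<in>S. TT r z powi n r) * (z - rp p) powi (- n p)) \<longlongrightarrow> C) (at (rp p))"
proof -
 obtain D where D: "D ~= 0" "((%z. TT p z / (z - rp p)) \<longlongrightarrow> D) (at (rp p))" using TT_simple[OF p] by blast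
 have o: "(TT r \<longlongrightarrow> TT r (rp p)) (at (rp p))" "TT r (rp p) ~= 0" if "r \<in> S - {p}" for r
  using TT_other[of r p] that p by auto
 have "((%z. (TT p z / (z - rp p)) powi n p * (\<Prod>r\<in>S - {p}. TT r z powi n r)) \<longlongrightarrow>
  D powi n p * (\<Prod>r\<in>S - {p}. TT r (rp p) powi n r)) (at (rp p))"
  using D by (intro tendsto_mult tendsto_prod tendsto_power_int o) auto
 moreover have "eventually (%z. (TT p z / (z - rp p)) powi n p * (\<Prod>r\<in>S - {p}. TT r z powi n r)
  = (\<Prod>r\<in>S. TT r z powi n r) * (z - rp p) powi (- n p)) (at (rp p))"
  using eventually_neq_at_within[of "rp p" "rp p" UNIV]
  by eventually_elim (simp add: prod.remove[OF finS p] power_int_divide_distrib power_int_minus divide_inverse[of _ "_ powi _"] mult_ac)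
 ultimately have "((%z. (\<Prod>r\<in>S. TT r z powi n r) * (z - rp p) powi (- n p)) \<longlongrightarrow>
  D powi n p * (\<Prod>r\<in>S - {p}. TT r (rp p) powi n r)) (at (rp p))"
  by (rule Lim_transform_eventually)
 moreover have "D powi n p * (\<Prod>r\<in>S - {p}. TT r (rp p) powi n r) ~= 0"
  using D o finS by simp
 ultimately show ?thesis by blast
qed

lemma RR_exponent:
 assumes n: "n \<in> RR"
 obtains L where "(\<Prod>p\<in>S. rp p powi n p) = q powi L"
  "\<And>z. (\<Prod>p\<in>S. exp (of_real (kap p) * Ln z) powi n p) = exp (of_int L * Ln z)"
proof -
 obtain L where L: "(\<Prod>p\<in>S. rp p powi n p) = q powi L" using n by (auto simp: RR_def spiral_def)
 have lq: "ln (norm q) > 0" using q by simp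
 have "ln (norm (q powi L)) = (\<Sum>p\<in>S. of_int (n p) * ln (norm (rp p)))"
  unfolding L[symmetric] prod_norm[symmetric] norm_power_int
  using rp finS by (subst ln_prod) (auto simp: ln_powi intro!: sum.cong)
 hence "of_int L * ln (norm q) = (\<Sum>p\<in>S. of_int (n p) * ln (norm (rp p)))"
  by (simp add: norm_power_int ln_powi)
 hence s: "(\<Sum>p\<in>S. of_int (n p) * kap p) = of_int L"
 proof -
  have "(\<Sum>p\<in>S. of_int (n p) * kap p) = (\<Sum>p\<in>S. of_int (n p) * ln (norm (rp p))) / ln (norm q)"
   by (simp add: kap_def sum_divide_distrib)
  also have "... = of_int L * ln (norm q) / ln (norm q)" using \<open>of_int L * ln (norm q) = _\<close> by simp
  finally show ?thesis using lq by simp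
 qed
 have "(\<Prod>p\<in>S. exp (of_real (kap p) * Ln z) powi n p) = exp (of_int L * Ln z)" for z
 proof -
  have "(\<Prod>p\<in>S. exp (of_real (kap p) * Ln z) powi n p) = (\<Prod>p\<in>S. exp (of_int (n p) * (of_real (kap p) * Ln z)))"
   by (simp add: exp_power_int)
  also have "... = exp (\<Sum>p\<in>S. of_int (n p) * (of_real (kap p) * Ln z))" by (simp add: exp_sum finS)
  also have "(\<Sum>p\<in>S. of_int (n p) * (of_real (kap p) * Ln z)) = of_real (\<Sum>p\<in>S. of_int (n p) * kap p) * Ln z"
   by (simp add: sum_distrib_right mult.assoc)
  finally show ?thesis by (simp add: s)
 qed
 with L show ?thesis by (rule that)
qed

lemma ch_xx:
 assumes n: "n \<in> RR"
 shows "\<exists>L N. N ~= 0 \<and> (\<Prod>p\<in>S. rp p powi n p) = q powi L \<and>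
  (\<forall>z\<in>W. ch n (%p. xx p z) = N * z powi L * (\<Prod>p\<in>S. TT p z powi n p))"
proof -
 obtain L where L: "(\<Prod>p\<in>S. rp p powi n p) = q powi L"
  "\<And>z. (\<Prod>p\<in>S. exp (of_real (kap p) * Ln z) powi n p) = exp (of_int L * Ln z)"
  using RR_exponent[OF n] by blast
 have N: "xxN p ~= 0" if "p \<in> S" for p using TT_W[OF that b_W] by (simp add: xxN_def)
 have "ch n (%p. xx p z) = 1 / ch n xxN * z powi L * (\<Prod>p\<in>S. TT p z powi n p)" if z: "z \<in> W" for z
 proof -
  have "ch n (%p. xx p z) = ch n (%p. exp (of_real (kap p) * Ln z) * TT p z / xxN p)"
   unfolding ch_def
  proof (intro prod.cong refl)
   fix p assume p: "p \<in> S"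
   have "th q (z / rp p) ~= 0" "th q (rp p / (q * z)) ~= 0" using TT_W[OF p z] by (auto simp: TT_def)
   thus "xx p z powi n p = (exp (of_real (kap p) * Ln z) * TT p z / xxN p) powi n p"
    using N[OF p] by (simp add: xx_def xx0_def xxI_def TT_def mult_ac)
  qed
  also have "... = exp (of_int L * Ln z) * (\<Prod>p\<in>S. TT p z powi n p) / ch n xxN"
   by (simp only: ch_divide ch_mult) (simp add: ch_def L)
  also have "exp (of_int L * Ln z) = z powi L" using W_nz[OF z] by (metis exp_Ln exp_power_int)
  finally show ?thesis by simp
 qed
 moreover have "1 / ch n xxN ~= 0" using N finS by (simp add: ch_def)
 ultimately show ?thesis using L(1) by (intro exI[of _ L] exI[of _ "1 / ch n xxN"]) blast
qed

lemma xx_b: "n \<in> RR ==> ch n (%p. xx p b) = 1"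
proof -
 have "xx p b = 1" if p: "p \<in> S" for p
 proof -
  have "th q (b / rp p) ~= 0" "th q (rp p / (q * b)) ~= 0" using TT_W[OF p b_W] by (auto simp: TT_def)
  thus ?thesis by (simp add: xx_def xx0_def xxI_def xxN_def TT_def)
 qed
 thus ?thesis by (simp add: ch_def)
qed

lemma TT_prod_q:
 assumes z: "z \<in> W"
 shows "(\<Prod>p\<in>S. TT p (q * z) powi n p) =
  (- q * z) powi (\<Sum>p\<in>S. n p) / (\<Prod>p\<in>S. rp p powi n p) * (\<Prod>p\<in>S. TT p z powi n p)"
proof -
 have "(\<Prod>p\<in>S. TT p (q * z) powi n p) = (\<Prod>p\<in>S. ((- q * z) powi n p / rp p powi n p) * TT p z powi n p)"
 proof (intro prod.cong refl)
  fix p assume "p \<in> S"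
  hence "TT p (q * z) = (- q * z) / rp p * TT p z" using TT_q z by simp
  thus "TT p (q * z) powi n p = (- q * z) powi n p / rp p powi n p * TT p z powi n p"
   by (simp only: power_int_mult_distrib power_int_divide_distrib)
 qed
 also have "... = (- q * z) powi (\<Sum>p\<in>S. n p) / (\<Prod>p\<in>S. rp p powi n p) * (\<Prod>p\<in>S. TT p z powi n p)"
  using W_nz[OF z] by (subst powi_sum) (auto simp: prod.distrib prod_dividef)
 finally show ?thesis .
qed

lemma EE_char:
 assumes n: "n \<in> RR"
 shows "EE (%z. ch n (%p. xx p z))" "\<And>z. z \<in> W ==> ch n (%p. xx p z) ~= 0"
proof -
 from ch_xx[OF n] obtain L N where L: "N ~= 0" "(\<Prod>p\<in>S. rp p powi n p) = q powi L"
  "\<forall>z\<in>W. ch n (%p. xx p z) = N * z powi L * (\<Prod>p\<in>S. TT p z powi n p)"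
  by (elim exE conjE)
 define F where "F z = N * z powi L * (\<Prod>p\<in>S. TT p z powi n p)" for z
 have Fh: "F holomorphic_on W"
  unfolding F_def using TT_W W_nz
  by (auto intro!: holomorphic_intros holomorphic_on_subset[OF TT_hol])
 have Fm: "F meromorphic_on - {0}"
  unfolding F_def
  by (intro meromorphic_intros; rule analytic_on_imp_meromorphic_on; subst analytic_on_open)
   (auto simp: open_Compl TT_hol)
 show "EE (%z. ch n (%p. xx p z))"
  unfolding EE_def
 proof (intro conjI ballI)
  show "(%z. ch n (%p. xx p z)) holomorphic_on W"
   by (rule holomorphic_transform[OF Fh]) (simp add: F_def L)
  show "(%z. ch n (%p. xx p z)) meromorphic_on - {0}"
  proof (rule meromorphic_on_cong[THEN iffD1, OF _ refl Fm])
   fix z :: complex assume "z \<in> - {0}"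
   hence "eventually (%w. w \<in> W) (at z)" by (intro eventually_W) auto
   thus "eventually (%w. F w = ch n (%p. xx p w)) (at z)"
    by eventually_elim (simp add: F_def L)
  qed
  fix z assume z: "z \<in> W"
  have "(\<Sum>p\<in>S. n p) = 0" using n by (simp add: RR_def)
  thus "ch n (%p. xx p (q * z)) = ch n (%p. xx p z)"
   using z by (simp add: L W_q TT_prod_q power_int_mult_distrib)
 qed
 show "ch n (%p. xx p z) ~= 0" if "z \<in> W" for z
  using that L(1) TT_W W_nz finS by (auto simp: L(3))
qed

lemma char_distinct:
 assumes n: "n \<in> RR" and 1: "\<And>z. z \<in> W ==> ch n (%p. xx p z) = 1" and p: "p \<in> S"
 shows "n p = 0"
proof -
 from ch_xx[OF n] obtain L N where L: "N ~= 0" "\<forall>z\<in>W. ch n (%p. xx p z) = N * z powi L * (\<Prod>p\<in>S. TT p z powi n p)"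
  by (elim exE conjE)
 define a where "a = rp p"
 have a: "a ~= 0" using rp[OF p] by (simp add: a_def)
 obtain C where C: "C ~= 0" "((%z. (\<Prod>r\<in>S. TT r z powi n r) * (z - a) powi (- n p)) \<longlongrightarrow> C) (at a)"
  using TT_prod_order[OF p] by (auto simp: a_def)
 have "((%z. N * z powi L * ((\<Prod>r\<in>S. TT r z powi n r) * (z - a) powi (- n p))) \<longlongrightarrow> N * a powi L * C) (at a)"
  using a by (intro tendsto_intros C) auto
 moreover have "eventually (%z. N * z powi L * ((\<Prod>r\<in>S. TT r z powi n r) * (z - a) powi (- n p)) = (z - a) powi (- n p)) (at a)"
  using eventually_W[OF a]
 proof eventually_elim
  case (elim z)
  have "N * z powi L * ((\<Prod>r\<in>S. TT r z powi n r) * (z - a) powi (- n p))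
   = ch n (%p. xx p z) * (z - a) powi (- n p)" using L(2) elim by (simp add: mult.assoc)
  thus ?case using 1[OF elim] by simp
 qed
 ultimately have l: "((%z. (z - a) powi (- n p)) \<longlongrightarrow> N * a powi L * C) (at a)" by (rule Lim_transform_eventually)
 have nz: "N * a powi L * C ~= 0" using L(1) C(1) a by simp
 have lz: "((%z. (z - a) ^ Suc m) \<longlongrightarrow> 0) (at a)" for m
 proof -
  have "((%z. (z - a) ^ Suc m) \<longlongrightarrow> (a - a) ^ Suc m) (at a)" by (intro tendsto_intros)
  thus ?thesis by simp
 qed
 show ?thesis
 proof (rule ccontr)
  assume "n p ~= 0"
  then consider m where "- n p = int (Suc m)" | m where "n p = int (Suc m)"
   by (metis int_cases3 not0_implies_Suc of_nat_0 minus_equation_iff of_nat_0_less_iff less_irrefl)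
  thus False
  proof cases
   case 1
   hence "((%z. (z - a) powi (- n p)) \<longlongrightarrow> 0) (at a)" using lz[of m] by (simp only: power_int_of_nat)
   thus False using LIM_unique[OF l] nz by simp
  next
   case 2
   have "((%z. (z - a) powi (- n p) * (z - a) ^ Suc m) \<longlongrightarrow> N * a powi L * C * 0) (at a)"
    by (intro tendsto_mult l lz)
   moreover have "eventually (%z. (z - a) powi (- n p) * (z - a) ^ Suc m = 1) (at a)"
    using eventually_neq_at_within[of a a UNIV]
    unfolding 2 power_int_minus power_int_of_nat by eventually_elim (rule left_inverse, simp)
   ultimately have "((%z. 1) \<longlongrightarrow> N * a powi L * C * 0) (at a)" by (rule Lim_transform_eventually)
   thus False by (simp add: tendsto_const_iff)
  qed
 qed
qed

text \<open>Abel's theorem. Dividing \<open>f\<close> by the theta quotient with the same divisor leaves a holomorphic function without zeros on the punctured plane whose automorphy factor is a monomial, hence the function is a monomial; comparing factors shows that the divisor lies in \<open>RR\<close>.\<close>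
lemma EE_multiplicative:
 assumes f: "EE f" and nz: "\<And>z. z \<in> W ==> f z ~= 0" and fb: "f b = 1"
 shows "\<exists>n\<in>RR. \<forall>z\<in>W. f z = ch n (%p. xx p z)"
proof -
 define n where "n = restrict (%p. zorder f (rp p)) S"
 define h where "h z = f z * (\<Prod>p\<in>S. TT p z powi (- n p))" for z
 have hh: "h holomorphic_on W"
  unfolding h_def using TT_W W_nz f
  by (auto intro!: holomorphic_intros holomorphic_on_subset[OF TT_hol] simp: EE_def)
 have hnz: "h z ~= 0" if "z \<in> W" for z using nz that TT_W finS by (simp add: h_def)
 define c where "c = (\<Prod>p\<in>S. rp p powi n p) * (- q) powi (- (\<Sum>p\<in>S. n p))"
 define m where "m = - (\<Sum>p\<in>S. n p)"
 note rn = prod_powi_minus[of rp n S]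
 have hq: "h (q * z) = c * z powi m * h z + 0" if z: "z \<in> W" for z
 proof -
  have "f (q * z) = f z" using f z by (simp add: EE_def)
  thus ?thesis
   unfolding h_def TT_prod_q[OF z] rn power_int_mult_distrib[of "- q" z]
   by (simp add: c_def m_def sum_negf mult_ac)
 qed
 have c0: "c ~= 0" using rp finS by (simp add: c_def)
 have hl: "\<exists>C. C ~= 0 \<and> (h \<longlongrightarrow> C) (at (rp p))" if p: "p \<in> S" for p
 proof -
  define a where "a = rp p"
  have a: "a ~= 0" using rp[OF p] by (simp add: a_def)
  have "f meromorphic_on {a}" using f meromorphic_on_subset a by (auto simp: EE_def)
  hence "isolated_singularity_at f a" "not_essential f a" by (auto simp: meromorphic_at_iff)
  moreover have "\<exists>\<^sub>F w in at a. f w ~= 0"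
   by (rule eventually_frequently[OF at_neq_bot eventually_mono[OF eventually_W[OF a]]]) (rule nz)
  ultimately obtain r where r: "r > 0" "zor_poly f a a ~= 0" "zor_poly f a holomorphic_on cball a r"
   "\<And>w. w \<in> cball a r - {a} ==> f w = zor_poly f a w * (w - a) powi zorder f a"
   using zorder_exist by blast
  have "continuous_on (cball a r) (zor_poly f a)" using r(3) by (rule holomorphic_on_imp_continuous_on)
  hence "isCont (zor_poly f a) a" using r(1) by (intro continuous_on_interior[of "cball a r"]) auto
  hence g: "(zor_poly f a \<longlongrightarrow> zor_poly f a a) (at a)" by (rule isContD)
  obtain C where C: "C ~= 0" "((%z. (\<Prod>r\<in>S. TT r z powi (- n r)) * (z - a) powi (- (- n p))) \<longlongrightarrow> C) (at a)"
   using TT_prod_order[OF p, of "%r. - n r"] by (auto simp: a_def)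
  have "((%z. zor_poly f a z * ((\<Prod>r\<in>S. TT r z powi (- n r)) * (z - a) powi (- (- n p)))) \<longlongrightarrow> zor_poly f a a * C) (at a)"
   by (intro tendsto_mult g C)
  moreover have "eventually (%z. zor_poly f a z * ((\<Prod>r\<in>S. TT r z powi (- n r)) * (z - a) powi (- (- n p))) = h z) (at a)"
  proof -
   have "eventually (%w. w \<in> cball a r - {a}) (at a)"
    using r(1) unfolding eventually_at by (auto simp: dist_commute intro!: exI[of _ r])
   thus ?thesis
    by eventually_elim (use p in \<open>simp add: h_def r(4) n_def a_def[symmetric] mult_ac\<close>)
  qed
  ultimately have "(h \<longlongrightarrow> zor_poly f a a * C) (at a)" by (rule Lim_transform_eventually)
  thus ?thesis using r(2) C(1) by (intro exI[of _ "zor_poly f a a * C"]) (simp add: a_def)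
 qed
 have hl': "\<exists>C. (h \<longlongrightarrow> C) (at (rp p))" if "p \<in> S" for p using hl[OF that] by blast
 have ac: "continuous_on (- {0}) (%z. c * z powi m)" by (intro continuous_intros) auto
 have anz: "\<And>z. z ~= 0 ==> c * z powi m ~= 0" using c0 by simp
 have "\<exists>H. H holomorphic_on - {0} \<and> (\<forall>z\<in>W. H z = h z) \<and>
  (\<forall>z. z ~= 0 --> H (q * z) = c * z powi m * H z + 0) \<and> (\<forall>p\<in>S. (h \<longlongrightarrow> H (rp p)) (at (rp p)))"
  by (rule extend_over_punctures[OF hh ac continuous_on_const], erule anz, erule hq, erule hl')
 then obtain H where HH: "H holomorphic_on - {0} \<and> (\<forall>z\<in>W. H z = h z) \<and>
  (\<forall>z. z ~= 0 --> H (q * z) = c * z powi m * H z + 0) \<and> (\<forall>p\<in>S. (h \<longlongrightarrow> H (rp p)) (at (rp p)))"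
  by (elim exE)
 hence H: "H holomorphic_on - {0}" "\<And>z. z \<in> W ==> H z = h z"
  "\<And>p. p \<in> S ==> (h \<longlongrightarrow> H (rp p)) (at (rp p))" by blast+
 have Hq: "H (q * z) = c * z powi m * H z" if "z ~= 0" for z using HH that by simp
 have Hp: "H (rp p) ~= 0" if "p \<in> S" for p
  using hl[OF that] H(3)[OF that] LIM_unique by blast
 have Hnz: "H z ~= 0" if z: "z ~= 0" for z
 proof (cases "z \<in> W")
  case True
  thus ?thesis using H(2) hnz by simp
 next
  case False
  then obtain p where p: "p \<in> S" "z / rp p \<in> spiral" using z by (auto simp: W_iff)
  then obtain k where "z / rp p = q powi k" by (auto simp: spiral_def)
  hence ak: "z = q powi k * rp p" using rp[OF p(1)] by (simp add: field_simps)
  have "H (q powi k * rp p) ~= 0"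
  proof (induction k rule: int_induct[where k = 0])
   case base
   thus ?case using Hp[OF p(1)] by simp
  next
   case (step1 i)
   have e: "q powi (i + 1) * rp p = q * (q powi i * rp p)" by (simp add: power_int_add)
   show ?case unfolding e using step1 Hq[of "q powi i * rp p"] rp[OF p(1)] c0 by simp
  next
   case (step2 i)
   have e: "q powi i * rp p = q * (q powi (i - 1) * rp p)" by (simp add: power_int_diff)
   show ?case using step2(2) Hq[of "q powi (i - 1) * rp p"] rp[OF p(1)] unfolding e by auto
  qed
  thus ?thesis using ak by simp
 qed
 have "m = 0" by (rule multiplicative_automorphy_monomial(1)[OF H(1)], erule Hnz, erule Hq)
 hence m0: "(\<Sum>p\<in>S. n p) = 0" by (simp add: m_def)
 have "\<exists>C L. C ~= 0 \<and> c = q powi L \<and> (\<forall>z. z ~= 0 --> H z = C * z powi L)"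
  by (rule multiplicative_automorphy_monomial(2)[OF H(1)], erule Hnz, erule Hq)
 then obtain C L where C: "C ~= 0" "c = q powi L" "\<forall>z. z ~= 0 --> H z = C * z powi L" by blast
 have cr: "(\<Prod>p\<in>S. rp p powi n p) = q powi L" using C(2) by (simp add: c_def m0)
 have nR: "n \<in> RR" using m0 cr by (auto simp: RR_def n_def spiral_def)
 from ch_xx[OF nR] obtain L' N where N: "N ~= 0" "(\<Prod>p\<in>S. rp p powi n p) = q powi L'"
  "\<forall>z\<in>W. ch n (%p. xx p z) = N * z powi L' * (\<Prod>p\<in>S. TT p z powi n p)"
  by (elim exE conjE)
 have "q powi L = q powi L'" using cr N(2) by simp
 hence "ln (norm q powi L) = ln (norm q powi L')" by (metis norm_power_int)
 hence LL: "L = L'" using q by (simp add: ln_powi)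
 have fz: "f z = C / N * ch n (%p. xx p z)" if z: "z \<in> W" for z
 proof -
  have "h z = C * z powi L" using H(2)[OF z] C(3) W_nz[OF z] by simp
  hence "f z = C * z powi L * (\<Prod>p\<in>S. TT p z powi n p)"
   using TT_W[OF _ z] finS by (simp add: h_def prod_powi_minus field_simps)
  thus ?thesis using N(1) N(3) z by (simp add: LL)
 qed
 have "C / N = 1" using fz[OF b_W] fb xx_b[OF nR] by simp
 thus ?thesis using nR fz by (intro bexI[of _ n]) auto
qed

end

section \<open>Function algebras\<close>

lemma fun_algebra_uminus: "f \<in> fun_algebra X B ==> (%x. - f x) \<in> fun_algebra X B"
 using fun_algebra.mult[OF fun_algebra.const[of "-1"]] by fastforce

lemma fun_algebra_diff: "f \<in> fun_algebra X B ==> g \<in> fun_algebra X B ==> (%x. f x - g x) \<in> fun_algebra X B"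
 using fun_algebra.add[of f X B "%x. - g x"] fun_algebra_uminus[of g X B] by simp

lemma fun_algebra_sum: "(\<And>i. i \<in> I ==> f i \<in> fun_algebra X B) ==> (%x. \<Sum>i\<in>I. f i x) \<in> fun_algebra X B"
 by (induction I rule: infinite_finite_induct) (auto intro: fun_algebra.const fun_algebra.add)

lemma fun_algebra_prod: "(\<And>i. i \<in> I ==> f i \<in> fun_algebra X B) ==> (%x. \<Prod>i\<in>I. f i x) \<in> fun_algebra X B"
 by (induction I rule: infinite_finite_induct) (auto intro: fun_algebra.const fun_algebra.mult)

lemma fun_algebra_power: "f \<in> fun_algebra X B ==> (%x. f x ^ k) \<in> fun_algebra X B"
 by (induction k) (auto intro: fun_algebra.const fun_algebra.mult)

lemma fun_algebra_compose:
 assumes "f \<in> fun_algebra X B" "\<And>y. y \<in> Y ==> \<phi> y \<in> X" "\<And>g. g \<in> B ==> (%y. g (\<phi> y)) \<in> fun_algebra Y C"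
 shows "(%y. f (\<phi> y)) \<in> fun_algebra Y C"
 using assms(1)
proof induction
 case (gen f) thus ?case by (rule assms(3))
next
 case (const c) thus ?case by (rule fun_algebra.const)
next
 case (add f g) thus ?case by (intro fun_algebra.add)
next
 case (mult f g) thus ?case by (intro fun_algebra.mult)
next
 case (cong f g)
 show ?case by (rule fun_algebra.cong[OF cong(3)]) (use cong(2) assms(2) in blast)
qed

section \<open>Exponential polynomials\<close>

type_synonym addc = "complex set => nat => complex"

definition tadd :: "addc => addc => addc" where
 "tadd t v = (%p k. t p k + v p k)"

definition tscale :: "complex => addc => addc" where
 "tscale c v = (%p k. c * v p k)"

lemma tadd_assoc: "tadd (tadd t v) w = tadd t (tadd v w)"
 and tadd_commute: "tadd t v = tadd v t"
 and tadd_0 [simp]: "tadd t (%_ _. 0) = t" "tadd (%_ _. 0) t = t"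
 by (auto simp: tadd_def add_ac)

definition polyfun :: "complex set set => (addc => complex) set" where
 "polyfun S = fun_algebra UNIV {%t. t p k | p k. p \<in> S}"

text \<open>\<open>diff_deg d G\<close> says that all \<open>d\<close>-fold differences of \<open>G\<close> vanish.\<close>
primrec diff_deg :: "nat => (addc => complex) => bool" where
 "diff_deg 0 G = (\<forall>t. G t = 0)"
| "diff_deg (Suc d) G = (\<forall>v. diff_deg d (%t. G (tadd t v) - G t))"

lemma diff_deg_zero: "diff_deg d (%t. 0)"
 by (induction d) auto

lemma diff_deg_lin: "diff_deg d F ==> diff_deg d G ==> diff_deg d (%t. a * F t + b * G t)"
proof (induction d arbitrary: F G)
 case (Suc d)
 have "diff_deg d (%t. a * (F (tadd t v) - F t) + b * (G (tadd t v) - G t))" for v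
  using Suc by auto
 moreover have "(%t. a * (F (tadd t v) - F t) + b * (G (tadd t v) - G t))
  = (%t. a * F (tadd t v) + b * G (tadd t v) - (a * F t + b * G t))" for v
  by (auto simp: algebra_simps)
 ultimately show ?case by simp
qed auto

lemma diff_deg_shift: "diff_deg d F ==> diff_deg d (%t. F (tadd t w))"
proof (induction d arbitrary: F)
 case (Suc d)
 have "diff_deg d (%t. F (tadd (tadd t w) v) - F (tadd t w))" for v
  using Suc by auto
 thus ?case by (simp add: tadd_assoc tadd_commute[of w])
qed auto

lemma diff_deg_Suc: "diff_deg d F ==> diff_deg (Suc d) F"
 using diff_deg_lin[OF diff_deg_shift, of d F F 1 _ "-1"] by simp

lemma diff_deg_mono: "d \<le> e ==> diff_deg d F ==> diff_deg e F"
 by (induction e rule: dec_induct) (auto simp del: diff_deg.simps intro: diff_deg_Suc)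

lemma diff_deg_mult: "diff_deg (Suc d) F ==> diff_deg (Suc e) G ==> diff_deg (Suc (d + e)) (%t. F t * G t)"
proof (induction "d + e" arbitrary: d e F G rule: less_induct)
 case less
 have "diff_deg (d + e) (%t. F (tadd t v) * G (tadd t v) - F t * G t)" for v
 proof -
  have 1: "diff_deg (d + e) (%t. F (tadd t v) * (G (tadd t v) - G t))"
  proof (cases e)
   case 0
   hence "G (tadd t v) - G t = 0" for t using less(3) by simp
   thus ?thesis by (simp add: diff_deg_zero)
  next
   case (Suc e')
   have "diff_deg e (%t. G (tadd t v) - G t)" using less(3) by (simp only: diff_deg.simps)
   hence "diff_deg (Suc e') (%t. G (tadd t v) - G t)" unfolding Suc .
   from less(1)[OF _ diff_deg_shift[OF less(2)] this] Suc
   have "diff_deg (Suc (d + e')) (%t. F (tadd t v) * (G (tadd t v) - G t))" by simp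
   thus ?thesis using Suc by simp
  qed
  have 2: "diff_deg (d + e) (%t. (F (tadd t v) - F t) * G t)"
  proof (cases d)
   case 0
   hence "F (tadd t v) - F t = 0" for t using less(2) by simp
   thus ?thesis by (simp add: diff_deg_zero)
  next
   case (Suc d')
   have "diff_deg d (%t. F (tadd t v) - F t)" using less(2) by (simp only: diff_deg.simps)
   hence "diff_deg (Suc d') (%t. F (tadd t v) - F t)" unfolding Suc .
   from less(1)[OF _ this less(3)] Suc
   have "diff_deg (Suc (d' + e)) (%t. (F (tadd t v) - F t) * G t)" by simp
   thus ?thesis using Suc by simp
  qed
  show ?thesis using diff_deg_lin[OF 1 2, of 1 1] by (simp add: algebra_simps)
 qed
 thus ?case by simp
qed

lemma polyfun_diff_deg: "G \<in> polyfun S ==> \<exists>d. diff_deg (Suc d) G"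
 unfolding polyfun_def
proof (induction rule: fun_algebra.induct)
 case (gen f)
 hence "diff_deg (Suc 1) f" by (auto simp: tadd_def)
 thus ?case by blast
next
 case (const c)
 have "diff_deg (Suc 0) (%_. c)" by simp
 thus ?case by blast
next
 case (add f g)
 then obtain d e where "diff_deg (Suc d) f" "diff_deg (Suc e) g" by blast
 hence "diff_deg (Suc (max d e)) f" "diff_deg (Suc (max d e)) g"
  using diff_deg_mono[of "Suc d" "Suc (max d e)" f] diff_deg_mono[of "Suc e" "Suc (max d e)" g]
  by (auto simp del: diff_deg.simps)
 from diff_deg_lin[OF this, of 1 1] show ?case by (auto simp del: diff_deg.simps)
next
 case (mult f g)
 thus ?case using diff_deg_mult by blast
next
 case (cong f g)
 hence "g = f" by auto
 thus ?case using cong by simp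
qed

lemma polyfun_shift:
 assumes "G \<in> polyfun S"
 shows "(%t. G (tadd t v)) \<in> polyfun S"
 unfolding polyfun_def
proof (rule fun_algebra_compose[OF assms[unfolded polyfun_def]])
 fix g :: "addc => complex" assume "g \<in> {%t. t p k |p k. p \<in> S}"
 then obtain p k where "g = (%t. t p k)" "p \<in> S" by blast
 thus "(%y. g (tadd y v)) \<in> fun_algebra UNIV {%t. t p k |p k. p \<in> S}"
  unfolding tadd_def by (simp only:, intro fun_algebra.add[OF fun_algebra.gen fun_algebra.const]) blast
qed auto

lemma polyfun_finite_support:
 "G \<in> polyfun S ==> \<exists>I. finite I \<and> I \<subseteq> S \<times> UNIV \<and> (\<forall>t t'. (\<forall>(p,k)\<in>I. t p k = t' p k) --> G t = G t')"
 unfolding polyfun_def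
proof (induction rule: fun_algebra.induct)
 case (gen f)
 then obtain p k where "f = (%t. t p k)" "p \<in> S" by blast
 thus ?case by (intro exI[of _ "{(p,k)}"]) auto
next
 case (const c)
 thus ?case by (intro exI[of _ "{}"]) auto
next
 case (add f g)
 then obtain I J where I: "finite I" "I \<subseteq> S \<times> UNIV" "\<forall>t t'. (\<forall>(p,k)\<in>I. t p k = t' p k) --> f t = f t'"
  and J: "finite J" "J \<subseteq> S \<times> UNIV" "\<forall>t t'. (\<forall>(p,k)\<in>J. t p k = t' p k) --> g t = g t'" by blast
 have "f t + g t = f t' + g t'" if "\<forall>(p,k)\<in>I \<union> J. t p k = t' p k" for t t'
  using I(3)[rule_format, of t t'] J(3)[rule_format, of t t'] that by auto
 thus ?case using I(1,2) J(1,2) by (intro exI[of _ "I \<union> J"]) blast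
next
 case (mult f g)
 then obtain I J where I: "finite I" "I \<subseteq> S \<times> UNIV" "\<forall>t t'. (\<forall>(p,k)\<in>I. t p k = t' p k) --> f t = f t'"
  and J: "finite J" "J \<subseteq> S \<times> UNIV" "\<forall>t t'. (\<forall>(p,k)\<in>J. t p k = t' p k) --> g t = g t'" by blast
 have "f t * g t = f t' * g t'" if "\<forall>(p,k)\<in>I \<union> J. t p k = t' p k" for t t'
  using I(3)[rule_format, of t t'] J(3)[rule_format, of t t'] that by auto
 thus ?case using I(1,2) J(1,2) by (intro exI[of _ "I \<union> J"]) blast
next
 case (cong f g)
 hence "g = f" by auto
 thus ?case using cong by simp
qed

lemma polyfun_line:
 "G \<in> polyfun S ==> \<exists>P. \<forall>s. G (tadd t (tscale s v)) = poly P s"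
 unfolding polyfun_def
proof (induction rule: fun_algebra.induct)
 case (gen f)
 then obtain p k where "f = (%t. t p k)" by blast
 thus ?case by (intro exI[of _ "[:t p k, v p k:]"]) (auto simp: tadd_def tscale_def)
next
 case (const c)
 thus ?case by (intro exI[of _ "[:c:]"]) auto
next
 case (add f g)
 then obtain P Q where "\<forall>s. f (tadd t (tscale s v)) = poly P s" "\<forall>s. g (tadd t (tscale s v)) = poly Q s" by blast
 thus ?case by (intro exI[of _ "P + Q"]) auto
next
 case (mult f g)
 then obtain P Q where "\<forall>s. f (tadd t (tscale s v)) = poly P s" "\<forall>s. g (tadd t (tscale s v)) = poly Q s" by blast
 thus ?case by (intro exI[of _ "P * Q"]) auto
next
 case (cong f g)
 hence "g = f" by auto
 thus ?case using cong by simp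
qed

lemma eigenfunction_zero:
 "diff_deg d G ==> (\<And>t. G (tadd t v) = c * G t) ==> c ~= 1 ==> G t = 0"
proof (induction d arbitrary: G t)
 case (Suc d)
 define F where "F t = G (tadd t v) - G t" for t
 have F: "F t = (c - 1) * G t" for t using Suc(3) by (simp add: F_def algebra_simps)
 have "F t = 0" for t
 proof (rule Suc.IH[of F t])
  show "diff_deg d F" using Suc(2) by (simp add: F_def[abs_def])
  show "F (tadd t v) = c * F t" for t unfolding F using Suc(3) by simp
 qed (rule Suc(4))
 thus ?case using F Suc(4) by simp
qed auto

context punctures
begin

definition eps :: "complex => addc" where
 "eps z = (%p k. ee p k z)"

text \<open>The monoid generated by the images of points of \<open>W\<close>, in coordinates.\<close>
inductive_set albanese_monoid :: "((complex set => complex) \<times> addc) set" where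
 one: "(%_. 1, %_ _. 0) \<in> albanese_monoid"
| step: "(x, t) \<in> albanese_monoid ==> z \<in> W ==> (%p. x p * xx p z, tadd t (eps z)) \<in> albanese_monoid"

text \<open>Invariance under one translation implies invariance along the line that it spans, because a polynomial in one variable that takes a value infinitely often is constant. The vectors \<open>eps z\<close> span all finite sets of coordinates by independence of the \<open>ee p k\<close>.\<close>
lemma polyfun_invariant_const:
 assumes G: "G \<in> polyfun S" and inv: "\<And>t z. z \<in> W ==> G (tadd t (eps z)) = G t"
 shows "G t = G (%_ _. 0)"
proof -
 have line: "G (tadd t (tscale s (eps z))) = G t" if z: "z \<in> W" for t s z
 proof -
  obtain P where P: "\<And>s. G (tadd t (tscale s (eps z))) = poly P s" using polyfun_line[OF G] by blast
  have N: "G (tadd t (tscale (of_nat k) (eps z))) = G t" for k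
  proof (induction k)
   case 0
   thus ?case by (simp add: tscale_def)
  next
   case (Suc k)
   have "tadd t (tscale (of_nat (Suc k)) (eps z)) = tadd (tadd t (tscale (of_nat k) (eps z))) (eps z)"
    by (auto simp: tadd_def tscale_def algebra_simps)
   thus ?case using inv[OF z] Suc by simp
  qed
  have "P - [:G t:] = 0"
  proof (rule ccontr)
   assume "P - [:G t:] ~= 0"
   hence "finite {s. poly (P - [:G t:]) s = 0}" by (rule poly_roots_finite)
   moreover have "range of_nat \<subseteq> {s. poly (P - [:G t:]) s = 0}" using N P by auto
   ultimately have "finite (range (of_nat :: nat => complex))" using finite_subset by blast
   moreover have "infinite (range (of_nat :: nat => complex))" by (rule range_inj_infinite) (simp add: inj_on_def)
   ultimately show False by blast
  qed
  hence "P = [:G t:]" by simp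
  thus ?thesis using P by simp
 qed
 from polyfun_finite_support[OF G] obtain I where I: "finite I" "I \<subseteq> S \<times> UNIV"
  "\<forall>t t'. (\<forall>(p,k)\<in>I. t p k = t' p k) --> G t = G t'"
  by (elim exE conjE)
 have "\<exists>(m::nat) w b. (\<forall>k<m. w k \<in> W) \<and>
  (\<forall>i\<in>I. \<forall>j\<in>I. (\<Sum>k<m. b k j * ee (fst i) (snd i) (w k)) = (if i = j then 1 else 0))"
 proof (rule dual_points[where g = "%i z. ee (fst i) (snd i) z"])
  fix c assume h: "\<And>z. z \<in> W ==> (\<Sum>i\<in>I. c i * ee (fst i) (snd i) z) = 0"
  show "\<forall>i\<in>I. c i = 0"
  proof (rule ee_independent[OF I(1,2)])
   fix z assume "z \<in> W"
   from h[OF this] show "(\<Sum>(p,k)\<in>I. c (p,k) * ee p k z) = 0" by (simp only: case_prod_unfold prod.collapse)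
  qed
 qed (rule I(1))
 then obtain m :: nat and w b where w0: "\<forall>k<m. w k \<in> W" and
  b: "\<forall>i\<in>I. \<forall>j\<in>I. (\<Sum>k<m. b k j * ee (fst i) (snd i) (w k)) = (if i = j then 1 else 0)"
  by (elim exE conjE)
 define s where "s k = (\<Sum>j\<in>I. - t (fst j) (snd j) * b k j)" for k
 have it: "n \<le> m ==> G (tadd t (%p k. \<Sum>i<n. s i * eps (w i) p k)) = G t" for n
 proof (induction n)
  case (Suc n)
  have e: "tadd t (%p k. \<Sum>i<Suc n. s i * eps (w i) p k) = tadd (tadd t (%p k. \<Sum>i<n. s i * eps (w i) p k)) (tscale (s n) (eps (w n)))"
   unfolding tadd_def tscale_def by (intro ext) simp
  have wn: "w n \<in> W" using w0 Suc(2) by simp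
  have "G (tadd (tadd t (%p k. \<Sum>i<n. s i * eps (w i) p k)) (tscale (s n) (eps (w n))))
    = G (tadd t (%p k. \<Sum>i<n. s i * eps (w i) p k))" by (rule line[OF wn])
  also have "... = G t" by (rule Suc.IH) (use Suc(2) in simp)
  finally show ?case unfolding e .
 qed simp
 have "tadd t (%p k. \<Sum>i<m. s i * eps (w i) p k) p k = 0" if pk: "(p,k) \<in> I" for p k
 proof -
  have "(\<Sum>i<m. s i * eps (w i) p k) = (\<Sum>i<m. \<Sum>j\<in>I. - t (fst j) (snd j) * (b i j * ee p k (w i)))"
   unfolding s_def eps_def sum_distrib_right by (simp add: mult.assoc)
  also have "... = (\<Sum>j\<in>I. - t (fst j) (snd j) * (\<Sum>i<m. b i j * ee p k (w i)))"
   by (subst sum.swap) (simp only: sum_distrib_left)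
  also have "... = (\<Sum>j\<in>I. if (p,k) = j then - t (fst j) (snd j) else 0)"
  proof (intro sum.cong refl)
   fix j assume "j \<in> I"
   hence "(\<Sum>i<m. b i j * ee p k (w i)) = (if (p,k) = j then 1 else 0)"
    using b[rule_format, OF pk] by simp
   thus "- t (fst j) (snd j) * (\<Sum>i<m. b i j * ee p k (w i)) = (if (p,k) = j then - t (fst j) (snd j) else 0)"
    by simp
  qed
  also have "... = - t p k" using I(1) pk by simp
  finally show ?thesis by (simp add: tadd_def)
 qed
 hence "G (tadd t (%p k. \<Sum>i<m. s i * eps (w i) p k)) = G (%_ _. 0)"
  by (intro I(3)[rule_format]) auto
 thus ?thesis using it[of m] by simp
qed

lemma RR_diff: "n \<in> RR ==> m \<in> RR ==> (\<lambda>p\<in>S. n p - m p) \<in> RR"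
proof -
 assume n: "n \<in> RR" "m \<in> RR"
 have "(\<Prod>p\<in>S. rp p powi (n p - m p)) = (\<Prod>p\<in>S. rp p powi n p) * inverse (\<Prod>p\<in>S. rp p powi m p)"
  using rp by (simp add: power_int_diff prod.distrib divide_inverse prod_inversef[symmetric])
 thus ?thesis using n spiral_mult spiral_inverse by (auto simp: RR_def sum_subtractf)
qed

lemma ch_diff:
 assumes "\<And>p. p \<in> S ==> x p ~= 0"
 shows "ch (\<lambda>p\<in>S. n p - m p) x = ch n x / ch m x"
proof -
 have "ch (\<lambda>p\<in>S. n p - m p) x = (\<Prod>p\<in>S. x p powi n p / x p powi m p)"
  unfolding ch_def by (intro prod.cong refl) (simp add: power_int_diff assms)
 thus ?thesis by (simp add: ch_def prod_dividef)
qed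

lemma xx_nz: "p \<in> S ==> z \<in> W ==> xx p z ~= 0"
proof -
 assume p: "p \<in> S" and z: "z \<in> W"
 have "th q (z / rp p) ~= 0" "th q (rp p / (q * z)) ~= 0" using TT_W[OF p z] by (auto simp: TT_def)
 moreover have "xxN p ~= 0" using TT_W[OF p b_W] by (simp add: xxN_def)
 ultimately show ?thesis by (simp add: xx_def xx0_def xxI_def)
qed

lemma ch_nz: "(\<And>p. p \<in> S ==> x p ~= 0) ==> ch n x ~= 0"
 using finS by (simp add: ch_def)

lemma char_separates:
 assumes "n \<in> RR" "m \<in> RR" "n ~= m"
 shows "\<exists>z\<in>W. ch n (%p. xx p z) ~= ch m (%p. xx p z)"
proof (rule ccontr)
 assume no: "\<not> ?thesis"
 have "ch (\<lambda>p\<in>S. n p - m p) (%p. xx p z) = 1" if "z \<in> W" for z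
  using no that ch_nz[of "%p. xx p z" m] xx_nz by (simp add: ch_diff)
 from char_distinct[OF RR_diff[OF assms(1,2)] this] have "n p = m p" if "p \<in> S" for p using that by auto
 moreover have "n \<in> S \<rightarrow>\<^sub>E UNIV" "m \<in> S \<rightarrow>\<^sub>E UNIV" using assms by (auto simp: RR_def)
 ultimately have "n = m" by (intro PiE_ext) auto
 thus False using assms by simp
qed

text \<open>The twisted difference along \<open>z\<close> kills one exponential after finitely many steps and acts injectively on the polynomials attached to the others, as \<open>char_separates\<close> provides a \<open>z\<close> at which two characters differ.\<close>
lemma exponential_polynomial_zero:
 assumes J: "finite J" "J \<subseteq> RR" and G: "\<And>n. n \<in> J ==> G n \<in> polyfun S"
  and van: "\<And>x t. (x,t) \<in> albanese_monoid ==> (\<Sum>n\<in>J. ch n x * G n t) = 0"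
 shows "\<forall>n\<in>J. \<forall>t. G n t = 0"
proof -
 have gen: "\<forall>n\<in>J. \<forall>t. G n t = 0" if "\<And>n. n \<in> J ==> G n \<in> polyfun S" "\<And>n. n \<in> J ==> diff_deg (d n) (G n)"
  "\<And>x t. (x,t) \<in> albanese_monoid ==> (\<Sum>n\<in>J. ch n x * G n t) = 0" for G d
  using that
 proof (induction "\<Sum>n\<in>J. d n" arbitrary: G d rule: less_induct)
  case less
  show ?case
  proof (cases "\<exists>m\<in>J. d m ~= 0")
   case False
   hence "diff_deg 0 (G n)" if "n \<in> J" for n using less(3)[OF that] that by auto
   thus ?thesis by simp
  next
   case True
   then obtain m d' where m: "m \<in> J" "d m = Suc d'" by (auto simp: gr0_conv_Suc)
   have G': "ch n (%p. xx p z) / ch m (%p. xx p z) * G n (tadd t (eps z)) - G n t = 0"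
    if z: "z \<in> W" and n: "n \<in> J" for z n t
   proof -
    define c where "c n = ch n (%p. xx p z)" for n
    have cm: "c m ~= 0" unfolding c_def using xx_nz z by (intro ch_nz)
    define H where "H n t = c n / c m * G n (tadd t (eps z)) - G n t" for n t
    define e where "e n = (if n = m then d' else d n)" for n
    have "\<forall>n\<in>J. \<forall>t. H n t = 0"
    proof (rule less(1)[of e])
     show "(\<Sum>n\<in>J. e n) < (\<Sum>n\<in>J. d n)"
      using J(1) m by (intro sum_strict_mono_ex1) (auto simp: e_def)
     show "H n \<in> polyfun S" if "n \<in> J" for n
      unfolding H_def[abs_def] polyfun_def
      by (intro fun_algebra_diff fun_algebra.mult fun_algebra.const)
       (use polyfun_shift[OF less(2)[OF that]] less(2)[OF that] in \<open>simp_all add: polyfun_def\<close>)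
     show "diff_deg (e n) (H n)" if "n \<in> J" for n
     proof (cases "n = m")
      case True
      have "diff_deg (Suc d') (G m)" using less(3)[OF m(1)] unfolding m(2) .
      hence "diff_deg d' (%t. G m (tadd t (eps z)) - G m t)" by (simp only: diff_deg.simps)
      moreover have "H n = (%t. G m (tadd t (eps z)) - G m t)" using True cm by (simp add: H_def[abs_def])
      ultimately show ?thesis using True by (simp add: e_def)
     next
      case False
      have "H n = (%t. c n / c m * G n (tadd t (eps z)) + - 1 * G n t)" by (simp add: H_def[abs_def])
      moreover have "diff_deg (d n) (%t. c n / c m * G n (tadd t (eps z)) + - 1 * G n t)"
       by (intro diff_deg_lin diff_deg_shift less(3) that)
      ultimately show ?thesis using False by (simp only: e_def if_False)
     qed
     fix x t assume xt: "(x,t) \<in> albanese_monoid"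
     have "(\<Sum>n\<in>J. ch n (%p. x p * xx p z) * G n (tadd t (eps z))) = 0"
      by (rule less(4)[OF albanese_monoid.step[OF xt z]])
     hence z1: "(\<Sum>n\<in>J. ch n x * (c n * G n (tadd t (eps z)))) = 0"
      by (simp only: ch_mult c_def mult.assoc)
     have "(\<Sum>n\<in>J. ch n x * H n t) = (\<Sum>n\<in>J. ch n x * (c n * G n (tadd t (eps z))) / c m - ch n x * G n t)"
      by (intro sum.cong refl) (simp add: H_def right_diff_distrib)
     also have "... = (\<Sum>n\<in>J. ch n x * (c n * G n (tadd t (eps z)))) / c m - (\<Sum>n\<in>J. ch n x * G n t)"
      by (simp only: sum_subtractf sum_divide_distrib)
     finally show "(\<Sum>n\<in>J. ch n x * H n t) = 0" using less(4)[OF xt] z1 by simp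
    qed
    hence "H n t = 0" using n by blast
    thus ?thesis by (simp add: H_def c_def)
   qed
   have others: "G n t = 0" if n: "n \<in> J" "n ~= m" for n t
   proof -
    have "n \<in> RR" "m \<in> RR" using n m(1) J by auto
    from char_separates[OF this n(2)]
    obtain z where z: "z \<in> W" "ch n (%p. xx p z) ~= ch m (%p. xx p z)" by (elim bexE)
    define c where "c n = ch n (%p. xx p z)" for n
    have c: "c n ~= 0" for n unfolding c_def using xx_nz z(1) by (intro ch_nz)
    have e: "G n (tadd t (eps z)) = c m / c n * G n t" for t
    proof -
     have "c n / c m * G n (tadd t (eps z)) = G n t" using G'[OF z(1) n(1), of t] by (simp add: c_def)
     hence "c m / c n * G n t = c m / c n * (c n / c m * G n (tadd t (eps z)))" by simp
     thus ?thesis using c[of n] c[of m] by simp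
    qed
    have "c m / c n ~= 1" using z(2) c[of n] by (simp add: c_def)
    with e show ?thesis by (rule eigenfunction_zero[OF less(3)[OF n(1)]])
   qed
   have inv: "G m (tadd t (eps z)) = G m t" if "z \<in> W" for t z
   proof -
    have "ch m (%p. xx p z) ~= 0" using xx_nz that by (intro ch_nz)
    thus ?thesis using G'[OF that m(1), of t] by simp
   qed
   have "(\<Sum>n\<in>J. ch n (%_. 1) * G n (%_ _. 0)) = 0" by (rule less(4)[OF albanese_monoid.one])
   also have "(\<Sum>n\<in>J. ch n (%_. 1) * G n (%_ _. 0)) = (\<Sum>n\<in>J. if n = m then G m (%_ _. 0) else 0)"
    using others by (intro sum.cong refl) (auto simp: ch_def)
   also have "... = G m (%_ _. 0)" using J(1) m(1) by simp
   finally have G0: "G m (%_ _. 0) = 0" .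
   have "G m t = 0" for t
   proof -
    have "G m t = G m (%_ _. 0)" by (rule polyfun_invariant_const[OF less(2)[OF m(1)]]) (rule inv)
    with G0 show ?thesis by simp
   qed
   hence "G n t = 0" if "n \<in> J" for n t using others[of n t] that by (cases "n = m") auto
   thus ?thesis by blast
  qed
 qed
 have "\<forall>n\<in>J. \<exists>d. diff_deg (Suc d) (G n)" using polyfun_diff_deg[OF G] by blast
 from bchoice[OF this] obtain d where d: "\<forall>n\<in>J. diff_deg (Suc (d n)) (G n)" by (elim exE)
 show ?thesis
 proof (rule gen[of G "%n. Suc (d n)"])
  fix n assume "n \<in> J"
  thus "G n \<in> polyfun S" "diff_deg (Suc (d n)) (G n)" using G d by blast+
 qed (rule van)
qed

end

section \<open>Coordinates on the group\<close>

lemma with_regular_simps [simp]: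
 "carrier (with_regular G R) = carrier G" "monoid.mult (with_regular G R) = monoid.mult G"
 "one (with_regular G R) = one G" "reg_funs (with_regular G R) = R"
 by (simp_all add: with_regular_def monoid.defs alg_group.defs)

lemma comm_group_with_regular:
 assumes "comm_group G"
 shows "comm_group (with_regular G R)"
proof -
 interpret comm_group G by (rule assms)
 show ?thesis
 proof (rule comm_groupI)
  fix x assume "x \<in> carrier (with_regular G R)"
  thus "\<exists>y\<in>carrier (with_regular G R). y \<otimes>\<^bsub>with_regular G R\<^esub> x = \<one>\<^bsub>with_regular G R\<^esub>"
   by (intro bexI[of _ "inv\<^bsub>G\<^esub> x"]) auto
 qed (auto simp: m_ac)
qed

lemma with_regular_r_coset [simp]: "N #>\<^bsub>with_regular G R\<^esub> x = N #>\<^bsub>G\<^esub> x"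
 by (simp add: r_coset_def)

lemma with_regular_FactGroup [simp]: "with_regular G R Mod N = G Mod N"
 by (simp add: FactGroup_def RCOSETS_def set_mult_def[abs_def] r_coset_def)

lemma alg_quotient_simps:
 "carrier (alg_quotient G N) = (%x. N #>\<^bsub>G\<^esub> x) ` carrier G"
 "reg_funs (alg_quotient G N) = {f. (%x. f (N #>\<^bsub>G\<^esub> x)) \<in> reg_funs G}"
 "\<one>\<^bsub>alg_quotient G N\<^esub> = N"
 by (auto simp: alg_quotient_def FactGroup_def RCOSETS_def)

lemma alg_quotient_mult:
 "N \<lhd> G ==> x \<in> carrier G ==> y \<in> carrier G ==>
  (N #>\<^bsub>G\<^esub> x) \<otimes>\<^bsub>alg_quotient G N\<^esub> (N #>\<^bsub>G\<^esub> y) = N #>\<^bsub>G\<^esub> (x \<otimes>\<^bsub>G\<^esub> y)"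
 by (simp add: alg_quotient_def FactGroup_def normal.rcos_sum)

lemma alg_quotient_comm: "comm_group G ==> subgroup N G ==> comm_group (alg_quotient G N)"
 unfolding alg_quotient_def by (intro comm_group_with_regular comm_group.abelian_FactGroup)

lemma Gm_simps [simp]:
 "carrier Gm = - {0}" "x \<otimes>\<^bsub>Gm\<^esub> y = x * y" "\<one>\<^bsub>Gm\<^esub> = 1"
 "reg_funs Gm = fun_algebra (- {0}) {%x. x, %x. inverse x}"
 by (simp_all add: Gm_def Cstar_simps)

lemma Gm_pow_simps:
 "carrier (Gm_pow S) = S \<rightarrow>\<^sub>E - {0}" "x \<otimes>\<^bsub>Gm_pow S\<^esub> y = (\<lambda>p\<in>S. x p * y p)"
 "\<one>\<^bsub>Gm_pow S\<^esub> = (\<lambda>p\<in>S. 1)"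
 "reg_funs (Gm_pow S) = fun_algebra (S \<rightarrow>\<^sub>E - {0}) {%x. f (x i) | i f. i \<in> S \<and> f \<in> reg_funs Gm}"
 by (simp_all add: Gm_pow_def alg_product_def product_group_def)

lemma Gm_pow_comm: "comm_group (Gm_pow S)"
proof (rule comm_groupI)
 fix x assume x: "x \<in> carrier (Gm_pow S)"
 show "\<exists>y\<in>carrier (Gm_pow S). y \<otimes>\<^bsub>Gm_pow S\<^esub> x = \<one>\<^bsub>Gm_pow S\<^esub>"
  by (rule bexI[of _ "\<lambda>p\<in>S. inverse (x p)"]) (use x in \<open>auto simp: Gm_pow_simps PiE_iff intro!: restrict_ext\<close>)
 show "\<one>\<^bsub>Gm_pow S\<^esub> \<otimes>\<^bsub>Gm_pow S\<^esub> x = x"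
  using x by (auto simp: Gm_pow_simps PiE_iff extensional_def restrict_def fun_eq_iff)
qed (auto simp: Gm_pow_simps PiE_iff mult_ac intro!: restrict_ext)

lemma Gm_pow_inv: "x \<in> carrier (Gm_pow S) ==> inv\<^bsub>Gm_pow S\<^esub> x = (\<lambda>p\<in>S. inverse (x p))"
 using comm_group.axioms(2)[OF Gm_pow_comm]
 by (intro group.inv_equality) (auto simp: Gm_pow_simps PiE_iff intro!: restrict_ext)

lemma diagonal_subgroup: "subgroup (diagonal S) (Gm_pow S)"
proof (rule group.subgroupI)
 show "Group.group (Gm_pow S)" by (rule comm_group.axioms(2)[OF Gm_pow_comm])
 show "diagonal S \<subseteq> carrier (Gm_pow S)" by (auto simp: diagonal_def Gm_pow_simps)
 show "diagonal S ~= {}" by (auto simp: diagonal_def intro: exI[of _ 1])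
 fix a assume "a \<in> diagonal S"
 then obtain x where x: "x ~= 0" "a = (\<lambda>p\<in>S. x)" by (auto simp: diagonal_def)
 hence "a \<in> carrier (Gm_pow S)" by (auto simp: Gm_pow_simps)
 hence "inv\<^bsub>Gm_pow S\<^esub> a = (\<lambda>p\<in>S. inverse x)" using x by (auto simp: Gm_pow_inv intro!: restrict_ext)
 thus "inv\<^bsub>Gm_pow S\<^esub> a \<in> diagonal S" using x by (auto simp: diagonal_def)
 fix b assume "b \<in> diagonal S"
 then obtain y where y: "y ~= 0" "b = (\<lambda>p\<in>S. y)" by (auto simp: diagonal_def)
 have "a \<otimes>\<^bsub>Gm_pow S\<^esub> b = (\<lambda>p\<in>S. x * y)" using x y by (auto simp: Gm_pow_simps intro!: restrict_ext)
 thus "a \<otimes>\<^bsub>Gm_pow S\<^esub> b \<in> diagonal S" using x y by (auto simp: diagonal_def)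
qed

lemma L_s_comm: "comm_group (L_s S)"
 unfolding L_s_def by (intro alg_quotient_comm Gm_pow_comm diagonal_subgroup)

fun ucoef :: "(nat => complex) => nat => complex" where
 "ucoef s 0 = 1"
| "ucoef s (Suc n) = (\<Sum>i\<in>{0..n}. ucoef s i * s (n - i)) / of_nat (Suc n)"

text \<open>The series with constant term 1 and logarithmic derivative \<open>\<Sum> s k X ^ k\<close>.\<close>
text \<open>Via the logarithmic derivative the multiplicative group \<open>1 + X C[[X]]\<close> becomes the additive group of sequences; both directions are polynomial in finitely many coefficients.\<close>
definition uf :: "(nat => complex) => complex fps" where
 "uf s = Abs_fps (ucoef s)"

lemma uf_nth [simp]: "fps_nth (uf s) n = ucoef s n"
 by (simp add: uf_def)

lemma uf_deriv: "fps_deriv (uf s) = uf s * Abs_fps s"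
 by (rule fps_ext) (simp add: fps_mult_nth del: of_nat_Suc)

lemma uf_unique:
 assumes "fps_nth u 0 = 1" "fps_deriv u = u * Abs_fps s"
 shows "u = uf s"
proof (rule fps_ext)
 fix n show "fps_nth u n = fps_nth (uf s) n"
 proof (induction n rule: less_induct)
  case (less n)
  show ?case
  proof (cases n)
   case (Suc m)
   have "of_nat (Suc m) * fps_nth u (Suc m) = (\<Sum>i=0..m. fps_nth u i * s (m - i))"
    using arg_cong[OF assms(2), of "%f. fps_nth f m"] by (simp add: fps_mult_nth del: of_nat_Suc)
   also have "... = (\<Sum>i=0..m. ucoef s i * s (m - i))"
    using less Suc by (intro sum.cong) auto
   finally have "fps_nth u (Suc m) = (\<Sum>i=0..m. ucoef s i * s (m - i)) / of_nat (Suc m)"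
    by (simp add: eq_divide_eq mult.commute del: of_nat_Suc)
   thus ?thesis using Suc by simp
  qed (use assms in simp)
 qed
qed

lemma uf_add: "uf (%k. s k + s' k) = uf s * uf s'"
proof (rule uf_unique[symmetric])
 have "Abs_fps (%k. s k + s' k) = Abs_fps s + Abs_fps s'" by (simp add: fps_eq_iff)
 thus "fps_deriv (uf s * uf s') = uf s * uf s' * Abs_fps (%k. s k + s' k)"
  by (simp add: uf_deriv algebra_simps)
qed simp

definition lc :: "nat => complex fps => complex" where
 "lc k u = fps_nth (fps_deriv u * inverse u) k"

lemma lc_uf: "lc k (uf s) = s k"
proof -
 have "uf s * inverse (uf s) = 1" using inverse_mult_eq_1'[of "uf s"] by simp
 hence "fps_deriv (uf s) * inverse (uf s) = Abs_fps s"
  by (simp add: uf_deriv mult_ac)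
 thus ?thesis by (simp add: lc_def)
qed

lemma uf_lc: "fps_nth u 0 = 1 ==> u = uf (%k. lc k u)"
proof (rule uf_unique)
 assume u: "fps_nth u 0 = 1"
 have "Abs_fps (%k. lc k u) = fps_deriv u * inverse u" by (simp add: lc_def fps_eq_iff)
 moreover have "u * inverse u = 1" using inverse_mult_eq_1'[of u] u by simp
 ultimately show "fps_deriv u = u * Abs_fps (%k. lc k u)"
  by (simp add: mult_ac)
qed

lemma one_units_simps [simp]:
 "carrier one_units = {f. fps_nth f 0 = 1}" "f \<otimes>\<^bsub>one_units\<^esub> g = f * g" "\<one>\<^bsub>one_units\<^esub> = 1"
 "reg_funs one_units = fun_algebra {f. fps_nth f 0 = 1} (range (%n f. fps_nth f n))"
 by (simp_all add: one_units_def)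

lemma lc_regular: "lc k \<in> fun_algebra {f. fps_nth f 0 = 1} (range (%n f. fps_nth f n))"
proof (induction k rule: less_induct)
 case (less k)
 let ?A = "fun_algebra {f. fps_nth f 0 = (1::complex)} (range (%n f. fps_nth f n))"
 have nth: "(%f. fps_nth f n) \<in> ?A" for n by (rule fun_algebra.gen) blast
 have "(%u. of_nat (Suc k) * fps_nth u (Suc k) - (\<Sum>j<k. fps_nth u (k - j) * lc j u)) \<in> ?A"
  by (intro fun_algebra_diff fun_algebra_sum fun_algebra.mult fun_algebra.const nth) (use less in simp)
 moreover have "lc k u = of_nat (Suc k) * fps_nth u (Suc k) - (\<Sum>j<k. fps_nth u (k - j) * lc j u)"
  if u: "fps_nth u 0 = 1" for u
 proof -
  have "fps_deriv u = u * Abs_fps (%k. lc k u)" using uf_deriv uf_lc[OF u] by metis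
  hence "of_nat (Suc k) * fps_nth u (Suc k) = fps_nth (Abs_fps (%k. lc k u) * u) k"
   by (metis Suc_eq_plus1 fps_deriv_nth mult.commute)
  also have "... = (\<Sum>j=0..k. lc j u * fps_nth u (k - j))" by (simp add: fps_mult_nth)
  also have "{0..k} = insert k {..<k}" by auto
  also have "(\<Sum>j\<in>insert k {..<k}. lc j u * fps_nth u (k - j)) = lc k u + (\<Sum>j<k. fps_nth u (k - j) * lc j u)"
   using u by (simp add: mult.commute)
  finally show ?thesis by simp
 qed
 hence "\<forall>u\<in>{f. fps_nth f 0 = 1}. lc k u = of_nat (Suc k) * fps_nth u (Suc k) - (\<Sum>j<k. fps_nth u (k - j) * lc j u)"
  by blast
 ultimately show ?case by (rule fun_algebra.cong)
qed

lemma L_u_simps: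
 "carrier (L_u S) = S \<rightarrow>\<^sub>E {f. fps_nth f 0 = 1}" "x \<otimes>\<^bsub>L_u S\<^esub> y = (\<lambda>p\<in>S. x p * y p)"
 "\<one>\<^bsub>L_u S\<^esub> = (\<lambda>p\<in>S. 1)"
 "reg_funs (L_u S) = fun_algebra (S \<rightarrow>\<^sub>E {f. fps_nth f 0 = 1}) {%x. f (x i) | i f. i \<in> S \<and> f \<in> reg_funs one_units}"
 by (simp_all add: L_u_def alg_product_def product_group_def)

lemma ucoef_polyfun: "p \<in> S ==> (%t. ucoef (t p) n) \<in> polyfun S"
proof (induction n rule: less_induct)
 case (less n)
 have t: "(%t. t p k) \<in> polyfun S" for k unfolding polyfun_def by (rule fun_algebra.gen) (use less in blast)
 show ?case
 proof (cases n)
  case 0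
  thus ?thesis unfolding polyfun_def by (simp add: fun_algebra.const)
 next
  case (Suc m)
  have "(%t. (\<Sum>i\<in>{0..m}. ucoef (t p) i * t p (m - i)) * (1 / of_nat (Suc m))) \<in> polyfun S"
   unfolding polyfun_def
   by (intro fun_algebra.mult fun_algebra_sum fun_algebra.const)
    (use less Suc t in \<open>auto simp: polyfun_def\<close>)
  thus ?thesis using Suc by simp
 qed
qed

lemma L_u_regular_polyfun:
 assumes "f \<in> reg_funs (L_u S)"
 shows "(%t. f (\<lambda>p\<in>S. uf (t p))) \<in> polyfun S"
 unfolding polyfun_def
proof (rule fun_algebra_compose[OF assms[unfolded L_u_simps]])
 fix g :: "(complex set => complex fps) => complex"
 assume "g \<in> {%x. f (x i) | i f. i \<in> S \<and> f \<in> reg_funs one_units}"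
 then obtain i f where g: "g = (%x. f (x i))" "i \<in> S" "f \<in> fun_algebra {f. fps_nth f 0 = 1} (range (%n f. fps_nth f n))"
  by auto
 have "(%t. f (uf (t i))) \<in> fun_algebra UNIV {%t. t p k | p k. p \<in> S}"
  by (rule fun_algebra_compose[OF g(3)]) (use ucoef_polyfun[OF g(2)] in \<open>auto simp: polyfun_def\<close>)
 thus "(%t. g (\<lambda>p\<in>S. uf (t p))) \<in> fun_algebra UNIV {%t. t p k | p k. p \<in> S}"
  using g by simp
qed auto

context punctures
begin

abbreviation "ZS \<equiv> S \<rightarrow>\<^sub>E (UNIV :: int set)"

lemma Rel_iff: "n \<in> Rel q S \<longleftrightarrow> n \<in> ZS \<and> (\<Prod>p\<in>S. rp p powi n p) \<in> spiral"
proof -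
 interpret E: comm_group "ell_curve q" by (rule ell_comm)
 have "finprod (ell_curve q) (%p. p [^]\<^bsub>ell_curve q\<^esub> n p) F = ell_pt q (\<Prod>p\<in>F. rp p powi n p)"
  if "F \<subseteq> S" for F
  using finite_subset[OF that finS] that
 proof (induction F rule: finite_induct)
  case empty
  thus ?case by (simp add: ell_pt_one)
 next
  case (insert p F)
  have p: "p \<in> S" using insert by auto
  have e: "r [^]\<^bsub>ell_curve q\<^esub> n r = ell_pt q (rp r powi n r)" if "r \<in> S" for r
   using ell_pt_pow[of "rp r" "n r"] rp[OF that] by simp
  have nz: "(\<Prod>p\<in>F. rp p powi n p) ~= 0" using insert rp by auto
  have "finprod (ell_curve q) (%p. p [^]\<^bsub>ell_curve q\<^esub> n p) (insert p F) =
   p [^]\<^bsub>ell_curve q\<^esub> n p \<otimes>\<^bsub>ell_curve q\<^esub> finprod (ell_curve q) (%p. p [^]\<^bsub>ell_curve q\<^esub> n p) F"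
   using insert S by (intro E.finprod_insert) (auto intro!: E.int_pow_closed)
  also have "... = ell_pt q (rp p powi n p) \<otimes>\<^bsub>ell_curve q\<^esub> ell_pt q (\<Prod>p\<in>F. rp p powi n p)"
   using insert e[OF p] by simp
  also have "... = ell_pt q (\<Prod>p\<in>insert p F. rp p powi n p)"
   using insert(1,2) nz rp[OF p] by (simp add: ell_pt_hom)
  finally show ?case .
 qed
 moreover have "(\<Prod>p\<in>S. rp p powi n p) ~= 0" using rp finS by simp
 ultimately show ?thesis
  using ell_pt_eq[of "\<Prod>p\<in>S. rp p powi n p" 1] by (auto simp: Rel_def ell_pt_one)
qed

definition KK :: "(complex set => complex) set" where
 "KK = {x \<in> carrier (Gm_pow S). \<forall>n\<in>Rel q S. (\<Prod>p\<in>S. x p powi n p) = 1}"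

lemma KK_subgroup: "subgroup KK (Gm_pow S)"
proof (rule group.subgroupI)
 show "Group.group (Gm_pow S)" by (rule comm_group.axioms(2)[OF Gm_pow_comm])
 show "KK \<subseteq> carrier (Gm_pow S)" by (auto simp: KK_def)
 have "(\<lambda>p\<in>S. 1) \<in> KK" by (simp add: KK_def Gm_pow_simps)
 thus "KK ~= {}" by blast
 fix a assume a: "a \<in> KK"
 thus "inv\<^bsub>Gm_pow S\<^esub> a \<in> KK"
  by (auto simp: KK_def Gm_pow_inv Gm_pow_simps power_int_inverse prod_inversef[unfolded o_def] PiE_iff)
 fix b assume "b \<in> KK"
 with a show "a \<otimes>\<^bsub>Gm_pow S\<^esub> b \<in> KK"
  by (auto simp: KK_def Gm_pow_simps power_int_mult_distrib prod.distrib PiE_iff)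
qed

lemma L_s'_subgroup: "subgroup (L_s' q S) (L_s S)"
proof -
 have n: "diagonal S \<lhd> Gm_pow S"
  by (intro comm_group.subgroup_imp_normal Gm_pow_comm diagonal_subgroup)
 have "(%x. diagonal S #>\<^bsub>Gm_pow S\<^esub> x) \<in> hom (Gm_pow S) (L_s S)"
  unfolding L_s_def by (rule homI) (auto simp: alg_quotient_simps alg_quotient_mult[OF n])
 hence "group_hom (Gm_pow S) (L_s S) (%x. diagonal S #>\<^bsub>Gm_pow S\<^esub> x)"
  using comm_group.axioms(2)[OF Gm_pow_comm] comm_group.axioms(2)[OF L_s_comm]
  by (simp add: group_hom_def group_hom_axioms_def)
 from group_hom.subgroup_img_is_subgroup[OF this KK_subgroup]
 show ?thesis by (simp add: L_s'_def KK_def)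
qed

definition tor :: "(complex set => complex) => (complex set => complex) set set" where
 "tor x = L_s' q S #>\<^bsub>L_s S\<^esub> (diagonal S #>\<^bsub>Gm_pow S\<^esub> x)"

definition pt :: "(complex set => complex) => addc =>
  (complex set => complex) set set \<times> (complex set => complex fps)" where
 "pt x t = (tor (restrict x S), \<lambda>p\<in>S. uf (t p))"

abbreviation "TG \<equiv> alg_quotient (L_s S) (L_s' q S)"

lemma diagonal_normal: "diagonal S \<lhd> Gm_pow S"
 by (intro comm_group.subgroup_imp_normal Gm_pow_comm diagonal_subgroup)

lemma L_s'_normal: "L_s' q S \<lhd> L_s S"
 by (intro comm_group.subgroup_imp_normal L_s_comm L_s'_subgroup)

lemma L_s_carrier: "carrier (L_s S) = (%x. diagonal S #>\<^bsub>Gm_pow S\<^esub> x) ` carrier (Gm_pow S)"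
 by (simp add: L_s_def alg_quotient_simps)

lemma tor_carrier: "carrier TG = tor ` carrier (Gm_pow S)"
 by (simp add: alg_quotient_simps L_s_carrier image_image tor_def)

lemma tor_mult:
 assumes "x \<in> carrier (Gm_pow S)" "y \<in> carrier (Gm_pow S)"
 shows "tor x \<otimes>\<^bsub>TG\<^esub> tor y = tor (x \<otimes>\<^bsub>Gm_pow S\<^esub> y)"
proof -
 have "(diagonal S #>\<^bsub>Gm_pow S\<^esub> x) \<otimes>\<^bsub>L_s S\<^esub> (diagonal S #>\<^bsub>Gm_pow S\<^esub> y) = diagonal S #>\<^bsub>Gm_pow S\<^esub> (x \<otimes>\<^bsub>Gm_pow S\<^esub> y)"
  unfolding L_s_def by (intro alg_quotient_mult diagonal_normal assms)
 thus ?thesis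
  using assms unfolding tor_def by (subst alg_quotient_mult[OF L_s'_normal]) (auto simp: L_s_carrier)
qed

lemma tor_eqD:
 assumes x: "x \<in> carrier (Gm_pow S)" and y: "y \<in> carrier (Gm_pow S)" and "tor x = tor y"
 shows "\<exists>d\<in>diagonal S. \<exists>k\<in>KK. x = d \<otimes>\<^bsub>Gm_pow S\<^esub> (k \<otimes>\<^bsub>Gm_pow S\<^esub> y)"
proof -
 interpret L: comm_group "L_s S" by (rule L_s_comm)
 interpret G: comm_group "Gm_pow S" by (rule Gm_pow_comm)
 let ?c = "%x. diagonal S #>\<^bsub>Gm_pow S\<^esub> x"
 have "?c x \<in> tor x"
  unfolding tor_def by (rule L.rcos_self[OF _ L_s'_subgroup]) (use x in \<open>simp add: L_s_carrier\<close>)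
 hence "?c x \<in> L_s' q S #>\<^bsub>L_s S\<^esub> ?c y" using assms(3) by (simp add: tor_def)
 then obtain k where k: "k \<in> KK" "?c x = ?c k \<otimes>\<^bsub>L_s S\<^esub> ?c y"
  by (auto simp: r_coset_def[of "L_s S"] L_s'_def KK_def)
 have kc: "k \<in> carrier (Gm_pow S)" using k by (simp add: KK_def)
 have "?c x = ?c (k \<otimes>\<^bsub>Gm_pow S\<^esub> y)"
  unfolding k(2) L_s_def by (intro alg_quotient_mult diagonal_normal kc y)
 moreover have "x \<in> ?c x" by (rule G.rcos_self[OF x diagonal_subgroup])
 ultimately have "x \<in> ?c (k \<otimes>\<^bsub>Gm_pow S\<^esub> y)" by simp
 thus ?thesis using k(1) by (auto simp: r_coset_def)
qed

lemma RR_Rel: "n \<in> RR ==> n \<in> Rel q S"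
 by (simp add: RR_def Rel_iff)

lemma ch_restrict [simp]: "ch n (\<lambda>p\<in>S. f p) = ch n f"
 by (simp add: ch_def)

lemma ch_diagonal: "d \<in> diagonal S ==> n \<in> RR ==> ch n d = 1"
proof -
 assume "d \<in> diagonal S" "n \<in> RR"
 then obtain x where "x ~= 0" "d = (\<lambda>p\<in>S. x)" "(\<Sum>p\<in>S. n p) = 0" by (auto simp: diagonal_def RR_def)
 thus ?thesis using powi_sum[of x n S] by (simp add: ch_def)
qed

lemma ch_tor:
 assumes "x \<in> carrier (Gm_pow S)" "y \<in> carrier (Gm_pow S)" "tor x = tor y" "n \<in> RR"
 shows "ch n x = ch n y"
proof -
 obtain d k where dk: "d \<in> diagonal S" "k \<in> KK" "x = d \<otimes>\<^bsub>Gm_pow S\<^esub> (k \<otimes>\<^bsub>Gm_pow S\<^esub> y)"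
  using tor_eqD[OF assms(1-3)] by blast
 have "ch n k = 1" using dk(2) RR_Rel[OF assms(4)] by (simp add: KK_def ch_def)
 moreover have "ch n x = ch n d * (ch n k * ch n y)"
  unfolding dk(3) Gm_pow_simps by (simp add: ch_def power_int_mult_distrib prod.distrib)
 ultimately show ?thesis using ch_diagonal[OF dk(1) assms(4)] by simp
qed

definition chi :: "(complex set => int) => (complex set => complex) set set => complex" where
 "chi n F = ch n (SOME x. x \<in> carrier (Gm_pow S) \<and> tor x = F)"

lemma chi_tor: "n \<in> RR ==> x \<in> carrier (Gm_pow S) ==> chi n (tor x) = ch n x"
proof -
 assume n: "n \<in> RR" and x: "x \<in> carrier (Gm_pow S)"
 let ?P = "%y. y \<in> carrier (Gm_pow S) \<and> tor y = tor x"
 have "?P (SOME y. ?P y)" by (rule someI[of ?P x]) (use x in simp)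
 thus ?thesis unfolding chi_def using ch_tor[OF _ x _ n] by blast
qed

lemma chi_regular: "n \<in> RR ==> chi n \<in> reg_funs TG"
proof -
 assume n: "n \<in> RR"
 have gen: "(%x. x i powi k) \<in> reg_funs (Gm_pow S)" if "i \<in> S" for i k
 proof -
  have x: "(%x. x) \<in> fun_algebra (- {0}) {%x. x, %x. inverse x :: complex}"
   "(%x. inverse x) \<in> fun_algebra (- {0}) {%x. x, %x. inverse x :: complex}"
   by (rule fun_algebra.gen; simp)+
  have "(%x. x powi k) \<in> reg_funs Gm"
   using fun_algebra_power[OF x(1), of "nat k"] fun_algebra_power[OF x(2), of "nat (- k)"]
   by (cases "k \<ge> 0") (simp_all add: power_int_def[abs_def])
  hence "(%x. x i powi k) \<in> {%x. f (x i) |i f. i \<in> S \<and> f \<in> reg_funs Gm}"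
   using that by (intro CollectI exI[of _ i] exI[of _ "%x. x powi k"]) simp
  thus ?thesis unfolding Gm_pow_simps by (rule fun_algebra.gen)
 qed
 have "ch n \<in> reg_funs (Gm_pow S)"
  unfolding ch_def[abs_def] using gen unfolding Gm_pow_simps by (intro fun_algebra_prod) blast
 hence "(%x. chi n (tor x)) \<in> reg_funs (Gm_pow S)"
  unfolding Gm_pow_simps by (rule fun_algebra.cong) (use chi_tor[OF n] in \<open>simp add: Gm_pow_simps\<close>)
 thus ?thesis by (simp add: alg_quotient_simps L_s_def tor_def)
qed

abbreviation "PG \<equiv> pi1_ab q S"

lemma PG_simps:
 "carrier PG = carrier TG \<times> carrier (L_u S)"
 "(a, u) \<otimes>\<^bsub>PG\<^esub> (a', u') = (a \<otimes>\<^bsub>TG\<^esub> a', u \<otimes>\<^bsub>L_u S\<^esub> u')"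
 "\<one>\<^bsub>PG\<^esub> = (\<one>\<^bsub>TG\<^esub>, \<one>\<^bsub>L_u S\<^esub>)"
 "reg_funs PG = fun_algebra (carrier TG \<times> carrier (L_u S))
  ({%x. f (fst x) | f. f \<in> reg_funs TG} \<union> {%x. f (snd x) | f. f \<in> reg_funs (L_u S)})"
 by (simp_all add: pi1_ab_def alg_dirprod_def DirProd_def)

abbreviation "nzS x \<equiv> \<forall>p\<in>S. x p ~= (0::complex)"

lemma restrict_Gm_pow: "nzS x ==> restrict x S \<in> carrier (Gm_pow S)"
 by (auto simp: Gm_pow_simps)

lemma pt_carrier: "nzS x ==> pt x t \<in> carrier PG"
 using restrict_Gm_pow by (auto simp: PG_simps pt_def tor_carrier L_u_simps)

lemma pt_mult: "nzS x ==> nzS y ==> pt x t \<otimes>\<^bsub>PG\<^esub> pt y v = pt (%p. x p * y p) (tadd t v)"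
proof -
 assume x: "nzS x" and y: "nzS y"
 have "tor (restrict x S) \<otimes>\<^bsub>TG\<^esub> tor (restrict y S) = tor (restrict (%p. x p * y p) S)"
  using restrict_Gm_pow[OF x] restrict_Gm_pow[OF y]
  by (simp add: tor_mult) (auto simp: Gm_pow_simps intro!: arg_cong[of _ _ tor] restrict_ext)
 thus ?thesis
  by (auto simp: pt_def PG_simps L_u_simps tadd_def uf_add intro!: restrict_ext)
qed

lemma pt_surj: "g \<in> carrier PG ==> \<exists>x t. nzS x \<and> g = pt x t"
proof -
 assume g: "g \<in> carrier PG"
 obtain F u where gu: "g = (F, u)" by (cases g)
 from g gu obtain x where x: "x \<in> carrier (Gm_pow S)" "F = tor x" by (auto simp: PG_simps tor_carrier)
 have u: "u \<in> S \<rightarrow>\<^sub>E {f. fps_nth f 0 = 1}" using g gu by (simp add: PG_simps L_u_simps)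
 have "restrict x S = x" using x(1) by (auto simp: Gm_pow_simps PiE_iff extensional_restrict)
 moreover have "(\<lambda>p\<in>S. uf (%k. lc k (u p))) = u"
 proof
  fix p show "(\<lambda>p\<in>S. uf (%k. lc k (u p))) p = u p"
   using u uf_lc[of "u p"] by (auto simp: PiE_iff extensional_def)
 qed
 ultimately have "g = pt x (%p k. lc k (u p))" using gu x(2) by (simp add: pt_def)
 moreover have "nzS x" using x(1) by (auto simp: Gm_pow_simps)
 ultimately show ?thesis by blast
qed

lemma pt_one: "\<one>\<^bsub>PG\<^esub> = pt (%_. 1) (%_ _. 0)"
proof -
 interpret G: comm_group "Gm_pow S" by (rule Gm_pow_comm)
 interpret L: comm_group "L_s S" by (rule L_s_comm)
 have one: "\<one>\<^bsub>L_s S\<^esub> = diagonal S" by (simp add: L_s_def alg_quotient_simps)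
 have "diagonal S #>\<^bsub>Gm_pow S\<^esub> \<one>\<^bsub>Gm_pow S\<^esub> = diagonal S"
  using G.coset_mult_one subgroup.subset[OF diagonal_subgroup] by blast
 hence "tor (restrict (%_. 1) S) = L_s' q S #>\<^bsub>L_s S\<^esub> \<one>\<^bsub>L_s S\<^esub>"
  by (simp add: tor_def one Gm_pow_simps)
 also have "... = L_s' q S" using L.coset_mult_one subgroup.subset[OF L_s'_subgroup] by blast
 finally have 1: "tor (restrict (%_. 1) S) = \<one>\<^bsub>TG\<^esub>" by (simp add: alg_quotient_simps)
 have "uf (%_. 0) = 1" by (rule uf_unique[symmetric]) (auto simp: fps_eq_iff fps_mult_nth)
 thus ?thesis by (simp add: PG_simps pt_def 1 L_u_simps)
qed

definition xchar :: "(complex set => int) => (complex set => complex) set set \<times> (complex set => complex fps) => complex" where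
 "xchar n h = chi n (fst h)"

definition tcoord :: "complex set => nat => (complex set => complex) set set \<times> (complex set => complex fps) => complex" where
 "tcoord p k g = lc k (snd g p)"

lemma xchar_regular: "n \<in> RR ==> xchar n \<in> reg_funs PG"
 unfolding PG_simps xchar_def[abs_def]
 by (intro fun_algebra.gen UnI1 CollectI exI[of _ "chi n"] conjI refl chi_regular)

lemma tcoord_regular: "p \<in> S ==> tcoord p k \<in> reg_funs PG"
proof -
 assume p: "p \<in> S"
 have "lc k \<in> reg_funs one_units" using lc_regular by simp
 hence "(%x. lc k (x p)) \<in> reg_funs (L_u S)"
  unfolding L_u_simps using p by (intro fun_algebra.gen CollectI exI[of _ p] exI[of _ "lc k"] conjI refl)
 thus ?thesis unfolding PG_simps tcoord_def[abs_def]
  by (intro fun_algebra.gen UnI2 CollectI exI[of _ "%x. lc k (x p)"] conjI refl)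
qed

lemma xchar_pt: "n \<in> RR ==> nzS x ==> xchar n (pt x t) = ch n x"
 using restrict_Gm_pow[of x] by (simp add: xchar_def pt_def chi_tor)

lemma tcoord_pt: "p \<in> S ==> tcoord p k (pt x t) = t p k"
 by (simp add: tcoord_def pt_def lc_uf)

text \<open>A regular function on the group in coordinates: a polynomial in additive coordinates for each of finitely many characters from \<open>R\<close>.\<close>
section \<open>Zariski density\<close>

definition nf :: "(complex set => int) set => ((complex set => complex) => addc => complex) => bool" where
 "nf R h \<longleftrightarrow> (\<exists>J G. finite J \<and> J \<subseteq> R \<and> (\<forall>n\<in>J. G n \<in> polyfun S) \<and>
  (\<forall>x t. nzS x --> h x t = (\<Sum>n\<in>J. ch n x * G n t)))"

lemma nf_term: "n \<in> R ==> G \<in> polyfun S ==> nf R (%x t. ch n x * G t)"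
proof -
 assume a: "n \<in> R" "G \<in> polyfun S"
 have s: "(\<Sum>m\<in>{n}. ch m x * G t) = ch n x * G t" for x t by (subst sum.insert) (simp_all only: finite.emptyI empty_iff not_False_eq_True sum.empty add_0_right)
 show ?thesis unfolding nf_def
 proof (rule exI[of _ "{n}"], rule exI[of _ "%_. G"], intro conjI ballI allI impI)
  show "finite {n}" "{n} \<subseteq> R" using a(1) by auto
  show "G \<in> polyfun S" by (rule a(2))
  show "ch n x * G t = (\<Sum>m\<in>{n}. ch m x * G t)" for x t by (rule s[symmetric])
 qed
qed

lemma nf_cong: "nf R h ==> (\<And>x t. nzS x ==> h' x t = h x t) ==> nf R h'"
 by (simp add: nf_def)

lemma polyfun_const: "(%_. c) \<in> polyfun S"
 unfolding polyfun_def by (rule fun_algebra.const)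

lemma nf_add:
 assumes "nf R h" "nf R h'"
 shows "nf R (%x t. h x t + h' x t)"
proof -
 from assms(1) obtain J G where J: "finite J" "J \<subseteq> R" "\<forall>n\<in>J. G n \<in> polyfun S"
  "\<forall>x t. nzS x --> h x t = (\<Sum>n\<in>J. ch n x * G n t)" unfolding nf_def by (elim exE conjE)
 from assms(2) obtain J' G' where J': "finite J'" "J' \<subseteq> R" "\<forall>n\<in>J'. G' n \<in> polyfun S"
  "\<forall>x t. nzS x --> h' x t = (\<Sum>n\<in>J'. ch n x * G' n t)" unfolding nf_def by (elim exE conjE)
 define F where "F n t = (if n \<in> J then G n t else 0) + (if n \<in> J' then G' n t else 0)" for n t
 have "(\<Sum>n\<in>J \<union> J'. ch n x * F n t) = (\<Sum>n\<in>J. ch n x * G n t) + (\<Sum>n\<in>J'. ch n x * G' n t)" for x t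
 proof -
  have "(\<Sum>n\<in>J \<union> J'. ch n x * F n t) = (\<Sum>n\<in>J \<union> J'. if n \<in> J then ch n x * G n t else 0)
    + (\<Sum>n\<in>J \<union> J'. if n \<in> J' then ch n x * G' n t else 0)"
   unfolding sum.distrib[symmetric] by (intro sum.cong refl) (auto simp: F_def distrib_left)
  also have "(\<Sum>n\<in>J \<union> J'. if n \<in> J then ch n x * G n t else 0) = (\<Sum>n\<in>J. ch n x * G n t)"
   using J(1) J'(1) by (intro sum.mono_neutral_cong_right) auto
  also have "(\<Sum>n\<in>J \<union> J'. if n \<in> J' then ch n x * G' n t else 0) = (\<Sum>n\<in>J'. ch n x * G' n t)"
   using J(1) J'(1) by (intro sum.mono_neutral_cong_right) auto
  finally show ?thesis .
 qed
 hence "\<forall>x t. nzS x --> h x t + h' x t = (\<Sum>n\<in>J \<union> J'. ch n x * F n t)" using J(4) J'(4) by simp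
 moreover have "\<forall>n\<in>J \<union> J'. F n \<in> polyfun S"
 proof
  fix n assume "n \<in> J \<union> J'"
  have "(%t. if n \<in> J then G n t else 0) \<in> polyfun S" "(%t. if n \<in> J' then G' n t else 0) \<in> polyfun S"
   by (cases "n \<in> J"; cases "n \<in> J'"; simp add: J(3) J'(3) polyfun_def[symmetric] polyfun_const)+
  thus "F n \<in> polyfun S" unfolding F_def[abs_def] polyfun_def by (rule fun_algebra.add)
 qed
 ultimately show ?thesis using J(1,2) J'(1,2) unfolding nf_def
  by (intro exI[of _ "J \<union> J'"] exI[of _ F] conjI) auto
qed

lemma nf_zero: "nf R (%x t. 0)"
 unfolding nf_def by (rule exI[of _ "{}"]) simp

lemma nf_sum: "(\<And>i. i \<in> I ==> nf R (h i)) ==> nf R (%x t. \<Sum>i\<in>I. h i x t)"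
 by (induction I rule: infinite_finite_induct) (auto intro: nf_zero nf_add)

lemma ch_add: "nzS x ==> ch (\<lambda>p\<in>S. n p + m p) x = ch n x * ch m x"
 by (simp add: ch_def power_int_add prod.distrib)

lemma nf_mult:
 assumes R: "\<And>n m. n \<in> R ==> m \<in> R ==> (\<lambda>p\<in>S. n p + m p) \<in> R" and "nf R h" "nf R h'"
 shows "nf R (%x t. h x t * h' x t)"
proof -
 from assms(2) obtain J G where J: "finite J" "J \<subseteq> R" "\<forall>n\<in>J. G n \<in> polyfun S"
  "\<forall>x t. nzS x --> h x t = (\<Sum>n\<in>J. ch n x * G n t)" unfolding nf_def by (elim exE conjE)
 from assms(3) obtain J' G' where J': "finite J'" "J' \<subseteq> R" "\<forall>n\<in>J'. G' n \<in> polyfun S"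
  "\<forall>x t. nzS x --> h' x t = (\<Sum>n\<in>J'. ch n x * G' n t)" unfolding nf_def by (elim exE conjE)
 have "nf R (%x t. \<Sum>n\<in>J. \<Sum>m\<in>J'. ch (\<lambda>p\<in>S. n p + m p) x * (G n t * G' m t))"
 proof (intro nf_sum nf_term R)
  fix n m assume nm: "n \<in> J" "m \<in> J'"
  show "(%t. G n t * G' m t) \<in> polyfun S"
   using J(3) J'(3) nm unfolding polyfun_def by (intro fun_algebra.mult) auto
 qed (use J J' in auto)
 thus ?thesis
 proof (rule nf_cong)
  fix x t assume x: "nzS x"
  have "h x t * h' x t = (\<Sum>n\<in>J. \<Sum>m\<in>J'. ch n x * G n t * (ch m x * G' m t))"
   using x J(4) J'(4) by (simp add: sum_product)
  also have "... = (\<Sum>n\<in>J. \<Sum>m\<in>J'. ch (\<lambda>p\<in>S. n p + m p) x * (G n t * G' m t))"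
   using x by (intro sum.cong refl) (simp add: ch_add)
  finally show "h x t * h' x t = ..." .
 qed
qed

lemma nf_algebra:
 assumes R: "\<And>n m. n \<in> R ==> m \<in> R ==> (\<lambda>p\<in>S. n p + m p) \<in> R" and R0: "(\<lambda>p\<in>S. 0) \<in> R"
  and f: "f \<in> fun_algebra X B" and phi: "\<And>x t. nzS x ==> \<phi> x t \<in> X"
  and gens: "\<And>g. g \<in> B ==> nf R (%x t. g (\<phi> x t))"
 shows "nf R (%x t. f (\<phi> x t))"
 using f
proof induction
 case (gen f) thus ?case by (rule gens)
next
 case (const c)
 have "nf R (%x t. ch (\<lambda>p\<in>S. 0) x * (%_. c) t)"
  by (rule nf_term[OF R0]) (simp add: polyfun_def fun_algebra.const)
 thus ?case by (simp add: ch_def)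
next
 case (add f g) thus ?case by (intro nf_add)
next
 case (mult f g) thus ?case by (intro nf_mult R)
next
 case (cong f g)
 show ?case by (rule nf_cong[OF cong(3)]) (use cong(2) phi in blast)
qed

lemma ZS_add: "n \<in> ZS ==> m \<in> ZS ==> (\<lambda>p\<in>S. n p + m p) \<in> ZS"
 by auto

lemma RR_add: "n \<in> RR ==> m \<in> RR ==> (\<lambda>p\<in>S. n p + m p) \<in> RR"
proof -
 assume n: "n \<in> RR" "m \<in> RR"
 have "(\<Prod>p\<in>S. rp p powi (n p + m p)) = (\<Prod>p\<in>S. rp p powi n p) * (\<Prod>p\<in>S. rp p powi m p)"
  using rp by (simp add: power_int_add prod.distrib)
 thus ?thesis using n spiral_mult by (auto simp: RR_def sum.distrib)
qed

lemma RR_zero: "(\<lambda>p\<in>S. 0) \<in> RR"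
 by (simp add: RR_def)

lemma Gm_pow_nf:
 assumes "f \<in> reg_funs (Gm_pow S)"
 shows "nf ZS (%x t. f (restrict x S))"
proof (rule nf_algebra[OF ZS_add _ assms[unfolded Gm_pow_simps]])
 fix g :: "(complex set => complex) => complex"
 assume "g \<in> {%x. f (x i) |i f. i \<in> S \<and> f \<in> reg_funs Gm}"
 then obtain i f where g: "g = (%x. f (x i))" "i \<in> S" "f \<in> fun_algebra (- {0}) {%x. x, %x. inverse x}"
  by auto
 have one: "(%_. 1) \<in> polyfun S" by (simp add: polyfun_def fun_algebra.const)
 have "nf ZS (%x t. f (x i))"
 proof (rule nf_algebra[OF ZS_add _ g(3)])
  fix h assume h: "h \<in> {%x. x, %x. inverse x :: complex}"
  have d: "nf ZS (%x t. ch (\<lambda>p\<in>S. if p = i then k else 0) x * (%_. 1) t)" for k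
   by (rule nf_term[OF _ one]) auto
  have c: "ch (\<lambda>p\<in>S. if p = i then k else 0) x = x i powi k" for k x
  proof -
   have "ch (\<lambda>p\<in>S. if p = i then k else 0) x = (\<Prod>p\<in>S. if p = i then x i powi k else 1)"
    unfolding ch_def by (intro prod.cong refl) auto
   thus ?thesis using finS g(2) by simp
  qed
  show "nf ZS (%x t. h (x i))"
   using h d[of 1] d[of "-1"] by (auto simp: c power_int_minus)
 qed (use g(2) in auto)
 thus "nf ZS (%x t. g (restrict x S))" using g by simp
qed auto

lemma monomials_independent:
 assumes "finite J" "J \<subseteq> ZS" "\<And>x. nzS x ==> (\<Sum>n\<in>J. c n * ch n x) = 0"
 shows "\<forall>n\<in>J. c n = 0"
 using assms
proof (induction J arbitrary: c rule: finite_induct)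
 case (insert m J)
 have 1: "c n = 0" if n: "n \<in> J" for n
 proof -
  have "n ~= m" "n \<in> ZS" "m \<in> ZS" using n insert by auto
  then obtain p where p: "p \<in> S" "n p ~= m p" using PiE_ext[of n S _ m] by blast
  define y where "y r = (if r = p then 2 else 1 :: complex)" for r
  have chy: "ch k y = 2 powi k p" for k
  proof -
   have "ch k y = (\<Prod>r\<in>S. if r = p then 2 powi k p else 1)"
    unfolding ch_def y_def by (intro prod.cong refl) auto
   thus ?thesis using finS p(1) by simp
  qed
  have ny: "ch n y ~= ch m y"
  proof
   assume "ch n y = ch m y"
   hence "norm (2 powi n p :: complex) = norm (2 powi m p :: complex)" by (simp add: chy)
   hence "ln (2 powi n p :: real) = ln (2 powi m p)" by (simp add: norm_power_int)
   thus False using p(2) by (simp add: ln_powi)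
  qed
  have "\<forall>n\<in>J. c n * (ch n y - ch m y) = 0"
  proof (rule insert.IH)
   show "J \<subseteq> ZS" using insert by auto
   fix x assume x: "nzS x"
   have xy: "nzS (%p. x p * y p)" using x by (simp add: y_def)
   have "(\<Sum>n\<in>insert m J. c n * ch n (%p. x p * y p)) - ch m y * (\<Sum>n\<in>insert m J. c n * ch n x) = 0"
    using insert.prems(2)[OF xy] insert.prems(2)[OF x] by simp
   also have "(\<Sum>n\<in>insert m J. c n * ch n (%p. x p * y p)) - ch m y * (\<Sum>n\<in>insert m J. c n * ch n x)
     = (\<Sum>n\<in>insert m J. c n * (ch n y - ch m y) * ch n x)"
    unfolding sum_distrib_left sum_subtractf[symmetric]
    by (intro sum.cong refl) (simp add: ch_mult algebra_simps)
   also have "... = (\<Sum>n\<in>J. c n * (ch n y - ch m y) * ch n x)"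
    using insert(1,2) by simp
   finally show "(\<Sum>n\<in>J. c n * (ch n y - ch m y) * ch n x) = 0" .
  qed
  thus ?thesis using n ny by auto
 qed
 have "(\<Sum>n\<in>insert m J. c n * ch n (%_. 1)) = 0" by (rule insert.prems(2)) simp
 hence "c m = 0" using insert(1,2) 1 by (simp add: ch_def)
 with 1 show ?case by blast
qed auto

text \<open>The characters of the complex torus \<open>C\<^sup>* / q\<^sup>Z\<close> separate its points.\<close>
lemma character_off_spiral:
 assumes "z ~= 0" "z \<notin> spiral"
 shows "\<exists>c. c z ~= 1 \<and> (\<forall>x. x ~= 0 --> c x ~= (0::complex)) \<and> (\<forall>h\<in>spiral. c h = 1) \<and>
  (\<forall>x y. x ~= 0 --> y ~= 0 --> c (x * y) = c x * c y)"
proof -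
 define l where "l x = complex_of_real (ln (norm x) / ln (norm q))" for x :: complex
 have lq: "ln (norm q) ~= 0" using q by simp
 have ladd: "l (x * y) = l x + l y" if "x ~= 0" "y ~= 0" for x y
  using that by (simp add: l_def norm_mult ln_mult add_divide_distrib)
 have lpow: "l (q powi k) = of_int k" for k
  using lq q by (simp add: l_def norm_power_int ln_powi)
 define c1 where "c1 x = exp (2 * of_real pi * \<i> * l x)" for x
 define c2 where "c2 x = x / exp (Ln q * l x)" for x
 have spiral1: "c1 h = 1" "c2 h = 1" if h: "h \<in> spiral" for h
 proof -
  obtain k where k: "h = q powi k" using h unfolding spiral_def by (elim rangeE)
  show "c1 h = 1" unfolding c1_def k lpow
   by (subst exp_eq_1) (auto intro!: exI[of _ k])
  have "exp (Ln q * of_int k) = q powi k" by (metis exp_Ln exp_power_int mult.commute q_nz)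
  thus "c2 h = 1" unfolding c2_def k lpow by simp
 qed
 show ?thesis
 proof (cases "c1 z = 1")
  case False
  show ?thesis
   by (rule exI[of _ c1])
    (use False spiral1 in \<open>auto simp: c1_def ladd exp_add distrib_left\<close>)
 next
  case True
  have "c2 z ~= 1"
  proof
   assume c2: "c2 z = 1"
   from True obtain k :: int where "Im (2 * of_real pi * \<i> * l z) = of_int (2 * k) * pi"
    unfolding c1_def exp_eq_1 by blast
   hence "pi * (2 * (ln (norm z) / ln (norm q))) = pi * (2 * of_int k)" by (simp add: l_def mult.commute mult.left_commute)
   hence "ln (norm z) / ln (norm q) = of_int k" by (simp only: mult_left_cancel[OF pi_neq_zero] mult_left_cancel[OF zero_neq_numeral[symmetric]])
   hence "l z = of_int k" unfolding l_def by simp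
   hence "z = exp (Ln q * of_int k)" using c2 by (simp add: c2_def)
   also have "... = q powi k" by (metis exp_Ln exp_power_int mult.commute q_nz)
   finally show False using assms(2) by (auto simp: spiral_def)
  qed
  thus ?thesis
   by (intro exI[of _ c2])
    (use spiral1 in \<open>auto simp: c2_def ladd exp_add distrib_left dest: spiral_nz\<close>)
 qed
qed

lemma tor_trivial:
 assumes "y \<in> diagonal S \<or> y \<in> KK" "x \<in> carrier (Gm_pow S)"
 shows "tor (y \<otimes>\<^bsub>Gm_pow S\<^esub> x) = tor x"
proof -
 interpret G: comm_group "Gm_pow S" by (rule Gm_pow_comm)
 interpret L: comm_group "L_s S" by (rule L_s_comm)
 interpret T: comm_group TG by (intro alg_quotient_comm L_s_comm L_s'_subgroup)
 have y: "y \<in> carrier (Gm_pow S)"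
  using assms(1) subgroup.subset[OF diagonal_subgroup] by (auto simp: KK_def)
 have "diagonal S #>\<^bsub>Gm_pow S\<^esub> y \<in> L_s' q S"
 proof (cases "y \<in> KK")
  case True
  thus ?thesis by (auto simp: L_s'_def KK_def)
 next
  case False
  hence "y \<in> diagonal S" using assms by simp
  hence "diagonal S #>\<^bsub>Gm_pow S\<^esub> y = \<one>\<^bsub>L_s S\<^esub>"
   using G.coset_join2[OF y diagonal_subgroup] by (simp add: L_s_def alg_quotient_simps)
  thus ?thesis using subgroup.one_closed[OF L_s'_subgroup] by simp
 qed
 hence "tor y = L_s' q S"
  unfolding tor_def by (intro L.coset_join2 L_s'_subgroup) (use y in \<open>auto simp: L_s_carrier\<close>)
 hence "tor y = \<one>\<^bsub>TG\<^esub>" by (simp add: alg_quotient_simps)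
 moreover have "tor x \<in> carrier TG" using assms(2) by (simp add: tor_carrier)
 ultimately show ?thesis using tor_mult[OF y assms(2)] by simp
qed

text \<open>The characters of the torus that are trivial on the closed subgroup generated by the diagonal and \<open>KK\<close> are those of \<open>RR\<close>. For degree \<open>0\<close>, a character of the complex torus that is nontrivial at \<open>\<Sum> n\<^sub>p p\<close> supplies the element.\<close>
lemma separating_element:
 assumes n: "n \<in> ZS" "n \<notin> RR"
 shows "\<exists>y. nzS y \<and> ch n y ~= 1 \<and> (restrict y S \<in> diagonal S \<or> restrict y S \<in> KK)"
proof (cases "(\<Sum>p\<in>S. n p) = 0")
 case False
 have "ch n (%_. 2) = 2 powi (\<Sum>p\<in>S. n p)" using powi_sum[of 2 n S] by (simp add: ch_def)
 moreover have "(2::complex) powi (\<Sum>p\<in>S. n p) ~= 1"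
 proof
  assume "(2::complex) powi (\<Sum>p\<in>S. n p) = 1"
  hence "norm ((2::complex) powi (\<Sum>p\<in>S. n p)) = 1" by simp
  hence "ln ((2::real) powi (\<Sum>p\<in>S. n p)) = ln 1" by (simp add: norm_power_int)
  hence "of_int (\<Sum>p\<in>S. n p) * ln (2::real) = 0" by (simp add: ln_powi del: of_int_sum)
  thus False using False by (simp del: of_int_sum)
 qed
 moreover have "restrict (%_. 2) S \<in> diagonal S" unfolding diagonal_def by force
 ultimately show ?thesis by (intro exI[of _ "%_. 2"]) simp
next
 case True
 define z where "z = (\<Prod>p\<in>S. rp p powi n p)"
 have z: "z ~= 0" "z \<notin> spiral" using n True rp finS by (auto simp: RR_def z_def)
 from character_off_spiral[OF z] obtain c where c: "c z ~= 1" "\<forall>x. x ~= 0 --> c x ~= (0::complex)"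
  "\<forall>h\<in>spiral. c h = 1" "\<forall>x y. x ~= 0 --> y ~= 0 --> c (x * y) = c x * c y" by (elim exE conjE)
 have c1: "c 1 = 1" using c(3) one_spiral by blast
 have cinv: "c (inverse x) = inverse (c x)" if "x ~= 0" for x
 proof -
  have "c x * c (inverse x) = 1" using c(4) that c1 by (metis inverse_nonzero_iff_nonzero right_inverse)
  thus ?thesis by (metis inverse_unique)
 qed
 have cpow: "c (x ^ k) = c x ^ k" if "x ~= 0" for x k
  using that c1 c(4) by (induction k) auto
 have cpowi: "c (x powi k) = c x powi k" if "x ~= 0" for x k
  using that cpow[of x] cpow[of "inverse x"] cinv by (simp add: power_int_def)
 have cprod: "c (\<Prod>p\<in>F. rp p powi m p) = (\<Prod>p\<in>F. c (rp p) powi m p)" if "F \<subseteq> S" for F m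
  using finite_subset[OF that finS] that
 proof (induction F rule: finite_induct)
  case (insert p F)
  have "rp p powi m p ~= 0" "(\<Prod>p\<in>F. rp p powi m p) ~= 0" using insert rp by auto
  thus ?case using insert c(4) cpowi rp[of p] by simp
 qed (simp add: c1)
 define y where "y p = c (rp p)" for p
 have ch_y: "ch m y = c (\<Prod>p\<in>S. rp p powi m p)" for m by (simp add: ch_def y_def cprod)
 have ny: "nzS y" using c(2) rp by (simp add: y_def)
 moreover have "ch n y ~= 1" using c(1) by (simp add: ch_y z_def)
 moreover have "restrict y S \<in> KK"
 proof -
  have "(\<Prod>p\<in>S. restrict y S p powi m p) = 1" if "m \<in> Rel q S" for m
  proof -
   have "(\<Prod>p\<in>S. restrict y S p powi m p) = ch m y" by (simp add: ch_def)
   thus ?thesis using that c(3) by (simp add: ch_y Rel_iff)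
  qed
  thus ?thesis using restrict_Gm_pow[OF ny] by (simp add: KK_def)
 qed
 ultimately show ?thesis by blast
qed

text \<open>A regular function on the quotient is an invariant Laurent polynomial; linear independence of monomials shows that only invariant monomials occur.\<close>
lemma TG_nf:
 assumes "f \<in> reg_funs TG"
 shows "nf RR (%x (t :: addc). f (tor (restrict x S)))"
proof -
 have "(%x. f (tor x)) \<in> reg_funs (Gm_pow S)"
  using assms by (simp add: alg_quotient_simps L_s_def tor_def)
 from Gm_pow_nf[OF this] obtain J G where J: "finite J" "J \<subseteq> ZS"
  "\<forall>n\<in>J. G n \<in> polyfun S"
  "\<forall>x (t :: addc). nzS x --> f (tor (restrict x S)) = (\<Sum>n\<in>J. ch n x * G n t)" unfolding nf_def by (elim exE conjE)
 define c where "c n = G n (%(_::complex set) (_::nat). 0::complex)" for n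
 have h: "f (tor (restrict x S)) = (\<Sum>n\<in>J. c n * ch n x)" if "nzS x" for x
  unfolding c_def mult.commute[of "G _ _"] using J(4) that by blast
 have c0: "c n = 0" if n: "n \<in> J" "n \<notin> RR" for n
 proof -
  obtain y where y: "nzS y" "ch n y ~= 1" "restrict y S \<in> diagonal S \<or> restrict y S \<in> KK"
   using separating_element[of n] n J(2) by blast
  have "\<forall>n\<in>J. c n * (ch n y - 1) = 0"
  proof (rule monomials_independent[OF J(1,2)])
   fix x assume x: "nzS x"
   have yx: "nzS (%p. y p * x p)" using x y(1) by simp
   have "restrict (%p. y p * x p) S = restrict y S \<otimes>\<^bsub>Gm_pow S\<^esub> restrict x S"
    by (auto simp: Gm_pow_simps intro!: restrict_ext)
   hence "tor (restrict (%p. y p * x p) S) = tor (restrict x S)"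
    using tor_trivial[OF y(3) restrict_Gm_pow[OF x]] by simp
   hence "(\<Sum>n\<in>J. c n * ch n (%p. y p * x p)) - (\<Sum>n\<in>J. c n * ch n x) = 0"
    using h[OF yx] h[OF x] by simp
   thus "(\<Sum>n\<in>J. c n * (ch n y - 1) * ch n x) = 0"
    unfolding sum_subtractf[symmetric] by (simp add: ch_mult algebra_simps)
  qed
  thus ?thesis using n(1) y(2) by auto
 qed
 have "nf RR (%x t. \<Sum>n\<in>J \<inter> RR. ch n x * (%_. c n) t)"
  by (intro nf_sum nf_term) (auto simp: polyfun_def fun_algebra.const)
 thus ?thesis
 proof (rule nf_cong)
  fix x and t :: addc assume x: "nzS x"
  have "(\<Sum>n\<in>J. c n * ch n x) = (\<Sum>n\<in>J \<inter> RR. ch n x * c n)"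
   using J(1) c0 by (intro sum.mono_neutral_cong_right) auto
  thus "f (tor (restrict x S)) = (\<Sum>n\<in>J \<inter> RR. ch n x * (%_. c n) t)" using h[OF x] by simp
 qed
qed

lemma PG_nf:
 assumes "F \<in> reg_funs PG"
 shows "nf RR (%x t. F (pt x t))"
proof (rule nf_algebra[OF RR_add RR_zero assms[unfolded PG_simps]])
 fix x t assume "nzS x"
 thus "pt x t \<in> carrier TG \<times> carrier (L_u S)" using pt_carrier[of x t] by (simp add: PG_simps)
next
 fix g assume "g \<in> {%x. f (fst x) |f. f \<in> reg_funs TG} \<union> {%x. f (snd x) |f. f \<in> reg_funs (L_u S)}"
 then consider f where "g = (%x. f (fst x))" "f \<in> reg_funs TG" | f where "g = (%x. f (snd x))" "f \<in> reg_funs (L_u S)"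
  by auto
 thus "nf RR (%x t. g (pt x t))"
 proof cases
  case 1
  thus ?thesis using TG_nf[of f] by (simp add: pt_def)
 next
  case 2
  have "nf RR (%x t. ch (\<lambda>p\<in>S. 0) x * (%t. f (\<lambda>p\<in>S. uf (t p))) t)"
   by (rule nf_term[OF RR_zero L_u_regular_polyfun[OF 2(2)]])
  thus ?thesis using 2(1) by (simp add: pt_def ch_def)
 qed
qed auto

lemma albanese_nz: "(x,t) \<in> albanese_monoid ==> nzS x"
 by (induction rule: albanese_monoid.induct) (auto simp: xx_nz)

text \<open>In coordinates the claim is that an exponential polynomial which vanishes on the monoid is zero.\<close>
lemma PG_density:
 assumes F: "F \<in> reg_funs PG" and z: "\<And>x t. (x,t) \<in> albanese_monoid ==> F (pt x t) = 0"
  and g: "g \<in> carrier PG"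
 shows "F g = 0"
proof -
 from PG_nf[OF F] obtain J G where J: "finite J" "J \<subseteq> RR" "\<forall>n\<in>J. G n \<in> polyfun S"
  "\<forall>x t. nzS x --> F (pt x t) = (\<Sum>n\<in>J. ch n x * G n t)" unfolding nf_def by (elim exE conjE)
 have "\<forall>n\<in>J. \<forall>t. G n t = 0"
 proof (rule exponential_polynomial_zero[OF J(1,2)])
  fix n assume "n \<in> J" thus "G n \<in> polyfun S" using J(3) by blast
 next
  fix x t assume xt: "(x,t) \<in> albanese_monoid"
  thus "(\<Sum>n\<in>J. ch n x * G n t) = 0" using J(4) albanese_nz[OF xt] z[OF xt] by simp
 qed
 hence "F (pt x t) = 0" if "nzS x" for x t using J(4) that by simp
 thus ?thesis using pt_surj[OF g] by blast
qed

end

section \<open>Kronecker products\<close>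

lemma mult_index: "X \<in> carrier_mat m n ==> Y \<in> carrier_mat n k ==> i < m ==> j < k ==>
  (X * Y) $$ (i,j) = (\<Sum>r<n. X $$ (i,r) * Y $$ (r,j))"
 by (auto simp: scalar_prod_def lessThan_atLeast0 intro!: sum.cong)

lemma div_less_dim: "i < m * n ==> i div n < (m::nat)"
 by (simp add: less_mult_imp_div_less)

lemma mod_less_dim: "i < m * n ==> i mod n < (n::nat)"
 by (cases "n = 0") auto

lemmas dm = div_less_dim mod_less_dim

lemma kron_carrier: "A \<in> carrier_mat m n ==> B \<in> carrier_mat k l ==> kron A B \<in> carrier_mat (m * k) (n * l)"
 by (auto simp: kron_def)

lemma kron_index: "A \<in> carrier_mat m n ==> B \<in> carrier_mat k l ==> i < m * k ==> j < n * l ==>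
  kron A B $$ (i,j) = A $$ (i div k, j div l) * B $$ (i mod k, j mod l)"
 by (auto simp: kron_def)

lemma sum_div_mod: "(\<Sum>r<b * e. f (r div e) (r mod e)) = (\<Sum>i<b. \<Sum>j<(e::nat). f i j)"
proof (cases "e = 0")
 case False
 have "(\<Sum>r<b * e. f (r div e) (r mod e)) = (\<Sum>i<b. \<Sum>r\<in>{i * e ..< i * e + e}. f (r div e) (r mod e))"
  by (rule sum.nat_group[symmetric])
 also have "... = (\<Sum>i<b. \<Sum>j<e. f i j)"
 proof (rule sum.cong[OF refl])
  fix i
  show "(\<Sum>r\<in>{i * e ..< i * e + e}. f (r div e) (r mod e)) = (\<Sum>j<e. f i j)"
  proof (rule sum.reindex_bij_witness[of _ "%j. i * e + j" "%r. r - i * e"])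
   fix r assume "r \<in> {i * e ..< i * e + e}"
   hence "r = i * e + (r - i * e)" "r - i * e < e" by auto
   hence "r div e = i" "r mod e = r - i * e"
    by (metis div_mult_self3 div_less add.right_neutral False, metis mod_mult_self3 mod_less)
   thus "f i (r - i * e) = f (r div e) (r mod e)" by simp
  qed auto
 qed
 finally show ?thesis .
qed simp

lemma kron_mult:
 fixes A B :: "'a::comm_semiring_0 mat"
 assumes A: "A \<in> carrier_mat a b" and C: "C \<in> carrier_mat b c"
  and B: "B \<in> carrier_mat d e" and D: "D \<in> carrier_mat e f"
 shows "kron (A * C) (B * D) = kron A B * kron C D"
proof (rule eq_matI)
 have AC: "A * C \<in> carrier_mat a c" and BD: "B * D \<in> carrier_mat d f" using assms by auto
 note KK = kron_carrier[OF A B] kron_carrier[OF C D] kron_carrier[OF AC BD]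
 show "dim_row (kron (A * C) (B * D)) = dim_row (kron A B * kron C D)"
  "dim_col (kron (A * C) (B * D)) = dim_col (kron A B * kron C D)" using KK by auto
 fix i j assume "i < dim_row (kron A B * kron C D)" "j < dim_col (kron A B * kron C D)"
 hence i: "i < a * d" and j: "j < c * f" using KK by auto
 have "(kron A B * kron C D) $$ (i,j) = (\<Sum>r<b * e. kron A B $$ (i,r) * kron C D $$ (r,j))"
  using KK i j by (auto simp: scalar_prod_def lessThan_atLeast0 intro!: sum.cong)
 also have "... = (\<Sum>r<b * e. (A $$ (i div d, r div e) * C $$ (r div e, j div f)) * (B $$ (i mod d, r mod e) * D $$ (r mod e, j mod f)))"
  by (intro sum.cong refl) (simp add: kron_index[OF A B] kron_index[OF C D] i j mult.assoc mult.left_commute)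
 also have "... = (\<Sum>k<b. \<Sum>l<e. (A $$ (i div d, k) * C $$ (k, j div f)) * (B $$ (i mod d, l) * D $$ (l, j mod f)))"
  by (rule sum_div_mod)
 also have "... = (\<Sum>k<b. A $$ (i div d, k) * C $$ (k, j div f)) * (\<Sum>l<e. B $$ (i mod d, l) * D $$ (l, j mod f))"
  by (simp add: sum_product)
 also have "(\<Sum>k<b. A $$ (i div d, k) * C $$ (k, j div f)) = (A * C) $$ (i div d, j div f)"
  using A C dm[OF i] dm[OF j] by (auto simp: scalar_prod_def lessThan_atLeast0 intro!: sum.cong)
 also have "(\<Sum>l<e. B $$ (i mod d, l) * D $$ (l, j mod f)) = (B * D) $$ (i mod d, j mod f)"
  using B D dm[OF i] dm[OF j] by (auto simp: scalar_prod_def lessThan_atLeast0 intro!: sum.cong)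
 also have "(A * C) $$ (i div d, j div f) * (B * D) $$ (i mod d, j mod f) = kron (A * C) (B * D) $$ (i,j)"
  by (rule kron_index[OF AC BD i j, symmetric])
 finally show "kron (A * C) (B * D) $$ (i,j) = (kron A B * kron C D) $$ (i,j)" by simp
qed

lemma kron_one: "kron (1\<^sub>m m) (1\<^sub>m n) = (1\<^sub>m (m * n) :: 'a::semiring_1 mat)"
proof (rule eq_matI)
 fix i j assume "i < dim_row (1\<^sub>m (m * n) :: 'a mat)" "j < dim_col (1\<^sub>m (m * n) :: 'a mat)"
 hence i: "i < m * n" and j: "j < m * n" by auto
 have "i = j \<longleftrightarrow> i div n = j div n \<and> i mod n = j mod n" by (metis div_mult_mod_eq)
 thus "kron (1\<^sub>m m) (1\<^sub>m n) $$ (i,j) = (1\<^sub>m (m * n) :: 'a mat) $$ (i,j)"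
  using i j dm[OF i] dm[OF j] by (auto simp: kron_index[of _ m m _ n n])
qed (auto simp: kron_def)

lemma kron_one_left [simp]: "kron (1\<^sub>m 1) X = (X :: 'a::semiring_1 mat)"
proof (rule eq_matI)
 fix i j assume ij: "i < dim_row X" "j < dim_col X"
 show "kron (1\<^sub>m 1) X $$ (i,j) = X $$ (i,j)" using ij
  by (subst kron_index[of _ 1 1 _ "dim_row X" "dim_col X"]) auto
qed (auto simp: kron_def)

lemma kron_one_right [simp]: "kron X (1\<^sub>m 1) = (X :: 'a::semiring_1 mat)"
proof (rule eq_matI)
 fix i j assume ij: "i < dim_row X" "j < dim_col X"
 show "kron X (1\<^sub>m 1) $$ (i,j) = X $$ (i,j)" using ij
  by (subst kron_index[of _ "dim_row X" "dim_col X" _ 1 1]) auto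
qed (auto simp: kron_def)

lemma mod_mult_div: "(i::nat) mod (b * c) div c = i div c mod b"
 using mod_mult2_eq[of i c b] by (cases "c = 0") (auto simp: mult.commute)

lemma kron_assoc:
 fixes A B C :: "'a::semigroup_mult mat"
 shows "kron (kron A B) C = kron A (kron B C)"
proof (rule eq_matI)
 obtain a a' b b' c c' where A: "A \<in> carrier_mat a a'" and B: "B \<in> carrier_mat b b'" and C: "C \<in> carrier_mat c c'"
  by (metis carrier_matI)
 note AB = kron_carrier[OF A B] and BC = kron_carrier[OF B C]
 show d: "dim_row (kron (kron A B) C) = dim_row (kron A (kron B C))"
  "dim_col (kron (kron A B) C) = dim_col (kron A (kron B C))" by (auto simp: kron_def)
 fix i j assume "i < dim_row (kron A (kron B C))" "j < dim_col (kron A (kron B C))"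
 hence i: "i < a * (b * c)" and j: "j < a' * (b' * c')" using kron_carrier[OF A BC] by auto
 have i': "i < a * b * c" and j': "j < a' * b' * c'" using i j by (simp_all add: mult.assoc)
 have "kron (kron A B) C $$ (i,j) = A $$ (i div c div b, j div c' div b') * B $$ (i div c mod b, j div c' mod b') * C $$ (i mod c, j mod c')"
  by (simp add: kron_index[OF AB C i' j'] kron_index[OF A B div_less_dim[OF i'] div_less_dim[OF j']])
 moreover have "kron A (kron B C) $$ (i,j) = A $$ (i div (b * c), j div (b' * c')) *
   (B $$ (i mod (b * c) div c, j mod (b' * c') div c') * C $$ (i mod (b * c) mod c, j mod (b' * c') mod c'))"
  by (simp add: kron_index[OF A BC i j] kron_index[OF B C mod_less_dim[OF i] mod_less_dim[OF j]])
 moreover have "x mod (y * z) mod z = x mod z" "x div (y * z) = x div z div y" for x y z :: nat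
  by (simp_all add: mod_mod_cancel div_mult2_eq mult.commute[of y z])
 ultimately show "kron (kron A B) C $$ (i,j) = kron A (kron B C) $$ (i,j)"
  by (simp add: mod_mult_div mult.assoc)
qed

lemma swap_carrier: "swap_mat m n \<in> carrier_mat (n * m) (m * n)"
 by (auto simp: swap_mat_def)

lemma swap_kron:
 fixes A B :: "'a::comm_semiring_1 mat"
 assumes A: "A \<in> carrier_mat m m'" and B: "B \<in> carrier_mat n n'"
 shows "swap_mat m n * kron A B = kron B A * swap_mat m' n'"
proof (rule eq_matI)
 note K = kron_carrier[OF A B] kron_carrier[OF B A]
 have S: "swap_mat m n \<in> carrier_mat (n * m) (m * n)" "swap_mat m' n' \<in> carrier_mat (n' * m') (m' * n')"
  by (rule swap_carrier)+
 show "dim_row (swap_mat m n * kron A B) = dim_row (kron B A * swap_mat m' n')"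
  "dim_col (swap_mat m n * kron A B) = dim_col (kron B A * swap_mat m' n')"
  using K by (auto simp: swap_mat_def)
 fix i j assume "i < dim_row (kron B A * swap_mat m' n')" "j < dim_col (kron B A * swap_mat m' n')"
 hence i: "i < n * m" and j: "j < m' * n'" using K by (auto simp: swap_mat_def)
 have i': "i div m < n" "i mod m < m" and j': "j div n' < m'" "j mod n' < n'" using dm[OF i] dm[OF j] by auto
 have "(swap_mat m n * kron A B) $$ (i,j) = (\<Sum>k<m * n. swap_mat m n $$ (i,k) * kron A B $$ (k,j))"
  using K i j by (auto simp: scalar_prod_def lessThan_atLeast0 swap_mat_def intro!: sum.cong)
 also have "... = (\<Sum>k<m * n. (if i div m = k mod n \<and> i mod m = k div n then 1 else 0) *
   (A $$ (k div n, j div n') * B $$ (k mod n, j mod n')))"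
  by (intro sum.cong refl) (use i j in \<open>simp add: kron_index[OF A B] swap_mat_def\<close>)
 also have "... = (\<Sum>a<m. \<Sum>c<n. (if i div m = c \<and> i mod m = a then 1 else 0) *
   (A $$ (a, j div n') * B $$ (c, j mod n')))"
  by (rule sum_div_mod)
 also have "... = (\<Sum>a<m. \<Sum>c<n. if c = i div m then (if a = i mod m then A $$ (a, j div n') * B $$ (c, j mod n') else 0) else 0)"
  by (intro sum.cong refl) auto
 also have "... = A $$ (i mod m, j div n') * B $$ (i div m, j mod n')"
  using i' by simp
 finally have 1: "(swap_mat m n * kron A B) $$ (i,j) = A $$ (i mod m, j div n') * B $$ (i div m, j mod n')" .
 have "(kron B A * swap_mat m' n') $$ (i,j) = (\<Sum>k<n' * m'. kron B A $$ (i,k) * swap_mat m' n' $$ (k,j))"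
  using K i j by (auto simp: scalar_prod_def lessThan_atLeast0 swap_mat_def intro!: sum.cong)
 also have "... = (\<Sum>k<n' * m'. (B $$ (i div m, k div m') * A $$ (i mod m, k mod m')) *
   (if k div m' = j mod n' \<and> k mod m' = j div n' then 1 else 0))"
  by (intro sum.cong refl) (use i j in \<open>simp add: kron_index[OF B A] swap_mat_def\<close>)
 also have "... = (\<Sum>c<n'. \<Sum>a<m'. (B $$ (i div m, c) * A $$ (i mod m, a)) *
   (if c = j mod n' \<and> a = j div n' then 1 else 0))"
  by (rule sum_div_mod)
 also have "... = (\<Sum>c<n'. \<Sum>a<m'. if a = j div n' then (if c = j mod n' then B $$ (i div m, c) * A $$ (i mod m, a) else 0) else 0)"
  by (intro sum.cong refl) auto
 also have "... = B $$ (i div m, j mod n') * A $$ (i mod m, j div n')"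
  using j' by simp
 finally show "(swap_mat m n * kron A B) $$ (i,j) = (kron B A * swap_mat m' n') $$ (i,j)"
  using 1 by (simp add: mult.commute)
qed

section \<open>Evaluation of rational matrices\<close>

lemma mat_eval_carrier: "A \<in> carrier_mat m n ==> mat_eval A z \<in> carrier_mat m n"
 by (simp add: mat_eval_def)

lemma mat_eval_index: "A \<in> carrier_mat m n ==> i < m ==> j < n ==> mat_eval A z $$ (i,j) = rat_eval (A $$ (i,j)) z"
 by (auto simp: mat_eval_def)

lemma eventually_mat_eqI:
 assumes "\<And>z. X z \<in> carrier_mat m n" "\<And>z. Y z \<in> carrier_mat m n"
  and "\<And>i j. i < m ==> j < n ==> eventually (%z. X z $$ (i,j) = Y z $$ (i,j)) F"
 shows "eventually (%z. X z = Y z) F"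
proof -
 have "eventually (%z. \<forall>i\<in>{..<m}. \<forall>j\<in>{..<n}. X z $$ (i,j) = Y z $$ (i,j)) F"
  using assms(3) by (intro eventually_ball_finite ballI) auto
 thus ?thesis
 proof eventually_elim
  case (elim z)
  thus ?case using assms(1,2)[of z] by (intro eq_matI) auto
 qed
qed

lemma mat_eval_mult:
 assumes A: "A \<in> carrier_mat m n" and B: "B \<in> carrier_mat n k"
 shows "eventually (%z. mat_eval (A * B) z = mat_eval A z * mat_eval B z) (cosparse U)"
proof (rule eventually_mat_eqI)
 have AB: "A * B \<in> carrier_mat m k" using A B by simp
 show "mat_eval (A * B) z \<in> carrier_mat m k" "mat_eval A z * mat_eval B z \<in> carrier_mat m k" for z
  by (rule mat_eval_carrier[OF AB], rule mult_carrier_mat[OF mat_eval_carrier[OF A] mat_eval_carrier[OF B]])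
 fix i j assume ij: "i < m" "j < k"
 have "eventually (%z. \<forall>r\<in>{..<n}. rat_eval (A $$ (i,r) * B $$ (r,j)) z = rat_eval (A $$ (i,r)) z * rat_eval (B $$ (r,j)) z) (cosparse U)"
  by (intro eventually_ball_finite ballI rat_eval_mult) simp
 moreover have "eventually (%z. rat_eval (\<Sum>r<n. A $$ (i,r) * B $$ (r,j)) z = (\<Sum>r<n. rat_eval (A $$ (i,r) * B $$ (r,j)) z)) (cosparse U)"
  by (rule rat_eval_sum) simp
 ultimately show "eventually (%z. mat_eval (A * B) z $$ (i,j) = (mat_eval A z * mat_eval B z) $$ (i,j)) (cosparse U)"
 proof eventually_elim
  case (elim z)
  have "(mat_eval A z * mat_eval B z) $$ (i,j) = (\<Sum>r<n. mat_eval A z $$ (i,r) * mat_eval B z $$ (r,j))"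
   by (rule mult_index[OF mat_eval_carrier[OF A] mat_eval_carrier[OF B] ij])
  also have "... = (\<Sum>r<n. rat_eval (A $$ (i,r)) z * rat_eval (B $$ (r,j)) z)"
   by (intro sum.cong refl) (simp add: mat_eval_index[OF A] mat_eval_index[OF B] ij)
  finally show ?case using elim by (simp only: mat_eval_index[OF AB ij] mult_index[OF A B ij] lessThan_iff) simp
 qed
qed

lemma mat_eval_add:
 assumes A: "A \<in> carrier_mat m n" and B: "B \<in> carrier_mat m n"
 shows "eventually (%z. mat_eval (A + B) z = mat_eval A z + mat_eval B z) (cosparse U)"
proof (rule eventually_mat_eqI)
 have AB: "A + B \<in> carrier_mat m n" using A B by simp
 note M = mat_eval_carrier[OF A] mat_eval_carrier[OF B]
 show "mat_eval (A + B) z \<in> carrier_mat m n" "mat_eval A z + mat_eval B z \<in> carrier_mat m n" for z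
  using mat_eval_carrier[OF AB] M by auto
 fix i j assume ij: "i < m" "j < n"
 show "eventually (%z. mat_eval (A + B) z $$ (i,j) = (mat_eval A z + mat_eval B z) $$ (i,j)) (cosparse U)"
  using rat_eval_add[of "A $$ (i,j)" "B $$ (i,j)" U]
 proof eventually_elim
  case (elim z)
  have "(mat_eval A z + mat_eval B z) $$ (i,j) = rat_eval (A $$ (i,j)) z + rat_eval (B $$ (i,j)) z"
   using M[of z] ij by (simp add: mat_eval_index[OF A] mat_eval_index[OF B])
  thus ?case using elim A B ij by (simp add: mat_eval_index[OF AB])
 qed
qed

lemma mat_eval_scale:
 assumes A: "A \<in> carrier_mat m n"
 shows "eventually (%z. mat_eval (rat_const c \<cdot>\<^sub>m A) z = c \<cdot>\<^sub>m mat_eval A z) (cosparse U)"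
proof (rule eventually_mat_eqI)
 have cA: "rat_const c \<cdot>\<^sub>m A \<in> carrier_mat m n" using A by simp
 show "mat_eval (rat_const c \<cdot>\<^sub>m A) z \<in> carrier_mat m n" "c \<cdot>\<^sub>m mat_eval A z \<in> carrier_mat m n" for z
  using mat_eval_carrier[OF cA] mat_eval_carrier[OF A] by auto
 fix i j assume ij: "i < m" "j < n"
 show "eventually (%z. mat_eval (rat_const c \<cdot>\<^sub>m A) z $$ (i,j) = (c \<cdot>\<^sub>m mat_eval A z) $$ (i,j)) (cosparse U)"
  using rat_eval_mult[of "rat_const c" "A $$ (i,j)" U]
  by eventually_elim (use A ij in \<open>simp add: mat_eval_def\<close>)
qed

lemma mat_eval_one [simp]: "mat_eval (1\<^sub>m n) z = 1\<^sub>m n"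
 by (rule eq_matI) (auto simp: mat_eval_def)

lemma mat_eval_swap [simp]: "mat_eval (swap_mat m n) z = swap_mat m n"
 by (rule eq_matI) (auto simp: mat_eval_def swap_mat_def)

lemma mat_eval_kron:
 "eventually (%z. mat_eval (kron A B) z = kron (mat_eval A z) (mat_eval B z)) (cosparse U)"
proof -
 obtain m n k l where A: "A \<in> carrier_mat m n" and B: "B \<in> carrier_mat k l" by (metis carrier_matI)
 note AB = kron_carrier[OF A B]
 show ?thesis
 proof (rule eventually_mat_eqI)
  show "mat_eval (kron A B) z \<in> carrier_mat (m * k) (n * l)" "kron (mat_eval A z) (mat_eval B z) \<in> carrier_mat (m * k) (n * l)" for z
   using mat_eval_carrier[OF AB] kron_carrier[OF mat_eval_carrier[OF A] mat_eval_carrier[OF B]] by auto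
  fix i j assume ij: "i < m * k" "j < n * l"
  show "eventually (%z. mat_eval (kron A B) z $$ (i,j) = kron (mat_eval A z) (mat_eval B z) $$ (i,j)) (cosparse U)"
   using rat_eval_mult[of "A $$ (i div k, j div l)" "B $$ (i mod k, j mod l)" U]
   by eventually_elim (simp add: mat_eval_index[OF AB ij] kron_index[OF A B ij]
     kron_index[OF mat_eval_carrier[OF A] mat_eval_carrier[OF B] ij]
     mat_eval_index[OF A] mat_eval_index[OF B] dm[OF ij(1)] dm[OF ij(2)])
 qed
qed

lemma mat_eval_sigma:
 assumes q: "q ~= 0"
 shows "eventually (%z. mat_eval (map_mat (sigma_rat q) A) z = mat_eval A (q * z)) (cosparse U)"
proof -
 obtain m n where A: "A \<in> carrier_mat m n" by (metis carrier_matI)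
 show ?thesis
 proof (rule eventually_mat_eqI)
  show "mat_eval (map_mat (sigma_rat q) A) z \<in> carrier_mat m n" "mat_eval A (q * z) \<in> carrier_mat m n" for z
   using mat_eval_carrier[OF A] mat_eval_carrier[of "map_mat (sigma_rat q) A" m n z] A by auto
  fix i j assume ij: "i < m" "j < n"
  show "eventually (%z. mat_eval (map_mat (sigma_rat q) A) z $$ (i,j) = mat_eval A (q * z) $$ (i,j)) (cosparse U)"
   using rat_eval_sigma[OF q, of "A $$ (i,j)" U]
   by eventually_elim (use A ij in \<open>simp add: mat_eval_def\<close>)
 qed
qed

lemma mat_eval_eqI:
 assumes A: "A \<in> carrier_mat m n" and B: "B \<in> carrier_mat m n"
  and e: "eventually (%z. mat_eval A z = mat_eval B z) (cosparse U)" "U ~= {}"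
 shows "A = B"
proof (rule eq_matI)
 fix i j assume ij: "i < dim_row B" "j < dim_col B"
 have "eventually (%z. rat_eval (A $$ (i,j)) z = rat_eval (B $$ (i,j)) z) (cosparse U)"
  using e(1)
 proof eventually_elim
  case (elim z)
  hence "mat_eval A z $$ (i,j) = mat_eval B z $$ (i,j)" by simp
  thus ?case using A B ij by (simp add: mat_eval_def)
 qed
 thus "A $$ (i,j) = B $$ (i,j)" by (rule rat_eval_eqI[OF _ e(2)])
qed (use A B in auto)

section \<open>Invertible matrices\<close>

lemma GL_carrier: "X \<in> carrier (GL T n) \<longleftrightarrow>
  X \<in> carrier_mat n n \<and> (\<exists>Y\<in>carrier_mat n n. Y * X = 1\<^sub>m n \<and> X * Y = 1\<^sub>m n)"
 by (auto simp: GL_def units_of_def Units_def ring_mat_def)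

lemma GL_simps [simp]: "monoid.mult (GL T n) = (*)" "\<one>\<^bsub>GL T n\<^esub> = 1\<^sub>m n"
 by (simp_all add: GL_def units_of_def ring_mat_def)

lemma GL_group: "group (GL (T :: 'k::field itself) n)"
proof -
 have "ring (ring_mat T n ())" using ring_mat[where ?n = n and ?'a = 'k] by (simp add: ring_mat_def)
 thus ?thesis unfolding GL_def by (intro monoid.units_group ring.is_monoid)
qed

lemma GL_inv:
 assumes "X \<in> carrier_mat n n" "Y \<in> carrier_mat n n" "Y * X = 1\<^sub>m n" "X * Y = 1\<^sub>m n"
 shows "inv\<^bsub>GL T n\<^esub> X = Y"
proof -
 interpret group "GL T n" by (rule GL_group)
 show ?thesis using assms by (intro inv_equality) (auto simp: GL_carrier)
qed

lemma mat_cancel: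
 fixes X :: "'k::field mat"
 assumes "Y * X = 1\<^sub>m m" "X \<in> carrier_mat m m" "Y \<in> carrier_mat m m" "U \<in> carrier_mat m n"
 shows "Y * (X * U) = U"
proof -
 have "Y * (X * U) = (Y * X) * U" by (rule assoc_mult_mat[OF assms(3,2,4), symmetric])
 thus ?thesis using assms(1,4) by simp
qed

lemma mat_cancel_right:
 fixes X :: "'k::field mat"
 assumes "X * Y = 1\<^sub>m m" "X \<in> carrier_mat m m" "Y \<in> carrier_mat m m" "U \<in> carrier_mat n m"
 shows "(U * X) * Y = U"
proof -
 have "(U * X) * Y = U * (X * Y)" by (rule assoc_mult_mat[OF assms(4,2,3)])
 thus ?thesis using assms(1,4) by simp
qed

lemma GL_left_cancel:
 fixes X :: "'k::field mat"
 assumes "Y * X = 1\<^sub>m n" "X \<in> carrier_mat n n" "Y \<in> carrier_mat n n"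
  "U \<in> carrier_mat n m" "V \<in> carrier_mat n m" "X * U = X * V"
 shows "U = V"
proof -
 have "U = Y * (X * U)" by (rule mat_cancel[OF assms(1-3,4), symmetric])
 also have "... = Y * (X * V)" by (rule arg_cong[OF assms(6)])
 also have "... = V" by (rule mat_cancel[OF assms(1-3,5)])
 finally show ?thesis .
qed

section \<open>Matrices with entries in a function algebra\<close>

text \<open>One notion for meromorphic, holomorphic, elliptic, continuous and regular functions: matrix products, determinants and Kronecker products have entries in the same algebra.\<close>
definition alg :: "('a => complex) set => bool" where
 "alg C \<longleftrightarrow> (\<forall>c. (%_. c) \<in> C) \<and> (\<forall>f\<in>C. \<forall>g\<in>C. (%x. f x + g x) \<in> C \<and> (%x. f x * g x) \<in> C)"

definition mat_in :: "('a => complex) set => nat => nat => ('a => complex mat) => bool" where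
 "mat_in C m n X \<longleftrightarrow> (\<forall>z. X z \<in> carrier_mat m n) \<and> (\<forall>i<m. \<forall>j<n. (%z. X z $$ (i,j)) \<in> C)"

lemma mat_inD: "mat_in C m n X ==> X z \<in> carrier_mat m n"
 "mat_in C m n X ==> i < m ==> j < n ==> (%z. X z $$ (i,j)) \<in> C"
 by (auto simp: mat_in_def)

lemma alg_sum: "alg C ==> (\<And>i. i \<in> I ==> f i \<in> C) ==> (%x. \<Sum>i\<in>I. f i x) \<in> C"
 by (induction I rule: infinite_finite_induct) (simp_all add: alg_def)

lemma alg_prod: "alg C ==> (\<And>i. i \<in> I ==> f i \<in> C) ==> (%x. \<Prod>i\<in>I. f i x) \<in> C"
 by (induction I rule: infinite_finite_induct) (simp_all add: alg_def)

lemma alg_mult: "alg C ==> f \<in> C ==> g \<in> C ==> (%x. f x * g x) \<in> C"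
 and alg_add: "alg C ==> f \<in> C ==> g \<in> C ==> (%x. f x + g x) \<in> C"
 and alg_const: "alg C ==> (%x. c) \<in> C"
 by (simp_all add: alg_def)

lemma alg_scale: "alg C ==> f \<in> C ==> (%x. c * f x) \<in> C"
 by (rule alg_mult[OF _ alg_const])

lemma alg_diff: "alg C ==> f \<in> C ==> g \<in> C ==> (%x. f x - g x) \<in> C"
 using alg_add[of C f "%x. - 1 * g x"] alg_scale[of C g "-1"] by simp

lemma mat_in_const: "alg C ==> T \<in> carrier_mat m n ==> mat_in C m n (%_. T)"
 by (simp add: mat_in_def alg_const)

lemma mat_in_mult:
 assumes C: "alg C" and X: "mat_in C m n X" and Y: "mat_in C n k Y"
 shows "mat_in C m k (%z. X z * Y z)"
 unfolding mat_in_def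
proof (intro conjI allI impI)
 show "X z * Y z \<in> carrier_mat m k" for z using mat_inD(1)[OF X, of z] mat_inD(1)[OF Y, of z] by simp
 fix i j assume ij: "i < m" "j < k"
 have "(%z. \<Sum>r<n. X z $$ (i,r) * Y z $$ (r,j)) \<in> C"
  by (intro alg_sum[OF C] alg_mult[OF C] mat_inD(2)[OF X] mat_inD(2)[OF Y]) (use ij in auto)
 thus "(%z. (X z * Y z) $$ (i,j)) \<in> C"
  by (simp only: mult_index[OF mat_inD(1)[OF X] mat_inD(1)[OF Y] ij])
qed

lemma mat_in_kron:
 assumes C: "alg C" and X: "mat_in C m n X" and Y: "mat_in C k l Y"
 shows "mat_in C (m * k) (n * l) (%z. kron (X z) (Y z))"
 unfolding mat_in_def
proof (intro conjI allI impI)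
 show "kron (X z) (Y z) \<in> carrier_mat (m * k) (n * l)" for z
  by (rule kron_carrier[OF mat_inD(1)[OF X] mat_inD(1)[OF Y]])
 fix i j assume ij: "i < m * k" "j < n * l"
 show "(%z. kron (X z) (Y z) $$ (i,j)) \<in> C"
  unfolding kron_index[OF mat_inD(1)[OF X] mat_inD(1)[OF Y] ij]
  by (intro alg_mult[OF C] mat_inD(2)[OF X] mat_inD(2)[OF Y] dm[OF ij(1)] dm[OF ij(2)])
qed

lemma det_in:
 assumes C: "alg C" and X: "mat_in C n n X"
 shows "(%z. det (X z)) \<in> C"
proof -
 have "(%z. \<Sum>p\<in>{p. p permutes {0..<n}}. signof p * (\<Prod>i=0..<n. X z $$ (i, p i))) \<in> C"
 proof (intro alg_sum[OF C] alg_scale[OF C] alg_prod[OF C] mat_inD(2)[OF X])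
  fix p i assume "p \<in> {p. p permutes {0..<n}}" "i \<in> {0..<n}"
  thus "i < n" "p i < n" using permutes_in_image[of p "{0..<n}" i] by simp_all
 qed
 thus ?thesis by (simp only: det_def'[OF mat_inD(1)[OF X]])
qed

lemma adj_in:
 assumes C: "alg C" and X: "mat_in C n n X"
 shows "mat_in C n n (%z. adj_mat (X z))"
 unfolding mat_in_def
proof (intro conjI allI impI)
 show "adj_mat (X z) \<in> carrier_mat n n" for z by (rule adj_mat(1)[OF mat_inD(1)[OF X]])
 fix i j assume ij: "i < n" "j < n"
 have "mat_in C (n - 1) (n - 1) (%z. mat_delete (X z) j i)"
  unfolding mat_in_def
 proof (intro conjI allI impI)
  show "mat_delete (X z) j i \<in> carrier_mat (n - 1) (n - 1)" for z
   using mat_inD(1)[OF X, of z] by (auto simp: mat_delete_def)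
  fix k l assume kl: "k < n - 1" "l < n - 1"
  have "mat_delete (X z) j i $$ (k,l) = X z $$ (if k < j then k else Suc k, if l < i then l else Suc l)" for z
   using mat_inD(1)[OF X, of z] kl by (auto simp: mat_delete_def)
  thus "(%z. mat_delete (X z) j i $$ (k,l)) \<in> C"
   using mat_inD(2)[OF X] kl by (simp add: less_diff_conv)
 qed
 hence "(%z. (-1) ^ (j + i) * det (mat_delete (X z) j i)) \<in> C"
  by (intro alg_scale[OF C] det_in[OF C])
 moreover have "adj_mat (X z) $$ (i,j) = (-1) ^ (j + i) * det (mat_delete (X z) j i)" for z
  using mat_inD(1)[OF X, of z] ij by (simp add: adj_mat_def cofactor_def)
 ultimately show "(%z. adj_mat (X z) $$ (i,j)) \<in> C" by simp
qed

lemma smult_smult_one: "c ~= 0 ==> inverse (c :: complex) \<cdot>\<^sub>m (c \<cdot>\<^sub>m 1\<^sub>m n) = 1\<^sub>m n"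
 by (rule eq_matI) auto

lemma GL_det: "(X :: complex mat) \<in> carrier (GL T n) \<longleftrightarrow> X \<in> carrier_mat n n \<and> det X ~= 0"
proof
 assume "X \<in> carrier (GL T n)"
 then obtain Y where Y: "X \<in> carrier_mat n n" "Y \<in> carrier_mat n n" "X * Y = 1\<^sub>m n" by (auto simp: GL_carrier)
 hence "det X * det Y = 1" using det_mult[of X n Y] by simp
 thus "X \<in> carrier_mat n n \<and> det X ~= 0" using Y by auto
next
 assume X: "X \<in> carrier_mat n n \<and> det X ~= 0"
 define Y where "Y = inverse (det X) \<cdot>\<^sub>m adj_mat X"
 have a: "X * adj_mat X = det X \<cdot>\<^sub>m 1\<^sub>m n" "adj_mat X * X = det X \<cdot>\<^sub>m 1\<^sub>m n" "adj_mat X \<in> carrier_mat n n"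
  using adj_mat[of X n] X by auto
 have "Y \<in> carrier_mat n n" using a by (simp add: Y_def)
 moreover have "X * Y = 1\<^sub>m n"
  using X a mult_smult_distrib[of X n n "adj_mat X" n] by (simp add: Y_def smult_smult_one)
 moreover have "Y * X = 1\<^sub>m n"
  using X a mult_smult_assoc_mat[of "adj_mat X" n n X n] by (simp add: Y_def smult_smult_one)
 ultimately show "X \<in> carrier (GL T n)" using X by (auto simp: GL_carrier)
qed

lemma GL_inv_adj:
 assumes "(X :: complex mat) \<in> carrier_mat n n" "det X ~= 0"
 shows "inv\<^bsub>GL T n\<^esub> X = inverse (det X) \<cdot>\<^sub>m adj_mat X"
proof (rule GL_inv)
 have a: "X * adj_mat X = det X \<cdot>\<^sub>m 1\<^sub>m n" "adj_mat X * X = det X \<cdot>\<^sub>m 1\<^sub>m n" "adj_mat X \<in> carrier_mat n n"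
  using adj_mat[of X n] assms by auto
 show "X \<in> carrier_mat n n" "inverse (det X) \<cdot>\<^sub>m adj_mat X \<in> carrier_mat n n" using assms a by auto
 show "X * (inverse (det X) \<cdot>\<^sub>m adj_mat X) = 1\<^sub>m n"
  using assms a mult_smult_distrib[of X n n "adj_mat X" n] by (simp add: smult_smult_one)
 show "inverse (det X) \<cdot>\<^sub>m adj_mat X * X = 1\<^sub>m n"
  using assms a mult_smult_assoc_mat[of "adj_mat X" n n X n] by (simp add: smult_smult_one)
qed

lemma alg_mero: "alg {f. f meromorphic_on U}"
 unfolding alg_def by (auto intro!: meromorphic_intros)

lemma alg_hol: "alg {f. f holomorphic_on U}"
 unfolding alg_def by (auto intro!: holomorphic_intros)

lemma alg_cont: "alg {f. isCont f (a::complex)}"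
 unfolding alg_def by (auto intro!: continuous_intros)

lemma alg_lim: "alg {f. \<exists>L. (f \<longlongrightarrow> L) (at (a::complex))}"
 unfolding alg_def
proof (intro conjI allI ballI; unfold mem_Collect_eq; (elim exE)?)
 show "\<exists>L. ((%_. c) \<longlongrightarrow> L) (at a)" for c :: complex by (rule exI[of _ c], rule tendsto_const)
 show "\<exists>L. ((%x. f x + g x) \<longlongrightarrow> L) (at a)" if "(f \<longlongrightarrow> K) (at a)" "(g \<longlongrightarrow> L) (at a)" for f g :: "complex => complex" and K L
  by (rule exI[of _ "K + L"], rule tendsto_add[OF that])
 show "\<exists>L. ((%x. f x * g x) \<longlongrightarrow> L) (at a)" if "(f \<longlongrightarrow> K) (at a)" "(g \<longlongrightarrow> L) (at a)" for f g :: "complex => complex" and K L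
  by (rule exI[of _ "K * L"], rule tendsto_mult[OF that])
qed

abbreviation "mero U \<equiv> {f :: complex => complex. f meromorphic_on U}"

lemma mero_mat_iff: "mero_mat U n M \<longleftrightarrow> mat_in (mero U) n n M"
 by (simp add: mero_mat_def mat_in_def)

lemma mat_eval_mero: "A \<in> carrier_mat m n ==> h meromorphic_on U ==> mat_in (mero U) m n (%z. mat_eval A (h z))"
 by (auto simp: mat_in_def mat_eval_carrier mat_eval_index intro: rat_eval_meromorphic)

section \<open>Properties that hold outside a sparse set\<close>

lemma cos_at: "open U ==> eventually Q (cosparse U) \<longleftrightarrow> (\<forall>a\<in>U. eventually Q (at (a::complex)))"
 by (simp add: eventually_cosparse_open_eq)

lemma cos_at0: "eventually Q (cosparse (- {0})) \<longleftrightarrow> (\<forall>a. a ~= 0 --> eventually Q (at (a::complex)))"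
proof -
 have "open (- {0 :: complex})" by (simp add: open_Compl)
 from cos_at[OF this, of Q] show ?thesis by (metis ComplD ComplI singletonD singletonI)
qed

lemma cos_compose:
 fixes U V :: "complex set"
 assumes U: "open U" "open V" and Q: "eventually Q (cosparse U)"
  and h: "\<And>a. a \<in> V ==> h a \<in> U \<and> filterlim h (at (h a)) (at a)"
 shows "eventually (%z. Q (h z)) (cosparse (V :: complex set))"
 unfolding cos_at[OF U(2)]
proof
 fix a assume a: "a \<in> V"
 have "eventually Q (at (h a))" using Q[unfolded cos_at[OF U(1)]] h[OF a] by blast
 thus "eventually (%z. Q (h z)) (at a)" by (rule eventually_compose_filterlim[OF _ conjunct2[OF h[OF a]]])
qed

lemma cos_inverse: "eventually Q (cosparse (- {0})) ==> eventually (%z. Q (inverse z)) (cosparse (- {0 :: complex}))"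
 by (rule cos_compose[of "- {0}"]) (use inverse_tendsto_at in auto)

lemma scale_tendsto_at: "c ~= 0 ==> filterlim (%z. c * z) (at (c * a)) (at (a::complex))"
 unfolding filterlim_at by (auto intro!: tendsto_intros simp: eventually_at_filter)

lemma cos_scale: "c ~= 0 ==> eventually Q (cosparse (- {0})) ==> eventually (%z. Q (c * z)) (cosparse (- {0 :: complex}))"
 by (rule cos_compose[of "- {0}"]) (use scale_tendsto_at in auto)

lemma cos_scale_UNIV: "c ~= 0 ==> eventually Q (cosparse UNIV) ==> eventually (%z. Q (c * z)) (cosparse (UNIV :: complex set))"
 by (rule cos_compose[of UNIV]) (use scale_tendsto_at in auto)

lemma cos_sub: "eventually Q (cosparse UNIV) ==> eventually Q (cosparse (U :: complex set))"
 by (rule cosparse_mono[OF subset_UNIV])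

lemma cos_nz: "eventually (%z. z ~= 0) (cosparse (U :: complex set))"
 by (rule cos_sub) (auto simp: cos_at intro!: eventually_neq_at_within)

lemma cos_True: "eventually (%z. c) (cosparse (U :: complex set)) ==> U ~= {} ==> c"
 using cosparse_not_false[of U] by (cases c) auto

context punctures
begin

lemma cos_W: "eventually (%z. z \<in> W) (cosparse (- {0}))"
 by (simp add: cos_at0 eventually_W)

lemma W_eqI:
 assumes "f holomorphic_on W" "g holomorphic_on W" "eventually (%z. f z = g z) (cosparse (- {0}))" "z \<in> W"
 shows "f z = g z"
proof -
 have "isCont f z" "isCont g z" using assms W_open
  by (auto intro!: continuous_on_interior[OF holomorphic_on_imp_continuous_on] simp: interior_open)
 hence l: "(f \<longlongrightarrow> f z) (at z)" "(g \<longlongrightarrow> g z) (at z)" by (simp_all add: isCont_def)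
 have "eventually (%z. f z = g z) (at z)" using assms(3) W_nz[OF assms(4)] unfolding cos_at0 by blast
 hence "(g \<longlongrightarrow> f z) (at z)" by (rule Lim_transform_eventually[OF l(1)])
 thus ?thesis using l(2) by (intro tendsto_unique[of "at z" g]) auto
qed

lemma W_mat_eqI:
 assumes X: "mat_in {f. f holomorphic_on W} m n X" and Y: "mat_in {f. f holomorphic_on W} m n Y"
  and e: "eventually (%z. X z = Y z) (cosparse (- {0}))" and z: "z \<in> W"
 shows "X z = Y z"
proof (rule eq_matI)
 fix i j assume "i < dim_row (Y z)" "j < dim_col (Y z)"
 hence ij: "i < m" "j < n" using mat_inD(1)[OF Y, of z] by auto
 show "X z $$ (i,j) = Y z $$ (i,j)"
 proof (rule W_eqI[of "%z. X z $$ (i,j)" "%z. Y z $$ (i,j)"])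
  show "eventually (%z. X z $$ (i,j) = Y z $$ (i,j)) (cosparse (- {0}))"
   using e by eventually_elim simp
 qed (use mat_inD(2)[OF X ij] mat_inD(2)[OF Y ij] z in auto)
qed (use mat_inD(1)[OF X, of z] mat_inD(1)[OF Y, of z] in auto)

text \<open>Invariance moves every point close to \<open>0\<close>, where a meromorphic function has no other singularities. So the function is holomorphic on the punctured plane after removal of singularities.\<close>
lemma mero_const:
 assumes f: "f meromorphic_on UNIV" and inv: "eventually (%z. f (q * z) = f z) (cosparse (- {0}))"
 shows "\<exists>c. eventually (%z. f z = c) (cosparse UNIV)"
proof -
 have fm: "isolated_singularity_at f z" for z
  using meromorphic_on_subset[OF f, of "{z}"] by (simp add: meromorphic_at_iff)
 from fm[of 0] obtain r where r: "r > 0" "f analytic_on ball 0 r - {0}"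
  unfolding isolated_singularity_at_def by (elim exE conjE)
 have invk: "eventually (%z. f (q ^ k * z) = f z) (cosparse (- {0}))" for k
 proof (induction k)
  case (Suc k)
  have "eventually (%z. f (q * (q ^ k * z)) = f (q ^ k * z)) (cosparse (- {0}))"
   by (rule cos_scale[OF _ inv]) simp
  with Suc show ?case by eventually_elim (simp add: mult.assoc)
 qed simp
 have lim: "\<exists>L. (f \<longlongrightarrow> L) (at z)" if z: "z ~= 0" for z
 proof -
  obtain k where k: "norm z / r < norm q ^ k" using real_arch_pow[OF q] by blast
  define y where "y = z / q ^ k"
  have y: "z = q ^ k * y" "y ~= 0" using z by (simp_all add: y_def)
  have "norm z < r * norm q ^ k" using k r(1) by (simp add: pos_divide_less_eq mult.commute)
  hence "norm y < r" using q z by (simp add: y_def norm_divide norm_power pos_divide_less_eq)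
  hence "f analytic_on {y}" using y(2) by (intro analytic_on_subset[OF r(2)]) auto
  hence "(f \<longlongrightarrow> f y) (at y)" by (intro isContD analytic_at_imp_isCont)
  moreover have "eventually (%w. f w = f (q ^ k * w)) (at y)"
   using invk[of k, unfolded cos_at0, rule_format, OF y(2)] by eventually_elim (rule sym)
  ultimately have 1: "((%w. f (q ^ k * w)) \<longlongrightarrow> f y) (at y)" by (rule Lim_transform_eventually)
  have "filterlim (%w. inverse (q ^ k) * w) (at (inverse (q ^ k) * z)) (at z)" by (rule scale_tendsto_at) simp
  moreover have "inverse (q ^ k) * z = y" by (simp add: y_def divide_inverse)
  ultimately have "filterlim (%w. inverse (q ^ k) * w) (at y) (at z)" by simp
  from filterlim_compose[OF 1 this] show ?thesis by (simp add: mult.assoc[symmetric]) (rule exI)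
 qed
 define h where "h = remove_sings f"
 have fh: "(f \<longlongrightarrow> h z) (at z)" if z: "z ~= 0" for z
 proof -
  obtain L where L: "(f \<longlongrightarrow> L) (at z)" using lim[OF z] ..
  thus ?thesis using remove_sings_eqI[OF L] by (simp add: h_def)
 qed
 have "h holomorphic_on - {0}"
 proof (rule analytic_imp_holomorphic, subst analytic_on_analytic_at, rule ballI)
  fix z :: complex assume "z \<in> - {0}"
  hence "z ~= 0" by simp
  from remove_sings_analytic_at[OF fm fh[OF this]] show "h analytic_on {z}" by (simp add: h_def)
 qed
 moreover have "h (q * z) = h z" if z: "z ~= 0" for z
 proof -
  have "((%w. f (q * w)) \<longlongrightarrow> h (q * z)) (at z)"
   using filterlim_compose[OF fh[of "q * z"] scale_tendsto_at[of q z]] z by simp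
  moreover have "eventually (%w. f (q * w) = f w) (at z)" using inv z unfolding cos_at0 by blast
  ultimately have "(f \<longlongrightarrow> h (q * z)) (at z)" by (rule Lim_transform_eventually)
  with fh[OF z] show ?thesis by (intro tendsto_unique[of "at z" f]) auto
 qed
 ultimately obtain c where c: "\<And>z. z ~= 0 ==> h z = c" by (rule invariant_imp_constant) blast+
 have "eventually (%z. h z = f z) (cosparse UNIV)" unfolding h_def by (rule eventually_remove_sings_eq[OF f])
 with cos_nz have "eventually (%z. f z = c) (cosparse UNIV)" by eventually_elim (use c in metis)
 thus ?thesis by (rule exI)
qed

lemma const_mat:
 assumes X: "mat_in (mero UNIV) m n X" and inv: "eventually (%z. X (q * z) = X z) (cosparse (- {0}))"
 shows "\<exists>T\<in>carrier_mat m n. eventually (%z. X z = T) (cosparse UNIV)"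
proof -
 define c where "c i j = (SOME c. eventually (%z. X z $$ (i,j) = c) (cosparse UNIV))" for i j
 have c: "eventually (%z. X z $$ (i,j) = c i j) (cosparse UNIV)" if ij: "i < m" "j < n" for i j
 proof -
  have "(%z. X z $$ (i,j)) meromorphic_on UNIV" using mat_inD(2)[OF X ij] by simp
  moreover have "eventually (%z. X (q * z) $$ (i,j) = X z $$ (i,j)) (cosparse (- {0}))"
   using inv by eventually_elim simp
  ultimately show ?thesis unfolding c_def by (rule someI_ex[OF mero_const])
 qed
 have "eventually (%z. X z = mat m n (%(i,j). c i j)) (cosparse UNIV)"
  by (rule eventually_mat_eqI[of _ m n]) (use mat_inD(1)[OF X] c in auto)
 thus ?thesis by (intro bexI[of _ "mat m n (%(i,j). c i j)"]) auto
qed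

section \<open>Normalized connection data\<close>

text \<open>A commuting family of elliptic matrices, normalized at the base point.\<close>
definition cfam :: "nat => (complex => complex mat) => bool" where
 "cfam n P \<longleftrightarrow> mat_in {f. EE f} n n P \<and> (\<forall>z\<in>W. P z \<in> carrier (GLC n)) \<and>
  (\<forall>z\<in>W. \<forall>w\<in>W. P z * P w = P w * P z) \<and> P b = 1\<^sub>m n"

text \<open>Normalized data of an abelian regular system \<open>A\<close>: solutions \<open>M\<close> at \<open>0\<close> and \<open>N\<close> at \<open>\<infinity>\<close>, and the connection matrix \<open>P\<close>.\<close>
definition cdata :: "ratfun mat => nat => (complex => complex mat) => (complex => complex mat) => (complex => complex mat) => bool" where
 "cdata A n M N P \<longleftrightarrow> A \<in> carrier (GL TYPE(ratfun) n) \<and> sol_zero q n A M \<and> sol_inf q n A N \<and>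
  cfam n P \<and> (\<forall>\<^sub>\<approx>z\<in>- {0}. M z = N z * P z)"

lemma alg_EE: "alg {f. EE f}"
 unfolding alg_def EE_def by (auto intro!: holomorphic_intros meromorphic_intros)

lemma EE_hol: "mat_in {f. EE f} m n X ==> mat_in {f. f holomorphic_on W} m n X"
 by (auto simp: mat_in_def EE_def)

lemma mero_GL_D:
 assumes "mero_GL UNIV n M"
 shows "mat_in (mero UNIV) n n M" "\<exists>Mi. mat_in (mero UNIV) n n Mi \<and> (\<forall>\<^sub>\<approx>z\<in>UNIV. M z * Mi z = 1\<^sub>m n \<and> Mi z * M z = 1\<^sub>m n)"
 using assms unfolding mero_GL_def mero_mat_iff by blast+

lemma cdata_D:
 assumes "cdata A n M N P"
 shows "A \<in> carrier_mat n n" "mat_in (mero UNIV) n n M" "mat_in (mero UNIV) n n (%w. N (inverse w))"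
  "\<And>z. M z \<in> carrier_mat n n" "\<And>z. N z \<in> carrier_mat n n" "\<And>z. P z \<in> carrier_mat n n" "\<And>z. mat_eval A z \<in> carrier_mat n n"
  "mat_in {f. EE f} n n P"
  "\<forall>\<^sub>\<approx>z\<in>UNIV. M (q * z) = mat_eval A z * M z" "\<forall>\<^sub>\<approx>z\<in>- {0}. N (q * z) = mat_eval A z * N z"
  "\<forall>\<^sub>\<approx>z\<in>- {0}. M z = N z * P z"
  "\<exists>Mi. mat_in (mero UNIV) n n Mi \<and> (\<forall>\<^sub>\<approx>z\<in>UNIV. M z * Mi z = 1\<^sub>m n \<and> Mi z * M z = 1\<^sub>m n)"
  "\<exists>Ni. mat_in (mero UNIV) n n Ni \<and> (\<forall>\<^sub>\<approx>z\<in>- {0}. N z * Ni (inverse z) = 1\<^sub>m n \<and> Ni (inverse z) * N z = 1\<^sub>m n)"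
proof -
 have Mz: "mero_GL UNIV n M" and Ni: "mero_GL UNIV n (%w. N (inverse w))" and A: "A \<in> carrier (GL TYPE(ratfun) n)"
  and cf: "cfam n P"
  using assms by (auto simp: cdata_def sol_zero_def sol_inf_def mero_GL_inf_def)
 show A': "A \<in> carrier_mat n n" using A by (simp add: GL_carrier)
 show M: "mat_in (mero UNIV) n n M" and N: "mat_in (mero UNIV) n n (%w. N (inverse w))"
  by (rule mero_GL_D(1)[OF Mz], rule mero_GL_D(1)[OF Ni])
 show P: "mat_in {f. EE f} n n P" using cf by (simp add: cfam_def)
 show "M z \<in> carrier_mat n n" for z by (rule mat_inD(1)[OF M])
 show "N z \<in> carrier_mat n n" for z using mat_inD(1)[OF N, of "inverse z"] by simp
 show "P z \<in> carrier_mat n n" for z by (rule mat_inD(1)[OF P])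
 show "mat_eval A z \<in> carrier_mat n n" for z by (rule mat_eval_carrier[OF A'])
 show "\<forall>\<^sub>\<approx>z\<in>UNIV. M (q * z) = mat_eval A z * M z" "\<forall>\<^sub>\<approx>z\<in>- {0}. N (q * z) = mat_eval A z * N z"
  "\<forall>\<^sub>\<approx>z\<in>- {0}. M z = N z * P z"
  using assms by (auto simp: cdata_def sol_zero_def sol_inf_def)
 show "\<exists>Mi. mat_in (mero UNIV) n n Mi \<and> (\<forall>\<^sub>\<approx>z\<in>UNIV. M z * Mi z = 1\<^sub>m n \<and> Mi z * M z = 1\<^sub>m n)"
  by (rule mero_GL_D(2)[OF Mz])
 from mero_GL_D(2)[OF Ni] obtain Y where Y: "mat_in (mero UNIV) n n Y"
  "\<forall>\<^sub>\<approx>w\<in>UNIV. N (inverse w) * Y w = 1\<^sub>m n \<and> Y w * N (inverse w) = 1\<^sub>m n" by (elim exE conjE)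
 from cos_inverse[OF cos_sub[OF Y(2)]]
 have "\<forall>\<^sub>\<approx>z\<in>- {0}. N z * Y (inverse z) = 1\<^sub>m n \<and> Y (inverse z) * N z = 1\<^sub>m n" by simp
 with Y(1) show "\<exists>Ni. mat_in (mero UNIV) n n Ni \<and> (\<forall>\<^sub>\<approx>z\<in>- {0}. N z * Ni (inverse z) = 1\<^sub>m n \<and> Ni (inverse z) * N z = 1\<^sub>m n)"
  by (intro exI[of _ Y] conjI)
qed

lemma conj_invariant:
 fixes X X' :: "complex => complex mat"
 assumes X: "\<And>z. X z \<in> carrier_mat n n" "\<And>z. X' z \<in> carrier_mat m m" "\<And>z. Y z \<in> carrier_mat m m"
  and A: "\<And>z. A z \<in> carrier_mat n n" "\<And>z. B z \<in> carrier_mat m m" "\<And>z. F z \<in> carrier_mat m n"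
  and Y: "\<forall>\<^sub>\<approx>z\<in>- {0}. X' z * Y z = 1\<^sub>m m \<and> Y z * X' z = 1\<^sub>m m"
  and XA: "\<forall>\<^sub>\<approx>z\<in>- {0}. X (q * z) = A z * X z" and XB: "\<forall>\<^sub>\<approx>z\<in>- {0}. X' (q * z) = B z * X' z"
  and F: "\<forall>\<^sub>\<approx>z\<in>- {0}. F (q * z) * A z = B z * F z"
 shows "\<forall>\<^sub>\<approx>z\<in>- {0}. Y (q * z) * (F (q * z) * X (q * z)) = Y z * (F z * X z)"
 using Y cos_scale[OF q_nz Y] XA XB F
proof eventually_elim
 case (elim z)
 note c = X A
 have FX: "F z * X z \<in> carrier_mat m n" using c by (intro mult_carrier_mat)
 have YFX: "Y z * (F z * X z) \<in> carrier_mat m n" using c FX by (intro mult_carrier_mat)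
 have "F (q * z) * X (q * z) = F (q * z) * (A z * X z)" using elim(3) by simp
 also have "... = (F (q * z) * A z) * X z" by (rule assoc_mult_mat[OF c(6) c(4) c(1), symmetric])
 also have "... = (B z * F z) * X z" using elim(5) by simp
 also have "... = B z * (F z * X z)" by (rule assoc_mult_mat[OF c(5) c(6) c(1)])
 also have "F z * X z = X' z * (Y z * (F z * X z))"
  by (rule mat_cancel[OF _ c(3) c(2) FX, symmetric]) (use elim(1) in simp)
 also have "B z * (X' z * (Y z * (F z * X z))) = (B z * X' z) * (Y z * (F z * X z))"
  by (rule assoc_mult_mat[OF c(5) c(2) YFX, symmetric])
 also have "B z * X' z = X' (q * z)" using elim(4) by simp
 finally have "F (q * z) * X (q * z) = X' (q * z) * (Y z * (F z * X z))" .
 thus ?case using mat_cancel[OF conjunct2[OF elim(2)] c(2) c(3) YFX] by simp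
qed

text \<open>The matrix of \<open>F\<close> in the frames at \<open>0\<close> is a constant \<open>T\<close>, and in the frames at \<open>\<infinity>\<close> a constant \<open>T'\<close>, by \<open>const_mat\<close> in both charts; these satisfy \<open>T' P = P' T\<close>, and the base point shows \<open>T = T'\<close>.\<close>
lemma cdata_mor:
 assumes dA: "cdata A n M N P" and dB: "cdata B m M' N' P'"
  and F: "F \<in> carrier_mat m n" "map_mat (sigma_rat q) F * A = B * F"
 shows "\<exists>T\<in>carrier_mat m n. (\<forall>\<^sub>\<approx>z\<in>UNIV. mat_eval F z * M z = M' z * T) \<and> (\<forall>z\<in>W. T * P z = P' z * T)"
proof -
 note a = cdata_D[OF dA] and d = cdata_D[OF dB]
 note Fc = mat_eval_carrier[OF F(1)]
 have sF: "map_mat (sigma_rat q) F \<in> carrier_mat m n" using F(1) by simp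
 have "\<forall>\<^sub>\<approx>z\<in>- {0}. mat_eval F (q * z) * mat_eval A z = mat_eval B z * mat_eval F z"
  using mat_eval_mult[OF sF a(1), of "- {0}"] mat_eval_mult[OF d(1) F(1), of "- {0}"] mat_eval_sigma[OF q_nz, of F "- {0}"]
  by eventually_elim (simp add: F(2))
 note FE = this
 from d(12) obtain Mi where Mi: "mat_in (mero UNIV) m m Mi" "\<forall>\<^sub>\<approx>z\<in>UNIV. M' z * Mi z = 1\<^sub>m m \<and> Mi z * M' z = 1\<^sub>m m"
  by (elim exE conjE)
 from d(13) obtain Ni where Ni: "mat_in (mero UNIV) m m Ni" "\<forall>\<^sub>\<approx>z\<in>- {0}. N' z * Ni (inverse z) = 1\<^sub>m m \<and> Ni (inverse z) * N' z = 1\<^sub>m m"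
  by (elim exE conjE)
 note Mic = mat_inD(1)[OF Mi(1)] and Nic = mat_inD(1)[OF Ni(1)]
 define U where "U z = Mi z * (mat_eval F z * M z)" for z
 define V where "V z = Ni (inverse z) * (mat_eval F z * N z)" for z
 have Uc: "U z \<in> carrier_mat m n" for z unfolding U_def using Mic Fc a(4) by (intro mult_carrier_mat)
 have Vc: "V z \<in> carrier_mat m n" for z unfolding V_def using Nic Fc a(5) by (intro mult_carrier_mat)
 have "mat_in (mero UNIV) m n U" unfolding U_def
  by (rule mat_in_mult[OF alg_mero Mi(1) mat_in_mult[OF alg_mero mat_eval_mero[OF F(1), of "%z. z"] a(2)]])
   (intro meromorphic_intros)
 moreover have "\<forall>\<^sub>\<approx>z\<in>- {0}. U (q * z) = U z" unfolding U_def
  by (rule conj_invariant[OF a(4) d(4) Mic a(7) d(7) Fc cos_sub[OF Mi(2)] cos_sub[OF a(9)] cos_sub[OF d(9)] FE])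
 ultimately obtain T where T: "T \<in> carrier_mat m n" "\<forall>\<^sub>\<approx>z\<in>UNIV. U z = T" using const_mat by blast
 have V1: "\<forall>\<^sub>\<approx>z\<in>- {0}. V (q * z) = V z" unfolding V_def
  by (rule conj_invariant[OF a(5) d(5) Nic a(7) d(7) Fc Ni(2) a(10) d(10) FE])
 have "mat_in (mero UNIV) m n (%w. Ni w * (mat_eval F (inverse w) * N (inverse w)))"
  by (rule mat_in_mult[OF alg_mero Ni(1) mat_in_mult[OF alg_mero mat_eval_mero[OF F(1)] a(3)]])
   (intro meromorphic_intros)
 hence "mat_in (mero UNIV) m n (%w. V (inverse w))" by (simp add: V_def)
 moreover have "\<forall>\<^sub>\<approx>w\<in>- {0}. V (inverse (q * w)) = V (inverse w)"
  using cos_scale[OF q_nz cos_inverse[OF V1]]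
  by eventually_elim (simp add: mult.assoc[symmetric])
 ultimately obtain T' where T': "T' \<in> carrier_mat m n" "\<forall>\<^sub>\<approx>w\<in>UNIV. V (inverse w) = T'"
  using const_mat[of m n "%w. V (inverse w)"] by blast
 have VT: "\<forall>\<^sub>\<approx>z\<in>- {0}. V z = T'" using cos_inverse[OF cos_sub[OF T'(2)]] by simp
 have FM: "\<forall>\<^sub>\<approx>z\<in>UNIV. mat_eval F z * M z = M' z * T"
  using Mi(2) T(2)
 proof eventually_elim
  case (elim z)
  have "M' z * U z = mat_eval F z * M z"
   unfolding U_def by (rule mat_cancel[OF conjunct1[OF elim(1)] Mic d(4)]) (rule mult_carrier_mat[OF Fc a(4)])
  thus ?case using elim(2) by simp
 qed
 have FN: "\<forall>\<^sub>\<approx>z\<in>- {0}. mat_eval F z * N z = N' z * T'"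
  using Ni(2) VT
 proof eventually_elim
  case (elim z)
  have "N' z * V z = mat_eval F z * N z"
   unfolding V_def by (rule mat_cancel[OF conjunct1[OF elim(1)] Nic d(5)]) (rule mult_carrier_mat[OF Fc a(5)])
  thus ?case using elim(2) by simp
 qed
 have "\<forall>\<^sub>\<approx>z\<in>- {0}. T' * P z = P' z * T"
  using cos_sub[OF FM] FN a(11) d(11) Ni(2)
 proof eventually_elim
  case (elim z)
  have 1: "T' * P z \<in> carrier_mat m n" "P' z * T \<in> carrier_mat m n"
   by (rule mult_carrier_mat[OF T'(1) a(6)], rule mult_carrier_mat[OF d(6) T(1)])
  have "N' z * (T' * P z) = (N' z * T') * P z" by (rule assoc_mult_mat[OF d(5) T'(1) a(6), symmetric])
  also have "... = (mat_eval F z * N z) * P z" using elim(2) by simp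
  also have "... = mat_eval F z * (N z * P z)" by (rule assoc_mult_mat[OF Fc a(5) a(6)])
  also have "... = M' z * T" using elim(1,3) by simp
  also have "... = (N' z * P' z) * T" using elim(4) by simp
  also have "... = N' z * (P' z * T)" by (rule assoc_mult_mat[OF d(5) d(6) T(1)])
  finally show ?case by (rule GL_left_cancel[OF conjunct2[OF elim(5)] d(5) Nic 1])
 qed
 hence TP: "T' * P z = P' z * T" if z: "z \<in> W" for z
  by (rule W_mat_eqI[OF mat_in_mult[OF alg_hol mat_in_const[OF alg_hol T'(1)] EE_hol[OF a(8)]]
     mat_in_mult[OF alg_hol EE_hol[OF d(8)] mat_in_const[OF alg_hol T(1)]] _ z])
 have "P b = 1\<^sub>m n" "P' b = 1\<^sub>m m" using dA dB by (auto simp: cdata_def cfam_def)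
 \<comment> \<open>The normalization at the base point makes the two constants equal.\<close>
 with TP[OF b_W] T(1) T'(1) have "T' = T" by simp
 with T(1) FM TP show ?thesis by blast
qed

lemma sphere_mat:
 assumes X: "mat_in (mero UNIV) m n X" and Y: "mat_in (mero UNIV) m n Y"
  and e: "\<forall>\<^sub>\<approx>z\<in>- {0}. X z = Y (inverse z)"
 shows "\<exists>F\<in>carrier_mat m n. \<forall>\<^sub>\<approx>z\<in>UNIV. mat_eval F z = X z"
proof -
 define r where "r i j = (SOME r. eventually (%z. rat_eval r z = X z $$ (i,j)) (cosparse UNIV))" for i j
 have r: "eventually (%z. rat_eval (r i j) z = X z $$ (i,j)) (cosparse UNIV)" if ij: "i < m" "j < n" for i j
 proof -
  have "eventually (%z. X z $$ (i,j) = Y (inverse z) $$ (i,j)) (cosparse (- {0}))"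
   using e by eventually_elim simp
  with mat_inD(2)[OF X ij] mat_inD(2)[OF Y ij] show ?thesis unfolding r_def
   by (intro someI_ex[OF meromorphic_on_sphere_imp_rational]) auto
 qed
 define F where "F = mat m n (%(i,j). r i j)"
 have F: "F \<in> carrier_mat m n" by (simp add: F_def)
 have "\<forall>\<^sub>\<approx>z\<in>UNIV. mat_eval F z = X z"
 proof (rule eventually_mat_eqI[OF mat_eval_carrier[OF F] mat_inD(1)[OF X]])
  fix i j assume ij: "i < m" "j < n"
  show "eventually (%z. mat_eval F z $$ (i,j) = X z $$ (i,j)) (cosparse UNIV)"
   using r[OF ij] ij by (simp add: mat_eval_index[OF F ij]) (simp add: F_def)
 qed
 with F show ?thesis by blast
qed

text \<open>The same matrix function is \<open>M' T M\<inverse>\<close> and \<open>N' T N\<inverse>\<close>, so it is meromorphic in both charts of the sphere.\<close>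
lemma cdata_mor_conv:
 assumes dA: "cdata A n M N P" and dB: "cdata B m M' N' P'"
  and T: "T \<in> carrier_mat m n" "\<forall>z\<in>W. T * P z = P' z * T"
 shows "\<exists>F\<in>carrier_mat m n. map_mat (sigma_rat q) F * A = B * F \<and> (\<forall>\<^sub>\<approx>z\<in>UNIV. mat_eval F z * M z = M' z * T)"
proof -
 note a = cdata_D[OF dA] and d = cdata_D[OF dB]
 from a(12) obtain Mi where Mi: "mat_in (mero UNIV) n n Mi" "\<forall>\<^sub>\<approx>z\<in>UNIV. M z * Mi z = 1\<^sub>m n \<and> Mi z * M z = 1\<^sub>m n"
  by (elim exE conjE)
 from a(13) obtain Ni where Ni: "mat_in (mero UNIV) n n Ni" "\<forall>\<^sub>\<approx>z\<in>- {0}. N z * Ni (inverse z) = 1\<^sub>m n \<and> Ni (inverse z) * N z = 1\<^sub>m n"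
  by (elim exE conjE)
 note Mic = mat_inD(1)[OF Mi(1)] and Nic = mat_inD(1)[OF Ni(1)]
 define K where "K z = (M' z * T) * Mi z" for z
 define L where "L w = (N' (inverse w) * T) * Ni w" for w
 have Kc: "K z \<in> carrier_mat m n" for z unfolding K_def using d(4) T(1) Mic by (intro mult_carrier_mat)
 have K: "mat_in (mero UNIV) m n K" unfolding K_def
  by (rule mat_in_mult[OF alg_mero mat_in_mult[OF alg_mero d(2) mat_in_const[OF alg_mero T(1)]] Mi(1)])
 have L: "mat_in (mero UNIV) m n L" unfolding L_def
  by (rule mat_in_mult[OF alg_mero mat_in_mult[OF alg_mero d(3) mat_in_const[OF alg_mero T(1)]] Ni(1)])
 have KM: "K z * M z = M' z * T" if "Mi z * M z = 1\<^sub>m n" for z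
  unfolding K_def by (rule mat_cancel_right[OF that Mic a(4) mult_carrier_mat[OF d(4) T(1)]])
 have "\<forall>\<^sub>\<approx>z\<in>- {0}. K z = L (inverse z)"
  using cos_sub[OF Mi(2)] Ni(2) a(11) d(11) cos_W
 proof eventually_elim
  case (elim z)
  have c: "N' z * T \<in> carrier_mat m n" by (rule mult_carrier_mat[OF d(5) T(1)])
  have "M' z * T = (N' z * P' z) * T" using elim(4) by simp
  also have "... = N' z * (P' z * T)" by (rule assoc_mult_mat[OF d(5) d(6) T(1)])
  also have "... = N' z * (T * P z)" using bspec[OF T(2) elim(5)] by simp
  also have "... = (N' z * T) * P z" by (rule assoc_mult_mat[OF d(5) T(1) a(6), symmetric])
  finally have 1: "M' z * T = (N' z * T) * P z" .
  have "P z = Ni (inverse z) * (N z * P z)" by (rule mat_cancel[OF conjunct2[OF elim(2)] a(5) Nic a(6), symmetric])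
  hence "P z * Mi z = (Ni (inverse z) * M z) * Mi z" using elim(3) by simp
  also have "... = Ni (inverse z)" by (rule mat_cancel_right[OF conjunct1[OF elim(1)] a(4) Mic Nic])
  finally have 2: "P z * Mi z = Ni (inverse z)" .
  have "K z = ((N' z * T) * P z) * Mi z" unfolding K_def 1 ..
  also have "... = (N' z * T) * (P z * Mi z)" by (rule assoc_mult_mat[OF c a(6) Mic])
  finally show ?case unfolding 2 L_def by simp
 qed
 from sphere_mat[OF K L this] obtain F where F: "F \<in> carrier_mat m n" "\<forall>\<^sub>\<approx>z\<in>UNIV. mat_eval F z = K z" by blast
 note Fc = mat_eval_carrier[OF F(1)]
 have sF: "map_mat (sigma_rat q) F \<in> carrier_mat m n" using F(1) by simp
 have FM: "\<forall>\<^sub>\<approx>z\<in>UNIV. mat_eval F z * M z = M' z * T"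
  using F(2) Mi(2) by eventually_elim (use KM in simp)
 have "\<forall>\<^sub>\<approx>z\<in>UNIV. mat_eval (map_mat (sigma_rat q) F * A) z = mat_eval (B * F) z"
  using mat_eval_mult[OF sF a(1), of UNIV] mat_eval_mult[OF d(1) F(1), of UNIV] mat_eval_sigma[OF q_nz, of F UNIV]
   FM cos_scale_UNIV[OF q_nz FM] Mi(2) a(9) d(9)
 proof eventually_elim
  case (elim z)
  have c: "mat_eval F (q * z) * mat_eval A z \<in> carrier_mat m n" "mat_eval B z * mat_eval F z \<in> carrier_mat m n"
   by (rule mult_carrier_mat[OF Fc a(7)], rule mult_carrier_mat[OF d(7) Fc])
  have "(mat_eval F (q * z) * mat_eval A z) * M z = mat_eval F (q * z) * (mat_eval A z * M z)"
   by (rule assoc_mult_mat[OF Fc a(7) a(4)])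
  also have "... = (mat_eval B z * M' z) * T" using elim(5,7,8) by simp
  also have "... = mat_eval B z * (M' z * T)" by (rule assoc_mult_mat[OF d(7) d(4) T(1)])
  also have "... = mat_eval B z * (mat_eval F z * M z)" using elim(4) by simp
  also have "... = (mat_eval B z * mat_eval F z) * M z" by (rule assoc_mult_mat[OF d(7) Fc a(4), symmetric])
  finally have "mat_eval F (q * z) * mat_eval A z = mat_eval B z * mat_eval F z"
   using mat_cancel_right[OF conjunct1[OF elim(6)] a(4) Mic c(1)] mat_cancel_right[OF conjunct1[OF elim(6)] a(4) Mic c(2)]
   by metis
  thus ?case using elim(1,2,3) by simp
 qed
 hence "map_mat (sigma_rat q) F * A = B * F"
  by (rule mat_eval_eqI[OF mult_carrier_mat[OF sF a(1)] mult_carrier_mat[OF d(1) F(1)]]) simp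
 with F(1) FM show ?thesis by blast
qed

lemma GL_kron:
 fixes A B :: "'k::field mat"
 assumes "A \<in> carrier_mat n n" "A' \<in> carrier_mat n n" "A' * A = 1\<^sub>m n"
  and "B \<in> carrier_mat m m" "B' \<in> carrier_mat m m" "B' * B = 1\<^sub>m m"
 shows "kron A' B' * kron A B = 1\<^sub>m (n * m)"
 using kron_mult[OF assms(2,1,5,4)] assms(3,6) by (simp add: kron_one)

lemma kron_GL:
 assumes "A \<in> carrier (GL T n)" "B \<in> carrier (GL T m)"
 shows "kron A B \<in> carrier (GL T (n * m))"
proof -
 obtain A' B' where *: "A \<in> carrier_mat n n" "A' \<in> carrier_mat n n" "A' * A = 1\<^sub>m n" "A * A' = 1\<^sub>m n"
  "B \<in> carrier_mat m m" "B' \<in> carrier_mat m m" "B' * B = 1\<^sub>m m" "B * B' = 1\<^sub>m m"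
  using assms by (auto simp: GL_carrier)
 show ?thesis unfolding GL_carrier
  using kron_carrier[OF *(1,5)] kron_carrier[OF *(2,6)] GL_kron[OF *(1-3) *(5-7)] GL_kron[OF *(2,1,4) *(6,5,8)] by blast
qed

lemma mero_GL_kron:
 assumes "mero_GL UNIV n M" "mero_GL UNIV m M'"
 shows "mero_GL UNIV (n * m) (%z. kron (M z) (M' z))"
proof -
 from mero_GL_D(2)[OF assms(1)] obtain X where X: "mat_in (mero UNIV) n n X"
  "\<forall>\<^sub>\<approx>z\<in>UNIV. M z * X z = 1\<^sub>m n \<and> X z * M z = 1\<^sub>m n" by (elim exE conjE)
 from mero_GL_D(2)[OF assms(2)] obtain X' where X': "mat_in (mero UNIV) m m X'"
  "\<forall>\<^sub>\<approx>z\<in>UNIV. M' z * X' z = 1\<^sub>m m \<and> X' z * M' z = 1\<^sub>m m" by (elim exE conjE)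
 note M = mero_GL_D(1)[OF assms(1)] and M' = mero_GL_D(1)[OF assms(2)]
 have "\<forall>\<^sub>\<approx>z\<in>UNIV. kron (M z) (M' z) * kron (X z) (X' z) = 1\<^sub>m (n * m) \<and> kron (X z) (X' z) * kron (M z) (M' z) = 1\<^sub>m (n * m)"
  using X(2) X'(2)
 proof eventually_elim
  case (elim z)
  note c = mat_inD(1)[OF M, of z] mat_inD(1)[OF M', of z] mat_inD(1)[OF X(1), of z] mat_inD(1)[OF X'(1), of z]
  show ?case using GL_kron[OF c(1,3) _ c(2,4)] GL_kron[OF c(3,1) _ c(4,2)] elim by blast
 qed
 thus ?thesis unfolding mero_GL_def mero_mat_iff
  using mat_in_kron[OF alg_mero M M'] mat_in_kron[OF alg_mero X(1) X'(1)] by blast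
qed

lemma cdata_kron:
 assumes dA: "cdata A n M N P" and dB: "cdata B m M' N' P'"
 shows "cdata (kron A B) (n * m) (%z. kron (M z) (M' z)) (%z. kron (N z) (N' z)) (%z. kron (P z) (P' z))"
proof -
 note a = cdata_D[OF dA] and d = cdata_D[OF dB]
 have A: "kron A B \<in> carrier (GL TYPE(ratfun) (n * m))" using dA dB by (auto simp: cdata_def intro: kron_GL)
 have M: "sol_zero q (n * m) (kron A B) (%z. kron (M z) (M' z))"
  unfolding sol_zero_def
 proof
  show "mero_GL UNIV (n * m) (%z. kron (M z) (M' z))"
   using dA dB by (auto simp: cdata_def sol_zero_def intro: mero_GL_kron)
  show "\<forall>\<^sub>\<approx>z\<in>UNIV. kron (M (q * z)) (M' (q * z)) = mat_eval (kron A B) z * kron (M z) (M' z)"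
   using a(9) d(9) mat_eval_kron[of A B UNIV] by eventually_elim (simp add: kron_mult[OF a(7,4) d(7,4)])
 qed
 have N: "sol_inf q (n * m) (kron A B) (%z. kron (N z) (N' z))"
  unfolding sol_inf_def mero_GL_inf_def
 proof
  show "mero_GL UNIV (n * m) (%z. kron (N (inverse z)) (N' (inverse z)))"
   using dA dB by (auto simp: cdata_def sol_inf_def mero_GL_inf_def intro: mero_GL_kron)
  show "\<forall>\<^sub>\<approx>z\<in>- {0}. kron (N (q * z)) (N' (q * z)) = mat_eval (kron A B) z * kron (N z) (N' z)"
   using a(10) d(10) mat_eval_kron[of A B "- {0}"] by eventually_elim (simp add: kron_mult[OF a(7,5) d(7,5)])
 qed
 have P: "cfam (n * m) (%z. kron (P z) (P' z))"
  unfolding cfam_def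
 proof (intro conjI ballI)
  show "mat_in {f. EE f} (n * m) (n * m) (%z. kron (P z) (P' z))" by (rule mat_in_kron[OF alg_EE a(8) d(8)])
  show "kron (P z) (P' z) \<in> carrier (GLC (n * m))" if "z \<in> W" for z
   using dA dB that by (auto simp: cdata_def cfam_def intro: kron_GL)
  show "kron (P b) (P' b) = 1\<^sub>m (n * m)" using dA dB by (auto simp: cdata_def cfam_def kron_one)
  fix z w assume "z \<in> W" "w \<in> W"
  hence "P z * P w = P w * P z" "P' z * P' w = P' w * P' z" using dA dB by (auto simp: cdata_def cfam_def)
  thus "kron (P z) (P' z) * kron (P w) (P' w) = kron (P w) (P' w) * kron (P z) (P' z)"
   by (simp add: kron_mult[OF a(6,6) d(6,6), symmetric])
 qed
 have "\<forall>\<^sub>\<approx>z\<in>- {0}. kron (M z) (M' z) = kron (N z) (N' z) * kron (P z) (P' z)"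
  using a(11) d(11) by eventually_elim (simp add: kron_mult[OF a(5,6) d(5,6)])
 with A M N P show ?thesis by (simp add: cdata_def)
qed

lemma cdata_one: "cdata (1\<^sub>m n) n (%_. 1\<^sub>m n) (%_. 1\<^sub>m n) (%_. 1\<^sub>m n)"
proof -
 have m: "mero_GL UNIV n (%_. 1\<^sub>m n)"
  unfolding mero_GL_def mero_mat_iff
  by (intro conjI exI[of _ "%_. 1\<^sub>m n"] mat_in_const[OF alg_mero] always_eventually) auto
 have "1\<^sub>m n \<in> carrier (GLC n)" "1\<^sub>m n \<in> carrier (GL TYPE(ratfun) n)"
  unfolding GL_carrier by (intro conjI bexI[of _ "1\<^sub>m n"]; simp)+
 moreover have "mat_in {f. EE f} n n (%_. 1\<^sub>m n)" by (rule mat_in_const[OF alg_EE]) simp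
 ultimately show ?thesis unfolding cdata_def sol_zero_def sol_inf_def mero_GL_inf_def cfam_def
  using m by (auto intro!: always_eventually)
qed

end

section \<open>Objects and normalized data\<close>

lemma comm_subgroup_generated:
 fixes G (structure)
 assumes "group G" "\<And>x y. x \<in> carrier G \<inter> H ==> y \<in> carrier G \<inter> H ==> x \<otimes>\<^bsub>G\<^esub> y = y \<otimes>\<^bsub>G\<^esub> x"
 shows "comm_group (subgroup_generated G H)"
proof -
 interpret group G by fact
 have cent: "y \<otimes> x = x \<otimes> y" if "x \<in> generate G (carrier G \<inter> H)" "y \<in> carrier G" "\<forall>h\<in>carrier G \<inter> H. y \<otimes> h = h \<otimes> y" for x y
  using that(1)
 proof induction
  case (inv h)
  hence h: "h \<in> carrier G" "y \<otimes> h = h \<otimes> y" using that(3) by auto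
  have "inv h \<otimes> y = inv h \<otimes> (y \<otimes> h) \<otimes> inv h" using h(1) that(2) by (simp add: m_assoc)
  also have "... = inv h \<otimes> (h \<otimes> y) \<otimes> inv h" using h(2) by simp
  also have "... = y \<otimes> inv h" using h(1) that(2) by (simp add: m_assoc[symmetric])
  finally show ?case by simp
 next
  case (eng x x')
  hence c: "x \<in> carrier G" "x' \<in> carrier G" by (auto intro: generate_in_carrier[of "carrier G \<inter> H"])
  have "y \<otimes> (x \<otimes> x') = (x \<otimes> y) \<otimes> x'" using c that(2) eng by (simp add: m_assoc[symmetric])
  also have "... = (x \<otimes> x') \<otimes> y" using c that(2) eng by (simp add: m_assoc)
  finally show ?case .
 qed (use that in auto)
 have 1: "h \<otimes> x = x \<otimes> h" if "x \<in> generate G (carrier G \<inter> H)" "h \<in> carrier G \<inter> H" for x h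
  by (rule cent[OF that(1)]) (use that(2) assms(2) in auto)
 have 2: "y \<otimes> x = x \<otimes> y" if "x \<in> generate G (carrier G \<inter> H)" "y \<in> generate G (carrier G \<inter> H)" for x y
  by (rule cent[OF that(1)]) (use generate_in_carrier[OF _ that(2)] 1[OF that(2)] in auto)
 show ?thesis
  by (rule group.group_comm_groupI[OF group_subgroup_generated])
   (use 2 in \<open>auto simp: subgroup_generated_def\<close>)
qed

lemma no_pole: "(f \<longlongrightarrow> L) (at a) ==> \<not> is_pole f (a :: complex)" for f :: "complex => complex"
 unfolding is_pole_def using not_tendsto_and_filterlim_at_infinity[of "at a" f L] by auto

lemma meromorphic_no_pole_lim:
 assumes "f meromorphic_on {a}" "\<not> is_pole f a"
 shows "\<exists>L. (f \<longlongrightarrow> L) (at a)"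
proof -
 have "not_essential f a" using assms(1) by (simp add: meromorphic_at_iff)
 thus ?thesis using assms(2) unfolding not_essential_def by blast
qed

lemma mat_in_gl_inverse:
 assumes "mat_in (mero U) n n Q"
 shows "mat_in (mero U) n n (%z. inverse (det (Q z)) \<cdot>\<^sub>m adj_mat (Q z))"
 unfolding mat_in_def
proof (intro conjI allI impI)
 note A = adj_in[OF alg_mero assms]
 show "inverse (det (Q z)) \<cdot>\<^sub>m adj_mat (Q z) \<in> carrier_mat n n" for z using mat_inD(1)[OF A, of z] by simp
 fix i j assume ij: "i < n" "j < n"
 have "(inverse (det (Q z)) \<cdot>\<^sub>m adj_mat (Q z)) $$ (i,j) = inverse (det (Q z)) * adj_mat (Q z) $$ (i,j)" for z
  using mat_inD(1)[OF A, of z] ij by simp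
 moreover have "(%z. inverse (det (Q z)) * adj_mat (Q z) $$ (i,j)) meromorphic_on U"
  using det_in[OF alg_mero assms] mat_inD(2)[OF A ij] by (auto intro!: meromorphic_intros)
 ultimately show "(%z. (inverse (det (Q z)) \<cdot>\<^sub>m adj_mat (Q z)) $$ (i,j)) \<in> mero U" by simp
qed

lemma mat_cont_eqI:
 assumes X: "mat_in {f. isCont f a} m n X" and Y: "mat_in {f. isCont f a} m n Y"
  and e: "eventually (%z. X z = Y z) (at (a :: complex))"
 shows "X a = Y a"
proof (rule eq_matI)
 fix i j assume "i < dim_row (Y a)" "j < dim_col (Y a)"
 hence ij: "i < m" "j < n" using mat_inD(1)[OF Y, of a] by auto
 have l: "((%z. X z $$ (i,j)) \<longlongrightarrow> X a $$ (i,j)) (at a)" "((%z. Y z $$ (i,j)) \<longlongrightarrow> Y a $$ (i,j)) (at a)"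
  using mat_inD(2)[OF X ij] mat_inD(2)[OF Y ij] by (auto simp: isCont_def)
 have "eventually (%z. X z $$ (i,j) = Y z $$ (i,j)) (at a)" using e by eventually_elim simp
 from Lim_transform_eventually[OF l(1) this] show "X a $$ (i,j) = Y a $$ (i,j)"
  by (intro tendsto_unique[OF _ _ l(2)]) simp_all
qed (use mat_inD(1)[OF X, of a] mat_inD(1)[OF Y, of a] in auto)

context punctures
begin

definition nmero :: "nat => (complex => complex mat) => bool" where
 "nmero n Q \<longleftrightarrow> (\<forall>z. Q z \<in> carrier_mat n n) \<and>
  (\<forall>i<n. \<forall>j<n. (%z. Q z $$ (i,j)) nicely_meromorphic_on - {0}) \<and> (\<forall>\<^sub>\<approx>z\<in>- {0}. Q z \<in> carrier (GLC n))"

text \<open>At a point where the inverse has no pole, both determinants have finite limits with product \<open>1\<close>.\<close>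
lemma nonsingular_point:
 assumes Q: "nmero n Q" and a: "a ~= 0" "a \<notin> sing_set n Q"
 shows "i < n ==> j < n ==> (%z. Q z $$ (i,j)) analytic_on {a}"
  and "mat_in {f. isCont f a} n n Q" and "Q a \<in> carrier (GLC n)"
proof -
 have Qc: "Q z \<in> carrier_mat n n" for z using Q by (simp add: nmero_def)
 have an: "(%z. Q z $$ (i,j)) analytic_on {a}" if ij: "i < n" "j < n" for i j
 proof (rule nicely_meromorphic_on_imp_analytic_at)
  show "(%z. Q z $$ (i,j)) nicely_meromorphic_on - {0}" using Q ij by (simp add: nmero_def)
  show "\<not> is_pole (%z. Q z $$ (i,j)) a" using a ij by (auto simp: sing_set_def mat_poles_def)
 qed (use a in simp)
 thus "i < n ==> j < n ==> (%z. Q z $$ (i,j)) analytic_on {a}" .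
 show Qcont: "mat_in {f. isCont f a} n n Q" using Qc an by (auto simp: mat_in_def intro: analytic_at_imp_isCont)
 define Y where "Y z = inverse (det (Q z)) \<cdot>\<^sub>m adj_mat (Q z)" for z
 have "mat_in (mero {a}) n n Q"
  using Qc an by (auto simp: mat_in_def intro: analytic_on_imp_meromorphic_on)
 from mat_in_gl_inverse[OF this] have Y: "mat_in (mero {a}) n n Y" unfolding Y_def .
 have GL: "eventually (%z. Q z \<in> carrier (GLC n)) (at a)" using Q a(1) by (simp add: nmero_def cos_at0)
 have invQ: "eventually (%z. inv\<^bsub>GLC n\<^esub> (Q z) = Y z) (at a)"
  using GL by eventually_elim (use GL_inv_adj Qc in \<open>auto simp: GL_det Y_def\<close>)
 have "\<exists>L. ((%z. Y z $$ (i,j)) \<longlongrightarrow> L) (at a)" if ij: "i < n" "j < n" for i j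
 proof (rule meromorphic_no_pole_lim)
  show "(%z. Y z $$ (i,j)) meromorphic_on {a}" using mat_inD(2)[OF Y ij] by simp
  have e: "eventually (%z. (inv\<^bsub>GLC n\<^esub> (Q z)) $$ (i,j) = Y z $$ (i,j)) (at a)"
   using invQ by eventually_elim simp
  have "\<not> is_pole (%z. (inv\<^bsub>GLC n\<^esub> (Q z)) $$ (i,j)) a" using a ij by (auto simp: sing_set_def mat_poles_def)
  moreover have "is_pole (%z. (inv\<^bsub>GLC n\<^esub> (Q z)) $$ (i,j)) a \<longleftrightarrow> is_pole (%z. Y z $$ (i,j)) a"
   by (rule is_pole_cong[OF e refl])
  ultimately show "\<not> is_pole (%z. Y z $$ (i,j)) a" by simp
 qed
 hence "mat_in {f. \<exists>L. (f \<longlongrightarrow> L) (at a)} n n Y" using mat_inD(1)[OF Y] by (simp add: mat_in_def)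
 from det_in[OF alg_lim this] obtain L where L: "((%z. det (Y z)) \<longlongrightarrow> L) (at a)" by auto
 have "isCont (%z. det (Q z)) a" using det_in[OF alg_cont Qcont] by simp
 hence "((%z. det (Q z)) \<longlongrightarrow> det (Q a)) (at a)" by (simp add: isCont_def)
 from tendsto_mult[OF this L] have l: "((%z. det (Q z) * det (Y z)) \<longlongrightarrow> det (Q a) * L) (at a)" .
 have "eventually (%z. det (Q z) * det (Y z) = 1) (at a)"
  using GL invQ
 proof eventually_elim
  case (elim z)
  interpret group "GLC n" by (rule GL_group)
  have "Q z * Y z = 1\<^sub>m n" using r_inv[OF elim(1)] elim(2) by simp
  thus ?case using det_mult[OF Qc mat_inD(1)[OF Y], of z z] by simp
 qed
 from Lim_transform_eventually[OF l this] have "((%z::complex. 1) \<longlongrightarrow> det (Q a) * L) (at a)" .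
 hence "det (Q a) * L = 1" by (intro tendsto_unique[OF _ _ tendsto_const]) auto
 thus "Q a \<in> carrier (GLC n)" using Qc by (auto simp: GL_det)
qed

text \<open>Removing singularities makes \<open>P\<close> nicely meromorphic. Its nonsingular points may lie over \<open>S\<close>, where commutativity follows by continuity, once in each argument.\<close>
lemma cdata_imp_object:
 assumes d: "cdata A n M N P"
 shows "abelian_regular q S n A"
proof -
 note D = cdata_D[OF d]
 have cf: "cfam n P" and A: "A \<in> carrier (GL TYPE(ratfun) n)" and sol: "sol_zero q n A M" "sol_inf q n A N"
  using d by (auto simp: cdata_def)
 define Q where "Q z = mat n n (%(i,j). remove_sings (%z. P z $$ (i,j)) z)" for z
 have Qc: "Q z \<in> carrier_mat n n" for z by (simp add: Q_def)
 have Qij: "(%z. Q z $$ (i,j)) = remove_sings (%z. P z $$ (i,j))" if "i < n" "j < n" for i j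
  using that by (auto simp: Q_def)
 have QW: "Q z = P z" if z: "z \<in> W" for z
 proof (rule eq_matI)
  fix i j assume "i < dim_row (P z)" "j < dim_col (P z)"
  hence ij: "i < n" "j < n" using D(6)[of z] by auto
  have "(%z. P z $$ (i,j)) holomorphic_on W" using mat_inD(2)[OF D(8) ij] by (simp add: EE_def)
  hence "(%z. P z $$ (i,j)) analytic_on {z}" using W_open z by (rule holomorphic_on_imp_analytic_at)
  thus "Q z $$ (i,j) = P z $$ (i,j)" using ij by (simp add: Q_def)
 qed (use D(6)[of z] in \<open>auto simp: Q_def\<close>)
 have QP: "\<forall>\<^sub>\<approx>z\<in>- {0}. Q z = P z" using cos_W by eventually_elim (rule QW)
 have GLP: "P z \<in> carrier (GLC n)" if "z \<in> W" for z using cf that by (simp add: cfam_def)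
 have Qn: "nmero n Q" unfolding nmero_def
 proof (intro conjI allI impI)
  fix i j assume ij: "i < n" "j < n"
  show "(%z. Q z $$ (i,j)) nicely_meromorphic_on - {0}"
   unfolding Qij[OF ij] using mat_inD(2)[OF D(8) ij] by (intro remove_sings_nicely_meromorphic) (simp add: EE_def)
 next
  show "\<forall>\<^sub>\<approx>z\<in>- {0}. Q z \<in> carrier (GLC n)" using cos_W by eventually_elim (use QW GLP in simp)
 qed (rule Qc)
 define Y where "Y z = inverse (det (P z)) \<cdot>\<^sub>m adj_mat (P z)" for z
 have sing: "a \<notin> sing_set n Q" if a: "a \<in> W" for a
 proof -
  have aW: "eventually (%z. z \<in> W) (at a)" using eventually_W W_nz[OF a] by blast
  have Pcont: "mat_in {f. isCont f a} n n P"
   using D(6) mat_inD(2)[OF D(8)] W_open a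
   by (auto simp: mat_in_def EE_def intro!: analytic_at_imp_isCont holomorphic_on_imp_analytic_at)
  have "\<not> is_pole (%z. Q z $$ (i,j)) a" if ij: "i < n" "j < n" for i j
  proof (rule no_pole[OF Lim_transform_eventually])
   show "((%z. P z $$ (i,j)) \<longlongrightarrow> P a $$ (i,j)) (at a)" using mat_inD(2)[OF Pcont ij] by (simp add: isCont_def)
   show "eventually (%z. P z $$ (i,j) = Q z $$ (i,j)) (at a)" using aW by eventually_elim (simp add: QW)
  qed
  moreover have "\<not> is_pole (%z. (inv\<^bsub>GLC n\<^esub> (Q z)) $$ (i,j)) a" if ij: "i < n" "j < n" for i j
  proof (rule no_pole[OF Lim_transform_eventually])
   note A = adj_in[OF alg_cont Pcont]
   have "((%z. det (P z)) \<longlongrightarrow> det (P a)) (at a)" "((%z. adj_mat (P z) $$ (i,j)) \<longlongrightarrow> adj_mat (P a) $$ (i,j)) (at a)"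
    using det_in[OF alg_cont Pcont] mat_inD(2)[OF A ij] by (auto simp: isCont_def)
   thus "((%z. inverse (det (P z)) * adj_mat (P z) $$ (i,j)) \<longlongrightarrow> inverse (det (P a)) * adj_mat (P a) $$ (i,j)) (at a)"
    using GLP[OF a] by (intro tendsto_intros) (auto simp: GL_det)
   show "eventually (%z. inverse (det (P z)) * adj_mat (P z) $$ (i,j) = (inv\<^bsub>GLC n\<^esub> (Q z)) $$ (i,j)) (at a)"
    using aW
   proof eventually_elim
    case (elim z)
    have "det (P z) ~= 0" using GLP[OF elim] by (simp add: GL_det)
    thus ?case using GL_inv_adj[OF D(6), of z] mat_inD(1)[OF A, of z] ij by (simp add: QW[OF elim])
   qed
  qed
  ultimately show ?thesis by (auto simp: sing_set_def mat_poles_def)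
 qed
 have conn: "connection_matrix q n A Q"
  unfolding connection_matrix_def
 proof (intro conjI exI)
  show "\<forall>z. Q z \<in> carrier_mat n n" "\<forall>i<n. \<forall>j<n. (%z. Q z $$ (i,j)) nicely_meromorphic_on - {0}"
   using Qn by (auto simp: nmero_def)
  from D(13) obtain Ni where Ni: "mat_in (mero UNIV) n n Ni" "\<forall>\<^sub>\<approx>z\<in>- {0}. N z * Ni (inverse z) = 1\<^sub>m n \<and> Ni (inverse z) * N z = 1\<^sub>m n"
   by (elim exE conjE)
  show "\<forall>\<^sub>\<approx>z\<in>- {0}. Q z = inv\<^bsub>GLC n\<^esub> (N z) * M z"
   using Ni(2) D(11) QP
  proof eventually_elim
   case (elim z)
   have "inv\<^bsub>GLC n\<^esub> (N z) = Ni (inverse z)" by (rule GL_inv) (use D(5) mat_inD(1)[OF Ni(1)] elim in auto)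
   thus ?case using elim(2,3) mat_cancel[OF conjunct2[OF elim(1)] D(5) mat_inD(1)[OF Ni(1)] D(6)] by simp
  qed
 qed (use sol in auto)
 interpret G: group "GLC n" by (rule GL_group)
 define R where "R = Q ` (- {0} - sing_set n Q)"
 have RG: "x \<in> carrier (GLC n)" if "x \<in> R" for x using that nonsingular_point(3)[OF Qn] by (auto simp: R_def)
 have Rcomm: "x * y = y * x" if "x \<in> R" "y \<in> R" for x y
 proof -
  obtain a c where a: "x = Q a" "a ~= 0" "a \<notin> sing_set n Q" and c: "y = Q c" "c ~= 0" "c \<notin> sing_set n Q"
   using \<open>x \<in> R\<close> \<open>y \<in> R\<close> by (auto simp: R_def)
  note ca = nonsingular_point(2)[OF Qn a(2,3)] and cc = nonsingular_point(2)[OF Qn c(2,3)]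
  have 1: "Q a * Q w = Q w * Q a" if w: "w \<in> W" for w
  proof (rule mat_cont_eqI[of a n n "%z. Q z * Q w" "%z. Q w * Q z"])
   show "mat_in {f. isCont f a} n n (%z. Q z * Q w)" "mat_in {f. isCont f a} n n (%z. Q w * Q z)"
    by (rule mat_in_mult[OF alg_cont ca mat_in_const[OF alg_cont Qc]], rule mat_in_mult[OF alg_cont mat_in_const[OF alg_cont Qc] ca])
   show "eventually (%z. Q z * Q w = Q w * Q z) (at a)"
    using eventually_W[OF a(2)] by eventually_elim (use cf w in \<open>simp add: QW cfam_def\<close>)
  qed
  have "Q a * Q c = Q c * Q a"
  proof (rule mat_cont_eqI[of c n n "%z. Q a * Q z" "%z. Q z * Q a"])
   show "mat_in {f. isCont f c} n n (%z. Q z * Q a)" "mat_in {f. isCont f c} n n (%z. Q a * Q z)"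
    by (rule mat_in_mult[OF alg_cont cc mat_in_const[OF alg_cont Qc]], rule mat_in_mult[OF alg_cont mat_in_const[OF alg_cont Qc] cc])
   show "eventually (%z. Q a * Q z = Q z * Q a) (at c)"
    using eventually_W[OF c(2)] by eventually_elim (rule 1)
  qed
  thus ?thesis by (simp add: a c)
 qed
 have cg: "comm_group (subgroup_generated (GLC n) R)"
  by (rule comm_subgroup_generated[OF GL_group]) (use Rcomm in auto)
 have comp: "comm_group (connection_component n Q)"
  unfolding connection_component_def
 proof (rule comm_subgroup_generated[OF GL_group])
  have gen: "inv\<^bsub>GLC n\<^esub> x \<otimes>\<^bsub>GLC n\<^esub> y \<in> carrier (subgroup_generated (GLC n) R)" if "x \<in> R" "y \<in> R" for x y
   unfolding carrier_subgroup_generated using that RG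
   by (intro generate.eng generate.inv generate.incl) auto
  fix x y assume "x \<in> carrier (GLC n) \<inter> {inv\<^bsub>GLC n\<^esub> (Q a) * Q b |a b. a \<in> - {0} - sing_set n Q \<and> b \<in> - {0} - sing_set n Q}"
   "y \<in> carrier (GLC n) \<inter> {inv\<^bsub>GLC n\<^esub> (Q a) * Q b |a b. a \<in> - {0} - sing_set n Q \<and> b \<in> - {0} - sing_set n Q}"
  then obtain x1 x2 y1 y2 where "x = inv\<^bsub>GLC n\<^esub> x1 * x2" "y = inv\<^bsub>GLC n\<^esub> y1 * y2" "x1 \<in> R" "x2 \<in> R" "y1 \<in> R" "y2 \<in> R"
   unfolding R_def by blast
  hence "x \<in> carrier (subgroup_generated (GLC n) R)" "y \<in> carrier (subgroup_generated (GLC n) R)"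
   using gen by auto
  from comm_groupE(4)[OF cg this] show "x \<otimes>\<^bsub>GLC n\<^esub> y = y \<otimes>\<^bsub>GLC n\<^esub> x" by (simp add: subgroup_generated_def)
 qed
 have "ell_pt q ` sing_set n Q \<subseteq> S"
 proof
  fix p assume "p \<in> ell_pt q ` sing_set n Q"
  then obtain a where a: "p = ell_pt q a" "a \<in> sing_set n Q" by blast
  hence "a ~= 0" by (auto simp: sing_set_def mat_poles_def)
  moreover have "a \<notin> W" using sing a(2) by blast
  ultimately show "p \<in> S" using a by (simp add: W_def)
 qed
 with conn comp A sol show ?thesis unfolding abelian_regular_def regular_system_def by blast
qed

lemma mero_GL_right:
 assumes M: "mero_GL UNIV n M" and C: "C \<in> carrier (GLC n)"
 shows "mero_GL UNIV n (%z. M z * C)"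
proof -
 from C obtain D where D: "C \<in> carrier_mat n n" "D \<in> carrier_mat n n" "D * C = 1\<^sub>m n" "C * D = 1\<^sub>m n"
  unfolding GL_carrier by blast
 from mero_GL_D(2)[OF M] obtain X where X: "mat_in (mero UNIV) n n X"
  "\<forall>\<^sub>\<approx>z\<in>UNIV. M z * X z = 1\<^sub>m n \<and> X z * M z = 1\<^sub>m n" by (elim exE conjE)
 note Mm = mero_GL_D(1)[OF M]
 note c = mat_inD(1)[OF Mm] mat_inD(1)[OF X(1)]
 have "\<forall>\<^sub>\<approx>z\<in>UNIV. (M z * C) * (D * X z) = 1\<^sub>m n \<and> (D * X z) * (M z * C) = 1\<^sub>m n"
  using X(2)
 proof eventually_elim
  case (elim z)
  have 1: "(M z * C) * (D * X z) = M z * (C * (D * X z))"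
   by (rule assoc_mult_mat[OF c(1) D(1) mult_carrier_mat[OF D(2) c(2)]])
  have 2: "(D * X z) * (M z * C) = D * (X z * (M z * C))"
   by (rule assoc_mult_mat[OF D(2) c(2) mult_carrier_mat[OF c(1) D(1)]])
  show ?case unfolding 1 2 mat_cancel[OF D(4) D(2,1) c(2)] mat_cancel[OF conjunct2[OF elim] c(1,2) D(1)]
   using elim D(3) by simp
 qed
 thus ?thesis unfolding mero_GL_def mero_mat_iff
  using mat_in_mult[OF alg_mero Mm mat_in_const[OF alg_mero D(1)]] mat_in_mult[OF alg_mero mat_in_const[OF alg_mero D(2)] X(1)]
  by blast
qed

text \<open>Multiply the given connection matrix by \<open>(Q b)\<inverse>\<close> on the left and the solution at \<open>\<infinity>\<close> by \<open>Q b\<close> on the right; the values of the new matrix are generators of the connection component.\<close>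
lemma cdata_exists:
 assumes ab: "abelian_regular q S n A"
 shows "\<exists>M N P. cdata A n M N P"
proof -
 from ab obtain Q where A: "A \<in> carrier (GL TYPE(ratfun) n)" and conn: "connection_matrix q n A Q"
  and sub: "ell_pt q ` sing_set n Q \<subseteq> S" and cg: "comm_group (connection_component n Q)"
  unfolding abelian_regular_def regular_system_def by blast
 from conn obtain M N0 where Qc: "\<forall>z. Q z \<in> carrier_mat n n"
  and Qn: "\<forall>i<n. \<forall>j<n. (%z. Q z $$ (i,j)) nicely_meromorphic_on - {0}"
  and M: "sol_zero q n A M" and N0: "sol_inf q n A N0" and QMN: "\<forall>\<^sub>\<approx>z\<in>- {0}. Q z = inv\<^bsub>GLC n\<^esub> (N0 z) * M z"
  unfolding connection_matrix_def by (elim exE conjE)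
 interpret G: group "GLC n" by (rule GL_group)
 have A': "A \<in> carrier_mat n n" using A by (simp add: GL_carrier)
 have MG: "mero_GL UNIV n M" and NG: "mero_GL UNIV n (%w. N0 (inverse w))"
  using M N0 by (auto simp: sol_zero_def sol_inf_def mero_GL_inf_def)
 have GLev: "\<forall>\<^sub>\<approx>z\<in>UNIV. X z \<in> carrier (GLC n)" if X: "mero_GL UNIV n X" for X
 proof -
  from mero_GL_D(2)[OF X] obtain Y where Y: "mat_in (mero UNIV) n n Y" "\<forall>\<^sub>\<approx>z\<in>UNIV. X z * Y z = 1\<^sub>m n \<and> Y z * X z = 1\<^sub>m n"
   by (elim exE conjE)
  note c = mat_inD(1)[OF mero_GL_D(1)[OF X]] mat_inD(1)[OF Y(1)]
  from Y(2) show ?thesis by eventually_elim (use c in \<open>auto simp: GL_carrier\<close>)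
 qed
 have Mev: "\<forall>\<^sub>\<approx>z\<in>- {0}. M z \<in> carrier (GLC n)" by (rule cos_sub[OF GLev[OF MG]])
 have Nev: "\<forall>\<^sub>\<approx>z\<in>- {0}. N0 z \<in> carrier (GLC n)" using cos_inverse[OF cos_sub[OF GLev[OF NG]]] by simp
 have Nc: "N0 z \<in> carrier_mat n n" for z using mat_inD(1)[OF mero_GL_D(1)[OF NG], of "inverse z"] by simp
 have Mc: "M z \<in> carrier_mat n n" for z by (rule mat_inD(1)[OF mero_GL_D(1)[OF MG]])
 have Ac: "mat_eval A z \<in> carrier_mat n n" for z by (rule mat_eval_carrier[OF A'])
 have NQ: "\<forall>\<^sub>\<approx>z\<in>- {0}. N0 z * Q z = M z"
  using QMN Mev Nev
 proof eventually_elim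
  case (elim z)
  have "N0 z \<otimes>\<^bsub>GLC n\<^esub> (inv\<^bsub>GLC n\<^esub> (N0 z) \<otimes>\<^bsub>GLC n\<^esub> M z) = M z"
   using elim(2,3) by (simp only: G.m_assoc[symmetric] G.inv_closed G.r_inv G.l_one)
  thus ?case using elim(1) by simp
 qed
 have QG: "\<forall>\<^sub>\<approx>z\<in>- {0}. Q z \<in> carrier (GLC n)"
  using QMN Mev Nev by eventually_elim (use G.m_closed G.inv_closed in \<open>metis GL_simps(1)\<close>)
 have nm: "nmero n Q" using Qc Qn QG by (simp add: nmero_def)
 have WS: "z \<notin> sing_set n Q" if "z \<in> W" for z using that sub by (auto simp: W_def)
 have QW: "Q z \<in> carrier (GLC n)" if "z \<in> W" for z by (rule nonsingular_point(3)[OF nm W_nz[OF that] WS[OF that]])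
 have Qhol: "(%z. Q z $$ (i,j)) holomorphic_on W" if ij: "i < n" "j < n" for i j
  by (rule analytic_imp_holomorphic, subst analytic_on_analytic_at)
   (use nonsingular_point(1)[OF nm W_nz WS ij] in blast)
 have Qq: "\<forall>\<^sub>\<approx>z\<in>- {0}. Q (q * z) = Q z"
  using NQ cos_scale[OF q_nz NQ] cos_scale[OF q_nz Nev] cos_sub[OF conjunct2[OF M[unfolded sol_zero_def]]]
   conjunct2[OF N0[unfolded sol_inf_def]]
 proof eventually_elim
  case (elim z)
  have "N0 (q * z) * Q (q * z) = mat_eval A z * (N0 z * Q z)" using elim by simp
  also have "... = (mat_eval A z * N0 z) * Q z" by (rule assoc_mult_mat[OF Ac Nc Qc[rule_format], symmetric])
  also have "... = N0 (q * z) * Q z" using elim(5) by simp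
  finally have "N0 (q * z) * Q (q * z) = N0 (q * z) * Q z" .
  moreover have "inv\<^bsub>GLC n\<^esub> (N0 (q * z)) * N0 (q * z) = 1\<^sub>m n" "inv\<^bsub>GLC n\<^esub> (N0 (q * z)) \<in> carrier_mat n n"
   using G.l_inv[OF elim(3)] G.inv_closed[OF elim(3)] by (simp_all add: GL_carrier)
  ultimately show ?case using GL_left_cancel[OF _ Nc _ Qc[rule_format] Qc[rule_format]] by blast
 qed
 have QEE: "mat_in {f. EE f} n n Q"
  unfolding mat_in_def
 proof (intro conjI allI impI CollectI)
  fix i j assume ij: "i < n" "j < n"
  show "EE (%z. Q z $$ (i,j))" unfolding EE_def
  proof (intro conjI ballI)
   show "(%z. Q z $$ (i,j)) meromorphic_on - {0}" using Qn ij by (simp add: nicely_meromorphic_on_def)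
   show "(%z. Q z $$ (i,j)) holomorphic_on W" by (rule Qhol[OF ij])
   fix z assume z: "z \<in> W"
   show "Q (q * z) $$ (i,j) = Q z $$ (i,j)"
   proof (rule W_eqI[of "%z. Q (q * z) $$ (i,j)" "%z. Q z $$ (i,j)"])
    have "(%z. q * z) ` W \<subseteq> W" using W_q by auto
    from holomorphic_on_compose_gen[OF _ Qhol[OF ij] this]
    show "(%z. Q (q * z) $$ (i,j)) holomorphic_on W" by (simp add: o_def holomorphic_intros)
    show "\<forall>\<^sub>\<approx>z\<in>- {0}. Q (q * z) $$ (i,j) = Q z $$ (i,j)" using Qq by eventually_elim simp
   qed (use Qhol[OF ij] z in auto)
  qed
 qed (use Qc in blast)
 define C where "C = Q b"
 have C: "C \<in> carrier (GLC n)" "C \<in> carrier_mat n n" using QW[OF b_W] Qc by (auto simp: C_def)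
 define D where "D = inv\<^bsub>GLC n\<^esub> C"
 have D: "D \<in> carrier (GLC n)" "D \<in> carrier_mat n n" "D * C = 1\<^sub>m n" "C * D = 1\<^sub>m n"
  using C G.inv_closed[OF C(1)] G.l_inv[OF C(1)] G.r_inv[OF C(1)] by (simp_all add: D_def GL_carrier)
 define P where "P z = D * Q z" for z
 define N where "N z = N0 z * C" for z
 have gen: "P z \<in> carrier (connection_component n Q)" if z: "z \<in> W" for z
 proof -
  have "D \<otimes>\<^bsub>GLC n\<^esub> Q z \<in> carrier (GLC n)" by (rule G.m_closed[OF D(1) QW[OF z]])
  thus ?thesis unfolding connection_component_def carrier_subgroup_generated P_def D_def C_def
   using b_W z WS W_nz
   by (intro generate.incl IntI CollectI exI[of _ b] exI[of _ z] conjI refl DiffI) auto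
 qed
 have cf: "cfam n P" unfolding cfam_def
 proof (intro conjI ballI)
  show "mat_in {f. EE f} n n P" unfolding P_def by (rule mat_in_mult[OF alg_EE mat_in_const[OF alg_EE D(2)] QEE])
  show "P z \<in> carrier (GLC n)" if "z \<in> W" for z using G.m_closed[OF D(1) QW[OF that]] by (simp add: P_def)
  show "P z * P w = P w * P z" if "z \<in> W" "w \<in> W" for z w
   using comm_groupE(4)[OF cg gen gen, OF that] by (simp add: connection_component_def subgroup_generated_def)
  show "P b = 1\<^sub>m n" using D(3) by (simp add: P_def C_def)
 qed
 have sN: "sol_inf q n A N" unfolding sol_inf_def mero_GL_inf_def N_def
 proof
  show "mero_GL UNIV n (%w. N0 (inverse w) * C)" by (rule mero_GL_right[OF NG C(1)])
  show "\<forall>\<^sub>\<approx>z\<in>- {0}. N0 (q * z) * C = mat_eval A z * (N0 z * C)"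
   using conjunct2[OF N0[unfolded sol_inf_def]]
   by eventually_elim (simp add: assoc_mult_mat[OF Ac Nc C(2)])
 qed
 have "\<forall>\<^sub>\<approx>z\<in>- {0}. M z = N z * P z"
  using NQ
 proof eventually_elim
  case (elim z)
  have "N z * P z = N0 z * (C * (D * Q z))" unfolding N_def P_def
   by (rule assoc_mult_mat[OF Nc C(2) mult_carrier_mat[OF D(2) Qc[rule_format]]])
  also have "... = M z" using mat_cancel[OF D(4,2) C(2) Qc[rule_format]] elim by simp
  finally show ?case by simp
 qed
 with A M sN cf show ?thesis unfolding cdata_def by blast
qed

end

section \<open>From connection matrices to representations\<close>

lemma comm_sum: "(\<And>i. i \<in> I ==> a * f i = f i * a) ==> a * sum f I = sum f I * (a :: 'a :: ring_1)"
 by (simp add: sum_distrib_left sum_distrib_right)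

lemma comm_mult: "a * b = b * a ==> a * c = c * a ==> a * (b * c) = (b * c) * (a :: 'a :: ring_1)"
 by (metis mult.assoc)

lemma comm_pow: "a * b = b * a ==> a * b ^ k = b ^ k * (a :: 'a :: ring_1)"
 by (metis power_commute)

lemma comm_scale: "a * b = b * a ==> a * (cc c * b) = (cc c * b) * a"
 by (rule comm_mult[OF cc_commute[symmetric]])

lemma comm_diff_cc: "a * b = b * a ==> a * (b - cc c) = (b - cc c) * a"
 by (simp add: left_diff_distrib right_diff_distrib cc_commute[of c a])

lemma comm_ev: "a * Y = Y * a ==> a * ev D Y f = ev D Y f * a"
 unfolding ev_def by (intro comm_sum comm_scale comm_pow)

lemma comm_nexp: "a * Y = Y * a ==> a * nexp D Y = nexp D Y * a"
 unfolding nexp_def by (intro comm_sum comm_scale comm_pow)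

lemma cc_mult_power: "(cc c * x) ^ k = cc (c ^ k) * x ^ k"
 by (induction k) (simp_all add: cc_prod)

lemma idempotents_mult:
 fixes E :: "'k => 'a::ring_1"
 assumes K: "finite K" and E: "\<And>k l. k \<in> K ==> l \<in> K ==> E k * E l = (if k = l then E k else 0)"
  and c: "\<And>k l. k \<in> K ==> l \<in> K ==> E k * b l = b l * E k"
 shows "(\<Sum>k\<in>K. a k * E k) * (\<Sum>k\<in>K. b k * E k) = (\<Sum>k\<in>K. (a k * b k) * E k)"
proof -
 have "(a k * E k) * (b l * E l) = (if k = l then (a k * b k) * E k else 0)" if "k \<in> K" "l \<in> K" for k l
 proof -
  have "(a k * E k) * (b l * E l) = a k * ((E k * b l) * E l)" by (simp only: mult.assoc)
  also have "... = a k * ((b l * E k) * E l)" by (simp only: c[OF that])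
  also have "... = (a k * b l) * (E k * E l)" by (simp only: mult.assoc)
  finally show ?thesis using E[OF that] by simp
 qed
 hence "(\<Sum>k\<in>K. a k * E k) * (\<Sum>k\<in>K. b k * E k) = (\<Sum>k\<in>K. \<Sum>l\<in>K. if k = l then (a k * b k) * E k else 0)"
  unfolding sum_product by (intro sum.cong refl) blast
 thus ?thesis using K by simp
qed

lemma idempotents_power:
 fixes E :: "'k => 'a::ring_1"
 assumes K: "finite K" and E: "\<And>k l. k \<in> K ==> l \<in> K ==> E k * E l = (if k = l then E k else 0)"
  and c: "\<And>k l. k \<in> K ==> l \<in> K ==> E k * a l = a l * E k"
 shows "(\<Sum>k\<in>K. a k * E k) ^ Suc j = (\<Sum>k\<in>K. a k ^ Suc j * E k)"
proof (induction j)
 case (Suc j)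
 have "(\<Sum>k\<in>K. a k * E k) ^ Suc (Suc j) = (\<Sum>k\<in>K. a k * E k) * (\<Sum>k\<in>K. a k ^ Suc j * E k)"
  by (simp only: power_Suc[of _ "Suc j"] Suc)
 also have "... = (\<Sum>k\<in>K. (a k * a k ^ Suc j) * E k)"
  by (rule idempotents_mult[OF K E comm_pow[OF c]])
 finally show ?case by simp
qed simp

definition lin_in :: "('a => complex) set => nat => ('a => linop) => bool" where
 "lin_in C n Y \<longleftrightarrow> (\<forall>z. Y z \<in> corner n) \<and> (\<forall>i<n. \<forall>j<n. (%z. ent (Y z) i j) \<in> C)"

lemma lin_inD: "lin_in C n Y ==> Y z \<in> corner n" "lin_in C n Y ==> i < n ==> j < n ==> (%z. ent (Y z) i j) \<in> C"
 by (auto simp: lin_in_def)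

lemma lin_in_const: "alg C ==> a \<in> corner n ==> lin_in C n (%_. a)"
 by (simp add: lin_in_def alg_const)

lemma lin_in_mult:
 assumes C: "alg C" and X: "lin_in C n X" and Y: "lin_in C n Y"
 shows "lin_in C n (%z. X z * Y z)"
 unfolding lin_in_def
proof (intro conjI allI impI)
 show "X z * Y z \<in> corner n" for z by (rule corner_mult[OF lin_inD(1)[OF X] lin_inD(1)[OF Y]])
 fix i j assume ij: "i < n" "j < n"
 have "(%z. \<Sum>k<n. ent (X z) i k * ent (Y z) k j) \<in> C"
  by (intro alg_sum[OF C] alg_mult[OF C] lin_inD(2)[OF X] lin_inD(2)[OF Y]) (use ij in auto)
 thus "(%z. ent (X z * Y z) i j) \<in> C" by (simp only: ent_mult[OF lin_inD(1)[OF X] lin_inD(1)[OF Y] ij])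
qed

lemma lin_in_sum:
 assumes C: "alg C" and X: "\<And>k. k \<in> I ==> lin_in C n (X k)"
 shows "lin_in C n (%z. \<Sum>k\<in>I. X k z)"
 unfolding lin_in_def ent_simps
 by (intro conjI allI impI corner_sum alg_sum[OF C] lin_inD(1)[OF X] lin_inD(2)[OF X])

lemma lin_in_scale:
 assumes C: "alg C" and f: "f \<in> C" and X: "lin_in C n X"
 shows "lin_in C n (%z. cc (f z) * X z)"
 unfolding lin_in_def ent_simps
 by (intro conjI allI impI corner_scale alg_mult[OF C] f lin_inD(1)[OF X] lin_inD(2)[OF X])

lemma lin_in_diff:
 assumes C: "alg C" and X: "lin_in C n X" and Y: "lin_in C n Y"
 shows "lin_in C n (%z. X z - Y z)"
 unfolding lin_in_def ent_simps
 by (intro conjI allI impI corner_minus alg_diff[OF C] lin_inD(1)[OF X] lin_inD(2)[OF X] lin_inD(1)[OF Y] lin_inD(2)[OF Y])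

lemma lin_in_power: "alg C ==> lin_in C n X ==> lin_in C n (%z. X z ^ Suc k)"
 by (induction k) (simp_all add: lin_in_mult)

context punctures
begin

lemma EE_inverse: "EE f ==> (\<And>z. z \<in> W ==> f z ~= 0) ==> EE (%z. inverse (f z))"
 unfolding EE_def by (auto intro!: holomorphic_intros meromorphic_intros)

lemma EE_additive_matrix:
 assumes N: "lin_in {f. EE f} n N" and b: "N b = 0"
 shows "\<exists>I V. finite I \<and> I \<subseteq> S \<times> UNIV \<and> (\<forall>x. V x \<in> corner n) \<and>
  (\<forall>z\<in>W. N z = (\<Sum>x\<in>I. cc (ee (fst x) (snd x) z) * V x))"
proof -
 let ?Q = "%x Ic. finite (fst Ic) \<and> fst Ic \<subseteq> S \<times> UNIV \<and>
   (\<forall>z\<in>W. ent (N z) (fst x) (snd x) = (\<Sum>(p,k)\<in>fst Ic. snd Ic (p,k) * ee p k z))"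
 have "\<forall>x\<in>{..<n} \<times> {..<n}. \<exists>Ic. ?Q x Ic"
 proof
  fix x assume "x \<in> {..<n} \<times> {..<n}"
  hence "EE (%z. ent (N z) (fst x) (snd x))" using lin_inD(2)[OF N] by auto
  moreover have "ent (N b) (fst x) (snd x) = 0" by (simp add: b)
  ultimately have "\<exists>I c. finite I \<and> I \<subseteq> S \<times> UNIV \<and> (\<forall>z\<in>W. ent (N z) (fst x) (snd x) = (\<Sum>(p,k)\<in>I. c (p,k) * ee p k z))"
   by (rule EE_additive)
  then obtain I c where "finite I" "I \<subseteq> S \<times> UNIV" "\<forall>z\<in>W. ent (N z) (fst x) (snd x) = (\<Sum>(p,k)\<in>I. c (p,k) * ee p k z)"
   by (elim exE conjE)
  thus "\<exists>Ic. ?Q x Ic" by (intro exI[of _ "(I,c)"]) simp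
 qed
 from bchoice[OF this] obtain F where F: "\<forall>x\<in>{..<n} \<times> {..<n}. ?Q x (F x)" by (elim exE)
 define I where "I = (\<Union>x\<in>{..<n} \<times> {..<n}. fst (F x))"
 define V where "V y = emb (mat n n (%x. if y \<in> fst (F x) then snd (F x) y else 0))" for y
 have I: "finite I" "I \<subseteq> S \<times> UNIV" using F unfolding I_def by blast+
 have Vc: "V y \<in> corner n" for y unfolding V_def by (rule corner_emb) simp
 have "N z = (\<Sum>y\<in>I. cc (ee (fst y) (snd y) z) * V y)" if z: "z \<in> W" for z
 proof (rule corner_eqI[OF lin_inD(1)[OF N] corner_sum[OF corner_scale[OF Vc]]])
  fix i j assume ij: "i < n" "j < n"
  hence x: "(i,j) \<in> {..<n} \<times> {..<n}" by simp
  have "ent (N z) i j = (\<Sum>y\<in>fst (F (i,j)). snd (F (i,j)) y * ee (fst y) (snd y) z)"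
   using bspec[OF F x] z by (simp add: case_prod_beta)
  also have "... = (\<Sum>y\<in>I. if y \<in> fst (F (i,j)) then snd (F (i,j)) y * ee (fst y) (snd y) z else 0)"
   using I(1) x by (intro sum.mono_neutral_cong_left) (auto simp: I_def)
  also have "... = (\<Sum>y\<in>I. ee (fst y) (snd y) z * ent (V y) i j)"
   using ij by (intro sum.cong refl) (simp add: V_def ent_emb)
  finally show "ent (N z) i j = ent (\<Sum>y\<in>I. cc (ee (fst y) (snd y) z) * V y) i j" by simp
 qed
 with I Vc show ?thesis by blast
qed

text \<open>
 Interpolation writes \<open>P z\<close> as a combination of finitely many of its values with elliptic coefficients. On a joint
 generalized eigenspace the same combination of eigenvalues is the eigenvalue of \<open>P z\<close>; it is elliptic, nonzero on
 \<open>W\<close> and \<open>1\<close> at \<open>b\<close>, hence a character.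
\<close>
lemma character_decomposition:
 assumes P: "cfam n P"
 shows "\<exists>(K :: complex list set) E nn D. finite K \<and> D \<ge> 2 \<and> (\<Sum>k\<in>K. E k) = idn n \<and> (\<forall>k. E k \<in> corner n) \<and>
  (\<forall>k\<in>K. \<forall>l\<in>K. E k * E l = (if k = l then E k else 0)) \<and> (\<forall>k\<in>K. nn k \<in> RR) \<and>
  (\<forall>z\<in>W. \<forall>k\<in>K. emb (P z) * E k = E k * emb (P z)) \<and>
  (\<forall>z\<in>W. \<forall>k\<in>K. (emb (P z) - cc (ch (nn k) (%p. xx p z))) ^ D * E k = 0)"
proof -
 have Pin: "mat_in {f. EE f} n n P" and Pgl: "\<forall>z\<in>W. P z \<in> carrier (GLC n)"
  and Pc: "\<forall>z\<in>W. \<forall>w\<in>W. P z * P w = P w * P z" and Pb: "P b = 1\<^sub>m n" using P by (auto simp: cfam_def)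
 define p where "p z = emb (P z)" for z
 have pc: "p z \<in> corner n" for z unfolding p_def by (rule corner_emb[OF mat_inD(1)[OF Pin]])
 have pcomm: "p z * p w = p w * p z" if "z \<in> W" "w \<in> W" for z w
 proof -
  have "emb (P z * P w) = emb (P w * P z)" using Pc that by simp
  thus ?thesis using mat_inD(1)[OF Pin, of z] mat_inD(1)[OF Pin, of w] by (simp add: p_def emb_mult)
 qed
 have entp: "ent (p z) i j = P z $$ (i,j)" if "i < n" "j < n" for z i j
  using mat_inD(1)[OF Pin, of z] that by (simp add: p_def ent_emb)
 let ?I = "{..<n} \<times> {..<n}"
 have "finite ?I" by simp
 from finite_interpolation[OF this, of W "%x z. P z $$ x"] obtain m :: nat and w c where
  w: "\<forall>k<m. w k \<in> W" and ip: "\<forall>z\<in>W. \<forall>x\<in>?I. P z $$ x = (\<Sum>k<m. (\<Sum>j\<in>?I. c k j * P z $$ j) * P (w k) $$ x)"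
  by (elim exE conjE)
 define a where "a k z = (\<Sum>j\<in>?I. c k j * P z $$ j)" for k z
 have aEE: "EE (a k)" for k
 proof -
  have "(%z. \<Sum>j\<in>?I. c k j * P z $$ j) \<in> {f. EE f}"
   by (intro alg_sum[OF alg_EE] alg_scale[OF alg_EE]) (use mat_inD(2)[OF Pin] in auto)
  thus ?thesis by (simp add: a_def[abs_def])
 qed
 have pz: "p z = (\<Sum>k<m. cc (a k z) * p (w k))" if z: "z \<in> W" for z
 proof (rule corner_eqI[OF pc corner_sum[OF corner_scale[OF pc]]])
  fix i j assume ij: "i < n" "j < n"
  hence "P z $$ (i,j) = (\<Sum>k<m. a k z * P (w k) $$ (i,j))" using bspec[OF ip z] by (simp add: a_def)
  thus "ent (p z) i j = ent (\<Sum>k<m. cc (a k z) * p (w k)) i j" using ij by (simp add: entp)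
 qed
 define as where "as = map (%k. p (w k)) [0..<m]"
 have "set as \<subseteq> corner n" and asc: "x * y = y * x" if "x \<in> set as" "y \<in> set as" for x y
  using pc pcomm w that by (auto simp: as_def)
 have "\<exists>K E. finite K \<and> (\<Sum>k\<in>K. E k) = idn n \<and> (\<forall>k. E k \<in> corner n) \<and>
  (\<forall>k\<in>K. \<forall>i<length as. (as ! i - cc (k ! i)) ^ n * E k = 0) \<and>
  (\<forall>k\<in>K. \<forall>l\<in>K. E k * E l = (if k = l then E k else 0)) \<and>
  (\<forall>k\<in>K. \<forall>b\<in>corner n. (\<forall>a\<in>set as. a * b = b * a) --> b * E k = E k * b)"
  by (rule joint_spectral_idempotents) (use pc asc in \<open>auto simp: as_def\<close>)
 then obtain K E where K: "finite K" "(\<Sum>k\<in>K. E k) = idn n" "\<forall>k. E k \<in> corner n"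
  "\<forall>k\<in>K. \<forall>i<length as. (as ! i - cc (k ! i)) ^ n * E k = 0"
  "\<forall>k\<in>K. \<forall>l\<in>K. E k * E l = (if k = l then E k else 0)"
  "\<forall>k\<in>K. \<forall>b\<in>corner n. (\<forall>a\<in>set as. a * b = b * a) --> b * E k = E k * b" by (elim exE conjE)
 have nil: "(p (w i) - cc (k ! i)) ^ n * E k = 0" if "k \<in> K" "i < m" for k i
  using K(4) that by (simp add: as_def)
 have pE: "p z * E k = E k * p z" if "z \<in> W" "k \<in> K" for z k
  using K(6) that pc pcomm w by (auto simp: as_def)
 define lam where "lam k z = (\<Sum>i<m. a i z * (k ! i))" for k :: "complex list" and z
 have lamEE: "EE (lam k)" for k
 proof -
  have "(%z. \<Sum>i<m. (k ! i) * a i z) \<in> {f. EE f}"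
   by (intro alg_sum[OF alg_EE] alg_scale[OF alg_EE]) (use aEE in simp)
  thus ?thesis by (simp add: lam_def[abs_def] mult.commute)
 qed
 \<comment> \<open>The summand \<open>2\<close> covers the case \<open>m = 0\<close> and the truncation bound of the logarithm.\<close>
 define D where "D = m * n + 2"
 have nilp: "(p z - cc (lam k z)) ^ D * E k = 0" if z: "z \<in> W" and k: "k \<in> K" for z k
 proof -
  define X where "X i = cc (a i z) * (p (w i) - cc (k ! i))" for i
  have sum: "p z - cc (lam k z) = (\<Sum>i<m. X i)"
   by (simp add: pz[OF z] lam_def X_def cc_sum right_diff_distrib sum_subtractf cc_mult)
  have "X i * X j = X j * X i" if "i \<in> {..<m}" "j \<in> {..<m}" for i j
  proof -
   have "p (w i) * p (w j) = p (w j) * p (w i)" using pcomm w that by simp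
   from comm_diff_cc[OF this] have "(p (w j) - cc (k ! j)) * p (w i) = p (w i) * (p (w j) - cc (k ! j))" by simp
   from comm_diff_cc[OF this] have "(p (w j) - cc (k ! j)) * (p (w i) - cc (k ! i)) = (p (w i) - cc (k ! i)) * (p (w j) - cc (k ! j))" .
   thus ?thesis unfolding X_def cc_prod by (simp only: mult.commute[of "a i z"])
  qed
  moreover have "X i ^ n * E k = 0" if "i \<in> {..<m}" for i
   using nil[OF k] that by (simp add: X_def cc_mult_power mult.assoc)
  ultimately have "{..<m} = {} \<or> (\<Sum>i<m. X i) ^ (\<Sum>i<m. n) * E k = 0" by (intro nilpotent_sum) auto
  thus ?thesis
  proof
   assume "{..<m} = {}"
   hence "(\<Sum>i<m. X i) = 0" by simp
   thus ?thesis unfolding sum by (simp add: D_def)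
  next
   assume "(\<Sum>i<m. X i) ^ (\<Sum>i<m. n) * E k = 0"
   hence "(\<Sum>i<m. X i) ^ 2 * ((\<Sum>i<m. X i) ^ (m * n) * E k) = 0" by simp
   thus ?thesis unfolding sum D_def by (simp only: power_add mult.assoc power_commutes[symmetric] add.commute[of "m * n"])
  qed
 qed
 \<comment> \<open>On a zero idempotent the joint eigenvalue is meaningless; only the others give characters.\<close>
 define K' where "K' = {k \<in> K. E k ~= 0}"
 have lam_nz: "lam k z ~= 0" if z: "z \<in> W" and k: "k \<in> K'" for z k
 proof
  assume 0: "lam k z = 0"
  obtain R where R: "R \<in> carrier_mat n n" "R * P z = 1\<^sub>m n" using Pgl z by (auto simp: GL_carrier)
  have Rp: "emb R * p z = idn n"
   using R mat_inD(1)[OF Pin, of z] emb_mult[of R "P z"] by (simp add: p_def)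
  have Ec: "p z ^ j * E k \<in> corner n" for j
   by (induction j) (use K(3) pc in \<open>auto simp: mult.assoc intro: corner_mult\<close>)
  have "p z ^ j * E k = 0 ==> E k = 0" for j
  proof (induction j)
   case (Suc j)
   have "p z ^ j * E k = idn n * (p z ^ j * E k)" using corner_id(1)[OF Ec] by simp
   also have "... = emb R * (p z ^ Suc j * E k)" unfolding Rp[symmetric] by (simp add: mult.assoc)
   also have "... = 0" using Suc.prems by simp
   finally show ?case by (rule Suc.IH)
  qed simp
  moreover have "p z ^ D * E k = 0" using nilp[OF z, of k] k 0 by (simp add: K'_def)
  ultimately show False using k by (simp add: K'_def)
 qed
 have lam_b: "lam k b = 1" if k: "k \<in> K'" for k
 proof (rule ccontr)
  assume "lam k b ~= 1"
  moreover have "(idn n - cc (lam k b)) ^ D * E k = 0" using nilp[OF b_W, of k] k by (simp add: K'_def p_def Pb)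
  moreover have "(idn n - cc 1) ^ 1 * E k = 0" using K(3) corner_id(1) by (simp add: left_diff_distrib)
  ultimately have "E k = 0"
   using coprime_annihilators[where a = "idn n" and l = "lam k b" and d = D and m = 1 and e = 1 and Y = "E k"] by simp
  thus False using k by (simp add: K'_def)
 qed
 have "\<forall>k\<in>K'. \<exists>n\<in>RR. \<forall>z\<in>W. lam k z = ch n (%p. xx p z)"
  using EE_multiplicative[OF lamEE lam_nz lam_b] by blast
 hence "\<forall>k\<in>K'. \<exists>n. n \<in> RR \<and> (\<forall>z\<in>W. lam k z = ch n (%p. xx p z))" by blast
 from bchoice[OF this] obtain nn where nn: "\<forall>k\<in>K'. nn k \<in> RR \<and> (\<forall>z\<in>W. lam k z = ch (nn k) (%p. xx p z))" by (elim exE)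
 have sumE: "(\<Sum>k\<in>K'. E k) = idn n"
  unfolding K(2)[symmetric] using K(1) by (intro sum.mono_neutral_left) (auto simp: K'_def)
 show ?thesis
 proof (rule exI[of _ K'], rule exI[of _ E], rule exI[of _ nn], rule exI[of _ D], intro conjI ballI)
  show "(emb (P z) - cc (ch (nn k) (%p. xx p z))) ^ D * E k = 0" if "z \<in> W" "k \<in> K'" for z k
   using nilp[OF that(1), of k] nn that by (simp add: K'_def p_def)
  show "emb (P z) * E k = E k * emb (P z)" if "z \<in> W" "k \<in> K'" for z k
   using pE[of z k] that by (simp add: K'_def p_def)
  show "E k * E l = (if k = l then E k else 0)" if "k \<in> K'" "l \<in> K'" for k l
   using K(5) that by (simp add: K'_def)
  show "nn k \<in> RR" if "k \<in> K'" for k using nn that by blast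
 qed (use K(1,3) sumE in \<open>simp_all add: K'_def D_def\<close>)
qed

text \<open>The unipotent factor \<open>1 + y z\<close> has a logarithm with elliptic entries that vanish at \<open>b\<close>. Its coefficients in the basis \<open>ee p k\<close> are combinations of values of the logarithm, by dual points, and therefore commute and are nilpotent.\<close>
lemma jordan_chevalley_family:
 assumes P: "cfam n P"
 shows "\<exists>(K :: complex list set) E nn I V D. finite K \<and> (\<Sum>k\<in>K. E k) = idn n \<and> (\<forall>k. E k \<in> corner n) \<and>
  (\<forall>k\<in>K. \<forall>l\<in>K. E k * E l = (if k = l then E k else 0)) \<and> (\<forall>k\<in>K. nn k \<in> RR) \<and>
  finite I \<and> I \<subseteq> S \<times> UNIV \<and> (\<forall>x. V x \<in> corner n) \<and>
  (\<forall>x\<in>I. \<forall>y\<in>I. V x * V y = V y * V x) \<and> (\<forall>x\<in>I. \<forall>k\<in>K. E k * V x = V x * E k) \<and> (\<forall>x\<in>I. \<exists>d. V x ^ d = 0) \<and>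
  (\<forall>z\<in>W. (\<Sum>x\<in>I. cc (ee (fst x) (snd x) z) * V x) ^ D = 0 \<and>
   emb (P z) = (\<Sum>k\<in>K. cc (ch (nn k) (%p. xx p z)) * E k) * nexp D (\<Sum>x\<in>I. cc (ee (fst x) (snd x) z) * V x))"
proof -
 from character_decomposition[OF P] obtain K :: "complex list set" and E nn D where K: "finite K" "D \<ge> 2" "(\<Sum>k\<in>K. E k) = idn n"
  "\<forall>k. E k \<in> corner n" "\<forall>k\<in>K. \<forall>l\<in>K. E k * E l = (if k = l then E k else 0)" "\<forall>k\<in>K. nn k \<in> RR"
  "\<forall>z\<in>W. \<forall>k\<in>K. emb (P z) * E k = E k * emb (P z)"
  "\<forall>z\<in>W. \<forall>k\<in>K. (emb (P z) - cc (ch (nn k) (%p. xx p z))) ^ D * E k = 0" by (elim exE conjE)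
 have Pin: "mat_in {f. EE f} n n P" and Pc: "\<forall>z\<in>W. \<forall>w\<in>W. P z * P w = P w * P z" and Pb: "P b = 1\<^sub>m n"
  using P by (auto simp: cfam_def)
 define p where "p z = emb (P z)" for z
 have pc: "p z \<in> corner n" for z unfolding p_def by (rule corner_emb[OF mat_inD(1)[OF Pin]])
 have pcomm: "p z * p w = p w * p z" if "z \<in> W" "w \<in> W" for z w
 proof -
  have "emb (P z * P w) = emb (P w * P z)" using Pc that by simp
  thus ?thesis using mat_inD(1)[OF Pin, of z] mat_inD(1)[OF Pin, of w] by (simp add: p_def emb_mult)
 qed
 have pEE: "lin_in {f. EE f} n p"
  unfolding lin_in_def
 proof (intro conjI allI impI)
  fix i j assume ij: "i < n" "j < n"
  have "ent (p z) i j = P z $$ (i,j)" for z using mat_inD(1)[OF Pin, of z] ij by (simp add: p_def ent_emb)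
  thus "(%z. ent (p z) i j) \<in> {f. EE f}" using mat_inD(2)[OF Pin ij] by simp
 qed (rule pc)
 define lam where "lam k z = ch (nn k) (%p. xx p z)" for k z
 have lamEE: "EE (lam k)" if "k \<in> K" for k unfolding lam_def using K(6) that by (intro EE_char(1)) blast
 have lam_nz: "lam k z ~= 0" if "k \<in> K" "z \<in> W" for k z unfolding lam_def using K(6) that by (intro EE_char(2)) blast+
 have lam_b: "lam k b = 1" if "k \<in> K" for k unfolding lam_def using K(6) that by (intro xx_b) blast
 have pE: "E k * p z = p z * E k" if "k \<in> K" "z \<in> W" for k z using K(7) that by (simp add: p_def)
 have EE': "E k * E l = E l * E k" if "k \<in> K" "l \<in> K" for k l using K(5) that by simp
 define t where "t k z = cc (inverse (lam k z)) * (p z - cc (lam k z))" for k z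
 have tE: "E l * t k z = t k z * E l" if "k \<in> K" "l \<in> K" "z \<in> W" for k l z
  unfolding t_def by (rule comm_scale[OF comm_diff_cc[OF pE[OF that(2,3)]]])
 have tt: "t k z * t l w = t l w * t k z" if "k \<in> K" "l \<in> K" "z \<in> W" "w \<in> W" for k l z w
 proof -
  have "p z * t l w = t l w * p z" unfolding t_def by (rule comm_scale[OF comm_diff_cc[OF pcomm[OF that(3,4)]]])
  from comm_scale[OF comm_diff_cc[OF this[symmetric]]] show ?thesis by (simp add: t_def)
 qed
 define y where "y z = (\<Sum>k\<in>K. t k z * E k)" for z
 have yEE: "lin_in {f. EE f} n y"
 proof -
  have "lin_in {f. EE f} n (%z. cc (inverse (lam k z)) * (p z * E k - cc (lam k z) * E k))" if k: "k \<in> K" for k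
   by (intro lin_in_scale[OF alg_EE] lin_in_diff[OF alg_EE] lin_in_mult[OF alg_EE pEE] lin_in_const[OF alg_EE])
    (use EE_inverse[OF lamEE lam_nz] lamEE k K(4) in auto)
  from lin_in_sum[OF alg_EE this] show ?thesis
   by (simp add: y_def[abs_def] t_def left_diff_distrib mult.assoc)
 qed
 have yy: "y z * y w = y w * y z" if z: "z \<in> W" "w \<in> W" for z w
 proof -
  have "(t k z * E k) * (t l w * E l) = (t l w * E l) * (t k z * E k)" if k: "k \<in> K" "l \<in> K" for k l
  proof (rule comm_mult)
   show "t k z * E k * t l w = t l w * (t k z * E k)"
    by (rule comm_mult[symmetric]) (rule tt[OF k(2,1) z(2,1)], rule tE[OF k(2,1) z(2), symmetric])
   show "t k z * E k * E l = E l * (t k z * E k)"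
    by (rule comm_mult[symmetric]) (rule tE[OF k z(1)], rule EE'[OF k(2,1)])
  qed
  thus ?thesis unfolding y_def by (intro comm_sum comm_sum[symmetric]) auto
 qed
 have yE: "E k * y z = y z * E k" if "k \<in> K" "z \<in> W" for k z
  unfolding y_def using that by (intro comm_sum comm_mult tE EE')
 have yD: "y z ^ D = 0" if z: "z \<in> W" for z
 proof -
  obtain d where d: "D = Suc d" using K(2) by (cases D) auto
  have "y z ^ D = (\<Sum>k\<in>K. t k z ^ D * E k)"
   unfolding d y_def by (rule idempotents_power[OF K(1)]) (use K(5) tE z in auto)
  also have "... = 0"
   by (rule sum.neutral) (use K(8) z in \<open>auto simp: t_def cc_mult_power mult.assoc p_def lam_def\<close>)
  finally show ?thesis .
 qed
 define N where "N z = (\<Sum>i<D - 1. cc (fps_nth logser (Suc i)) * y z ^ Suc i)" for z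
 have N_ev: "N z = ev D (y z) logser" for z
 proof -
  have "D = Suc (D - 1)" using K(2) by simp
  hence "ev D (y z) logser = (\<Sum>i<Suc (D - 1). cc (fps_nth logser i) * y z ^ i)" by (simp add: ev_def)
  thus ?thesis unfolding sum.lessThan_Suc_shift by (simp add: N_def logser(1))
 qed
 have NEE: "lin_in {f. EE f} n N"
  unfolding N_def by (intro lin_in_sum[OF alg_EE] lin_in_scale[OF alg_EE] lin_in_power[OF alg_EE yEE]) (rule alg_const[OF alg_EE])
 have Nlog: "nexp D (N z) = 1 + y z" "N z ^ D = 0" if "z \<in> W" for z
  unfolding N_ev by (rule nexp_log[OF yD[OF that] K(2)])+
 have yb: "y b = 0"
  unfolding y_def
 proof (rule sum.neutral, rule ballI)
  fix k assume k: "k \<in> K"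
  have "p b * E k = E k" using K(4) corner_id(1) by (simp add: p_def Pb)
  thus "t k b * E k = 0" by (simp add: t_def lam_b[OF k] left_diff_distrib)
 qed
 have Nb: "N b = 0" by (simp add: N_def yb)
 have NN: "N z * N w = N w * N z" if "z \<in> W" "w \<in> W" for z w
  unfolding N_ev by (rule comm_ev[OF comm_ev[OF yy[OF that, symmetric], symmetric]])
 have EN: "E k * N z = N z * E k" if "k \<in> K" "z \<in> W" for k z unfolding N_ev by (rule comm_ev[OF yE[OF that]])
 have pN: "p z = (\<Sum>k\<in>K. cc (lam k z) * E k) * nexp D (N z)" if z: "z \<in> W" for z
 proof -
  have "(\<Sum>k\<in>K. cc (lam k z) * E k) * y z = (\<Sum>k\<in>K. (cc (lam k z) * t k z) * E k)"
   unfolding y_def by (rule idempotents_mult[OF K(1)]) (use K(5) tE z in auto)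
  also have "... = (\<Sum>k\<in>K. (p z - cc (lam k z)) * E k)"
   by (intro sum.cong refl) (use lam_nz z in \<open>simp add: t_def cc_cc cc_mult[symmetric] mult.assoc[symmetric]\<close>)
  finally have "(\<Sum>k\<in>K. cc (lam k z) * E k) * (1 + y z) = (\<Sum>k\<in>K. p z * E k)"
   by (simp add: distrib_left left_diff_distrib sum_subtractf)
  also have "... = p z" unfolding sum_distrib_left[symmetric] K(3) by (rule corner_id(2)[OF pc])
  finally show ?thesis unfolding Nlog(1)[OF z] by simp
 qed
 from EE_additive_matrix[OF NEE Nb] obtain I V where I: "finite I" "I \<subseteq> S \<times> UNIV" "\<forall>x. V x \<in> corner n"
  "\<forall>z\<in>W. N z = (\<Sum>x\<in>I. cc (ee (fst x) (snd x) z) * V x)" by (elim exE conjE)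
 have indep: "\<forall>x\<in>I. c x = 0" if "\<And>z. z \<in> W ==> (\<Sum>x\<in>I. c x * ee (fst x) (snd x) z) = 0" for c
  by (rule ee_independent[OF I(1,2)]) (use that in \<open>simp add: case_prod_beta\<close>)
 have "\<exists>(m :: nat) w \<beta>. (\<forall>k<m. w k \<in> W) \<and>
  (\<forall>x\<in>I. \<forall>j\<in>I. (\<Sum>k<m. \<beta> k j * ee (fst x) (snd x) (w k)) = (if x = j then 1 else 0))"
  by (rule dual_points[OF I(1), where g = "%x z. ee (fst x) (snd x) z"]) (rule indep)
 then obtain m :: nat and w \<beta> where w: "\<forall>k<m. w k \<in> W"
  and dual: "\<forall>x\<in>I. \<forall>j\<in>I. (\<Sum>k<m. \<beta> k j * ee (fst x) (snd x) (w k)) = (if x = j then 1 else 0)" by (elim exE conjE)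
 have V: "V j = (\<Sum>k<m. cc (\<beta> k j) * N (w k))" if j: "j \<in> I" for j
 proof -
  have "(\<Sum>k<m. cc (\<beta> k j) * N (w k)) = (\<Sum>k<m. \<Sum>x\<in>I. cc (\<beta> k j * ee (fst x) (snd x) (w k)) * V x)"
   using I(4) w by (intro sum.cong refl) (simp add: sum_distrib_left cc_cc)
  also have "... = (\<Sum>x\<in>I. cc (\<Sum>k<m. \<beta> k j * ee (fst x) (snd x) (w k)) * V x)"
   unfolding cc_sum sum_distrib_right by (rule sum.swap)
  also have "... = (\<Sum>x\<in>I. if x = j then V x else 0)"
   by (intro sum.cong refl) (use dual j in auto)
  also have "... = V j" using I(1) j by simp
  finally show ?thesis by simp
 qed
 have VN: "N z * V j = V j * N z" if "j \<in> I" "z \<in> W" for j z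
  unfolding V[OF that(1)] using w that NN by (intro comm_sum comm_scale) auto
 have VV: "V x * V j = V j * V x" if "x \<in> I" "j \<in> I" for x j
  unfolding V[OF that(2)] using w VN[OF that(1)] by (intro comm_sum comm_scale) auto
 have EV: "E k * V j = V j * E k" if "k \<in> K" "j \<in> I" for k j
  unfolding V[OF that(2)] using w EN[OF that(1)] by (intro comm_sum comm_scale) auto
 have Vnil: "\<exists>d. V j ^ d = 0" if j: "j \<in> I" for j
 proof -
  have "(cc (\<beta> k j) * N (w k)) * (cc (\<beta> l j) * N (w l)) = (cc (\<beta> l j) * N (w l)) * (cc (\<beta> k j) * N (w k))"
   if "k \<in> {..<m}" "l \<in> {..<m}" for k l
   unfolding cc_prod using NN w that by (simp add: mult.commute)
  moreover have "(cc (\<beta> k j) * N (w k)) ^ D * 1 = 0" if "k \<in> {..<m}" for k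
   using Nlog(2) w that by (simp add: cc_mult_power)
  ultimately have "{..<m} = {} \<or> (\<Sum>k<m. cc (\<beta> k j) * N (w k)) ^ (\<Sum>k<m. D) * 1 = 0"
   by (intro nilpotent_sum) auto
  hence "V j = 0 \<or> V j ^ (m * D) = 0" unfolding V[OF j] by auto
  thus ?thesis by (metis power_one_right)
 qed
 show ?thesis
  by (rule exI[of _ K], rule exI[of _ E], rule exI[of _ nn], rule exI[of _ I], rule exI[of _ V], rule exI[of _ D], intro conjI ballI)
   (use K I VV EV Vnil Nlog(2) pN in \<open>simp_all add: p_def lam_def\<close>)
qed

abbreviation gam :: "complex => (complex set => complex) set set \<times> (complex set => complex fps)" where
 "gam z \<equiv> pt (%p. xx p z) (eps z)"

definition is_rep :: "nat => ((complex set => complex) set set \<times> (complex set => complex fps) => complex mat) => bool" where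
 "is_rep n \<rho> \<longleftrightarrow> \<rho> \<in> Group.hom PG (GLC n) \<and> (\<forall>i<n. \<forall>j<n. (%g. \<rho> g $$ (i,j)) \<in> reg_funs PG)"

lemma alg_reg: "alg (reg_funs PG)"
 unfolding alg_def PG_simps by (auto intro: fun_algebra.const fun_algebra.add fun_algebra.mult)

text \<open>Substitute the coordinates \<open>xchar\<close> and \<open>tcoord\<close> for the elliptic functions in the decomposition of \<open>P\<close>.\<close>
lemma rep_exists:
 assumes P: "cfam n P"
 shows "\<exists>\<rho>. is_rep n \<rho> \<and> (\<forall>z\<in>W. \<rho> (gam z) = P z)"
proof -
 from jordan_chevalley_family[OF P] obtain K :: "complex list set" and E nn I V D where
  K: "finite K" "(\<Sum>k\<in>K. E k) = idn n" "\<forall>k. E k \<in> corner n"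
  "\<forall>k\<in>K. \<forall>l\<in>K. E k * E l = (if k = l then E k else 0)" "\<forall>k\<in>K. nn k \<in> RR" and
  I: "finite I" "I \<subseteq> S \<times> UNIV" "\<forall>x. V x \<in> corner n"
  "\<forall>x\<in>I. \<forall>y\<in>I. V x * V y = V y * V x" "\<forall>x\<in>I. \<forall>k\<in>K. E k * V x = V x * E k" "\<forall>x\<in>I. \<exists>d. V x ^ d = 0" and
  PW: "\<forall>z\<in>W. (\<Sum>x\<in>I. cc (ee (fst x) (snd x) z) * V x) ^ D = 0 \<and>
   emb (P z) = (\<Sum>k\<in>K. cc (ch (nn k) (%p. xx p z)) * E k) * nexp D (\<Sum>x\<in>I. cc (ee (fst x) (snd x) z) * V x)"
  by (elim exE conjE)
 from bchoice[OF I(6)] obtain d where d: "\<forall>x\<in>I. V x ^ d x = 0" by (elim exE)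
 \<comment> \<open>One truncation order that serves all points of the group and the elliptic functions as well.\<close>
 define B where "B = (\<Sum>x\<in>I. d x) + D + 1"
 define X where "X g = (\<Sum>x\<in>I. cc (tcoord (fst x) (snd x) g) * V x)" for g
 define H where "H g = (\<Sum>k\<in>K. cc (xchar (nn k) g) * E k)" for g
 define r where "r g = H g * nexp B (X g)" for g
 have Ip: "fst x \<in> S" if "x \<in> I" for x using that I(2) by auto
 have XX: "X g * X h = X h * X g" for g h
 proof -
  have "V x * X h = X h * V x" if "x \<in> I" for x h
   unfolding X_def using I(4) that by (intro comm_sum comm_scale) blast
  hence "X h * (cc c * V x) = (cc c * V x) * X h" if "x \<in> I" for x h c
   using that by (intro comm_scale) simp
  thus ?thesis unfolding X_def[of h] by (intro comm_sum) simp
 qed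
 have XH: "X g * H h = H h * X g" for g h
 proof -
  have "E k * X g = X g * E k" if "k \<in> K" for k
   unfolding X_def using I(5) that by (intro comm_sum comm_scale) blast
  thus ?thesis unfolding H_def by (intro comm_sum comm_scale) simp
 qed
 have XB: "X g ^ B = 0" for g
 proof -
  have "(cc c * V x) * (cc e * V y) = (cc e * V y) * (cc c * V x)" if "x \<in> I" "y \<in> I" for x y c e
   unfolding cc_prod using I(4) that by (simp add: mult.commute)
  moreover have "(cc c * V x) ^ d x * 1 = 0" if "x \<in> I" for x c using d that by (simp add: cc_mult_power)
  ultimately have "I = {} \<or> X g ^ (\<Sum>x\<in>I. d x) * 1 = 0" unfolding X_def by (intro nilpotent_sum I(1))
  thus ?thesis
  proof
   assume "I = {}"
   thus ?thesis by (simp add: X_def B_def)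
  next
   assume "X g ^ (\<Sum>x\<in>I. d x) * 1 = 0"
   thus ?thesis by (simp add: B_def power_add)
  qed
 qed
 have pts: "X (pt x t \<otimes>\<^bsub>PG\<^esub> pt y v) = X (pt x t) + X (pt y v)" "H (pt x t \<otimes>\<^bsub>PG\<^esub> pt y v) = H (pt x t) * H (pt y v)"
  if xy: "nzS x" "nzS y" for x y t v
 proof -
  have nz: "nzS (%p. x p * y p)" using xy by simp
  show "X (pt x t \<otimes>\<^bsub>PG\<^esub> pt y v) = X (pt x t) + X (pt y v)"
   unfolding pt_mult[OF xy] X_def sum.distrib[symmetric]
   by (intro sum.cong refl) (use Ip in \<open>simp add: tcoord_pt tadd_def cc_add distrib_right\<close>)
  have "H (pt x t) * H (pt y v) = (\<Sum>k\<in>K. (cc (xchar (nn k) (pt x t)) * cc (xchar (nn k) (pt y v))) * E k)"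
   unfolding H_def by (rule idempotents_mult[OF K(1)]) (use K(4) in \<open>auto simp: cc_commute\<close>)
  also have "... = H (pt (%p. x p * y p) (tadd t v))"
   unfolding H_def using K(5) xy nz
   by (intro sum.cong refl) (simp add: xchar_pt ch_mult cc_mult[symmetric])
  finally show "H (pt x t \<otimes>\<^bsub>PG\<^esub> pt y v) = H (pt x t) * H (pt y v)" unfolding pt_mult[OF xy] by simp
 qed
 have rmult: "r (g \<otimes>\<^bsub>PG\<^esub> h) = r g * r h" if g: "g \<in> carrier PG" and h: "h \<in> carrier PG" for g h
 proof -
  obtain x t y v where xy: "nzS x" "g = pt x t" "nzS y" "h = pt y v" using pt_surj[OF g] pt_surj[OF h] by blast
  note m = pts[OF xy(1,3), of t v, folded xy(2,4)]
  have "(X g + X h) ^ B = 0" using XB[of "g \<otimes>\<^bsub>PG\<^esub> h"] by (simp add: m)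
  hence "nexp B (X g + X h) = nexp B (X g) * nexp B (X h)" by (intro nexp_add XX XB)
  hence "r (g \<otimes>\<^bsub>PG\<^esub> h) = H g * ((H h * nexp B (X g)) * nexp B (X h))" by (simp add: r_def m mult.assoc)
  also have "H h * nexp B (X g) = nexp B (X g) * H h" by (rule comm_nexp[OF XH[symmetric]])
  finally show ?thesis by (simp add: r_def mult.assoc)
 qed
 have rone: "r \<one>\<^bsub>PG\<^esub> = idn n"
 proof -
  have "X \<one>\<^bsub>PG\<^esub> = 0" unfolding X_def pt_one by (intro sum.neutral ballI) (simp add: tcoord_pt Ip)
  moreover have "H \<one>\<^bsub>PG\<^esub> = (\<Sum>k\<in>K. E k)"
   unfolding H_def pt_one using K(5) by (intro sum.cong refl) (simp add: xchar_pt ch_def)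
  moreover have "nexp B 0 = 1"
  proof -
   have "nexp (Suc (B - 1)) 0 = 1" unfolding nexp_def sum.lessThan_Suc_shift by simp
   thus ?thesis by (simp add: B_def)
  qed
  ultimately show ?thesis using K(2) by (simp add: r_def)
 qed
 have Hin: "lin_in (reg_funs PG) n H"
  unfolding H_def[abs_def] using K(3,5)
  by (intro lin_in_sum[OF alg_reg] lin_in_scale[OF alg_reg] lin_in_const[OF alg_reg] xchar_regular) auto
 have Xin: "lin_in (reg_funs PG) n X"
  unfolding X_def[abs_def] using I(3) Ip
  by (intro lin_in_sum[OF alg_reg] lin_in_scale[OF alg_reg] lin_in_const[OF alg_reg]) (auto intro: tcoord_regular)
 have rin: "lin_in (reg_funs PG) n r"
 proof -
  have "lin_in (reg_funs PG) n (%g. H g * X g ^ k)" for k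
   using Hin lin_in_mult[OF alg_reg Hin lin_in_power[OF alg_reg Xin]] by (cases k) simp_all
  hence "lin_in (reg_funs PG) n (%g. \<Sum>k<B. cc (1 / fact k) * (H g * X g ^ k))"
   by (intro lin_in_sum[OF alg_reg] lin_in_scale[OF alg_reg alg_const[OF alg_reg]])
  thus ?thesis by (simp add: r_def[abs_def] nexp_def sum_distrib_left cc_left_commute[of "H _"])
 qed
 note rc = lin_inD(1)[OF rin]
 define \<rho> where "\<rho> g = cut n (r g)" for g
 have emb_rho: "emb (\<rho> g) = r g" for g unfolding \<rho>_def by (rule emb_cut[OF rc])
 have rho_c: "\<rho> g \<in> carrier_mat n n" for g by (simp add: \<rho>_def)
 have rho_mult: "\<rho> (g \<otimes>\<^bsub>PG\<^esub> h) = \<rho> g * \<rho> h" if "g \<in> carrier PG" "h \<in> carrier PG" for g h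
 proof (rule emb_inj[OF rho_c mult_carrier_mat[OF rho_c rho_c]])
  show "emb (\<rho> (g \<otimes>\<^bsub>PG\<^esub> h)) = emb (\<rho> g * \<rho> h)"
   using rho_c[of g] rho_c[of h] rmult[OF that] by (simp add: emb_mult emb_rho)
 qed
 have rho_one: "\<rho> \<one>\<^bsub>PG\<^esub> = 1\<^sub>m n" unfolding \<rho>_def rone by (rule cut_emb) simp
 have "\<rho> \<in> Group.hom PG (GLC n)"
 proof (rule homI)
  fix g assume g: "g \<in> carrier PG"
  obtain x t where x: "nzS x" "g = pt x t" using pt_surj[OF g] by blast
  define h where "h = pt (%p. inverse (x p)) (%p k. - t p k)"
  have hc: "h \<in> carrier PG" unfolding h_def using x by (intro pt_carrier) simp
  have eq: "pt (%p. x p * inverse (x p)) (%_ _. 0) = pt (%_. 1) (%_ _. 0)"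
   unfolding pt_def using x(1) by (auto intro!: arg_cong[of _ _ tor] restrict_ext)
  have nzi: "nzS (%p. inverse (x p))" using x by simp
  have gh: "g \<otimes>\<^bsub>PG\<^esub> h = \<one>\<^bsub>PG\<^esub>" "h \<otimes>\<^bsub>PG\<^esub> g = \<one>\<^bsub>PG\<^esub>"
   unfolding x(2) h_def pt_mult[OF x(1) nzi] pt_mult[OF nzi x(1)] pt_one eq[symmetric]
   by (simp_all add: tadd_def mult.commute)
  show "\<rho> g \<in> carrier (GLC n)" unfolding GL_carrier
   using rho_c rho_mult[OF g hc] rho_mult[OF hc g] gh rho_one by (metis (no_types))
 qed (simp add: rho_mult)
 moreover have "(%g. \<rho> g $$ (i,j)) \<in> reg_funs PG" if "i < n" "j < n" for i j
  using lin_inD(2)[OF rin that] that by (simp add: \<rho>_def cut_def)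
 moreover have "\<rho> (gam z) = P z" if z: "z \<in> W" for z
 proof -
  have nz: "nzS (%p. xx p z)" using z by (simp add: xx_nz)
  let ?N = "\<Sum>x\<in>I. cc (ee (fst x) (snd x) z) * V x"
  have "X (gam z) = ?N" unfolding X_def by (intro sum.cong refl) (simp add: tcoord_pt Ip eps_def)
  moreover have "H (gam z) = (\<Sum>k\<in>K. cc (ch (nn k) (%p. xx p z)) * E k)"
   unfolding H_def using K(5) nz by (intro sum.cong refl) (simp add: xchar_pt)
  moreover have "nexp B ?N = nexp D ?N" using PW z by (intro nexp_extend) (auto simp: B_def)
  ultimately have "r (gam z) = emb (P z)" using PW z by (simp add: r_def)
  hence "emb (\<rho> (gam z)) = emb (P z)" by (simp add: emb_rho)
  moreover have "P z \<in> carrier_mat n n" by (rule mat_inD(1)[OF conjunct1[OF P[unfolded cfam_def]]])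
  ultimately show ?thesis using emb_inj[OF rho_c] by blast
 qed
 ultimately show ?thesis unfolding is_rep_def by blast
qed

section \<open>From representations to systems\<close>

lemma rep_D:
 assumes "is_rep n \<rho>"
 shows "g \<in> carrier PG ==> \<rho> g \<in> carrier (GLC n)" "g \<in> carrier PG ==> \<rho> g \<in> carrier_mat n n"
  "g \<in> carrier PG ==> h \<in> carrier PG ==> \<rho> (g \<otimes>\<^bsub>PG\<^esub> h) = \<rho> g * \<rho> h" "\<rho> \<one>\<^bsub>PG\<^esub> = 1\<^sub>m n"
proof -
 have h: "\<rho> \<in> Group.hom PG (GLC n)" using assms by (simp add: is_rep_def)
 have 1: "\<rho> g \<in> carrier (GLC n)" if "g \<in> carrier PG" for g using h that by (auto simp: hom_def)
 show "g \<in> carrier PG ==> \<rho> g \<in> carrier (GLC n)" "g \<in> carrier PG ==> \<rho> g \<in> carrier_mat n n"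
  using 1 by (auto simp: GL_carrier)
 have 2: "\<rho> (g \<otimes>\<^bsub>PG\<^esub> h) = \<rho> g * \<rho> h" if "g \<in> carrier PG" "h \<in> carrier PG" for g h
  using h that by (auto simp: hom_def)
 thus "g \<in> carrier PG ==> h \<in> carrier PG ==> \<rho> (g \<otimes>\<^bsub>PG\<^esub> h) = \<rho> g * \<rho> h" .
 have o: "\<one>\<^bsub>PG\<^esub> \<in> carrier PG" unfolding pt_one by (rule pt_carrier) simp
 have "\<one>\<^bsub>PG\<^esub> \<otimes>\<^bsub>PG\<^esub> \<one>\<^bsub>PG\<^esub> = \<one>\<^bsub>PG\<^esub>" unfolding pt_one by (subst pt_mult) simp_all
 hence e: "\<rho> \<one>\<^bsub>PG\<^esub> * \<rho> \<one>\<^bsub>PG\<^esub> = \<rho> \<one>\<^bsub>PG\<^esub>" using 2[OF o o] by simp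
 interpret G: group "GLC n" by (rule GL_group)
 show "\<rho> \<one>\<^bsub>PG\<^esub> = 1\<^sub>m n" using G.l_cancel_one[OF 1[OF o] 1[OF o]] e by simp
qed

lemma polyfun_alg:
 assumes C: "alg C" and G: "G \<in> polyfun S" and t: "\<And>p k. p \<in> S ==> (%z. t z p k) \<in> C"
 shows "(%z. G (t z)) \<in> C"
 using G unfolding polyfun_def
proof induction
 case (gen f)
 thus ?case using t by auto
next
 case (cong f g)
 hence "g = f" by (simp add: fun_eq_iff)
 thus ?case using cong by simp
qed (simp_all add: alg_const[OF C] alg_add[OF C] alg_mult[OF C])

text \<open>Composing a representation with a map into the group.\<close>
lemma rep_entries:
 assumes C: "alg C" and r: "is_rep n \<rho>" and x: "\<And>z. nzS (x z)" and cx: "\<And>m. m \<in> RR ==> (%z. ch m (x z)) \<in> C"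
  and t: "\<And>p k. p \<in> S ==> (%z. t z p k) \<in> C"
 shows "mat_in C n n (%z. \<rho> (pt (x z) (t z)))"
 unfolding mat_in_def
proof (intro conjI allI impI)
 show "\<rho> (pt (x z) (t z)) \<in> carrier_mat n n" for z by (rule rep_D(2)[OF r pt_carrier[OF x]])
 fix i j assume ij: "i < n" "j < n"
 hence "(%g. \<rho> g $$ (i,j)) \<in> reg_funs PG" using r by (simp add: is_rep_def)
 from PG_nf[OF this] obtain J G where J: "finite J" "J \<subseteq> RR" "\<forall>m\<in>J. G m \<in> polyfun S"
  "\<forall>x t. nzS x --> \<rho> (pt x t) $$ (i,j) = (\<Sum>m\<in>J. ch m x * G m t)" unfolding nf_def by (elim exE conjE)
 have "(%z. \<Sum>m\<in>J. ch m (x z) * G m (t z)) \<in> C"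
 proof (rule alg_sum[OF C])
  fix m assume "m \<in> J"
  hence m: "m \<in> RR" "G m \<in> polyfun S" using J(2,3) by auto
  show "(%z. ch m (x z) * G m (t z)) \<in> C" by (rule alg_mult[OF C cx[OF m(1)] polyfun_alg[OF C m(2) t]])
 qed
 moreover have "\<rho> (pt (x z) (t z)) $$ (i,j) = (\<Sum>m\<in>J. ch m (x z) * G m (t z))" for z using J(4) x by blast
 ultimately show "(%z. \<rho> (pt (x z) (t z)) $$ (i,j)) \<in> C" by simp
qed

lemma rep_inverse:
 assumes r: "is_rep n \<rho>" and x: "nzS x"
 shows "\<rho> (pt x t) * \<rho> (pt (%p. inverse (x p)) (%p k. - t p k)) = 1\<^sub>m n"
  "\<rho> (pt (%p. inverse (x p)) (%p k. - t p k)) * \<rho> (pt x t) = 1\<^sub>m n"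
proof -
 have nzi: "nzS (%p. inverse (x p))" using x by simp
 have eq: "pt (%p. x p * inverse (x p)) (%_ _. 0) = pt (%_. 1) (%_ _. 0)"
  unfolding pt_def using x by (auto intro!: arg_cong[of _ _ tor] restrict_ext)
 have gh: "pt x t \<otimes>\<^bsub>PG\<^esub> pt (%p. inverse (x p)) (%p k. - t p k) = \<one>\<^bsub>PG\<^esub>"
  "pt (%p. inverse (x p)) (%p k. - t p k) \<otimes>\<^bsub>PG\<^esub> pt x t = \<one>\<^bsub>PG\<^esub>"
  unfolding pt_mult[OF x nzi] pt_mult[OF nzi x] pt_one eq[symmetric] by (simp_all add: tadd_def mult.commute)
 show "\<rho> (pt x t) * \<rho> (pt (%p. inverse (x p)) (%p k. - t p k)) = 1\<^sub>m n"
  "\<rho> (pt (%p. inverse (x p)) (%p k. - t p k)) * \<rho> (pt x t) = 1\<^sub>m n"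
  unfolding rep_D(3)[OF r pt_carrier[OF x] pt_carrier[OF nzi], symmetric] rep_D(3)[OF r pt_carrier[OF nzi] pt_carrier[OF x], symmetric]
   gh by (rule rep_D(4)[OF r])+
qed

lemma rep_mero_GL:
 assumes r: "is_rep n \<rho>" and x: "\<And>z. nzS (x z)" and cx: "\<And>m. m \<in> RR ==> (%z. ch m (x z)) meromorphic_on UNIV"
  and t: "\<And>p k. p \<in> S ==> (%z. t z p k) meromorphic_on UNIV"
 shows "mero_GL UNIV n (%z. \<rho> (pt (x z) (t z)))"
 unfolding mero_GL_def mero_mat_iff
proof (intro conjI exI)
 show "mat_in (mero UNIV) n n (%z. \<rho> (pt (x z) (t z)))"
  by (rule rep_entries[OF alg_mero r x]) (use cx t in auto)
 show "mat_in (mero UNIV) n n (%z. \<rho> (pt (%p. inverse (x z p)) (%p k. - t z p k)))"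
 proof (rule rep_entries[OF alg_mero r])
  show "nzS (%p. inverse (x z p))" for z using x by simp
  have "ch m (%p. inverse (x z p)) = inverse (ch m (x z))" for m z
   by (simp add: ch_def power_int_inverse prod_inversef[symmetric] o_def)
  thus "(%z. ch m (%p. inverse (x z p))) \<in> mero UNIV" if "m \<in> RR" for m
   using cx[OF that] by (auto intro!: meromorphic_intros)
  show "(%z. - t z p k) \<in> mero UNIV" if "p \<in> S" for p k using t[OF that] by (auto intro!: meromorphic_intros)
 qed
 show "\<forall>\<^sub>\<approx>z\<in>UNIV. \<rho> (pt (x z) (t z)) * \<rho> (pt (%p. inverse (x z p)) (%p k. - t z p k)) = 1\<^sub>m n \<and>
   \<rho> (pt (%p. inverse (x z p)) (%p k. - t z p k)) * \<rho> (pt (x z) (t z)) = 1\<^sub>m n"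
  using rep_inverse[OF r x] by simp
qed

text \<open>The additive part of the factorization of \<open>gam\<close>: \<open>t0\<close> collects the terms \<open>zk j (z / a)\<close> of the \<open>ee p k\<close>, which are meromorphic at \<open>0\<close>, and \<open>tI\<close> the others, meromorphic at \<open>\<infinity>\<close>.\<close>
definition t0 :: "complex => addc" where
 "t0 z p k = cmb (%j p. zk j (z / rp p)) p k"

definition tI :: "complex => addc" where
 "tI z p k = cmb (%j p. (- 1) ^ j * zk j (rp p / (q * z))) p k + cmb (%j p. zeta j (b / rp p)) p k"

lemma xx0_nz: "xx0 p z ~= 0" by (simp add: xx0_def)

lemma xxI_nz: "p \<in> S ==> xxI p z ~= 0"
 using TT_W[OF _ b_W, of p] by (simp add: xxI_def xxN_def)

lemma t0_eps: "t0 z = tadd (tI z) (eps z)"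
proof (intro ext)
 fix p k
 have e: "1 / (q * (z / rp p)) = rp p / (q * z)" for p by simp
 show "t0 z p k = tadd (tI z) (eps z) p k"
  by (simp add: t0_def tI_def tadd_def eps_def ee_def cmb_def zeta_def e)
qed

lemma pt0_factor: "pt (%p. xx0 p z) (t0 z) = pt (%p. xxI p z) (tI z) \<otimes>\<^bsub>PG\<^esub> gam z"
proof -
 have nz: "nzS (%p. xxI p z)" "nzS (%p. xx p z)" using xxI_nz xx0_nz by (auto simp: xx_def)
 have "pt (%p. xx0 p z) (t0 z) = pt (%p. xxI p z * xx p z) (tadd (tI z) (eps z))"
  unfolding t0_eps pt_def using xxI_nz by (auto simp: xx_def intro!: arg_cong[of _ _ tor] restrict_ext)
 thus ?thesis unfolding pt_mult[OF nz] .
qed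

lemma cmb_mero: "p \<in> S ==> (\<And>j r. r \<in> S ==> (%z. f z j r) meromorphic_on A) ==> (%z. cmb (f z) p k) meromorphic_on A"
proof -
 assume p: "p \<in> S" and f: "\<And>j r. r \<in> S ==> (%z. f z j r) meromorphic_on A"
 have p0': "p0 \<in> S" using p p0 by auto
 show ?thesis
 proof (cases "p = p0")
  case True
  thus ?thesis unfolding cmb_def using f[OF p, of "Suc k"] by simp
 next
  case False
  thus ?thesis unfolding cmb_def using meromorphic_on_diff[OF f[OF p, of 0] f[OF p0', of 0]] f[OF p, of k]
   by (cases "k = 0") simp_all
 qed
qed

lemma t0_mero: "p \<in> S ==> (%z. t0 z p k) meromorphic_on UNIV"
 unfolding t0_def by (rule cmb_mero) (use rp in \<open>auto intro!: zk_mero analytic_intros\<close>)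

lemma tI_mero: "p \<in> S ==> (%w. tI (inverse w) p k) meromorphic_on UNIV"
proof -
 assume p: "p \<in> S"
 have e: "rp r / (q * inverse w) = rp r / q * w" for r w by (simp add: divide_inverse)
 have "(%w. (- 1) ^ j * zk j (rp r / q * w)) meromorphic_on UNIV" for j r
  by (intro meromorphic_intros zk_mero analytic_intros) simp
 thus ?thesis unfolding tI_def e by (intro meromorphic_on_add meromorphic_on_const cmb_mero p)
qed

lemma th_prod_mero: "(\<And>p. p \<in> S ==> g p analytic_on UNIV) ==> (%z. \<Prod>p\<in>S. th q (g p z) powi n p) meromorphic_on UNIV"
 by (intro meromorphic_intros entire_comp_mero th_hol)

lemma xx0_mero:
 assumes n: "n \<in> RR"
 shows "(%z. ch n (%p. xx0 p z)) meromorphic_on UNIV"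
proof -
 obtain L where L: "\<And>z. (\<Prod>p\<in>S. exp (of_real (kap p) * Ln z) powi n p) = exp (of_int L * Ln z)"
  using RR_exponent[OF n] by metis
 have "\<forall>\<^sub>\<approx>z\<in>UNIV. \<forall>p\<in>S. th q (z / rp p) ~= 0"
  using finS rp th_eventually_nz_scale by (intro eventually_ball_finite) (auto simp: cos_at)
 hence "\<forall>\<^sub>\<approx>z\<in>UNIV. (\<Prod>p\<in>S. th q (z / rp p) powi n p) * z powi L = ch n (%p. xx0 p z)"
  using cos_nz[of UNIV]
 proof eventually_elim
  case (elim z)
  have "ch n (%p. xx0 p z) = (\<Prod>p\<in>S. th q (z / rp p) powi n p * exp (of_real (kap p) * Ln z) powi n p)"
   unfolding ch_def using elim(1) by (intro prod.cong refl) (simp add: xx0_def power_int_mult_distrib)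
  also have "... = (\<Prod>p\<in>S. th q (z / rp p) powi n p) * exp (of_int L * Ln z)" unfolding prod.distrib L ..
  also have "exp (of_int L * Ln z) = z powi L" using elim(2) by (metis exp_Ln exp_power_int mult.commute)
  finally show ?case by simp
 qed
 moreover have "(%z. (\<Prod>p\<in>S. th q (z / rp p) powi n p) * z powi L) meromorphic_on UNIV"
  by (intro meromorphic_on_mult th_prod_mero) (use rp in \<open>auto intro!: analytic_intros meromorphic_intros\<close>)
 ultimately show ?thesis by (rule iffD1[OF meromorphic_on_cong'[OF _ refl]])
qed

lemma xxI_mero: "(%w. ch n (%p. xxI p (inverse w))) meromorphic_on UNIV"
proof -
 have e: "rp p / (q * inverse w) = rp p / q * w" for p w by (simp add: divide_inverse)
 have "eventually (%w. th q (rp p / q * w) ~= 0) (at a)" if "p \<in> S" for p a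
  using th_eventually_nz_scale[of "q / rp p" a] rp[OF that] by (simp add: mult.commute)
 hence "\<forall>\<^sub>\<approx>w\<in>UNIV. \<forall>p\<in>S. th q (rp p / q * w) ~= 0"
  using finS by (intro eventually_ball_finite) (auto simp: cos_at)
 hence "\<forall>\<^sub>\<approx>w\<in>UNIV. (\<Prod>p\<in>S. xxN p powi n p) / (\<Prod>p\<in>S. th q (rp p / q * w) powi n p) = ch n (%p. xxI p (inverse w))"
 proof eventually_elim
  case (elim w)
  have "ch n (%p. xxI p (inverse w)) = (\<Prod>p\<in>S. xxN p powi n p / th q (rp p / q * w) powi n p)"
   unfolding ch_def xxI_def e using elim by (intro prod.cong refl) (simp add: power_int_divide_distrib)
  thus ?case by (simp add: prod_dividef)
 qed
 moreover have "(%w. (\<Prod>p\<in>S. xxN p powi n p) / (\<Prod>p\<in>S. th q (rp p / q * w) powi n p)) meromorphic_on UNIV"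
  by (intro meromorphic_on_divide meromorphic_on_const th_prod_mero) (auto intro!: analytic_intros)
 ultimately show ?thesis by (rule iffD1[OF meromorphic_on_cong'[OF _ refl]])
qed

lemma rep_cfam:
 assumes r: "is_rep n \<rho>"
 shows "cfam n (%z. \<rho> (gam z))"
 unfolding cfam_def
proof (intro conjI ballI)
 have nz: "nzS (%p. xx p z)" for z using xxI_nz xx0_nz by (auto simp: xx_def)
 show "mat_in {f. EE f} n n (%z. \<rho> (gam z))"
  by (rule rep_entries[OF alg_EE r nz]) (use EE_char(1) ee_EE in \<open>simp_all add: eps_def\<close>)
 note gc = pt_carrier[OF nz]
 show "\<rho> (gam z) \<in> carrier (GLC n)" for z by (rule rep_D(1)[OF r gc])
 have "gam z \<otimes>\<^bsub>PG\<^esub> gam w = gam w \<otimes>\<^bsub>PG\<^esub> gam z" for z w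
  unfolding pt_mult[OF nz nz] by (simp add: mult.commute tadd_commute)
 thus "\<rho> (gam z) * \<rho> (gam w) = \<rho> (gam w) * \<rho> (gam z)" for z w
  unfolding rep_D(3)[OF r gc gc, symmetric] by simp
 have "eps b = (%_ _. 0)" by (simp add: eps_def ee_b)
 moreover have "xx p b = 1" if p: "p \<in> S" for p
 proof -
  have "th q (b / rp p) ~= 0" "th q (rp p / (q * b)) ~= 0" using TT_W[OF p b_W] by (auto simp: TT_def)
  thus ?thesis by (simp add: xx_def xx0_def xxI_def xxN_def TT_def)
 qed
 ultimately have "gam b = \<one>\<^bsub>PG\<^esub>" unfolding pt_one pt_def by (auto intro!: arg_cong[of _ _ tor] restrict_ext)
 thus "\<rho> (gam b) = 1\<^sub>m n" using rep_D(4)[OF r] by simp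
qed

lemma mat_mero_scale: "mat_in (mero UNIV) m n X ==> mat_in (mero UNIV) m n (%z. X (c * z))"
proof -
 assume X: "mat_in (mero UNIV) m n X"
 have "(%z. X (c * z) $$ (i,j)) meromorphic_on UNIV" if ij: "i < m" "j < n" for i j
  by (rule meromorphic_on_compose[of "%z. X z $$ (i,j)" UNIV])
   (use mat_inD(2)[OF X ij] in \<open>auto intro!: analytic_intros\<close>)
 thus ?thesis using mat_inD(1)[OF X] by (simp add: mat_in_def)
qed

text \<open>Both factors of \<open>gam\<close> change under \<open>z \<mapsto> q z\<close> by the same group element, since \<open>gam\<close> is invariant under every representation. That element depends meromorphically on \<open>z\<close> in both charts of the sphere.\<close>
lemma cdata_of_rep:
 assumes r: "is_rep n \<rho>"
 shows "\<exists>A M N P. cdata A n M N P \<and> (\<forall>z\<in>W. P z = \<rho> (gam z))"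
proof -
 have nz0: "nzS (%p. xx0 p z)" and nzI: "nzS (%p. xxI p z)" and nz: "nzS (%p. xx p z)" for z
  using xxI_nz xx0_nz by (auto simp: xx_def)
 define M where "M z = \<rho> (pt (%p. xx0 p z) (t0 z))" for z
 define N where "N z = \<rho> (pt (%p. xxI p z) (tI z))" for z
 define P where "P z = \<rho> (gam z)" for z
 have MG: "mero_GL UNIV n M" unfolding M_def by (rule rep_mero_GL[OF r nz0 xx0_mero t0_mero])
 have NG: "mero_GL UNIV n (%w. N (inverse w))" unfolding N_def by (rule rep_mero_GL[OF r nzI xxI_mero tI_mero])
 have cf: "cfam n P" unfolding P_def by (rule rep_cfam[OF r])
 have MNP: "M z = N z * P z" for z
  unfolding M_def N_def P_def pt0_factor by (rule rep_D(3)[OF r pt_carrier[OF nzI] pt_carrier[OF nz]])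
 have Pin: "mat_in {f. EE f} n n P" using cf by (simp add: cfam_def)
 have Pq: "P (q * z) = P z" if z: "z \<in> W" for z
 proof (rule eq_matI)
  fix i j assume "i < dim_row (P z)" "j < dim_col (P z)"
  hence "i < n" "j < n" using mat_inD(1)[OF Pin, of z] by auto
  from mat_inD(2)[OF Pin this] z show "P (q * z) $$ (i,j) = P z $$ (i,j)" by (simp add: EE_def)
 qed (use mat_inD(1)[OF Pin, of z] mat_inD(1)[OF Pin, of "q * z"] in auto)
 note Mm = mero_GL_D(1)[OF MG] and Nm = mero_GL_D(1)[OF NG]
 from mero_GL_D(2)[OF MG] obtain Mi where Mi: "mat_in (mero UNIV) n n Mi" "\<forall>\<^sub>\<approx>z\<in>UNIV. M z * Mi z = 1\<^sub>m n \<and> Mi z * M z = 1\<^sub>m n"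
  by (elim exE conjE)
 from mero_GL_D(2)[OF NG] obtain Ni where Ni0: "mat_in (mero UNIV) n n Ni"
  "\<forall>\<^sub>\<approx>w\<in>UNIV. N (inverse w) * Ni w = 1\<^sub>m n \<and> Ni w * N (inverse w) = 1\<^sub>m n" by (elim exE conjE)
 have Ni: "\<forall>\<^sub>\<approx>z\<in>- {0}. N z * Ni (inverse z) = 1\<^sub>m n \<and> Ni (inverse z) * N z = 1\<^sub>m n"
  using cos_inverse[OF cos_sub[OF Ni0(2)]] by simp
 have Mc: "M z \<in> carrier_mat n n" and Nc: "N z \<in> carrier_mat n n" and Pc: "P z \<in> carrier_mat n n"
  and Mic: "Mi z \<in> carrier_mat n n" and Nic: "Ni z \<in> carrier_mat n n" for z
  using mat_inD(1)[OF Mm] mat_inD(1)[OF Nm, of "inverse z"] mat_inD(1)[OF Pin] mat_inD(1)[OF Mi(1)] mat_inD(1)[OF Ni0(1)] by auto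
 define X where "X z = M (q * z) * Mi z" for z
 define Y where "Y w = N (inverse (inverse q * w)) * Ni w" for w
 have Xm: "mat_in (mero UNIV) n n X" unfolding X_def by (rule mat_in_mult[OF alg_mero mat_mero_scale[OF Mm] Mi(1)])
 have Ym: "mat_in (mero UNIV) n n Y" unfolding Y_def by (rule mat_in_mult[OF alg_mero mat_mero_scale[OF Nm] Ni0(1)])
 have XN: "\<forall>\<^sub>\<approx>z\<in>- {0}. X z = N (q * z) * Ni (inverse z)"
  using cos_sub[OF Mi(2)] Ni cos_W
 proof eventually_elim
  case (elim z)
  have "P z = Ni (inverse z) * (N z * P z)" by (rule mat_cancel[OF conjunct2[OF elim(2)] Nc Nic Pc, symmetric])
  hence "P z * Mi z = (Ni (inverse z) * M z) * Mi z" by (simp add: MNP)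
  also have "... = Ni (inverse z)" by (rule mat_cancel_right[OF conjunct1[OF elim(1)] Mc Mic Nic])
  finally have 1: "P z * Mi z = Ni (inverse z)" .
  have "X z = (N (q * z) * P z) * Mi z" unfolding X_def MNP[of "q * z"] Pq[OF elim(3)] ..
  also have "... = N (q * z) * (P z * Mi z)" by (rule assoc_mult_mat[OF Nc Pc Mic])
  finally show ?case unfolding 1 .
 qed
 hence XY: "\<forall>\<^sub>\<approx>z\<in>- {0}. X z = Y (inverse z)" by eventually_elim (simp add: Y_def)
 from sphere_mat[OF Xm Ym XY] obtain A where A: "A \<in> carrier_mat n n" "\<forall>\<^sub>\<approx>z\<in>UNIV. mat_eval A z = X z" by (elim bexE)
 have "\<forall>\<^sub>\<approx>z\<in>- {0}. inverse (det (X z)) \<cdot>\<^sub>m adj_mat (X z) = inverse (det (Y (inverse z))) \<cdot>\<^sub>m adj_mat (Y (inverse z))"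
  using XY by eventually_elim simp
 from sphere_mat[OF mat_in_gl_inverse[OF Xm] mat_in_gl_inverse[OF Ym] this] obtain A' where
  A': "A' \<in> carrier_mat n n" "\<forall>\<^sub>\<approx>z\<in>UNIV. mat_eval A' z = inverse (det (X z)) \<cdot>\<^sub>m adj_mat (X z)" by (elim bexE)
 have Xinv: "\<forall>\<^sub>\<approx>z\<in>UNIV. mat_eval A z * mat_eval A' z = 1\<^sub>m n \<and> mat_eval A' z * mat_eval A z = 1\<^sub>m n"
  using A(2) A'(2) Mi(2) cos_scale_UNIV[OF q_nz Mi(2)]
 proof eventually_elim
  case (elim z)
  interpret G: group "GLC n" by (rule GL_group)
  have "M (q * z) \<in> carrier (GLC n)" "Mi z \<in> carrier (GLC n)"
   using elim(3,4) Mc Mic by (auto simp: GL_carrier)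
  hence X: "X z \<in> carrier (GLC n)" using G.m_closed by (fastforce simp: X_def)
  hence "inv\<^bsub>GLC n\<^esub> (X z) = mat_eval A' z" unfolding elim(2) by (intro GL_inv_adj) (auto simp: GL_det)
  thus ?case using G.l_inv[OF X] G.r_inv[OF X] elim(1) by simp
 qed
 have "A * A' = 1\<^sub>m n"
 proof (rule mat_eval_eqI[OF mult_carrier_mat[OF A(1) A'(1)]])
  show "\<forall>\<^sub>\<approx>z\<in>UNIV. mat_eval (A * A') z = mat_eval (1\<^sub>m n) z"
   using mat_eval_mult[OF A(1) A'(1), of UNIV] Xinv by eventually_elim simp
 qed auto
 moreover have "A' * A = 1\<^sub>m n"
 proof (rule mat_eval_eqI[OF mult_carrier_mat[OF A'(1) A(1)]])
  show "\<forall>\<^sub>\<approx>z\<in>UNIV. mat_eval (A' * A) z = mat_eval (1\<^sub>m n) z"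
   using mat_eval_mult[OF A'(1) A(1), of UNIV] Xinv by eventually_elim simp
 qed auto
 ultimately have AGL: "A \<in> carrier (GL TYPE(ratfun) n)" using A(1) A'(1) by (auto simp: GL_carrier)
 have sM: "sol_zero q n A M" unfolding sol_zero_def
 proof (intro conjI MG)
  show "\<forall>\<^sub>\<approx>z\<in>UNIV. M (q * z) = mat_eval A z * M z"
   using A(2) Mi(2)
  proof eventually_elim
   case (elim z)
   show ?case unfolding elim(1) X_def using mat_cancel_right[OF conjunct2[OF elim(2)] Mic Mc Mc] by simp
  qed
 qed
 have sN: "sol_inf q n A N" unfolding sol_inf_def mero_GL_inf_def
 proof (intro conjI NG)
  show "\<forall>\<^sub>\<approx>z\<in>- {0}. N (q * z) = mat_eval A z * N z"
   using cos_sub[OF A(2)] XN Ni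
  proof eventually_elim
   case (elim z)
   show ?case unfolding elim(1,2) using mat_cancel_right[OF conjunct2[OF elim(3)] Nic Nc Nc] by simp
  qed
 qed
 have "cdata A n M N P" using AGL sM sN cf MNP by (simp add: cdata_def)
 thus ?thesis by (intro exI[of _ A] exI[of _ M] exI[of _ N] exI[of _ P] conjI ballI) (simp_all add: P_def)
qed

section \<open>Intertwiners\<close>

lemma gam_carrier: "z \<in> W ==> gam z \<in> carrier PG"
 by (rule pt_carrier) (simp add: xx_nz)

lemma reg_cong: "f \<in> reg_funs PG ==> (\<And>g. g \<in> carrier PG ==> f' g = f g) ==> f' \<in> reg_funs PG"
 unfolding PG_simps by (rule fun_algebra.cong) auto

lemma rep_mat_in:
 assumes "is_rep n \<rho>"
 shows "mat_in (reg_funs PG) n n (%g. if g \<in> carrier PG then \<rho> g else 1\<^sub>m n)"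
 unfolding mat_in_def
proof (intro conjI allI impI)
 show "(if g \<in> carrier PG then \<rho> g else 1\<^sub>m n) \<in> carrier_mat n n" for g using rep_D(2)[OF assms] by simp
 fix i j assume ij: "i < n" "j < n"
 hence "(%g. \<rho> g $$ (i,j)) \<in> reg_funs PG" using assms by (simp add: is_rep_def)
 thus "(%g. (if g \<in> carrier PG then \<rho> g else 1\<^sub>m n) $$ (i,j)) \<in> reg_funs PG"
  by (rule reg_cong) simp
qed

text \<open>The relation holds on the monoid generated by the values of \<open>gam\<close>, hence everywhere by density.\<close>
lemma rep_intertwine:
 assumes r: "is_rep n \<rho>" and s: "is_rep m \<tau>" and T: "T \<in> carrier_mat m n"
  and e: "\<And>z. z \<in> W ==> T * \<rho> (gam z) = \<tau> (gam z) * T" and g: "g \<in> carrier PG"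
 shows "T * \<rho> g = \<tau> g * T"
proof -
 define R where "R g = (if g \<in> carrier PG then \<rho> g else 1\<^sub>m n)" for g
 define Q where "Q g = (if g \<in> carrier PG then \<tau> g else 1\<^sub>m m)" for g
 have R: "mat_in (reg_funs PG) n n R" and Q: "mat_in (reg_funs PG) m m Q"
  unfolding R_def Q_def by (rule rep_mat_in[OF r], rule rep_mat_in[OF s])
 note TR = mat_in_mult[OF alg_reg mat_in_const[OF alg_reg T] R] and QT = mat_in_mult[OF alg_reg Q mat_in_const[OF alg_reg T]]
 have alb: "pt x t \<in> carrier PG \<and> T * \<rho> (pt x t) = \<tau> (pt x t) * T" if "(x,t) \<in> albanese_monoid" for x t
  using that
 proof induction
  case one
  have "pt (%_. 1) (%_ _. 0) \<in> carrier PG" by (rule pt_carrier) simp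
  thus ?case using rep_D(4)[OF r] rep_D(4)[OF s] T by (simp add: pt_one)
 next
  case (step x t z)
  have nz: "nzS x" "nzS (%p. xx p z)" using albanese_nz[OF step(1)] step(2) by (simp_all add: xx_nz)
  note m = pt_mult[OF nz, of t "eps z"]
  have c: "pt x t \<in> carrier PG" "gam z \<in> carrier PG" using step gam_carrier by auto
  note rc = rep_D(2)[OF r c(1)] rep_D(2)[OF r c(2)] rep_D(2)[OF s c(1)] rep_D(2)[OF s c(2)]
  have "pt x t \<otimes>\<^bsub>PG\<^esub> gam z \<in> carrier PG" unfolding m using nz by (intro pt_carrier) simp
  moreover have "T * \<rho> (pt x t \<otimes>\<^bsub>PG\<^esub> gam z) = \<tau> (pt x t \<otimes>\<^bsub>PG\<^esub> gam z) * T"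
  proof -
   have "T * (\<rho> (pt x t) * \<rho> (gam z)) = (T * \<rho> (pt x t)) * \<rho> (gam z)" by (rule assoc_mult_mat[OF T rc(1,2), symmetric])
   also have "... = (\<tau> (pt x t) * T) * \<rho> (gam z)" using step by simp
   also have "... = \<tau> (pt x t) * (T * \<rho> (gam z))" by (rule assoc_mult_mat[OF rc(3) T rc(2)])
   also have "... = \<tau> (pt x t) * (\<tau> (gam z) * T)" using e[OF step(2)] by simp
   also have "... = (\<tau> (pt x t) * \<tau> (gam z)) * T" by (rule assoc_mult_mat[OF rc(3,4) T, symmetric])
   finally show ?thesis using rep_D(3)[OF r c] rep_D(3)[OF s c] by simp
  qed
  ultimately show ?case unfolding m by blast
 qed
 have "T * R g = Q g * T"
 proof (rule eq_matI)
  fix i j assume "i < dim_row (Q g * T)" "j < dim_col (Q g * T)"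
  hence ij: "i < m" "j < n" using mat_inD(1)[OF Q, of g] T by auto
  have "(T * R g) $$ (i,j) - (Q g * T) $$ (i,j) = 0"
  proof (rule PG_density[OF alg_diff[OF alg_reg mat_inD(2)[OF TR ij] mat_inD(2)[OF QT ij]] _ g])
   fix x t assume "(x,t) \<in> albanese_monoid"
   from alb[OF this] show "(T * R (pt x t)) $$ (i,j) - (Q (pt x t) * T) $$ (i,j) = 0" by (simp add: R_def Q_def)
  qed
  thus "(T * R g) $$ (i,j) = (Q g * T) $$ (i,j)" by simp
 qed (use mat_inD(1)[OF Q, of g] mat_inD(1)[OF R, of g] T in auto)
 thus ?thesis using g by (simp add: R_def Q_def)
qed

lemma rep_kron:
 assumes r: "is_rep n \<rho>" and s: "is_rep m \<tau>"
 shows "is_rep (n * m) (%g. kron (\<rho> g) (\<tau> g))"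
 unfolding is_rep_def
proof (intro conjI allI impI)
 show "(%g. kron (\<rho> g) (\<tau> g)) \<in> Group.hom PG (GLC (n * m))"
 proof (rule homI)
  show "kron (\<rho> g) (\<tau> g) \<in> carrier (GLC (n * m))" if "g \<in> carrier PG" for g
   by (rule kron_GL[OF rep_D(1)[OF r that] rep_D(1)[OF s that]])
  fix g h assume g: "g \<in> carrier PG" "h \<in> carrier PG"
  show "kron (\<rho> (g \<otimes>\<^bsub>PG\<^esub> h)) (\<tau> (g \<otimes>\<^bsub>PG\<^esub> h)) = kron (\<rho> g) (\<tau> g) \<otimes>\<^bsub>GLC (n * m)\<^esub> kron (\<rho> h) (\<tau> h)"
   using kron_mult[OF rep_D(2)[OF r g(1)] rep_D(2)[OF r g(2)] rep_D(2)[OF s g(1)] rep_D(2)[OF s g(2)]]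
   by (simp add: rep_D(3)[OF r g] rep_D(3)[OF s g])
 qed
 fix i j assume ij: "i < n * m" "j < n * m"
 from mat_inD(2)[OF mat_in_kron[OF alg_reg rep_mat_in[OF r] rep_mat_in[OF s]] ij]
 show "(%g. kron (\<rho> g) (\<tau> g) $$ (i,j)) \<in> reg_funs PG" by (rule reg_cong) simp
qed

lemma rep_unit: "is_rep 1 (%_. 1\<^sub>m 1)"
proof -
 have "1\<^sub>m 1 \<in> carrier (GLC 1)" unfolding GL_carrier by (intro conjI bexI[of _ "1\<^sub>m 1"]) auto
 thus ?thesis unfolding is_rep_def by (auto simp: hom_def alg_const[OF alg_reg])
qed

lemma rep_cat_Ob: "\<rho> \<in> Ob (rep_cat PG) \<longleftrightarrow> (\<exists>n. is_rep n \<rho>)"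
 by (simp add: rep_cat_def is_rep_def)

lemma rep_cat_rk: "is_rep n \<rho> ==> rk (rep_cat PG) \<rho> = n"
 by (frule rep_D(4)) (simp add: rep_cat_def)

lemma rep_cat_Mor:
 assumes r: "is_rep n \<rho>" and s: "is_rep m \<tau>"
 shows "T \<in> Mor (rep_cat PG) \<rho> \<tau> \<longleftrightarrow> T \<in> carrier_mat m n \<and> (\<forall>z\<in>W. T * \<rho> (gam z) = \<tau> (gam z) * T)"
proof -
 have "T \<in> Mor (rep_cat PG) \<rho> \<tau> \<longleftrightarrow> T \<in> carrier_mat m n \<and> (\<forall>g\<in>carrier PG. T * \<rho> g = \<tau> g * T)"
  using rep_D(4)[OF r] rep_D(4)[OF s] by (simp add: rep_cat_def)
 thus ?thesis using rep_intertwine[OF r s] gam_carrier by blast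
qed

section \<open>Morphisms in terms of frames\<close>

text \<open>The matrix \<open>F\<close> acts as the constant \<open>T\<close> in the frames \<open>M\<close> and \<open>M'\<close>. As frames can be cancelled, \<open>T\<close> and \<open>F\<close> determine each other; every identity of the functor below is a comparison of two such constants.\<close>
definition act :: "nat => nat => (complex => complex mat) => (complex => complex mat) => ratfun mat => complex mat => bool" where
 "act n m M M' F T \<longleftrightarrow> mero_GL UNIV n M \<and> mero_GL UNIV m M' \<and> F \<in> carrier_mat m n \<and> T \<in> carrier_mat m n \<and>
  (\<forall>\<^sub>\<approx>z\<in>UNIV. mat_eval F z * M z = M' z * T)"

lemma act_D:
 assumes "act n m M M' F T"
 shows "M z \<in> carrier_mat n n" "M' z \<in> carrier_mat m m" "mat_eval F z \<in> carrier_mat m n" "F \<in> carrier_mat m n" "T \<in> carrier_mat m n"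
  "\<forall>\<^sub>\<approx>z\<in>UNIV. mat_eval F z * M z = M' z * T"
 using assms mat_inD(1)[OF mero_GL_D(1)] by (auto simp: act_def mat_eval_carrier)

lemma act_unique:
 assumes "act n m M M' F T" "act n m M M' F T'"
 shows "T = T'"
proof -
 note a = act_D[OF assms(1)] and a' = act_D[OF assms(2)]
 have "mero_GL UNIV m M'" using assms(1) by (simp add: act_def)
 from mero_GL_D(2)[OF this] obtain Y where Y: "mat_in (mero UNIV) m m Y" "\<forall>\<^sub>\<approx>z\<in>UNIV. M' z * Y z = 1\<^sub>m m \<and> Y z * M' z = 1\<^sub>m m"
  by (elim exE conjE)
 have "\<forall>\<^sub>\<approx>z\<in>(UNIV :: complex set). T = T'"
  using Y(2) a(6) a'(6)
 proof eventually_elim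
  case (elim z)
  have "M' z * T = M' z * T'" using elim(2,3) by simp
  thus ?case by (rule GL_left_cancel[OF conjunct2[OF elim(1)] a(2) mat_inD(1)[OF Y(1)] a(5) a'(5)])
 qed
 thus ?thesis by (rule cos_True) simp
qed

lemma act_unique_left:
 assumes "act n m M M' F T" "act n m M M' F' T"
 shows "F = F'"
proof -
 note a = act_D[OF assms(1)] and a' = act_D[OF assms(2)]
 have "mero_GL UNIV n M" using assms(1) by (simp add: act_def)
 from mero_GL_D(2)[OF this] obtain Y where Y: "mat_in (mero UNIV) n n Y" "\<forall>\<^sub>\<approx>z\<in>UNIV. M z * Y z = 1\<^sub>m n \<and> Y z * M z = 1\<^sub>m n"
  by (elim exE conjE)
 have "\<forall>\<^sub>\<approx>z\<in>UNIV. mat_eval F z = mat_eval F' z"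
  using Y(2) a(6) a'(6)
 proof eventually_elim
  case (elim z)
  have "mat_eval F z * M z = mat_eval F' z * M z" using elim(2,3) by simp
  thus ?case using mat_cancel_right[OF conjunct1[OF elim(1)] a(1) mat_inD(1)[OF Y(1)] a(3)]
    mat_cancel_right[OF conjunct1[OF elim(1)] a(1) mat_inD(1)[OF Y(1)] a'(3)] by metis
 qed
 thus ?thesis by (rule mat_eval_eqI[OF a(4) a'(4)]) simp
qed

lemma act_comp:
 assumes "act n m M M' F T" "act m k M' M'' G R"
 shows "act n k M M'' (G * F) (R * T)"
proof -
 note a = act_D[OF assms(1)] and d = act_D[OF assms(2)]
 have "\<forall>\<^sub>\<approx>z\<in>UNIV. mat_eval (G * F) z * M z = M'' z * (R * T)"
  using mat_eval_mult[OF d(4) a(4)] a(6) d(6)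
 proof eventually_elim
  case (elim z)
  have "mat_eval (G * F) z * M z = mat_eval G z * (mat_eval F z * M z)"
   unfolding elim(1) by (rule assoc_mult_mat[OF d(3) a(3) a(1)])
  also have "... = (mat_eval G z * M' z) * T" unfolding elim(2) by (rule assoc_mult_mat[OF d(3) a(2) a(5), symmetric])
  also have "... = M'' z * (R * T)" unfolding elim(3) by (rule assoc_mult_mat[OF d(2) d(5) a(5)])
  finally show ?case .
 qed
 thus ?thesis using assms a d by (auto simp: act_def)
qed

lemma act_add:
 assumes "act n m M M' F T" "act n m M M' F' T'"
 shows "act n m M M' (F + F') (T + T')"
proof -
 note a = act_D[OF assms(1)] and d = act_D[OF assms(2)]
 have "\<forall>\<^sub>\<approx>z\<in>UNIV. mat_eval (F + F') z * M z = M' z * (T + T')"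
  using mat_eval_add[OF a(4) d(4)] a(6) d(6)
 proof eventually_elim
  case (elim z)
  show ?case unfolding elim(1) add_mult_distrib_mat[OF a(3) d(3) a(1)] elim(2,3)
   by (rule mult_add_distrib_mat[OF a(2) a(5) d(5), symmetric])
 qed
 thus ?thesis using assms a d by (auto simp: act_def)
qed

lemma act_scale:
 assumes "act n m M M' F T"
 shows "act n m M M' (rat_const c \<cdot>\<^sub>m F) (c \<cdot>\<^sub>m T)"
proof -
 note a = act_D[OF assms(1)]
 have "\<forall>\<^sub>\<approx>z\<in>UNIV. mat_eval (rat_const c \<cdot>\<^sub>m F) z * M z = M' z * (c \<cdot>\<^sub>m T)"
  using mat_eval_scale[OF a(4), of c] a(6)
  by eventually_elim (simp add: mult_smult_distrib[OF a(2) a(5)] mult_smult_assoc_mat[OF a(3) a(1)])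
 thus ?thesis using assms a by (auto simp: act_def)
qed

lemma act_one: "mero_GL UNIV n M ==> act n n M M (1\<^sub>m n) (1\<^sub>m n)"
proof -
 assume M: "mero_GL UNIV n M"
 note c = mat_inD(1)[OF mero_GL_D(1)[OF M]]
 have "1\<^sub>m n * M z = M z * 1\<^sub>m n" for z using c[of z] by simp
 thus ?thesis using M by (simp add: act_def)
qed

lemma act_kron:
 assumes "act n m M M' F T" "act k l N N' G R"
 shows "act (n * k) (m * l) (%z. kron (M z) (N z)) (%z. kron (M' z) (N' z)) (kron F G) (kron T R)"
proof -
 note a = act_D[OF assms(1)] and d = act_D[OF assms(2)]
 have "\<forall>\<^sub>\<approx>z\<in>UNIV. mat_eval (kron F G) z * kron (M z) (N z) = kron (M' z) (N' z) * kron T R"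
  using mat_eval_kron[of F G] a(6) d(6)
  by eventually_elim (simp add: kron_mult[OF a(3,1) d(3,1), symmetric] kron_mult[OF a(2,5) d(2,5), symmetric])
 thus ?thesis using assms kron_carrier[OF a(4) d(4)] kron_carrier[OF a(5) d(5)]
  by (auto simp: act_def intro: mero_GL_kron)
qed

lemma act_swap:
 assumes "mero_GL UNIV n M" "mero_GL UNIV m N"
 shows "act (n * m) (m * n) (%z. kron (M z) (N z)) (%z. kron (N z) (M z)) (swap_mat n m) (swap_mat n m)"
proof -
 note c = mat_inD(1)[OF mero_GL_D(1)[OF assms(1)]] mat_inD(1)[OF mero_GL_D(1)[OF assms(2)]]
 show ?thesis unfolding act_def
  using mero_GL_kron[OF assms] mero_GL_kron[OF assms(2,1)] swap_kron[OF c] by (simp add: swap_carrier)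
qed

lemma sigma_one: "map_mat (sigma_rat q) (1\<^sub>m n) = (1\<^sub>m n :: ratfun mat)"
proof (rule mat_eval_eqI[of _ n n])
 show "\<forall>\<^sub>\<approx>z\<in>UNIV. mat_eval (map_mat (sigma_rat q) (1\<^sub>m n)) z = mat_eval (1\<^sub>m n) z"
  using mat_eval_sigma[OF q_nz, of "1\<^sub>m n"] by simp
qed auto

lemma cdata_mero_GL: "cdata A n M N P ==> mero_GL UNIV n M"
 by (simp add: cdata_def sol_zero_def)

text \<open>Two normalizations of one system differ by a constant matrix, the image of the identity morphism.\<close>
lemma cdata_iso:
 assumes d: "cdata A n M N P" and d': "cdata A n M' N' P'"
 shows "\<exists>T T'. act n n M M' (1\<^sub>m n) T \<and> act n n M' M (1\<^sub>m n) T' \<and> T * T' = 1\<^sub>m n \<and> T' * T = 1\<^sub>m n \<and>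
  (\<forall>z\<in>W. T * P z = P' z * T) \<and> (\<forall>z\<in>W. T' * P' z = P z * T')"
proof -
 have A: "map_mat (sigma_rat q) (1\<^sub>m n) * A = A * 1\<^sub>m n"
  unfolding sigma_one using cdata_D(1)[OF d] by simp
 have ex: "\<exists>T. act n n M M' (1\<^sub>m n) T \<and> (\<forall>z\<in>W. T * P z = P' z * T)"
  if d: "cdata A n M N P" and d': "cdata A n M' N' P'" for M N P M' N' P'
 proof -
  from cdata_mor[OF d d' one_carrier_mat A] obtain T where T: "T \<in> carrier_mat n n"
   "\<forall>\<^sub>\<approx>z\<in>UNIV. mat_eval (1\<^sub>m n) z * M z = M' z * T" "\<forall>z\<in>W. T * P z = P' z * T" by (elim bexE conjE)
  show ?thesis
   by (rule exI[of _ T]) (use T cdata_mero_GL[OF d] cdata_mero_GL[OF d'] in \<open>simp add: act_def\<close>)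
 qed
 from ex[OF d d'] obtain T where T: "act n n M M' (1\<^sub>m n) T" "\<forall>z\<in>W. T * P z = P' z * T" by (elim exE conjE)
 from ex[OF d' d] obtain T' where T': "act n n M' M (1\<^sub>m n) T'" "\<forall>z\<in>W. T' * P' z = P z * T'" by (elim exE conjE)
 have "T' * T = 1\<^sub>m n" using act_unique[OF act_comp[OF T(1) T'(1)]] act_one[OF cdata_mero_GL[OF d]] by simp
 moreover have "T * T' = 1\<^sub>m n" using act_unique[OF act_comp[OF T'(1) T(1)]] act_one[OF cdata_mero_GL[OF d']] by simp
 ultimately show ?thesis using T T' by blast
qed

section \<open>The equivalence\<close>

abbreviation "CC \<equiv> abelian_regular_cat q S"
abbreviation "DD \<equiv> rep_cat PG"

definition sel :: "ratfun mat => (complex => complex mat) \<times> (complex => complex mat) \<times> (complex => complex mat)" where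
 "sel A = (SOME (M, N, P). cdata A (dim_row A) M N P)"

definition sM :: "ratfun mat => complex => complex mat" where "sM A = fst (sel A)"
definition sN :: "ratfun mat => complex => complex mat" where "sN A = fst (snd (sel A))"
definition sP :: "ratfun mat => complex => complex mat" where "sP A = snd (snd (sel A))"

definition rho :: "ratfun mat => (complex set => complex) set set \<times> (complex set => complex fps) => complex mat" where
 "rho A = (SOME \<rho>. is_rep (dim_row A) \<rho> \<and> (\<forall>z\<in>W. \<rho> (gam z) = sP A z))"

definition fm :: "ratfun mat => ratfun mat => ratfun mat => complex mat" where
 "fm A B F = (THE T. act (dim_row A) (dim_row B) (sM A) (sM B) F T)"

definition jj :: "ratfun mat => ratfun mat => complex mat" where
 "jj A B = (THE T. act (dim_row A * dim_row B) (dim_row A * dim_row B) (%z. kron (sM A z) (sM B z)) (sM (kron A B))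
  (1\<^sub>m (dim_row A * dim_row B)) T)"

definition j1 :: "complex mat" where
 "j1 = (THE T. act 1 1 (%_. 1\<^sub>m 1) (sM (1\<^sub>m 1)) (1\<^sub>m 1) T)"

lemma CC_Ob: "A \<in> Ob CC \<longleftrightarrow> abelian_regular q S (dim_row A) A"
 and CC_rk: "rk CC A = dim_row A" and CC_tens: "tens CC A B = kron A B" and CC_unit: "unit_ob CC = 1\<^sub>m 1"
 and CC_scal: "scal CC c = rat_const c"
 and CC_Mor: "F \<in> Mor CC A B \<longleftrightarrow> F \<in> carrier_mat (dim_row B) (dim_row A) \<and> map_mat (sigma_rat q) F * A = B * F"
 by (simp_all add: abelian_regular_cat_def)

lemma DD_tens: "tens DD \<rho> \<tau> = (%g. kron (\<rho> g) (\<tau> g))" and DD_unit: "unit_ob DD = (%_. 1\<^sub>m 1)"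
 and DD_scal: "scal DD c = c"
 by (simp_all add: rep_cat_def)

lemma dim_kron: "dim_row (kron A B) = dim_row A * dim_row B"
 by (simp add: kron_def)

lemma sel_cdata: "A \<in> Ob CC ==> cdata A (dim_row A) (sM A) (sN A) (sP A)"
proof -
 assume "A \<in> Ob CC"
 hence "\<exists>M N P. cdata A (dim_row A) M N P" by (intro cdata_exists) (simp add: CC_Ob)
 hence "\<exists>d. case d of (M, N, P) => cdata A (dim_row A) M N P" by auto
 from someI_ex[OF this] show ?thesis unfolding sM_def sN_def sP_def sel_def case_prod_beta .
qed

lemma obj_cdata: "cdata A n M N P ==> A \<in> Ob CC \<and> dim_row A = n"
proof -
 assume d: "cdata A n M N P"
 have "dim_row A = n" using cdata_D(1)[OF d] by simp
 thus ?thesis using cdata_imp_object[OF d] by (simp add: CC_Ob)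
qed

lemma sM_GL: "A \<in> Ob CC ==> mero_GL UNIV (dim_row A) (sM A)"
 by (rule cdata_mero_GL[OF sel_cdata])

lemma Ob_kron: "A \<in> Ob CC ==> B \<in> Ob CC ==> kron A B \<in> Ob CC"
 using obj_cdata[OF cdata_kron[OF sel_cdata sel_cdata]] by blast

lemma Ob_one: "1\<^sub>m 1 \<in> Ob CC"
 using obj_cdata[OF cdata_one] by blast

lemma rho: "A \<in> Ob CC ==> is_rep (dim_row A) (rho A) \<and> (\<forall>z\<in>W. rho A (gam z) = sP A z)"
 unfolding rho_def by (rule someI_ex[OF rep_exists]) (use sel_cdata in \<open>auto simp: cdata_def\<close>)

lemma rho_rep: "A \<in> Ob CC ==> is_rep (dim_row A) (rho A)" and rho_gam: "A \<in> Ob CC ==> z \<in> W ==> rho A (gam z) = sP A z"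
 using rho by blast+

lemma fm_eq: "act (dim_row A) (dim_row B) (sM A) (sM B) F T ==> fm A B F = T"
 unfolding fm_def by (rule the_equality) (auto intro: act_unique)

lemma fm_Mor:
 assumes A: "A \<in> Ob CC" and B: "B \<in> Ob CC" and F: "F \<in> Mor CC A B"
 shows "act (dim_row A) (dim_row B) (sM A) (sM B) F (fm A B F)" "fm A B F \<in> Mor DD (rho A) (rho B)"
proof -
 from F have F': "F \<in> carrier_mat (dim_row B) (dim_row A)" "map_mat (sigma_rat q) F * A = B * F" by (auto simp: CC_Mor)
 from cdata_mor[OF sel_cdata[OF A] sel_cdata[OF B] F'] obtain T where T: "T \<in> carrier_mat (dim_row B) (dim_row A)"
  "\<forall>\<^sub>\<approx>z\<in>UNIV. mat_eval F z * sM A z = sM B z * T" "\<forall>z\<in>W. T * sP A z = sP B z * T" by (elim bexE conjE)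
 have a: "act (dim_row A) (dim_row B) (sM A) (sM B) F T"
  using T F'(1) sM_GL[OF A] sM_GL[OF B] by (simp add: act_def)
 from fm_eq[OF a] a show "act (dim_row A) (dim_row B) (sM A) (sM B) F (fm A B F)" by simp
 show "fm A B F \<in> Mor DD (rho A) (rho B)"
  unfolding rep_cat_Mor[OF rho_rep[OF A] rho_rep[OF B]] fm_eq[OF a] using T(1,3) rho_gam A B by simp
qed

lemma fm_surj:
 assumes A: "A \<in> Ob CC" and B: "B \<in> Ob CC" and T: "T \<in> Mor DD (rho A) (rho B)"
 shows "\<exists>F\<in>Mor CC A B. fm A B F = T"
proof -
 from T have T': "T \<in> carrier_mat (dim_row B) (dim_row A)" "\<forall>z\<in>W. T * sP A z = sP B z * T"
  unfolding rep_cat_Mor[OF rho_rep[OF A] rho_rep[OF B]] using rho_gam A B by auto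
 from cdata_mor_conv[OF sel_cdata[OF A] sel_cdata[OF B] T'] obtain F where F: "F \<in> carrier_mat (dim_row B) (dim_row A)"
  "map_mat (sigma_rat q) F * A = B * F" "\<forall>\<^sub>\<approx>z\<in>UNIV. mat_eval F z * sM A z = sM B z * T" by (elim bexE conjE)
 have "act (dim_row A) (dim_row B) (sM A) (sM B) F T"
  using F T' sM_GL[OF A] sM_GL[OF B] by (simp add: act_def)
 from fm_eq[OF this] F show ?thesis by (auto simp: CC_Mor)
qed

lemma jj_props:
 assumes A: "A \<in> Ob CC" and B: "B \<in> Ob CC"
 shows "act (dim_row A * dim_row B) (dim_row A * dim_row B) (%z. kron (sM A z) (sM B z)) (sM (kron A B)) (1\<^sub>m (dim_row A * dim_row B)) (jj A B)"
  "jj A B \<in> isos DD (%g. kron (rho A g) (rho B g)) (rho (kron A B))"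
proof -
 define n where "n = dim_row A * dim_row B"
 note AB = Ob_kron[OF A B]
 have d: "cdata (kron A B) n (sM (kron A B)) (sN (kron A B)) (sP (kron A B))"
  using sel_cdata[OF AB] by (simp add: dim_kron n_def)
 note dk = cdata_kron[OF sel_cdata[OF A] sel_cdata[OF B], folded n_def]
 from cdata_iso[OF dk d] obtain T T' where T: "act n n (%z. kron (sM A z) (sM B z)) (sM (kron A B)) (1\<^sub>m n) T"
  "act n n (sM (kron A B)) (%z. kron (sM A z) (sM B z)) (1\<^sub>m n) T'" "T * T' = 1\<^sub>m n" "T' * T = 1\<^sub>m n"
  "\<forall>z\<in>W. T * kron (sP A z) (sP B z) = sP (kron A B) z * T"
  "\<forall>z\<in>W. T' * sP (kron A B) z = kron (sP A z) (sP B z) * T'" by (elim exE conjE)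
 have jT: "jj A B = T" unfolding jj_def n_def[symmetric] by (rule the_equality, rule T(1), erule act_unique[OF _ T(1)])
 show "act (dim_row A * dim_row B) (dim_row A * dim_row B) (%z. kron (sM A z) (sM B z)) (sM (kron A B)) (1\<^sub>m (dim_row A * dim_row B)) (jj A B)"
  unfolding jT n_def[symmetric] by (rule T(1))
 have r: "is_rep n (%g. kron (rho A g) (rho B g))" "is_rep n (rho (kron A B))"
  using rep_kron[OF rho_rep[OF A] rho_rep[OF B]] rho_rep[OF AB] by (simp_all add: n_def dim_kron)
 have "T \<in> Mor DD (%g. kron (rho A g) (rho B g)) (rho (kron A B))"
  unfolding rep_cat_Mor[OF r] using T(5) act_D(5)[OF T(1)] rho_gam A B AB by simp
 moreover have "T' \<in> Mor DD (rho (kron A B)) (%g. kron (rho A g) (rho B g))"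
  unfolding rep_cat_Mor[OF r(2,1)] using T(6) act_D(5)[OF T(2)] rho_gam A B AB by simp
 ultimately show "jj A B \<in> isos DD (%g. kron (rho A g) (rho B g)) (rho (kron A B))"
  unfolding isos_def jT using T(3,4) rep_cat_rk[OF r(1)] rep_cat_rk[OF r(2)] by auto
qed

lemma j1_props: "act 1 1 (%_. 1\<^sub>m 1) (sM (1\<^sub>m 1)) (1\<^sub>m 1) j1" "j1 \<in> isos DD (%_. 1\<^sub>m 1) (rho (1\<^sub>m 1))"
proof -
 have d: "cdata (1\<^sub>m 1) 1 (sM (1\<^sub>m 1)) (sN (1\<^sub>m 1)) (sP (1\<^sub>m 1))" using sel_cdata[OF Ob_one] by simp
 from cdata_iso[OF cdata_one d] obtain T T' where T: "act 1 1 (%_. 1\<^sub>m 1) (sM (1\<^sub>m 1)) (1\<^sub>m 1) T"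
  "act 1 1 (sM (1\<^sub>m 1)) (%_. 1\<^sub>m 1) (1\<^sub>m 1) T'" "T * T' = 1\<^sub>m 1" "T' * T = 1\<^sub>m 1"
  "\<forall>z\<in>W. T * 1\<^sub>m 1 = sP (1\<^sub>m 1) z * T" "\<forall>z\<in>W. T' * sP (1\<^sub>m 1) z = 1\<^sub>m 1 * T'" by (elim exE conjE)
 have jT: "j1 = T" unfolding j1_def by (rule the_equality, rule T(1), erule act_unique[OF _ T(1)])
 show "act 1 1 (%_. 1\<^sub>m 1) (sM (1\<^sub>m 1)) (1\<^sub>m 1) j1" unfolding jT by (rule T(1))
 have r: "is_rep 1 (rho (1\<^sub>m 1))" using rho_rep[OF Ob_one] by simp
 have "T \<in> Mor DD (%_. 1\<^sub>m 1) (rho (1\<^sub>m 1))"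
  unfolding rep_cat_Mor[OF rep_unit r] using T(5) act_D(5)[OF T(1)] rho_gam[OF Ob_one] by simp
 moreover have "T' \<in> Mor DD (rho (1\<^sub>m 1)) (%_. 1\<^sub>m 1)"
  unfolding rep_cat_Mor[OF r rep_unit] using T(6) act_D(5)[OF T(2)] rho_gam[OF Ob_one] by simp
 ultimately show "j1 \<in> isos DD (%_. 1\<^sub>m 1) (rho (1\<^sub>m 1))"
  unfolding isos_def jT using T(3,4) rep_cat_rk[OF rep_unit] rep_cat_rk[OF r] by auto
qed

lemma rho_functor: "linear_functor CC DD rho fm"
 unfolding linear_functor_def
proof (intro conjI ballI allI)
 show "rho X \<in> Ob DD" if "X \<in> Ob CC" for X using rho_rep[OF that] by (auto simp: rep_cat_Ob)
 show "fm X Y f \<in> Mor DD (rho X) (rho Y)" if "X \<in> Ob CC" "Y \<in> Ob CC" "f \<in> Mor CC X Y" for X Y f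
  by (rule fm_Mor(2)[OF that])
 show "fm X X (1\<^sub>m (rk CC X)) = 1\<^sub>m (rk DD (rho X))" if "X \<in> Ob CC" for X
  using fm_eq[OF act_one[OF sM_GL[OF that]]] rep_cat_rk[OF rho_rep[OF that]] by (simp add: CC_rk)
 show "fm X Z (g * f) = fm Y Z g * fm X Y f"
  if "X \<in> Ob CC" "Y \<in> Ob CC" "Z \<in> Ob CC" "f \<in> Mor CC X Y" "g \<in> Mor CC Y Z" for X Y Z f g
  by (rule fm_eq[OF act_comp[OF fm_Mor(1)[OF that(1,2,4)] fm_Mor(1)[OF that(2,3,5)]]])
 show "fm X Y (f + g) = fm X Y f + fm X Y g" if "X \<in> Ob CC" "Y \<in> Ob CC" "f \<in> Mor CC X Y" "g \<in> Mor CC X Y" for X Y f g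
  by (rule fm_eq[OF act_add[OF fm_Mor(1)[OF that(1-3)] fm_Mor(1)[OF that(1,2,4)]]])
 show "fm X Y (scal CC c \<cdot>\<^sub>m f) = scal DD c \<cdot>\<^sub>m fm X Y f" if "X \<in> Ob CC" "Y \<in> Ob CC" "f \<in> Mor CC X Y" for X Y f c
  unfolding CC_scal DD_scal by (rule fm_eq[OF act_scale[OF fm_Mor(1)[OF that]]])
qed

lemma equivalence: "category_equivalence CC DD rho fm"
 unfolding category_equivalence_def
proof (intro conjI ballI)
 fix X Y assume XY: "X \<in> Ob CC" "Y \<in> Ob CC"
 show "bij_betw (fm X Y) (Mor CC X Y) (Mor DD (rho X) (rho Y))"
  unfolding bij_betw_def
 proof (intro conjI inj_onI equalityI subsetI)
  fix f g assume f: "f \<in> Mor CC X Y" "g \<in> Mor CC X Y" "fm X Y f = fm X Y g"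
  from act_unique_left[OF fm_Mor(1)[OF XY f(1)]] fm_Mor(1)[OF XY f(2)] show "f = g" by (simp add: f(3))
 next
  fix T assume "T \<in> fm X Y ` Mor CC X Y"
  thus "T \<in> Mor DD (rho X) (rho Y)" using fm_Mor(2)[OF XY] by blast
 next
  fix T assume "T \<in> Mor DD (rho X) (rho Y)"
  from fm_surj[OF XY this] show "T \<in> fm X Y ` Mor CC X Y" by blast
 qed
next
 fix \<tau> assume "\<tau> \<in> Ob DD"
 then obtain n where n: "is_rep n \<tau>" by (auto simp: rep_cat_Ob)
 from cdata_of_rep[OF n] obtain A M N P where d: "cdata A n M N P" "\<forall>z\<in>W. P z = \<tau> (gam z)" by (elim exE conjE)
 have A: "A \<in> Ob CC" "dim_row A = n" using obj_cdata[OF d(1)] by auto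
 from cdata_iso[OF sel_cdata[OF A(1), unfolded A(2)] d(1)] obtain T T' where T: "act n n (sM A) M (1\<^sub>m n) T"
  "act n n M (sM A) (1\<^sub>m n) T'" "T * T' = 1\<^sub>m n" "T' * T = 1\<^sub>m n"
  "\<forall>z\<in>W. T * sP A z = P z * T" "\<forall>z\<in>W. T' * P z = sP A z * T'" by (elim exE conjE)
 have r: "is_rep n (rho A)" using rho_rep[OF A(1)] by (simp add: A(2))
 have "T \<in> Mor DD (rho A) \<tau>"
  unfolding rep_cat_Mor[OF r n] using T(5) act_D(5)[OF T(1)] rho_gam[OF A(1)] d(2) by simp
 moreover have "T' \<in> Mor DD \<tau> (rho A)"
  unfolding rep_cat_Mor[OF n r] using T(6) act_D(5)[OF T(2)] rho_gam[OF A(1)] d(2) by simp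
 ultimately have "T \<in> isos DD (rho A) \<tau>"
  unfolding isos_def using T(3,4) rep_cat_rk[OF r] rep_cat_rk[OF n] by auto
 with A(1) show "\<exists>X\<in>Ob CC. isos DD (rho X) \<tau> ~= {}" by blast
qed

lemma monoidal: "symmetric_monoidal CC DD rho fm jj j1"
 unfolding symmetric_monoidal_def CC_tens CC_unit DD_tens DD_unit CC_rk
proof (intro conjI ballI)
 show "j1 \<in> isos DD (%_. 1\<^sub>m 1) (rho (1\<^sub>m 1))" by (rule j1_props(2))
 show "jj X Y \<in> isos DD (%g. kron (rho X g) (rho Y g)) (rho (kron X Y))" if "X \<in> Ob CC" "Y \<in> Ob CC" for X Y
  by (rule jj_props(2)[OF that])
next
 fix X X' Y Y' f g
 assume X: "X \<in> Ob CC" "X' \<in> Ob CC" and Y: "Y \<in> Ob CC" "Y' \<in> Ob CC" and f: "f \<in> Mor CC X X'" and g: "g \<in> Mor CC Y Y'"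
 let ?n = "dim_row X * dim_row Y" and ?m = "dim_row X' * dim_row Y'"
 note j = jj_props(1)[OF X(1) Y(1)] and j' = jj_props(1)[OF X(2) Y(2)]
 note k = act_kron[OF fm_Mor(1)[OF X f] fm_Mor(1)[OF Y g]]
 have kc: "kron f g \<in> carrier_mat ?m ?n" by (rule act_D(4)[OF k])
 have d: "cdata (kron X Y) ?n (sM (kron X Y)) (sN (kron X Y)) (sP (kron X Y))"
  using sel_cdata[OF Ob_kron[OF X(1) Y(1)]] by (simp add: dim_kron)
 from cdata_iso[OF d cdata_kron[OF sel_cdata[OF X(1)] sel_cdata[OF Y(1)]]] obtain T where
  T: "act ?n ?n (sM (kron X Y)) (%z. kron (sM X z) (sM Y z)) (1\<^sub>m ?n) T" by (elim exE conjE)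
 from act_comp[OF act_comp[OF T k] j'] kc
 have "act ?n ?m (sM (kron X Y)) (sM (kron X' Y')) (kron f g) (jj X' Y' * (kron (fm X X' f) (fm Y Y' g) * T))" by simp
 hence F: "act ?n ?m (sM (kron X Y)) (sM (kron X' Y')) (kron f g) (fm (kron X Y) (kron X' Y') (kron f g))"
  using fm_eq[of "kron X Y" "kron X' Y'" "kron f g"] by (simp add: dim_kron)
 show "fm (kron X Y) (kron X' Y') (kron f g) * jj X Y = jj X' Y' * kron (fm X X' f) (fm Y Y' g)"
  using act_unique[OF act_comp[OF j F]] act_comp[OF k j'] kc by simp
next
 fix X Y Z assume X: "X \<in> Ob CC" and Y: "Y \<in> Ob CC" and Z: "Z \<in> Ob CC"
 let ?n = "dim_row X * dim_row Y * dim_row Z"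
 note XY = Ob_kron[OF X Y] and YZ = Ob_kron[OF Y Z]
 have 1: "act ?n ?n (%z. kron (kron (sM X z) (sM Y z)) (sM Z z)) (sM (kron (kron X Y) Z)) (1\<^sub>m ?n)
   (jj (kron X Y) Z * kron (jj X Y) (1\<^sub>m (dim_row Z)))"
  using act_comp[OF act_kron[OF jj_props(1)[OF X Y] act_one[OF sM_GL[OF Z]]] jj_props(1)[OF XY Z, unfolded dim_kron]]
  by (simp add: kron_one)
 have 2: "act ?n ?n (%z. kron (sM X z) (kron (sM Y z) (sM Z z))) (sM (kron X (kron Y Z))) (1\<^sub>m ?n)
   (jj X (kron Y Z) * kron (1\<^sub>m (dim_row X)) (jj Y Z))"
  using act_comp[OF act_kron[OF act_one[OF sM_GL[OF X]] jj_props(1)[OF Y Z]] jj_props(1)[OF X YZ, unfolded dim_kron]]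
  by (simp add: kron_one mult.assoc)
 show "jj (kron X Y) Z * kron (jj X Y) (1\<^sub>m (rk DD (rho Z))) = jj X (kron Y Z) * kron (1\<^sub>m (rk DD (rho X))) (jj Y Z)"
  unfolding rep_cat_rk[OF rho_rep[OF X]] rep_cat_rk[OF rho_rep[OF Z]]
  using act_unique[OF 1] 2 by (simp add: kron_assoc)
next
 fix X assume X: "X \<in> Ob CC"
 have "act (dim_row X) (dim_row X) (sM X) (sM X) (1\<^sub>m (dim_row X)) (jj (1\<^sub>m 1) X * kron j1 (1\<^sub>m (dim_row X)))"
  using act_comp[OF act_kron[OF j1_props(1) act_one[OF sM_GL[OF X]]] jj_props(1)[OF Ob_one X, unfolded index_one_mat(2)]]
  by (simp add: kron_one del: One_nat_def)
 from act_unique[OF this act_one[OF sM_GL[OF X]]]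
 show "jj (1\<^sub>m 1) X * kron j1 (1\<^sub>m (rk DD (rho X))) = 1\<^sub>m (rk DD (rho X))"
  unfolding rep_cat_rk[OF rho_rep[OF X]] .
 have "act (dim_row X) (dim_row X) (sM X) (sM X) (1\<^sub>m (dim_row X)) (jj X (1\<^sub>m 1) * kron (1\<^sub>m (dim_row X)) j1)"
  using act_comp[OF act_kron[OF act_one[OF sM_GL[OF X]] j1_props(1)] jj_props(1)[OF X Ob_one, unfolded index_one_mat(2)]]
  by (simp add: kron_one del: One_nat_def)
 from act_unique[OF this act_one[OF sM_GL[OF X]]]
 show "jj X (1\<^sub>m 1) * kron (1\<^sub>m (rk DD (rho X))) j1 = 1\<^sub>m (rk DD (rho X))"
  unfolding rep_cat_rk[OF rho_rep[OF X]] .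
next
 fix X Y assume X: "X \<in> Ob CC" and Y: "Y \<in> Ob CC"
 let ?n = "dim_row X * dim_row Y" and ?m = "dim_row Y * dim_row X"
 note j = jj_props(1)[OF X Y] and j' = jj_props(1)[OF Y X] and s = act_swap[OF sM_GL[OF X] sM_GL[OF Y]]
 have sc: "(swap_mat (dim_row X) (dim_row Y) :: ratfun mat) \<in> carrier_mat ?m ?n" by (rule swap_carrier)
 have d: "cdata (kron X Y) ?n (sM (kron X Y)) (sN (kron X Y)) (sP (kron X Y))"
  using sel_cdata[OF Ob_kron[OF X Y]] by (simp add: dim_kron)
 from cdata_iso[OF d cdata_kron[OF sel_cdata[OF X] sel_cdata[OF Y]]] obtain T where
  T: "act ?n ?n (sM (kron X Y)) (%z. kron (sM X z) (sM Y z)) (1\<^sub>m ?n) T" by (elim exE conjE)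
 from act_comp[OF act_comp[OF T s] j'] sc
 have "act ?n ?m (sM (kron X Y)) (sM (kron Y X)) (swap_mat (dim_row X) (dim_row Y)) (jj Y X * (swap_mat (dim_row X) (dim_row Y) * T))"
  by simp
 hence F: "act ?n ?m (sM (kron X Y)) (sM (kron Y X)) (swap_mat (dim_row X) (dim_row Y)) (fm (kron X Y) (kron Y X) (swap_mat (dim_row X) (dim_row Y)))"
  using fm_eq[of "kron X Y" "kron Y X" "swap_mat (dim_row X) (dim_row Y)"] by (simp add: dim_kron)
 show "fm (kron X Y) (kron Y X) (swap_mat (dim_row X) (dim_row Y)) * jj X Y = jj Y X * swap_mat (rk DD (rho X)) (rk DD (rho Y))"
  unfolding rep_cat_rk[OF rho_rep[OF X]] rep_cat_rk[OF rho_rep[OF Y]]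
  using act_unique[OF act_comp[OF j F]] act_comp[OF s j'] sc by simp
qed

lemma punctures_equivalence: "tensor_equivalent CC DD"
 unfolding tensor_equivalent_def using rho_functor equivalence monoidal by blast

end

theorem mainTheorem7:
 fixes q :: complex and S :: "complex set set"
 assumes "norm q > 1"
  and "finite S"
  and "S \<subseteq> carrier (ell_curve q)"
 shows "tensor_equivalent (abelian_regular_cat q S) (rep_cat (pi1_ab q S))"
proof -
 interpret qplane q by unfold_locales (rule assms(1))
 have "\<exists>b. b ~= 0 \<and> ell_pt q b \<notin> S"
 proof (rule ccontr)
  assume no: "\<not> ?thesis"
  \<comment> \<open>Real points in an open fundamental interval are pairwise different on the curve, so \<open>S\<close> cannot contain all of them.\<close>
  define R where "R = complex_of_real ` {1<..<norm q}"
  have "inj_on (ell_pt q) R"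
  proof (rule inj_onI)
   fix x y assume "x \<in> R" "y \<in> R" and e: "ell_pt q x = ell_pt q y"
   then obtain r s where r: "x = of_real r" "1 < r" "r < norm q" and s: "y = of_real s" "1 < s" "s < norm q"
    by (auto simp: R_def)
   have "x / y \<in> spiral" using e ell_pt_eq[of x y] r s by auto
   then obtain k where k: "x / y = q powi k" unfolding spiral_def by (elim rangeE)
   have n: "r / s = norm q powi k" using arg_cong[OF k, of norm] r s by (simp add: norm_divide norm_power_int)
   have "k = 0"
   proof (rule ccontr)
    assume "k ~= 0"
    then consider "k \<ge> 1" | "k \<le> - 1" by linarith
    thus False
    proof cases
     case 1
     hence "norm q powi 1 \<le> norm q powi k" using assms(1) by (intro power_int_increasing) auto
     hence "norm q \<le> r / s" using n by simp
     hence "norm q * s \<le> r" using s by (simp add: pos_le_divide_eq)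
     moreover have "norm q * 1 < norm q * s" using assms(1) s by (intro mult_strict_left_mono) auto
     ultimately show False using r by simp
    next
     case 2
     hence "norm q powi k \<le> norm q powi - 1" using assms(1) by (intro power_int_increasing) auto
     hence "r / s \<le> 1 / norm q" using n by (simp add: power_int_minus inverse_eq_divide)
     moreover have "0 < norm q" using assms(1) by linarith
     ultimately have "r * norm q \<le> s * 1" using s frac_le_eq[of s "norm q" r 1] by (simp add: pos_divide_le_eq pos_le_divide_eq)
     hence "r * norm q \<le> s" by simp
     moreover have "1 * norm q < r * norm q" using assms(1) r by (intro mult_strict_right_mono) auto
     ultimately show False using s by simp
    qed
   qed
   thus "x = y" using k s by simp
  qed
  moreover have "ell_pt q ` R \<subseteq> S"
  proof (rule image_subsetI)
   fix x assume "x \<in> R"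
   hence "x ~= 0" by (auto simp: R_def)
   thus "ell_pt q x \<in> S" using no by blast
  qed
  ultimately have "finite R" using assms(2) finite_imageD finite_subset by blast
  hence "finite {1<..<norm q}" unfolding R_def by (rule finite_imageD) (auto intro: inj_onI)
  thus False using assms(1) by (simp add: infinite_Ioo)
 qed
 then obtain b where b: "b ~= 0" "ell_pt q b \<notin> S" by (elim exE conjE)
 interpret punctures q S b by unfold_locales (use assms b in auto)
 show ?thesis by (rule punctures_equivalence)
qed

end
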